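(* Let $\alpha>0$ be a constant independent of $n$, let $m=\alpha n$, and let $H$ be an $m\times n$ matrix with i.i.d. standard normal components. Let $$\xi_n=\min_{x\in\{-\frac{1}{\sqrt n},\frac{1}{\sqrt n}\}^n}\ \max_{y\in\{-\frac{1}{\sqrt m},\frac{1}{\sqrt m}\}^m} y^T H x$$ and let $$\xi_n^{(l,lift)}=\max_{c\ge 0}\left(-\frac{c}{2}-\frac{1}{c}\log\Big(\mathrm{erfc}\Big(-\frac{c}{\sqrt 2}\Big)\Big)-\frac{\alpha}{c}\log\Big(\mathrm{erfc}\Big(\frac{c}{\sqrt{2\alpha}}\Big)\Big)\right).$$ Then $$\frac{E\xi_n}{\sqrt n}\ge \xi_n^{(l,lift)}.$$ Moreover, $$\lim_{n\to\infty}P\big(\xi_n\ge \sqrt n\,\xi_n^{(l,lift)}\big)=1,\qquad\text{equivalently}\qquad \lim_{n\to\infty}P\big(\xi_n^2\ge n\,(\xi_n^{(l,lift)})^2\big)=1.$$ In particular, when $\alpha=1$, $\frac{E\xi_n}{\sqrt n}\ge\xi_n^{(l,lift)}$ with $\xi_n^{(l,lift)}\approx 0.24439$ (numerical value rounded).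
   Context: $\mathrm{erfc}(z)=\frac{2}{\sqrt\pi}\int_z^\infty e^{-t^2}\,dt$. The expression maximized is understood at $c=0$ as its limit for $c\to 0^+$. The subscripts in $\xi_n$ and $\xi_n^{(l,lift)}$ are part of their names; $\xi_n$ depends on $n$ and $m=\alpha n$, while $\xi_n^{(l,lift)}$ depends only on $\alpha$. The limits are taken along positive integers $n$ for which $m=\alpha n$ is an integer. $P$ and $E$ denote probability and expectation. *)

theory Defs
  imports "HOL-Probability.Probability"
begin

definition erfc :: "real \<Rightarrow> real" where
  "erfc z = 2 / sqrt pi * (LBINT t:{z..}. exp (- t\<^sup>2))"

(* The points of {-1/sqrt k, 1/sqrt k}^k, as extensional functions on {..<k}. *)
definition cube :: "nat \<Rightarrow> (nat \<Rightarrow> real) set" where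
  "cube k = {..<k} \<rightarrow>\<^sub>E {- (1 / sqrt (real k)), 1 / sqrt (real k)}"

(* y^T A x for an m x n matrix A with 0-based indices. *)
definition bilin :: "nat \<Rightarrow> nat \<Rightarrow> (nat \<Rightarrow> nat \<Rightarrow> real) \<Rightarrow> (nat \<Rightarrow> real) \<Rightarrow> (nat \<Rightarrow> real) \<Rightarrow> real" where
  "bilin m n A y x = (\<Sum>i<m. \<Sum>j<n. y i * A i j * x j)"

definition xi :: "nat \<Rightarrow> nat \<Rightarrow> (nat \<Rightarrow> nat \<Rightarrow> real) \<Rightarrow> real" where
  "xi m n A = Min ((\<lambda>x. Max ((\<lambda>y. bilin m n A y x) ` cube m)) ` cube n)"

definition std_gaussian_matrix ::
    "'w measure \<Rightarrow> nat \<Rightarrow> nat \<Rightarrow> (nat \<Rightarrow> nat \<Rightarrow> 'w \<Rightarrow> real) \<Rightarrow> bool" where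
  "std_gaussian_matrix M m n H \<longleftrightarrow>
     prob_space.indep_vars M (\<lambda>_. borel) (\<lambda>(i, j). H i j) ({..<m} \<times> {..<n}) \<and>
     (\<forall>i<m. \<forall>j<n. distributed M lborel (H i j) std_normal_density)"

definition lift_expr :: "real \<Rightarrow> real \<Rightarrow> real" where
  "lift_expr \<alpha> c = - c / 2 - 1 / c * ln (erfc (- c / sqrt 2))
                   - \<alpha> / c * ln (erfc (c / sqrt (2 * \<alpha>)))"

(* lift_expr is meaningless at c = 0 (division by zero), where its right limit is taken. *)
definition lift_obj :: "real \<Rightarrow> real \<Rightarrow> real" where
  "lift_obj \<alpha> c = (if c = 0 then Lim (at_right 0) (lift_expr \<alpha>) else lift_expr \<alpha> c)"

(* A maximum, not merely a supremum. *)
definition xi_lift :: "real \<Rightarrow> real" where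
  "xi_lift \<alpha> = (GREATEST v. \<exists>c\<ge>0. v = lift_obj \<alpha> c)"

definition admissible :: "real \<Rightarrow> nat set" where
  "admissible \<alpha> = {n. n > 0 \<and> \<alpha> * real n \<in> \<int>}"

(* For irrational alpha, admissible is empty and this filter is trivial. *)
definition admissible_at_top :: "real \<Rightarrow> nat filter" where
  "admissible_at_top \<alpha> = inf sequentially (principal (admissible \<alpha>))"

end

theory Submission
  imports Defs "HOL-Real_Asymp.Real_Asymp"
begin

text \<open>
  Gordon's comparison, in lifted form. Fix \<open>c > 0\<close>, put \<open>b = c / p\<close> with \<open>p\<close> small, and consider the
  expectation \<open>F t\<close> of the \<open>p\<close>-th power of a partition function over the cube whose Hamiltonian is a smoothed
  \<open>l\<^sub>1\<close> norm of \<open>sqrt t H x + sqrt (1 - t) g\<close>, plus independent fields \<open>sqrt (1 - t) h \<bullet> x\<close> and \<open>sqrt t g\<^sub>0\<close>.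
  Gaussian integration by parts shows that \<open>F\<close> is nonincreasing: its derivative is a negative multiple of
  the Gibbs average of \<open>(1 - overlap) * (\<Sum>i. 1 - T\<^sub>i T\<^sub>i')\<close> over two replicas. At \<open>t = 1\<close> one finds the exponential
  moment of the min-max value, at \<open>t = 0\<close> a product of one-dimensional moments, expressible by erfc; at the
  maximizing \<open>c\<close>, Jensen's inequality then gives the bound for the expectation.

  The threshold in the probability statement is exactly the bound for the mean, so Markov's inequality needs a
  comparison that is strict by a factor \<open>exp (- \<gamma> n)\<close>. For small \<open>t\<close>, integration by parts in \<open>g\<close> bounds the
  derivative of \<open>F\<close> below, in modulus, by the average of \<open>1 - overlap\<close>, and convexity in the strength of \<open>h\<close> keeps
  that average away from \<open>0\<close> unless \<open>F\<close> is already exponentially smaller than its value at \<open>0\<close>. Either way \<open>F\<close>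
  drops by an exponential factor. The maximizing \<open>c\<close> is positive because the objective increases at \<open>0\<close> (there
  its derivative is \<open>2 / pi - 1 / 2\<close>).
\<close>


subsection \<open>Gaussian product measures\<close>

text \<open>What shapes the strict comparison is a count of powers of \<open>p\<close>. At
  \<open>t = 0\<close> the finite power costs at most a factor \<open>exp (2 * n * p^2 / c)\<close>,
  quadratic in \<open>p\<close>, since a cosh moment differs from its exponential limit only on a
  window of width \<open>1 / b\<close>. The smoothing width \<epsilon> is of order
  \<open>1 / b\<close>, hence linear in \<open>p\<close>, and the decay of \<open>F\<close> near
  \<open>t = 0\<close> has a rate proportional to it. So the gain wins for small \<open>p\<close>,
  and \<open>p\<close> can stay fixed while \<open>n\<close> grows. The obstacle: replacing the
  smoothed norm by the true one pointwise costs order \<epsilon> as well, the same order as the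
  gain. Therefore two widths occur, a separate small \<open>e\<close> for the comparison with the
  min-max value and \<epsilon> = \<eta> / b for the decay. Passing from one to the other at an
  intermediate time costs only order \<epsilon> * \<eta>, because the Gaussian noise rarely leaves a
  local field within \<epsilon> of 0. The sign of the derivative comes from the power: as all states
  have norm one, the one-replica terms cancel, and the two-replica terms carry the factor
  \<open>p * (1 - p)\<close>.\<close>

abbreviation std_gauss :: "real measure" where
  "std_gauss \<equiv> density lborel std_normal_density"

abbreviation gauss :: "'k set \<Rightarrow> ('k \<Rightarrow> real) measure" where
  "gauss K \<equiv> PiM K (\<lambda>_. std_gauss)"

lemma prob_space_std_gauss: "prob_space std_gauss"
  by (rule prob_space_normal_density) simp

interpretation gauss: product_prob_space "\<lambda>_::'k. std_gauss" K for K :: "'k set"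
  by (intro product_prob_spaceI prob_space_std_gauss)

lemma integrable_std_gauss_iff:
  fixes f :: "real \<Rightarrow> real"
  assumes "f \<in> borel_measurable borel"
  shows "integrable std_gauss f \<longleftrightarrow> integrable lborel (\<lambda>x. std_normal_density x * f x)"
  using assms by (subst integrable_density) auto

lemma integral_std_gauss:
  fixes f :: "real \<Rightarrow> real"
  assumes "f \<in> borel_measurable borel"
  shows "integral\<^sup>L std_gauss f = (\<integral>x. std_normal_density x * f x \<partial>lborel)"
  using assms by (subst integral_density) auto

lemma std_normal_density_mult_exp:
  "std_normal_density x * exp (a * x) = exp (a\<^sup>2 / 2) * normal_density a 1 x"
proof -
  have "exp (- x\<^sup>2 / 2) * exp (a * x) = exp (a\<^sup>2 / 2) * exp (- (x - a)\<^sup>2 / 2)"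
    unfolding exp_add[symmetric] by (simp add: power2_eq_square field_simps)
  then show ?thesis
    by (simp add: std_normal_density_def normal_density_def field_simps)
qed

lemma std_gauss_exp:
  shows integrable_std_gauss_exp: "integrable std_gauss (\<lambda>x. exp (a * x))"
    and integral_std_gauss_exp: "(\<integral>x. exp (a * x) \<partial>std_gauss) = exp (a\<^sup>2 / 2)"
  by (simp_all add: integrable_std_gauss_iff integral_std_gauss std_normal_density_mult_exp)

lemma integrable_std_gauss_exp_abs: "integrable std_gauss (\<lambda>x. exp (a * \<bar>x\<bar>))"
proof (rule Bochner_Integration.integrable_bound)
  show "integrable std_gauss (\<lambda>x. exp (a * x) + exp (- a * x))"
    by (intro Bochner_Integration.integrable_add integrable_std_gauss_exp)
  have "exp (a * \<bar>x\<bar>) \<le> exp (a * x) + exp (- a * x)" for x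
    by (cases "x \<ge> 0") (auto simp: abs_if)
  then have "norm (exp (a * \<bar>x\<bar>)) \<le> norm (exp (a * x) + exp (- a * x))" for x
    by (simp add: order_trans[OF _ abs_ge_self])
  then show "AE x in std_gauss. norm (exp (a * \<bar>x\<bar>)) \<le> norm (exp (a * x) + exp (- a * x))"
    by (intro AE_I2)
qed simp

lemma integrable_std_gauss_bound:
  fixes f :: "real \<Rightarrow> real"
  assumes "f \<in> borel_measurable borel" "\<And>y. \<bar>f y\<bar> \<le> A * exp (B * \<bar>y\<bar>)"
  shows "integrable std_gauss f"
  by (rule Bochner_Integration.integrable_bound
      [OF integrable_mult_right[OF integrable_std_gauss_exp_abs[of B], of A]])
     (use assms in \<open>auto intro: order_trans[OF _ abs_ge_self]\<close>)

text \<open>Stein's identity: the density has derivative \<open>- y\<close> times itself, so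
  \<open>?d y * f' y - ?d y * (y * f y)\<close> is the derivative of \<open>?d y * f y\<close>. The
  Gaussian factor beats the exponential growth at both ends, and the fundamental theorem of calculus
  on the whole line gives 0.\<close>

lemma std_gauss_ibp:
  fixes f f' :: "real \<Rightarrow> real"
  assumes der: "\<And>y. (f has_real_derivative f' y) (at y)"
    and cont: "continuous_on UNIV f'"
    and bf: "\<And>y. \<bar>f y\<bar> \<le> A * exp (B * \<bar>y\<bar>)"
    and bf': "\<And>y. \<bar>f' y\<bar> \<le> A * exp (B * \<bar>y\<bar>)"
  shows "(\<integral>y. y * f y \<partial>std_gauss) = (\<integral>y. f' y \<partial>std_gauss)"
proof -
  let ?d = std_normal_density
  have contf: "continuous_on UNIV f"
    using der by (intro continuous_at_imp_continuous_on ballI DERIV_isCont) auto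
  have [measurable]: "f \<in> borel_measurable borel" "f' \<in> borel_measurable borel"
    using contf cont by (simp_all add: borel_measurable_continuous_onI)
  have A: "0 \<le> A" using order_trans[OF abs_ge_zero bf[of 0]] by simp
  have yb: "\<bar>y * f y\<bar> \<le> A * exp ((B + 1) * \<bar>y\<bar>)" for y
  proof -
    have "\<bar>y\<bar> \<le> exp \<bar>y\<bar>" using exp_ge_add_one_self[of "\<bar>y\<bar>"] by linarith
    then have "\<bar>y * f y\<bar> \<le> exp \<bar>y\<bar> * (A * exp (B * \<bar>y\<bar>))"
      unfolding abs_mult by (intro mult_mono bf) auto
    also have "\<dots> = A * exp ((B + 1) * \<bar>y\<bar>)" by (simp add: exp_add[symmetric] algebra_simps)
    finally show ?thesis .
  qed
  have i1: "integrable std_gauss (\<lambda>y. y * f y)"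
    by (rule integrable_std_gauss_bound[OF _ yb]) simp
  have i2: "integrable std_gauss f'"
    by (rule integrable_std_gauss_bound[OF _ bf']) simp
  have dd: "(?d has_real_derivative - y * ?d y) (at y)" for y
    unfolding std_normal_density_def
    by (auto intro!: derivative_eq_intros simp: field_simps)
  let ?g = "\<lambda>y. ?d y * f' y - ?d y * (y * f y)"
  have int: "integrable lborel ?g"
    using i1 i2 by (intro Bochner_Integration.integrable_diff) (simp_all add: integrable_std_gauss_iff)
  have lim0: "((\<lambda>y. ?d y * f y) \<longlongrightarrow> 0) F"
    if F: "((\<lambda>y::real. A * ((1 / sqrt (2 * pi)) * exp (- y\<^sup>2 / 2) * exp (B * \<bar>y\<bar>))) \<longlongrightarrow> 0) F" for F
  proof (rule Lim_null_comparison[OF _ F], rule always_eventually, rule allI)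
    fix y
    show "norm (?d y * f y) \<le> A * ((1 / sqrt (2 * pi)) * exp (- y\<^sup>2 / 2) * exp (B * \<bar>y\<bar>))"
      using mult_left_mono[OF bf[of y], of "?d y"]
      by (simp add: std_normal_density_def abs_mult mult_ac)
  qed
  have T: "((\<lambda>y::real. A * ((1 / sqrt (2 * pi)) * exp (- y\<^sup>2 / 2) * exp (B * \<bar>y\<bar>))) \<longlongrightarrow> 0) F"
    if F: "filterlim abs at_top F" for F
  proof -
    have "((\<lambda>y::real. exp (y * (B - y / 2))) \<longlongrightarrow> 0) at_top"
    proof (rule filterlim_compose[OF exp_at_bot])
      have "filterlim (\<lambda>y::real. y / 2 - B) at_top at_top"
        unfolding filterlim_at_top eventually_at_top_linorder
      proof
        fix Z :: real
        show "\<exists>N. \<forall>y\<ge>N. Z \<le> y / 2 - B"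
          by (rule exI[of _ "2 * (B + Z)"]) auto
      qed
      from filterlim_at_top_mult_at_top[OF filterlim_ident this]
      show "filterlim (\<lambda>y::real. y * (B - y / 2)) at_bot at_top"
        unfolding filterlim_uminus_at_bot by (simp add: algebra_simps)
    qed
    from filterlim_compose[OF this F]
    have "((\<lambda>y. exp (\<bar>y\<bar> * (B - \<bar>y\<bar> / 2))) \<longlongrightarrow> 0) F" .
    note lim = tendsto_mult_right_zero[OF this, of "A / sqrt (2 * pi)"]
    have eq: "A / sqrt (2 * pi) * exp (\<bar>y\<bar> * (B - \<bar>y\<bar> / 2)) =
        A * ((1 / sqrt (2 * pi)) * exp (- y\<^sup>2 / 2) * exp (B * \<bar>y\<bar>))" for y :: real
    proof -
      have "\<bar>y\<bar> * (B - \<bar>y\<bar> / 2) = - y\<^sup>2 / 2 + B * \<bar>y\<bar>"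
        by (simp add: algebra_simps power2_eq_square)
      then show ?thesis by (simp only: exp_add) simp
    qed
    show ?thesis using lim unfolding eq .
  qed
  have "(LBINT x=-\<infinity>..\<infinity>. ?g x) = 0 - 0"
  proof (rule interval_integral_FTC_integrable[where F = "\<lambda>y. ?d y * f y"])
    fix x
    show "((\<lambda>y. ?d y * f y) has_vector_derivative ?g x) (at x)"
      unfolding has_real_derivative_iff_has_vector_derivative[symmetric]
      by (auto intro!: derivative_eq_intros der dd simp: algebra_simps)
    show "isCont ?g x"
      using cont contf unfolding std_normal_density_def
      by (auto intro!: continuous_intros simp: continuous_on_eq_continuous_at)
  next
    show "set_integrable lborel (einterval (- \<infinity>) \<infinity>) ?g"
      using int by (simp add: set_integrable_def)
  next
    show "(((\<lambda>y. ?d y * f y) \<circ> real_of_ereal) \<longlongrightarrow> 0) (at_right (- \<infinity>))"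
      unfolding ereal_tendsto_simps1
      by (intro lim0 T filterlim_at_top_mono[OF filterlim_uminus_at_top_at_bot] always_eventually) auto
    show "(((\<lambda>y. ?d y * f y) \<circ> real_of_ereal) \<longlongrightarrow> 0) (at_left \<infinity>)"
      unfolding ereal_tendsto_simps1
      by (intro lim0 T filterlim_abs_real)
  qed simp
  then have "integral\<^sup>L lborel ?g = 0"
    by (simp add: interval_lebesgue_integral_def set_lebesgue_integral_def)
  then show ?thesis
    using i1 i2 by (simp add: integrable_std_gauss_iff integral_std_gauss)
qed

section \<open>Exponential majorants and integration by parts for product Gaussians\<close>

definition l1 :: "'k set \<Rightarrow> ('k \<Rightarrow> real) \<Rightarrow> real" where
  "l1 K z = (\<Sum>k\<in>K. \<bar>z k\<bar>)"

lemma l1_nonneg: "0 \<le> l1 K z"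
  by (simp add: l1_def sum_nonneg)

lemma l1_ge_component: "finite K \<Longrightarrow> k \<in> K \<Longrightarrow> \<bar>z k\<bar> \<le> l1 K z"
  unfolding l1_def by (rule member_le_sum) auto

lemma l1_insert_upd: "finite K \<Longrightarrow> k \<notin> K \<Longrightarrow> l1 (insert k K) (z(k := y)) = \<bar>y\<bar> + l1 K z"
  unfolding l1_def by (simp add: sum.insert) (intro sum.cong, auto)

lemma gauss_prod:
  fixes f :: "'k \<Rightarrow> real \<Rightarrow> real"
  assumes "finite K" "\<And>k. k \<in> K \<Longrightarrow> integrable std_gauss (f k)"
  shows integrable_gauss_prod: "integrable (gauss K) (\<lambda>z. \<Prod>k\<in>K. f k (z k))"
    and integral_gauss_prod: "(\<integral>z. (\<Prod>k\<in>K. f k (z k)) \<partial>gauss K) = (\<Prod>k\<in>K. integral\<^sup>L std_gauss (f k))"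
  using gauss.product_integrable_prod[of K f] gauss.product_integral_prod[of K f] assms by auto

lemma integrable_gauss_exp_l1:
  assumes "finite K"
  shows "integrable (gauss K) (\<lambda>z. A * exp (B * l1 K z))"
  using integrable_gauss_prod[OF assms, of "\<lambda>_ x. exp (B * \<bar>x\<bar>)"] assms
  by (intro integrable_mult_right)
     (simp add: integrable_std_gauss_exp_abs l1_def sum_distrib_left exp_sum)

text \<open>Integrands are dominated throughout by some \<open>A * exp (B * l1 K z)\<close>. Such
  majorants are products of one-dimensional integrable functions, absorb a factor \<open>z k\<close>
  by raising \<open>B\<close>, and split when one coordinate is singled out.\<close>

lemma integrable_gauss_bound:
  fixes G :: "('k \<Rightarrow> real) \<Rightarrow> real"
  assumes "finite K" "G \<in> borel_measurable (gauss K)"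
    and "\<And>z. \<bar>G z\<bar> \<le> A * exp (B * l1 K z)"
  shows "integrable (gauss K) G"
  by (rule Bochner_Integration.integrable_bound[OF integrable_gauss_exp_l1[OF assms(1), of A B]])
     (use assms in \<open>auto intro: order_trans[OF _ abs_ge_self]\<close>)

lemma mult_l1_bound:
  assumes "finite K" "k \<in> K" "\<bar>G\<bar> \<le> A * exp (B * l1 K z)"
  shows "\<bar>z k * G\<bar> \<le> A * exp ((B + 1) * l1 K z)"
proof -
  have "\<bar>z k\<bar> \<le> exp (l1 K z)"
    using l1_ge_component[OF assms(1,2), of z] exp_ge_add_one_self[of "l1 K z"] by linarith
  then have "\<bar>z k * G\<bar> \<le> exp (l1 K z) * (A * exp (B * l1 K z))"
    unfolding abs_mult by (intro mult_mono assms(3)) auto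
  also have "\<dots> = A * exp ((B + 1) * l1 K z)"
    by (simp add: exp_add[symmetric] algebra_simps)
  finally show ?thesis .
qed

text \<open>Fubini isolates coordinate \<open>k\<close>. On each fibre the other coordinates only
  enter the constant \<open>A * exp (B * l1 K' z)\<close>, so the one-dimensional identity applies
  there.\<close>

lemma gauss_ibp:
  fixes G G' :: "('k \<Rightarrow> real) \<Rightarrow> real"
  assumes K: "finite K" "k \<in> K"
    and [measurable]: "G \<in> borel_measurable (gauss K)" "G' \<in> borel_measurable (gauss K)"
    and der: "\<And>z y. ((\<lambda>y. G (z(k := y))) has_real_derivative G' (z(k := y))) (at y)"
    and cont: "\<And>z. continuous_on UNIV (\<lambda>y. G' (z(k := y)))"
    and bG: "\<And>z. \<bar>G z\<bar> \<le> A * exp (B * l1 K z)"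
    and bG': "\<And>z. \<bar>G' z\<bar> \<le> A * exp (B * l1 K z)"
  shows "(\<integral>z. z k * G z \<partial>gauss K) = (\<integral>z. G' z \<partial>gauss K)"
proof -
  define K' where "K' = K - {k}"
  have K': "K = insert k K'" "finite K'" "k \<notin> K'" using K by (auto simp: K'_def)
  have i1: "integrable (gauss K) (\<lambda>z. z k * G z)"
    by (rule integrable_gauss_bound[OF K(1) _ mult_l1_bound[OF K bG]]) (use K in measurable)
  have i2: "integrable (gauss K) G'"
    by (rule integrable_gauss_bound[OF K(1) _ bG']) simp
  have "(\<integral>z. z k * G z \<partial>gauss K) = (\<integral>z. (\<integral>y. y * G (z(k := y)) \<partial>std_gauss) \<partial>gauss K')"
    using gauss.product_integral_insert[OF K'(2,3), of "\<lambda>z. z k * G z"] i1 K'(1) by simp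
  also have "\<dots> = (\<integral>z. (\<integral>y. G' (z(k := y)) \<partial>std_gauss) \<partial>gauss K')"
  proof (rule Bochner_Integration.integral_cong[OF refl])
    fix z
    show "(\<integral>y. y * G (z(k := y)) \<partial>std_gauss) = (\<integral>y. G' (z(k := y)) \<partial>std_gauss)"
    proof (rule std_gauss_ibp[where A = "A * exp (B * l1 K' z)" and B = B, OF der cont])
      fix y
      show "\<bar>G (z(k := y))\<bar> \<le> A * exp (B * l1 K' z) * exp (B * \<bar>y\<bar>)"
        using bG[of "z(k := y)"] unfolding K'(1) l1_insert_upd[OF K'(2,3)]
        by (simp add: distrib_left exp_add mult_ac)
      show "\<bar>G' (z(k := y))\<bar> \<le> A * exp (B * l1 K' z) * exp (B * \<bar>y\<bar>)"
        using bG'[of "z(k := y)"] unfolding K'(1) l1_insert_upd[OF K'(2,3)]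
        by (simp add: distrib_left exp_add mult_ac)
    qed
  qed
  also have "\<dots> = (\<integral>z. G' z \<partial>gauss K)"
    using gauss.product_integral_insert[OF K'(2,3), of G'] i2 K'(1) by simp
  finally show ?thesis .
qed

text \<open>Dominated convergence along sequences: the mean value theorem writes each difference
  quotient as \<open>F'\<close> at an intermediate time, so a majorant of \<open>F'\<close> on the
  whole interval dominates the quotients too.\<close>

lemma has_real_derivative_integral:
  fixes F F' :: "real \<Rightarrow> 'a \<Rightarrow> real"
  assumes t0: "a < t0" "t0 < b"
    and int: "\<And>t. a < t \<Longrightarrow> t < b \<Longrightarrow> integrable M (F t)"
    and [measurable]: "F' t0 \<in> borel_measurable M"
    and der: "\<And>t z. a < t \<Longrightarrow> t < b \<Longrightarrow> z \<in> space M \<Longrightarrow> ((\<lambda>t. F t z) has_real_derivative F' t z) (at t)"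
    and bd: "\<And>t z. a < t \<Longrightarrow> t < b \<Longrightarrow> z \<in> space M \<Longrightarrow> \<bar>F' t z\<bar> \<le> D z"
    and D: "integrable M D"
  shows "((\<lambda>t. \<integral>z. F t z \<partial>M) has_real_derivative (\<integral>z. F' t0 z \<partial>M)) (at t0)"
  unfolding has_field_derivative_iff tendsto_at_iff_sequentially comp_def
proof (intro allI impI)
  fix X :: "nat \<Rightarrow> real"
  assume X: "\<forall>i. X i \<in> UNIV - {t0}" "X \<longlonglongrightarrow> t0"
  have "eventually (\<lambda>i. a < X i \<and> X i < b) sequentially"
    using order_tendstoD[OF X(2)] t0 by (auto intro: eventually_conj)
  then obtain N where N: "\<And>i. i \<ge> N \<Longrightarrow> a < X i \<and> X i < b"
    by (auto simp: eventually_sequentially)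
  \<comment> \<open>Dropping finitely many terms keeps the sequence inside the interval on which the
    derivative is known.\<close>
  define Y where "Y = (\<lambda>i. X (i + N))"
  have Y: "Y \<longlonglongrightarrow> t0" "\<And>i. a < Y i" "\<And>i. Y i < b" "\<And>i. Y i \<noteq> t0"
    using LIMSEQ_ignore_initial_segment[OF X(2), of N] N X(1) by (auto simp: Y_def)
  have "(\<lambda>i. \<integral>z. (F (Y i) z - F t0 z) / (Y i - t0) \<partial>M) \<longlonglongrightarrow> (\<integral>z. F' t0 z \<partial>M)"
  proof (rule integral_dominated_convergence[OF _ _ D])
    show "(\<lambda>z. (F (Y i) z - F t0 z) / (Y i - t0)) \<in> borel_measurable M" for i
      using int[of "Y i"] int[of t0] Y t0 by auto
    show "AE z in M. (\<lambda>i. (F (Y i) z - F t0 z) / (Y i - t0)) \<longlonglongrightarrow> F' t0 z"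
    proof (rule AE_I2)
      fix z assume "z \<in> space M"
      from der[OF t0 this] show "(\<lambda>i. (F (Y i) z - F t0 z) / (Y i - t0)) \<longlonglongrightarrow> F' t0 z"
        using Y by (auto simp: has_field_derivative_iff tendsto_at_iff_sequentially comp_def)
    qed
    show "AE z in M. norm ((F (Y i) z - F t0 z) / (Y i - t0)) \<le> D z" for i
    proof (rule AE_I2)
      fix z assume z: "z \<in> space M"
      show "norm ((F (Y i) z - F t0 z) / (Y i - t0)) \<le> D z"
      proof (cases "Y i < t0")
        case True
        obtain s where "Y i < s" "s < t0" "F t0 z - F (Y i) z = (t0 - Y i) * F' s z"
          using MVT2[OF True, of "\<lambda>t. F t z" "\<lambda>t. F' t z"] der z Y t0
          by (metis less_le_trans order.strict_trans1)
        then have "(F (Y i) z - F t0 z) / (Y i - t0) = F' s z" using True by (simp add: field_simps)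
        moreover have "a < s" "s < b" using \<open>Y i < s\<close> \<open>s < t0\<close> Y(2)[of i] t0 by auto
        ultimately show ?thesis using bd z by simp
      next
        case False
        then have "t0 < Y i" using Y(4)[of i] by simp
        then obtain s where "t0 < s" "s < Y i" "F (Y i) z - F t0 z = (Y i - t0) * F' s z"
          using MVT2[of t0 "Y i" "\<lambda>t. F t z" "\<lambda>t. F' t z"] der z Y t0
          by (metis less_le_trans order.strict_trans1)
        then have "(F (Y i) z - F t0 z) / (Y i - t0) = F' s z" using \<open>t0 < Y i\<close> by (simp add: field_simps)
        moreover have "a < s" "s < b" using \<open>t0 < s\<close> \<open>s < Y i\<close> Y(3)[of i] t0 by auto
        ultimately show ?thesis using bd z by simp
      qed
    qed
  qed simp
  also have "(\<lambda>i. \<integral>z. (F (Y i) z - F t0 z) / (Y i - t0) \<partial>M) =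
      (\<lambda>i. ((\<integral>z. F (Y i) z \<partial>M) - (\<integral>z. F t0 z \<partial>M)) / (Y i - t0))"
    using int Y t0 by (auto simp: Bochner_Integration.integral_diff)
  finally have "(\<lambda>i. ((\<integral>z. F (X (i + N)) z \<partial>M) - (\<integral>z. F t0 z \<partial>M)) / (X (i + N) - t0))
      \<longlonglongrightarrow> (\<integral>z. F' t0 z \<partial>M)" by (simp add: Y_def)
  then show "(\<lambda>i. ((\<integral>z. F (X i) z \<partial>M) - (\<integral>z. F t0 z \<partial>M)) / (X i - t0)) \<longlonglongrightarrow> (\<integral>z. F' t0 z \<partial>M)"
    by (rule LIMSEQ_offset)
qed

section \<open>Gibbs averages over a finite state space with Gaussian disorder\<close>

text \<open>
  A state \<open>x\<close> has weight \<open>exp (- \<Sum>i. \<psi>\<^sub>i (l i x))\<close>, where \<open>l = lin s z\<close> is a Gaussian matrix \<open>z\<close> with entrywise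
  standard deviations \<open>s\<close>; \<open>avg\<close> is the average over two independent replicas.
\<close>

locale gibbs =
  fixes I J :: "nat set" and X :: "(nat \<Rightarrow> real) set"
    and \<psi> \<psi>' \<psi>'' :: "nat \<Rightarrow> real \<Rightarrow> real" and p B :: real
  assumes fin: "finite I" "finite J" "finite X" and X_ne: "X \<noteq> {}"
    and X_le: "\<And>x j. x \<in> X \<Longrightarrow> j \<in> J \<Longrightarrow> \<bar>x j\<bar> \<le> 1"
    and \<psi>_der: "\<And>i u. (\<psi> i has_real_derivative \<psi>' i u) (at u)"
    and \<psi>'_der: "\<And>i u. (\<psi>' i has_real_derivative \<psi>'' i u) (at u)"
    and \<psi>''_cont: "\<And>i. continuous_on UNIV (\<psi>'' i)"
    and \<psi>'_le: "\<And>i u. \<bar>\<psi>' i u\<bar> \<le> B"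
    and \<psi>''_le: "\<And>i u. \<bar>\<psi>'' i u\<bar> \<le> B"
    and p: "0 < p" "p \<le> 1"
begin

definition energy :: "(nat \<Rightarrow> (nat \<Rightarrow> real) \<Rightarrow> real) \<Rightarrow> (nat \<Rightarrow> real) \<Rightarrow> real" where
  "energy l x = (\<Sum>i\<in>I. \<psi> i (l i x))"

definition W :: "(nat \<Rightarrow> (nat \<Rightarrow> real) \<Rightarrow> real) \<Rightarrow> real" where
  "W l = (\<Sum>x\<in>X. exp (- energy l x))"

definition \<Phi> :: "(nat \<Rightarrow> (nat \<Rightarrow> real) \<Rightarrow> real) \<Rightarrow> real" where
  "\<Phi> l = W l powr p"

definition pr :: "(nat \<Rightarrow> (nat \<Rightarrow> real) \<Rightarrow> real) \<Rightarrow> (nat \<Rightarrow> real) \<Rightarrow> real" where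
  "pr l x = exp (- energy l x) / W l"

definition avg1 :: "(nat \<Rightarrow> (nat \<Rightarrow> real) \<Rightarrow> real) \<Rightarrow> ((nat \<Rightarrow> real) \<Rightarrow> real) \<Rightarrow> real" where
  "avg1 l Q = (\<Sum>x\<in>X. pr l x * Q x)"

definition avg :: "(nat \<Rightarrow> (nat \<Rightarrow> real) \<Rightarrow> real) \<Rightarrow> ((nat \<Rightarrow> real) \<Rightarrow> (nat \<Rightarrow> real) \<Rightarrow> real) \<Rightarrow> real" where
  "avg l Q = avg1 l (\<lambda>x. avg1 l (Q x))"

definition lin :: "(nat \<times> nat \<Rightarrow> real) \<Rightarrow> (nat \<times> nat \<Rightarrow> real) \<Rightarrow> nat \<Rightarrow> (nat \<Rightarrow> real) \<Rightarrow> real" where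
  "lin s z i x = (\<Sum>j\<in>J. s (i, j) * z (i, j) * x j)"

abbreviation "\<gamma> \<equiv> gauss (I \<times> J)"

lemma W_pos: "0 < W l"
  unfolding W_def by (rule sum_pos) (use fin X_ne in auto)

lemma \<Phi>_pos: "0 < \<Phi> l"
  unfolding \<Phi>_def using W_pos[of l] by simp

lemma pr_nonneg: "0 \<le> pr l x"
  unfolding pr_def using W_pos[of l] by simp

lemma sum_pr: "(\<Sum>x\<in>X. pr l x) = 1"
  unfolding pr_def sum_divide_distrib[symmetric] W_def[symmetric] using W_pos[of l] by simp

lemma avg1_const[simp]: "avg1 l (\<lambda>_. a) = a"
  unfolding avg1_def sum_distrib_right[symmetric] sum_pr by simp

lemma avg1_add: "avg1 l (\<lambda>x. f x + g x) = avg1 l f + avg1 l g"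
  unfolding avg1_def by (simp add: distrib_left sum.distrib)

lemma avg1_diff: "avg1 l (\<lambda>x. f x - g x) = avg1 l f - avg1 l g"
  unfolding avg1_def by (simp add: right_diff_distrib sum_subtractf)

lemma avg1_cmult: "avg1 l (\<lambda>x. a * f x) = a * avg1 l f"
  unfolding avg1_def sum_distrib_left by (simp add: mult_ac)

lemma avg1_multc: "avg1 l (\<lambda>x. f x * a) = avg1 l f * a"
  unfolding avg1_def sum_distrib_right by (simp add: mult_ac)

lemma avg1_sum: "avg1 l (\<lambda>x. \<Sum>i\<in>S. f i x) = (\<Sum>i\<in>S. avg1 l (f i))"
  unfolding avg1_def sum_distrib_left by (rule sum.swap)

lemma avg1_mono: "(\<And>x. x \<in> X \<Longrightarrow> f x \<le> g x) \<Longrightarrow> avg1 l f \<le> avg1 l g"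
  unfolding avg1_def by (intro sum_mono mult_left_mono pr_nonneg)

lemma avg1_cong: "(\<And>x. x \<in> X \<Longrightarrow> f x = g x) \<Longrightarrow> avg1 l f = avg1 l g"
  unfolding avg1_def by (intro sum.cong refl) simp

lemma abs_avg1_le: "(\<And>x. x \<in> X \<Longrightarrow> \<bar>f x\<bar> \<le> C) \<Longrightarrow> \<bar>avg1 l f\<bar> \<le> C"
  using avg1_mono[of f "\<lambda>_. C" l] avg1_mono[of "\<lambda>_. - C" f l]
  by (auto simp: abs_le_iff minus_le_iff)

lemma avg_const[simp]: "avg l (\<lambda>_ _. a) = a"
  by (simp add: avg_def)

lemma avg_add: "avg l (\<lambda>x y. f x y + g x y) = avg l f + avg l g"
  by (simp add: avg_def avg1_add)

lemma avg_diff: "avg l (\<lambda>x y. f x y - g x y) = avg l f - avg l g"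
  by (simp add: avg_def avg1_diff)

lemma avg_cmult: "avg l (\<lambda>x y. a * f x y) = a * avg l f"
  by (simp add: avg_def avg1_cmult)

lemma avg_sum: "avg l (\<lambda>x y. \<Sum>i\<in>S. f i x y) = (\<Sum>i\<in>S. avg l (f i))"
  by (simp add: avg_def avg1_sum)

lemma avg_prod: "avg l (\<lambda>x y. f x * g y) = avg1 l f * avg1 l g"
  by (simp add: avg_def avg1_cmult avg1_multc)

lemma avg_mono: "(\<And>x y. x \<in> X \<Longrightarrow> y \<in> X \<Longrightarrow> f x y \<le> g x y) \<Longrightarrow> avg l f \<le> avg l g"
  unfolding avg_def by (intro avg1_mono)

lemma avg_cong: "(\<And>x y. x \<in> X \<Longrightarrow> y \<in> X \<Longrightarrow> f x y = g x y) \<Longrightarrow> avg l f = avg l g"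
  unfolding avg_def by (intro avg1_cong)

lemma abs_avg_le: "(\<And>x y. x \<in> X \<Longrightarrow> y \<in> X \<Longrightarrow> \<bar>f x y\<bar> \<le> C) \<Longrightarrow> \<bar>avg l f\<bar> \<le> C"
  unfolding avg_def by (intro abs_avg1_le)

lemma \<psi>_measurable[measurable]: "\<psi> i \<in> borel_measurable borel" "\<psi>' i \<in> borel_measurable borel"
    "\<psi>'' i \<in> borel_measurable borel"
proof -
  show "\<psi> i \<in> borel_measurable borel" "\<psi>' i \<in> borel_measurable borel"
    using \<psi>_der \<psi>'_der
    by (auto intro!: borel_measurable_continuous_onI continuous_at_imp_continuous_on DERIV_isCont)
  show "\<psi>'' i \<in> borel_measurable borel"
    using \<psi>''_cont by (rule borel_measurable_continuous_onI)
qed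

lemma lin_measurable[measurable]:
  assumes "i \<in> I"
  shows "(\<lambda>z. lin s z i x) \<in> borel_measurable \<gamma>"
  unfolding lin_def using assms by (intro borel_measurable_sum borel_measurable_times) auto

lemma energy_measurable[measurable]: "(\<lambda>z. energy (lin s z) x) \<in> borel_measurable \<gamma>"
  unfolding energy_def
  by (intro borel_measurable_sum measurable_compose[OF lin_measurable \<psi>_measurable(1)])

lemma W_measurable[measurable]: "(\<lambda>z. W (lin s z)) \<in> borel_measurable \<gamma>"
  unfolding W_def by measurable

lemma \<Phi>_measurable[measurable]: "(\<lambda>z. \<Phi> (lin s z)) \<in> borel_measurable \<gamma>"
  unfolding \<Phi>_def by measurable

lemma pr_measurable[measurable]: "(\<lambda>z. pr (lin s z) x) \<in> borel_measurable \<gamma>"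
  unfolding pr_def by measurable

lemma avg1_measurable:
  assumes "\<And>x. x \<in> X \<Longrightarrow> (\<lambda>z. Q z x) \<in> borel_measurable \<gamma>"
  shows "(\<lambda>z. avg1 (lin s z) (Q z)) \<in> borel_measurable \<gamma>"
  unfolding avg1_def by (intro borel_measurable_sum borel_measurable_times assms) measurable

lemma avg_measurable:
  assumes "\<And>x y. x \<in> X \<Longrightarrow> y \<in> X \<Longrightarrow> (\<lambda>z. Q z x y) \<in> borel_measurable \<gamma>"
  shows "(\<lambda>z. avg (lin s z) (Q z)) \<in> borel_measurable \<gamma>"
  unfolding avg_def by (intro avg1_measurable assms)


subsection \<open>Growth bounds\<close>

lemma B_nonneg: "0 \<le> B"
  using order_trans[OF abs_ge_zero \<psi>'_le[of 0 0]] .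

lemma \<psi>_growth: "\<bar>\<psi> i u\<bar> \<le> \<bar>\<psi> i 0\<bar> + B * \<bar>u\<bar>"
proof -
  have "norm (\<psi> i u - \<psi> i 0) \<le> B * norm (u - 0)"
    by (rule field_differentiable_bound[of UNIV "\<psi> i" "\<psi>' i"])
       (use \<psi>_der \<psi>'_le in \<open>auto intro: has_field_derivative_at_within\<close>)
  then show ?thesis by simp
qed

lemma sum_lin_le:
  assumes "x \<in> X" "\<And>k. k \<in> I \<times> J \<Longrightarrow> \<bar>s k\<bar> \<le> S"
  shows "(\<Sum>i\<in>I. \<bar>lin s z i x\<bar>) \<le> S * l1 (I \<times> J) z"
proof -
  have "(\<Sum>i\<in>I. \<bar>lin s z i x\<bar>) \<le> (\<Sum>i\<in>I. \<Sum>j\<in>J. S * \<bar>z (i, j)\<bar>)"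
  proof (rule sum_mono)
    fix i assume i: "i \<in> I"
    have "\<bar>lin s z i x\<bar> \<le> (\<Sum>j\<in>J. \<bar>s (i, j) * z (i, j) * x j\<bar>)"
      unfolding lin_def by (rule sum_abs)
    also have "\<dots> \<le> (\<Sum>j\<in>J. S * \<bar>z (i, j)\<bar>)"
    proof (rule sum_mono)
      fix j assume j: "j \<in> J"
      have "\<bar>s (i, j) * z (i, j) * x j\<bar> \<le> S * \<bar>z (i, j)\<bar> * 1"
        unfolding abs_mult using assms(2)[of "(i, j)"] X_le[OF assms(1) j] i j
        by (intro mult_mono) auto
      then show "\<bar>s (i, j) * z (i, j) * x j\<bar> \<le> S * \<bar>z (i, j)\<bar>" by simp
    qed
    finally show "\<bar>lin s z i x\<bar> \<le> (\<Sum>j\<in>J. S * \<bar>z (i, j)\<bar>)" .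
  qed
  also have "\<dots> = S * l1 (I \<times> J) z"
    unfolding l1_def by (simp add: sum.cartesian_product sum_distrib_left)
  finally show ?thesis .
qed

definition C0 :: real where
  "C0 = real (card X) * exp (\<Sum>i\<in>I. \<bar>\<psi> i 0\<bar>)"

lemma C0_ge: "1 \<le> C0"
proof -
  have "1 \<le> real (card X)" using X_ne fin by (simp add: Suc_le_eq card_gt_0_iff)
  moreover have "1 \<le> exp (\<Sum>i\<in>I. \<bar>\<psi> i 0\<bar>)" by (simp add: sum_nonneg)
  ultimately show ?thesis unfolding C0_def using mult_mono[of 1 "real (card X)" 1] by simp
qed

lemma \<Phi>_le:
  assumes "\<And>k. k \<in> I \<times> J \<Longrightarrow> \<bar>s k\<bar> \<le> S"
  shows "\<Phi> (lin s z) \<le> C0 * exp (B * S * l1 (I \<times> J) z)"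
proof -
  have e: "exp (- energy (lin s z) x) \<le> exp ((\<Sum>i\<in>I. \<bar>\<psi> i 0\<bar>) + B * S * l1 (I \<times> J) z)" if x: "x \<in> X" for x
  proof -
    have "- energy (lin s z) x \<le> \<bar>energy (lin s z) x\<bar>" by simp
    also have "\<dots> \<le> (\<Sum>i\<in>I. \<bar>\<psi> i (lin s z i x)\<bar>)" unfolding energy_def by (rule sum_abs)
    also have "\<dots> \<le> (\<Sum>i\<in>I. \<bar>\<psi> i 0\<bar> + B * \<bar>lin s z i x\<bar>)" by (intro sum_mono \<psi>_growth)
    also have "\<dots> = (\<Sum>i\<in>I. \<bar>\<psi> i 0\<bar>) + B * (\<Sum>i\<in>I. \<bar>lin s z i x\<bar>)"
      by (simp add: sum.distrib sum_distrib_left)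
    also have "\<dots> \<le> (\<Sum>i\<in>I. \<bar>\<psi> i 0\<bar>) + B * (S * l1 (I \<times> J) z)"
      by (intro add_left_mono mult_left_mono sum_lin_le x assms B_nonneg)
    finally show ?thesis by (simp add: mult.assoc)
  qed
  have W: "W (lin s z) \<le> C0 * exp (B * S * l1 (I \<times> J) z)"
    unfolding W_def C0_def using sum_bounded_above[of X, OF e] by (simp add: exp_add mult_ac)
  have "\<Phi> (lin s z) \<le> max 1 (W (lin s z))"
  proof (cases "W (lin s z) \<ge> 1")
    case True
    then show ?thesis unfolding \<Phi>_def using powr_mono[of p 1 "W (lin s z)"] p by simp
  next
    case False
    then show ?thesis unfolding \<Phi>_def
      using powr_mono2[of p "W (lin s z)" 1] p W_pos[of "lin s z"] by simp
  qed
  moreover have "1 \<le> C0 * exp (B * S * l1 (I \<times> J) z)" if "0 \<le> S"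
    using mult_mono[OF C0_ge, of 1 "exp (B * S * l1 (I \<times> J) z)"] C0_ge B_nonneg l1_nonneg[of "I \<times> J" z] that
    by simp
  \<comment> \<open>With an empty index set the hypothesis says nothing about the sign of
    \<open>S\<close>; in that case \<open>l1\<close> vanishes and the exponential equals 1.\<close>
  moreover have "0 \<le> S" if "I \<times> J \<noteq> {}"
    using that assms by (metis abs_ge_zero ex_in_conv order_trans)
  moreover have "1 \<le> C0 * exp (B * S * l1 (I \<times> J) z)" if "I \<times> J = {}"
    using C0_ge unfolding that by (simp add: l1_def)
  ultimately show ?thesis using W by (cases "I \<times> J = {}") auto
qed

lemma \<Phi>_mult_bound:
  assumes "\<And>k. k \<in> I \<times> J \<Longrightarrow> \<bar>s k\<bar> \<le> S" "\<bar>F\<bar> \<le> C"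
  shows "\<bar>\<Phi> (lin s z) * F\<bar> \<le> (C0 * C) * exp (B * S * l1 (I \<times> J) z)"
proof -
  have "\<bar>\<Phi> (lin s z) * F\<bar> \<le> (C0 * exp (B * S * l1 (I \<times> J) z)) * C"
    unfolding abs_mult using \<Phi>_le[of s S z, OF assms(1)] assms(2) \<Phi>_pos[of "lin s z"] C0_ge
    by (intro mult_mono) auto
  then show ?thesis by (simp add: mult_ac)
qed

lemma finite_s_bound: "\<exists>S. \<forall>k\<in>I \<times> J. \<bar>s k\<bar> \<le> (S :: real)"
  using finite_set_of_finite_maps fin
  by (intro exI[of _ "\<Sum>k\<in>I \<times> J. \<bar>s k\<bar>"]) (auto intro!: member_le_sum)

lemma integrable_\<Phi>_mult:
  assumes "F \<in> borel_measurable \<gamma>" "\<And>z. \<bar>F z\<bar> \<le> C"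
  shows "integrable \<gamma> (\<lambda>z. \<Phi> (lin s z) * F z)"
proof -
  obtain S where S: "\<And>k. k \<in> I \<times> J \<Longrightarrow> \<bar>s k\<bar> \<le> S" using finite_s_bound[of s] by auto
  show ?thesis
    using fin assms by (intro integrable_gauss_bound[OF _ _ \<Phi>_mult_bound[OF S]]) auto
qed

lemma integrable_\<Phi>: "integrable \<gamma> (\<lambda>z. \<Phi> (lin s z))"
  using integrable_\<Phi>_mult[of "\<lambda>_. 1" 1 s] by simp


subsection \<open>Derivatives of Gibbs averages\<close>

definition denergy where
  "denergy l l' r x = (\<Sum>i\<in>I. \<psi>' i (l r i x) * l' r i x)"
  for l l' :: "real \<Rightarrow> nat \<Rightarrow> (nat \<Rightarrow> real) \<Rightarrow> real"

context
  fixes l l' :: "real \<Rightarrow> nat \<Rightarrow> (nat \<Rightarrow> real) \<Rightarrow> real" and r :: real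
  assumes l: "\<And>i x. i \<in> I \<Longrightarrow> x \<in> X \<Longrightarrow> ((\<lambda>r. l r i x) has_real_derivative l' r i x) (at r)"
begin

abbreviation "de \<equiv> denergy l l' r"

lemma energy_deriv:
  assumes "x \<in> X"
  shows "((\<lambda>r. energy (l r) x) has_real_derivative de x) (at r)"
  unfolding energy_def denergy_def using assms
  by (intro DERIV_sum DERIV_chain2[OF \<psi>_der] l)

lemma weight_deriv:
  assumes "x \<in> X"
  shows "((\<lambda>r. exp (- energy (l r) x)) has_real_derivative - de x * exp (- energy (l r) x)) (at r)"
  using energy_deriv[OF assms] by (auto intro!: derivative_eq_intros)

lemma W_deriv: "((\<lambda>r. W (l r)) has_real_derivative - avg1 (l r) de * W (l r)) (at r)"
proof -
  have "((\<lambda>r. W (l r)) has_real_derivative (\<Sum>x\<in>X. - de x * exp (- energy (l r) x))) (at r)"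
    unfolding W_def by (intro DERIV_sum weight_deriv)
  also have "(\<Sum>x\<in>X. - de x * exp (- energy (l r) x)) = - avg1 (l r) de * W (l r)"
    unfolding avg1_def pr_def sum_distrib_right sum_negf[symmetric]
    using W_pos[of "l r"] by (intro sum.cong) auto
  finally show ?thesis .
qed

lemma \<Phi>_deriv: "((\<lambda>r. \<Phi> (l r)) has_real_derivative - p * avg1 (l r) de * \<Phi> (l r)) (at r)"
proof -
  have "((\<lambda>r. W (l r) powr p) has_real_derivative
      p * (- avg1 (l r) de * W (l r)) * W (l r) powr (p - 1)) (at r)"
    by (rule derivative_eq_intros W_deriv refl | use W_pos[of "l r"] in simp)+
  also have "p * (- avg1 (l r) de * W (l r)) * W (l r) powr (p - 1) = - p * avg1 (l r) de * \<Phi> (l r)"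
    unfolding \<Phi>_def using W_pos[of "l r"] by (simp add: powr_diff field_simps)
  finally show ?thesis unfolding \<Phi>_def .
qed

lemma pr_deriv:
  assumes "x \<in> X"
  shows "((\<lambda>r. pr (l r) x) has_real_derivative pr (l r) x * (avg1 (l r) de - de x)) (at r)"
  unfolding pr_def
  by (rule derivative_eq_intros weight_deriv[OF assms] W_deriv refl | use W_pos[of "l r"] in \<open>simp add: field_simps\<close>)+

lemma avg1_deriv:
  assumes "\<And>x. x \<in> X \<Longrightarrow> ((\<lambda>r. Q r x) has_real_derivative Q' x) (at r)"
  shows "((\<lambda>r. avg1 (l r) (Q r)) has_real_derivative
    avg1 (l r) (\<lambda>x. Q' x - Q r x * de x) + avg1 (l r) de * avg1 (l r) (Q r)) (at r)"
proof -
  have "((\<lambda>r. avg1 (l r) (Q r)) has_real_derivative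
      (\<Sum>x\<in>X. pr (l r) x * (avg1 (l r) de - de x) * Q r x + Q' x * pr (l r) x)) (at r)"
    unfolding avg1_def[of "l _" "Q _"] by (intro DERIV_sum DERIV_mult pr_deriv assms)
  also have "(\<Sum>x\<in>X. pr (l r) x * (avg1 (l r) de - de x) * Q r x + Q' x * pr (l r) x) =
     avg1 (l r) (\<lambda>x. Q' x - Q r x * de x + avg1 (l r) de * Q r x)"
    unfolding avg1_def[of "l r" "\<lambda>x. Q' x - Q r x * de x + avg1 (l r) de * Q r x"]
    by (intro sum.cong) (auto simp: algebra_simps)
  finally show ?thesis by (simp add: avg1_add avg1_cmult)
qed

lemma avg_deriv:
  assumes "\<And>x y. x \<in> X \<Longrightarrow> y \<in> X \<Longrightarrow> ((\<lambda>r. Q r x y) has_real_derivative Q' x y) (at r)"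
  shows "((\<lambda>r. avg (l r) (Q r)) has_real_derivative
    avg (l r) (\<lambda>x y. Q' x y - Q r x y * (de x + de y)) + 2 * avg1 (l r) de * avg (l r) (Q r)) (at r)"
proof -
  have "((\<lambda>r. avg (l r) (Q r)) has_real_derivative
    avg1 (l r) (\<lambda>x. (avg1 (l r) (\<lambda>y. Q' x y - Q r x y * de y) + avg1 (l r) de * avg1 (l r) (Q r x))
       - avg1 (l r) (Q r x) * de x) + avg1 (l r) de * avg1 (l r) (\<lambda>x. avg1 (l r) (Q r x))) (at r)"
    unfolding avg_def by (intro avg1_deriv assms)
  moreover have "avg (l r) (\<lambda>x y. Q' x y - Q r x y * (de x + de y)) =
    avg1 (l r) (\<lambda>x. avg1 (l r) (\<lambda>y. Q' x y - Q r x y * de y) - avg1 (l r) (Q r x) * de x)"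
  proof -
    have "avg1 (l r) (\<lambda>y. Q' x y - Q r x y * (de x + de y)) =
        avg1 (l r) (\<lambda>y. Q' x y - Q r x y * de y) - avg1 (l r) (Q r x) * de x" for x
      unfolding avg1_multc[symmetric] avg1_diff[symmetric]
      by (rule avg1_cong) (simp add: algebra_simps)
    then show ?thesis unfolding avg_def by (simp only:)
  qed
  ultimately show ?thesis
    by - (erule DERIV_cong, simp add: avg_def avg1_add avg1_diff avg1_cmult)
qed

text \<open>Each replica contributes its own \<open>- de\<close>, the two normalizations add
  \<open>2 * avg1 (l r) de\<close>, and the factor \<open>\<Phi>\<close> adds
  \<open>- p * avg1 (l r) de\<close>; hence the coefficient \<open>2 - p\<close>.\<close>

lemma \<Phi>_avg_deriv:
  assumes "\<And>x y. x \<in> X \<Longrightarrow> y \<in> X \<Longrightarrow> ((\<lambda>r. Q r x y) has_real_derivative Q' x y) (at r)"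
  shows "((\<lambda>r. \<Phi> (l r) * avg (l r) (Q r)) has_real_derivative
    \<Phi> (l r) * (avg (l r) (\<lambda>x y. Q' x y - Q r x y * (de x + de y))
      + (2 - p) * avg1 (l r) de * avg (l r) (Q r))) (at r)"
proof -
  have "((\<lambda>r. avg (l r) (Q r)) has_real_derivative
    avg (l r) (\<lambda>x y. Q' x y - Q r x y * (de x + de y)) + 2 * avg1 (l r) de * avg (l r) (Q r)) (at r)"
    by (rule avg_deriv[OF assms])
  from DERIV_mult[OF \<Phi>_deriv this] show ?thesis by (rule DERIV_cong) algebra
qed

end


subsection \<open>Gaussian integration by parts\<close>

lemma lin_upd_deriv:
  assumes "i0 \<in> I" "j0 \<in> J"
  shows "((\<lambda>r. lin s (z((i0, j0) := r)) i x) has_real_derivative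
    (if i = i0 then s (i0, j0) * x j0 else 0)) (at r)"
proof -
  have "((\<lambda>r. s (i, j) * (z((i0, j0) := r)) (i, j) * x j) has_real_derivative
      (if j0 = j then if i = i0 then s (i0, j0) * x j0 else 0 else 0)) (at r)" for j
    by (cases "(i, j) = (i0, j0)") (auto intro!: derivative_eq_intros)
  then have "((\<lambda>r. lin s (z((i0, j0) := r)) i x) has_real_derivative
      (\<Sum>j\<in>J. if j0 = j then if i = i0 then s (i0, j0) * x j0 else 0 else 0)) (at r)"
    unfolding lin_def by (intro DERIV_sum)
  then show ?thesis using fin assms by simp
qed

text \<open>A change of \<open>z (i, j)\<close> moves only the fields of row \<open>i\<close>. The
  test function is a weight \<open>R\<close> on replica pairs times a function \<open>A\<close> of
  one local field, so that one identity serves for \<open>\<psi>'\<close>, for \<open>tanh\<close>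
  at two different widths, and for the constant 1.\<close>

lemma ibp:
  assumes ij: "i \<in> I" "j \<in> J"
    and R: "\<And>x y. x \<in> X \<Longrightarrow> y \<in> X \<Longrightarrow> \<bar>R x y\<bar> \<le> C"
    and A: "\<And>u. (A has_real_derivative A' u) (at u)" "continuous_on UNIV A'"
      "\<And>u. \<bar>A u\<bar> \<le> C" "\<And>u. \<bar>A' u\<bar> \<le> C"
  shows "(\<integral>z. z (i, j) * (\<Phi> (lin s z) * avg (lin s z) (\<lambda>x y. R x y * A (lin s z i x))) \<partial>\<gamma>) =
    s (i, j) * (\<integral>z. \<Phi> (lin s z) *
      (avg (lin s z) (\<lambda>x y. R x y * (A' (lin s z i x) * x j
          - A (lin s z i x) * (\<psi>' i (lin s z i x) * x j + \<psi>' i (lin s z i y) * y j)))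
       + (2 - p) * avg1 (lin s z) (\<lambda>x. \<psi>' i (lin s z i x) * x j)
          * avg (lin s z) (\<lambda>x y. R x y * A (lin s z i x))) \<partial>\<gamma>)"
proof -
  obtain S where S: "\<And>k. k \<in> I \<times> J \<Longrightarrow> \<bar>s k\<bar> \<le> S" using finite_s_bound[of s] by auto
  define k where "k = (i, j)"
  have k: "k \<in> I \<times> J" using ij by (simp add: k_def)
  have C: "0 \<le> C" using order_trans[OF abs_ge_zero A(3)[of 0]] .
  have [measurable]: "A \<in> borel_measurable borel" "A' \<in> borel_measurable borel"
    using A(1,2)
    by (auto intro!: borel_measurable_continuous_onI continuous_at_imp_continuous_on intro: DERIV_isCont)
  define Q where "Q z x y = R x y * A (lin s z i x)" for z x y
  define Q' where "Q' z x y = R x y * (s k * (A' (lin s z i x) * x j)) -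
      R x y * A (lin s z i x) * (\<psi>' i (lin s z i x) * (s k * x j) + \<psi>' i (lin s z i y) * (s k * y j))" for z x y
  define G where "G z = \<Phi> (lin s z) * avg (lin s z) (Q z)" for z
  define G' where "G' z = \<Phi> (lin s z) * (avg (lin s z) (Q' z)
      + (2 - p) * avg1 (lin s z) (\<lambda>x. \<psi>' i (lin s z i x) * (s k * x j)) * avg (lin s z) (Q z))" for z
  note lm[measurable] = lin_measurable[OF ij(1)]
  have mQ[measurable]: "(\<lambda>z. avg (lin s z) (Q z)) \<in> borel_measurable \<gamma>"
    "(\<lambda>z. avg (lin s z) (Q' z)) \<in> borel_measurable \<gamma>"
    "(\<lambda>z. avg1 (lin s z) (\<lambda>x. \<psi>' i (lin s z i x) * (s k * x j))) \<in> borel_measurable \<gamma>"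
    unfolding Q_def Q'_def by (intro avg_measurable avg1_measurable; measurable)+
  have ld: "((\<lambda>r. lin s (z(k := r)) i' x) has_real_derivative (if i' = i then s k * x j else 0)) (at r)"
    for i' x z r unfolding k_def by (rule lin_upd_deriv[OF ij])
  have dek: "denergy (\<lambda>r. lin s (z(k := r))) (\<lambda>r i' x. if i' = i then s k * x j else 0) r
      = (\<lambda>x. \<psi>' i (lin s (z(k := r)) i x) * (s k * x j))" for z r
    using fin ij by (intro ext) (simp add: denergy_def if_distrib[of "\<lambda>u. _ * u"] cong: if_cong)
  have der: "((\<lambda>y. G (z(k := y))) has_real_derivative G' (z(k := y))) (at y)" for z y
  proof -
    have "((\<lambda>r. Q (z(k := r)) x x') has_real_derivative
        R x x' * (A' (lin s (z(k := y)) i x) * (s k * x j))) (at y)" for x x'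
      unfolding Q_def using ld[of z i x y] by (auto intro!: derivative_eq_intros DERIV_chain2[OF A(1)])
    from \<Phi>_avg_deriv[where l = "\<lambda>r. lin s (z(k := r))"
        and l' = "\<lambda>r i' x. if i' = i then s k * x j else 0", OF ld this]
    show ?thesis unfolding G_def G'_def dek Q'_def Q_def
      by (rule DERIV_cong) (simp add: mult_ac)
  qed
  have S0: "0 \<le> S" using order_trans[OF abs_ge_zero S[OF k]] .
  have xS: "\<bar>s k * x j\<bar> \<le> S" if "x \<in> X" for x
    unfolding abs_mult using mult_mono[OF S[OF k] X_le[OF that ij(2)]] S0 by simp
  have QC: "\<bar>Q z x y\<bar> \<le> C * C" if "x \<in> X" "y \<in> X" for z x y
    unfolding Q_def abs_mult using R[OF that] A(3) C by (intro mult_mono) auto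
  have pS: "\<bar>\<psi>' i u * (s k * x j)\<bar> \<le> B * S" if "x \<in> X" for u x
    unfolding abs_mult[of "\<psi>' i u"] using \<psi>'_le xS[OF that] B_nonneg by (intro mult_mono) auto
  have Q'C: "\<bar>Q' z x y\<bar> \<le> C * (S * C) + C * C * (B * S + B * S)" if "x \<in> X" "y \<in> X" for z x y
  proof -
    have "\<bar>R x y * (s k * (A' (lin s z i x) * x j))\<bar> \<le> C * (S * C)"
    proof -
      have "\<bar>s k * (A' (lin s z i x) * x j)\<bar> = \<bar>s k * x j\<bar> * \<bar>A' (lin s z i x)\<bar>"
        by (simp add: abs_mult mult_ac)
      also have "\<dots> \<le> S * C" using xS that A(4) S0 by (intro mult_mono) auto
      finally show ?thesis unfolding abs_mult[of "R x y"] using R[OF that] C by (intro mult_mono) auto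
    qed
    moreover have "\<bar>R x y * A (lin s z i x) * (\<psi>' i (lin s z i x) * (s k * x j) + \<psi>' i (lin s z i y) * (s k * y j))\<bar>
        \<le> C * C * (B * S + B * S)"
      unfolding abs_mult[of "R x y * _"]
      using QC[OF that, of z] C abs_triangle_ineq pS[OF that(1)] pS[OF that(2)]
      by (intro mult_mono order_trans[OF abs_triangle_ineq] add_mono) (auto simp: Q_def)
    ultimately show ?thesis unfolding Q'_def by linarith
  qed
  have cont: "continuous_on UNIV (\<lambda>y. G' (z(k := y)))" for z
  proof -
    have l: "continuous_on UNIV (\<lambda>y. lin s (z(k := y)) i x)" for x
      using ld by (intro continuous_at_imp_continuous_on ballI DERIV_isCont)
    have pc: "continuous_on UNIV (\<lambda>y. pr (lin s (z(k := y))) x)" if "x \<in> X" for x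
      using pr_deriv[where l = "\<lambda>r. lin s (z(k := r))"
        and l' = "\<lambda>r i' x. if i' = i then s k * x j else 0", OF ld that]
      by (intro continuous_at_imp_continuous_on ballI DERIV_isCont)
    have Pc: "continuous_on UNIV (\<lambda>y. \<Phi> (lin s (z(k := y))))"
      using \<Phi>_deriv[where l = "\<lambda>r. lin s (z(k := r))"
        and l' = "\<lambda>r i' x. if i' = i then s k * x j else 0", OF ld]
      by (intro continuous_at_imp_continuous_on ballI DERIV_isCont)
    have cA: "continuous_on UNIV A" "continuous_on UNIV (\<psi>' i)"
      using A(1) \<psi>'_der by (auto intro!: continuous_at_imp_continuous_on intro: DERIV_isCont)
    have "continuous_on UNIV (\<lambda>y. A (lin s (z(k := y)) i x))"
      "continuous_on UNIV (\<lambda>y. A' (lin s (z(k := y)) i x))"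
      "continuous_on UNIV (\<lambda>y. \<psi>' i (lin s (z(k := y)) i x))" for x
      using l by (auto intro!: continuous_on_compose2[OF cA(1)] continuous_on_compose2[OF cA(2)]
         continuous_on_compose2[OF A(2)])
    with pc Pc show ?thesis unfolding G'_def Q_def Q'_def avg_def avg1_def
      by (intro continuous_intros) auto
  qed
  have bG: "\<bar>G z\<bar> \<le> (C0 * (C * C)) * exp (B * S * l1 (I \<times> J) z)" for z
    unfolding G_def by (rule \<Phi>_mult_bound[OF S abs_avg_le[OF QC]])
  define D where "D = C * (S * C) + C * C * (B * S + B * S) + 2 * (B * S) * (C * C) + C * C"
  have bG': "\<bar>G' z\<bar> \<le> (C0 * D) * exp (B * S * l1 (I \<times> J) z)" for z
    unfolding G'_def
  proof (rule \<Phi>_mult_bound[OF S])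
    have "\<bar>avg (lin s z) (Q' z)\<bar> \<le> C * (S * C) + C * C * (B * S + B * S)"
      by (rule abs_avg_le[OF Q'C])
    moreover have "\<bar>(2 - p) * avg1 (lin s z) (\<lambda>x. \<psi>' i (lin s z i x) * (s k * x j)) * avg (lin s z) (Q z)\<bar>
        \<le> 2 * (B * S) * (C * C)"
      unfolding abs_mult[of "_ * _"] abs_mult[of "2 - p"]
      using p B_nonneg S0 C by (intro mult_mono abs_avg1_le pS abs_avg_le QC) auto
    moreover have "0 \<le> C * C" using C by simp
    ultimately show "\<bar>avg (lin s z) (Q' z) + (2 - p) * avg1 (lin s z) (\<lambda>x. \<psi>' i (lin s z i x) * (s k * x j))
        * avg (lin s z) (Q z)\<bar> \<le> D" unfolding D_def by linarith
  qed
  have "C * C \<le> D" unfolding D_def using C S0 B_nonneg by simp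
  then have bG2: "\<bar>G z\<bar> \<le> (C0 * D) * exp (B * S * l1 (I \<times> J) z)" for z
    using C0_ge by (intro order_trans[OF bG] mult_right_mono mult_left_mono) auto
  have "(\<integral>z. z k * G z \<partial>\<gamma>) = (\<integral>z. G' z \<partial>\<gamma>)"
    by (rule gauss_ibp[OF _ k _ _ der cont bG2 bG']) (use fin in \<open>auto simp: G_def G'_def\<close>)
  also have "\<dots> = (\<integral>z. s k * (\<Phi> (lin s z) *
      (avg (lin s z) (\<lambda>x y. R x y * (A' (lin s z i x) * x j
          - A (lin s z i x) * (\<psi>' i (lin s z i x) * x j + \<psi>' i (lin s z i y) * y j)))
       + (2 - p) * avg1 (lin s z) (\<lambda>x. \<psi>' i (lin s z i x) * x j)
          * avg (lin s z) (\<lambda>x y. R x y * A (lin s z i x)))) \<partial>\<gamma>)"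
  proof (rule Bochner_Integration.integral_cong[OF refl])
    fix z
    have "avg (lin s z) (Q' z) = s k * avg (lin s z) (\<lambda>x y. R x y * (A' (lin s z i x) * x j
          - A (lin s z i x) * (\<psi>' i (lin s z i x) * x j + \<psi>' i (lin s z i y) * y j)))"
      unfolding avg_cmult[symmetric] Q'_def by (rule avg_cong) algebra
    moreover have "avg1 (lin s z) (\<lambda>x. \<psi>' i (lin s z i x) * (s k * x j)) =
        s k * avg1 (lin s z) (\<lambda>x. \<psi>' i (lin s z i x) * x j)"
      unfolding avg1_cmult[symmetric] by (rule avg1_cong) algebra
    ultimately show "G' z = s k * (\<Phi> (lin s z) *
      (avg (lin s z) (\<lambda>x y. R x y * (A' (lin s z i x) * x j
          - A (lin s z i x) * (\<psi>' i (lin s z i x) * x j + \<psi>' i (lin s z i y) * y j)))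
       + (2 - p) * avg1 (lin s z) (\<lambda>x. \<psi>' i (lin s z i x) * x j)
          * avg (lin s z) (\<lambda>x y. R x y * A (lin s z i x))))"
      unfolding G'_def Q_def by algebra
  qed
  finally show ?thesis unfolding G_def Q_def k_def by simp
qed


subsection \<open>Gaussian interpolation\<close>

lemma avg1_le_lin:
  assumes "\<And>k. k \<in> I \<times> J \<Longrightarrow> \<bar>s k\<bar> \<le> S"
  shows "\<bar>avg1 l (\<lambda>x. \<Sum>i\<in>I. \<psi>' i (l i x) * lin s z i x)\<bar> \<le> B * (S * l1 (I \<times> J) z)"
proof (rule abs_avg1_le)
  fix x assume x: "x \<in> X"
  have "\<bar>\<Sum>i\<in>I. \<psi>' i (l i x) * lin s z i x\<bar> \<le> (\<Sum>i\<in>I. \<bar>\<psi>' i (l i x) * lin s z i x\<bar>)"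
    by (rule sum_abs)
  also have "\<dots> \<le> (\<Sum>i\<in>I. B * \<bar>lin s z i x\<bar>)"
    unfolding abs_mult by (intro sum_mono mult_right_mono \<psi>'_le) auto
  also have "\<dots> \<le> B * (S * l1 (I \<times> J) z)"
    unfolding sum_distrib_left[symmetric] by (intro mult_left_mono sum_lin_le x assms B_nonneg)
  finally show "\<bar>\<Sum>i\<in>I. \<psi>' i (l i x) * lin s z i x\<bar> \<le> B * (S * l1 (I \<times> J) z)" .
qed

text \<open>The assumption \<open>bal\<close> says that the variance of every local field is
  stationary at \<open>t0\<close>; the inner sum with \<open>x\<close> and \<open>y\<close> is half
  the derivative of its covariance between two states. Integration by parts gives one-replica terms
  with \<open>\<psi>'' - \<psi>'^2\<close>, which \<open>bal\<close> annihilates, and two-replica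
  products with net coefficient \<open>(2 - p) - 1 = 1 - p\<close>.\<close>

lemma interpolation_deriv:
  fixes s s' :: "real \<Rightarrow> nat \<times> nat \<Rightarrow> real"
  assumes t0: "a < t0" "t0 < b" and S0: "0 \<le> S"
    and s: "\<And>t k. a < t \<Longrightarrow> t < b \<Longrightarrow> k \<in> I \<times> J \<Longrightarrow> ((\<lambda>t. s t k) has_real_derivative s' t k) (at t)"
    and S: "\<And>t k. a < t \<Longrightarrow> t < b \<Longrightarrow> k \<in> I \<times> J \<Longrightarrow> \<bar>s t k\<bar> \<le> S"
    and S': "\<And>t k. a < t \<Longrightarrow> t < b \<Longrightarrow> k \<in> I \<times> J \<Longrightarrow> \<bar>s' t k\<bar> \<le> S"
    and bal: "\<And>i x. i \<in> I \<Longrightarrow> x \<in> X \<Longrightarrow> (\<Sum>j\<in>J. s t0 (i, j) * s' t0 (i, j) * (x j)\<^sup>2) = 0"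
  shows "((\<lambda>t. \<integral>z. \<Phi> (lin (s t) z) \<partial>\<gamma>) has_real_derivative
    - (p * (1 - p)) * (\<integral>z. \<Phi> (lin (s t0) z) * avg (lin (s t0) z)
       (\<lambda>x y. \<Sum>i\<in>I. \<psi>' i (lin (s t0) z i x) * \<psi>' i (lin (s t0) z i y)
           * (\<Sum>j\<in>J. s t0 (i, j) * s' t0 (i, j) * x j * y j)) \<partial>\<gamma>)) (at t0)"
proof -
  define m where "m t z = avg1 (lin (s t) z) (\<lambda>x. \<Sum>i\<in>I. \<psi>' i (lin (s t) z i x) * lin (s' t) z i x)" for t z
  let ?D = "\<lambda>z. (C0 * (B * S)) * exp ((B * S + 1) * l1 (I \<times> J) z)"
  have mm[measurable]: "m t \<in> borel_measurable \<gamma>" for t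
    unfolding m_def
    by (intro avg1_measurable borel_measurable_sum borel_measurable_times lin_measurable
        measurable_compose[OF lin_measurable \<psi>_measurable(2)])
  have D: "((\<lambda>t. \<integral>z. \<Phi> (lin (s t) z) \<partial>\<gamma>) has_real_derivative
      (\<integral>z. - p * m t0 z * \<Phi> (lin (s t0) z) \<partial>\<gamma>)) (at t0)"
  proof (rule has_real_derivative_integral[OF t0, where D = ?D])
    show "integrable \<gamma> (\<lambda>z. \<Phi> (lin (s t) z))" for t by (rule integrable_\<Phi>)
    show "(\<lambda>z. - p * m t0 z * \<Phi> (lin (s t0) z)) \<in> borel_measurable \<gamma>" by measurable
    show "integrable \<gamma> ?D" using fin by (intro integrable_gauss_exp_l1) auto
  next
    fix t z assume t: "a < t" "t < b"
    have "((\<lambda>t. lin (s t) z i x) has_real_derivative lin (s' t) z i x) (at t)" if "i \<in> I" for i x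
      unfolding lin_def using that s[OF t] by (auto intro!: DERIV_sum derivative_eq_intros)
    from \<Phi>_deriv[where l = "\<lambda>t. lin (s t) z" and l' = "\<lambda>t. lin (s' t) z", OF this]
    show "((\<lambda>t. \<Phi> (lin (s t) z)) has_real_derivative - p * m t z * \<Phi> (lin (s t) z)) (at t)"
      unfolding m_def denergy_def[abs_def] by simp
    let ?l = "l1 (I \<times> J) z"
    have "\<bar>- p * m t z * \<Phi> (lin (s t) z)\<bar> = p * (\<bar>m t z\<bar> * \<Phi> (lin (s t) z))"
      using p \<Phi>_pos[of "lin (s t) z"] by (simp add: abs_mult)
    also have "\<dots> \<le> 1 * ((B * (S * ?l)) * (C0 * exp (B * S * ?l)))"
      unfolding m_def using p \<Phi>_pos[of "lin (s t) z"]
        order_trans[OF abs_ge_zero avg1_le_lin[where s = "s' t" and z = z and l = "lin (s t) z", OF S'[OF t]]]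
      by (intro mult_mono avg1_le_lin \<Phi>_le S S' t) (auto simp: less_imp_le)
    also have "\<dots> = (C0 * exp (B * S * ?l)) * (?l * (B * S))" by simp
    also have "\<dots> \<le> (C0 * exp (B * S * ?l)) * (exp ?l * (B * S))"
    proof -
      have "?l \<le> exp ?l" using exp_ge_add_one_self[of ?l] by linarith
      then show ?thesis using C0_ge B_nonneg S0
        by (intro mult_left_mono mult_right_mono) auto
    qed
    also have "\<dots> = ?D z" by (simp add: exp_add[symmetric] algebra_simps)
    finally show "\<bar>- p * m t z * \<Phi> (lin (s t) z)\<bar> \<le> ?D z" .
  qed
  let ?l = "lin (s t0)"
  define P where "P i j z = avg (?l z) (\<lambda>x y. x j * \<psi>' i (?l z i x))" for i j z
  define N where "N i j z = (avg (?l z) (\<lambda>x y. x j * (\<psi>'' i (?l z i x) * x j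
          - \<psi>' i (?l z i x) * (\<psi>' i (?l z i x) * x j + \<psi>' i (?l z i y) * y j)))
       + (2 - p) * avg1 (?l z) (\<lambda>x. \<psi>' i (?l z i x) * x j) * P i j z)" for i j z
  have NI: "integrable \<gamma> (\<lambda>z. \<Phi> (?l z) * N i j z)" if "i \<in> I" "j \<in> J" for i j
  proof (rule integrable_\<Phi>_mult[where C = "B + B * (B + B) + 2 * B * B"])
    note [measurable] = lin_measurable[OF that(1)]
    show "N i j \<in> borel_measurable \<gamma>"
      unfolding N_def P_def
      by (intro borel_measurable_add borel_measurable_times avg_measurable avg1_measurable; measurable)
    fix z
    have xl: "\<bar>x j * u\<bar> \<le> B'" if "x \<in> X" "\<bar>u\<bar> \<le> B'" for x u B'
      unfolding abs_mult using mult_mono[OF X_le[OF that(1) \<open>j \<in> J\<close>] that(2)] that(2) by simp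
    have pl: "\<bar>\<psi>' i u * x j\<bar> \<le> B" if "x \<in> X" for u x
      using xl[OF that \<psi>'_le, of i u] by (simp add: mult.commute)
    have a: "\<bar>avg (?l z) (\<lambda>x y. x j * (\<psi>'' i (?l z i x) * x j
          - \<psi>' i (?l z i x) * (\<psi>' i (?l z i x) * x j + \<psi>' i (?l z i y) * y j)))\<bar> \<le> B + B * (B + B)"
    proof (intro abs_avg_le xl)
      fix x y assume xy: "x \<in> X" "y \<in> X"
      have "\<bar>\<psi>'' i (?l z i x) * x j\<bar> \<le> B"
        using xl[OF xy(1) \<psi>''_le, of i "?l z i x"] by (simp add: mult.commute)
      moreover have "\<bar>\<psi>' i (?l z i x) * (\<psi>' i (?l z i x) * x j + \<psi>' i (?l z i y) * y j)\<bar> \<le> B * (B + B)"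
        unfolding abs_mult[of "\<psi>' i _"] using \<psi>'_le pl[OF xy(1)] pl[OF xy(2)] B_nonneg
        by (intro mult_mono order_trans[OF abs_triangle_ineq] add_mono) auto
      ultimately show "\<bar>\<psi>'' i (?l z i x) * x j
          - \<psi>' i (?l z i x) * (\<psi>' i (?l z i x) * x j + \<psi>' i (?l z i y) * y j)\<bar> \<le> B + B * (B + B)"
        by linarith
    qed
    have P: "\<bar>P i j z\<bar> \<le> B" unfolding P_def by (intro abs_avg_le xl \<psi>'_le)
    have m: "\<bar>avg1 (?l z) (\<lambda>x. \<psi>' i (?l z i x) * x j)\<bar> \<le> B" by (intro abs_avg1_le pl)
    have "\<bar>(2 - p) * avg1 (?l z) (\<lambda>x. \<psi>' i (?l z i x) * x j) * P i j z\<bar> \<le> 2 * B * B"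
      unfolding abs_mult using p P m B_nonneg by (intro mult_mono) auto
    with a show "\<bar>N i j z\<bar> \<le> B + B * (B + B) + 2 * B * B" unfolding N_def by linarith
  qed
  have PI: "integrable \<gamma> (\<lambda>z. z (i, j) * (\<Phi> (?l z) * P i j z))"
    and PN: "(\<integral>z. z (i, j) * (\<Phi> (?l z) * P i j z) \<partial>\<gamma>) = s t0 (i, j) * (\<integral>z. \<Phi> (?l z) * N i j z \<partial>\<gamma>)"
    if ij: "i \<in> I" "j \<in> J" for i j
  proof -
    note [measurable] = lin_measurable[OF ij(1)]
    show "(\<integral>z. z (i, j) * (\<Phi> (?l z) * P i j z) \<partial>\<gamma>) = s t0 (i, j) * (\<integral>z. \<Phi> (?l z) * N i j z \<partial>\<gamma>)"
      unfolding N_def P_def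
      by (rule ibp[OF ij, of "\<lambda>x y. x j" "max 1 B"])
         (use X_le ij \<psi>'_der \<psi>''_cont \<psi>'_le \<psi>''_le in \<open>auto intro: le_max_iff_disj[THEN iffD2]\<close>)
    have "\<bar>x j * \<psi>' i u\<bar> \<le> B" if "x \<in> X" for x u
      unfolding abs_mult using mult_mono[OF X_le[OF that ij(2)] \<psi>'_le[of i u]] by simp
    then have "\<bar>P i j z\<bar> \<le> B" for z
      unfolding P_def by (intro abs_avg_le)
    then have b: "\<bar>\<Phi> (?l z) * P i j z\<bar> \<le> (C0 * B) * exp (B * S * l1 (I \<times> J) z)" for z
      by (intro \<Phi>_mult_bound) (use S[OF t0] in auto)
    show "integrable \<gamma> (\<lambda>z. z (i, j) * (\<Phi> (?l z) * P i j z))"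
    proof (rule integrable_gauss_bound[OF _ _ mult_l1_bound[OF _ _ b]])
      have "P i j \<in> borel_measurable \<gamma>" unfolding P_def by (intro avg_measurable) measurable
      then show "(\<lambda>z. z (i, j) * (\<Phi> (?l z) * P i j z)) \<in> borel_measurable \<gamma>"
        using ij by (intro borel_measurable_times \<Phi>_measurable) auto
    qed (use fin ij in auto)
  qed
  have "(\<integral>z. - p * m t0 z * \<Phi> (?l z) \<partial>\<gamma>) =
      (\<integral>z. (\<Sum>i\<in>I. \<Sum>j\<in>J. - p * s' t0 (i, j) * (z (i, j) * (\<Phi> (?l z) * P i j z))) \<partial>\<gamma>)"
  proof (rule Bochner_Integration.integral_cong[OF refl])
    fix z
    have "m t0 z = (\<Sum>i\<in>I. \<Sum>j\<in>J. s' t0 (i, j) * z (i, j) * P i j z)"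
      unfolding m_def P_def avg_def avg1_const lin_def[of "s' t0"] sum_distrib_left
      by (simp add: avg1_sum avg1_cmult[symmetric] mult_ac)
    then show "- p * m t0 z * \<Phi> (?l z) = (\<Sum>i\<in>I. \<Sum>j\<in>J. - p * s' t0 (i, j) * (z (i, j) * (\<Phi> (?l z) * P i j z)))"
      by (simp add: sum_distrib_left sum_distrib_right mult_ac)
  qed
  also have "\<dots> = (\<Sum>i\<in>I. \<Sum>j\<in>J. - p * s' t0 (i, j) * (s t0 (i, j) * (\<integral>z. \<Phi> (?l z) * N i j z \<partial>\<gamma>)))"
    by (simp add: PN PI)
  also have "\<dots> = (\<integral>z. (\<Sum>i\<in>I. \<Sum>j\<in>J. - p * s' t0 (i, j) * (s t0 (i, j) * (\<Phi> (?l z) * N i j z))) \<partial>\<gamma>)"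
    by (simp add: NI)
  also have "\<dots> = (\<integral>z. - (p * (1 - p)) * (\<Phi> (?l z) * avg (?l z)
       (\<lambda>x y. \<Sum>i\<in>I. \<psi>' i (?l z i x) * \<psi>' i (?l z i y)
           * (\<Sum>j\<in>J. s t0 (i, j) * s' t0 (i, j) * x j * y j))) \<partial>\<gamma>)"
  proof (rule Bochner_Integration.integral_cong[OF refl])
    fix z
    define q where "q i j = avg1 (?l z) (\<lambda>x. \<psi>' i (?l z i x) * x j)" for i j
    define d where "d i j = avg1 (?l z) (\<lambda>x. (\<psi>'' i (?l z i x) - (\<psi>' i (?l z i x))\<^sup>2) * (x j)\<^sup>2)" for i j
    have P: "P i j z = q i j" for i j
      unfolding P_def q_def avg_def by (simp add: mult_ac)
    have N: "N i j z = d i j + (1 - p) * (q i j * q i j)" for i j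
    proof -
      have "avg (?l z) (\<lambda>x y. x j * (\<psi>'' i (?l z i x) * x j
          - \<psi>' i (?l z i x) * (\<psi>' i (?l z i x) * x j + \<psi>' i (?l z i y) * y j)))
        = avg (?l z) (\<lambda>x y. (\<psi>'' i (?l z i x) - (\<psi>' i (?l z i x))\<^sup>2) * (x j)\<^sup>2
            - (\<psi>' i (?l z i x) * x j) * (\<psi>' i (?l z i y) * y j))"
        by (rule avg_cong) (simp add: power2_eq_square algebra_simps)
      also have "\<dots> = d i j - q i j * q i j"
        unfolding avg_diff avg_prod q_def d_def by (simp add: avg_def)
      finally show ?thesis unfolding N_def P q_def[symmetric] by algebra
    qed
    have d0: "(\<Sum>i\<in>I. \<Sum>j\<in>J. s t0 (i, j) * s' t0 (i, j) * d i j) = 0"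
    proof (rule sum.neutral, rule ballI)
      fix i assume i: "i \<in> I"
      have "(\<Sum>j\<in>J. s t0 (i, j) * s' t0 (i, j) * d i j) =
          avg1 (?l z) (\<lambda>x. (\<psi>'' i (?l z i x) - (\<psi>' i (?l z i x))\<^sup>2) * (\<Sum>j\<in>J. s t0 (i, j) * s' t0 (i, j) * (x j)\<^sup>2))"
        unfolding d_def avg1_cmult[symmetric] avg1_sum[symmetric] sum_distrib_left
        by (intro avg1_cong sum.cong) (auto simp: mult_ac)
      also have "\<dots> = avg1 (?l z) (\<lambda>_. 0)" by (rule avg1_cong) (simp add: bal i)
      finally show "(\<Sum>j\<in>J. s t0 (i, j) * s' t0 (i, j) * d i j) = 0" by simp
    qed
    have q: "avg (?l z) (\<lambda>x y. \<Sum>i\<in>I. \<psi>' i (?l z i x) * \<psi>' i (?l z i y)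
           * (\<Sum>j\<in>J. s t0 (i, j) * s' t0 (i, j) * x j * y j)) =
        (\<Sum>i\<in>I. \<Sum>j\<in>J. s t0 (i, j) * s' t0 (i, j) * (q i j * q i j))"
      unfolding q_def avg_prod[symmetric] avg_cmult[symmetric] avg_sum[symmetric] sum_distrib_left
      by (intro avg_cong sum.cong) (auto simp: mult_ac)
    have "(\<Sum>i\<in>I. \<Sum>j\<in>J. - p * s' t0 (i, j) * (s t0 (i, j) * (\<Phi> (?l z) * N i j z)))
        = - p * \<Phi> (?l z) * (\<Sum>i\<in>I. \<Sum>j\<in>J. s t0 (i, j) * s' t0 (i, j) * d i j)
         - (p * (1 - p)) * \<Phi> (?l z) * (\<Sum>i\<in>I. \<Sum>j\<in>J. s t0 (i, j) * s' t0 (i, j) * (q i j * q i j))"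
      unfolding N sum_distrib_left sum_subtractf[symmetric]
      by (intro sum.cong refl) algebra
    then show "(\<Sum>i\<in>I. \<Sum>j\<in>J. - p * s' t0 (i, j) * (s t0 (i, j) * (\<Phi> (?l z) * N i j z))) =
        - (p * (1 - p)) * (\<Phi> (?l z) * avg (?l z)
       (\<lambda>x y. \<Sum>i\<in>I. \<psi>' i (?l z i x) * \<psi>' i (?l z i y)
           * (\<Sum>j\<in>J. s t0 (i, j) * s' t0 (i, j) * x j * y j)))"
      unfolding d0 q by simp
  qed
  finally show ?thesis using D by simp
qed

end

section \<open>The complementary error function and moments of the modulus of a normal
  variable\<close>

lemma integrable_exp_minus_square: "integrable lborel (\<lambda>t::real. exp (- t\<^sup>2))"
proof -
  have "integrable lborel (\<lambda>t. normal_density 0 (1 / sqrt 2) t)" by simp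
  then have "integrable lborel (\<lambda>t. sqrt pi * normal_density 0 (1 / sqrt 2) t)" by (rule integrable_mult_right)
  then show ?thesis by (simp add: normal_density_def power_divide)
qed

lemma set_integrable_exp_minus_square:
  "A \<in> sets borel \<Longrightarrow> set_integrable lborel A (\<lambda>t::real. exp (- t\<^sup>2))"
  unfolding set_integrable_def
  by (rule integrable_mult_indicator) (auto simp: integrable_exp_minus_square)

lemma erfc_diff:
  assumes "a \<le> b"
  shows "erfc a - erfc b = 2 / sqrt pi * integral {a..b} (\<lambda>t. exp (- t\<^sup>2))"
proof -
  have "(LBINT t:{a..}. exp (- t\<^sup>2)) = (LBINT t:{a..<b} \<union> {b..}. exp (- t\<^sup>2))"
    using assms by (simp add: ivl_disj_un)
  also have "\<dots> = (LBINT t:{a..<b}. exp (- t\<^sup>2)) + (LBINT t:{b..}. exp (- t\<^sup>2))"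
    by (intro set_integral_Un set_integrable_exp_minus_square) auto
  also have "(LBINT t:{a..<b}. exp (- t\<^sup>2)) = (LBINT t:{a..b}. exp (- t\<^sup>2))"
    by (intro set_integral_cong_set)
       (auto simp: set_borel_measurable_def intro: eventually_mono[OF AE_lborel_singleton[of b]])
  also have "\<dots> = integral {a..b} (\<lambda>t. exp (- t\<^sup>2))"
    by (intro set_borel_integral_eq_integral set_integrable_exp_minus_square) auto
  finally show ?thesis unfolding erfc_def by (simp add: algebra_simps)
qed

lemma erfc_deriv: "(erfc has_real_derivative - 2 / sqrt pi * exp (- z\<^sup>2)) (at z)"
proof -
  have "((\<lambda>x. integral {z - 1..x} (\<lambda>t. exp (- t\<^sup>2))) has_real_derivative exp (- z\<^sup>2)) (at z within {z - 1..z + 1})"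
    by (rule integral_has_real_derivative) (auto intro!: continuous_intros)
  then have "((\<lambda>x. integral {z - 1..x} (\<lambda>t. exp (- t\<^sup>2))) has_real_derivative exp (- z\<^sup>2)) (at z)"
    by (subst (asm) at_within_interior) auto
  then have "((\<lambda>x. erfc (z - 1) - 2 / sqrt pi * integral {z - 1..x} (\<lambda>t. exp (- t\<^sup>2)))
      has_real_derivative - 2 / sqrt pi * exp (- z\<^sup>2)) (at z)"
    by (rule DERIV_cong[OF DERIV_diff[OF DERIV_const DERIV_cmult]]) simp
  moreover have "eventually (\<lambda>x. erfc (z - 1) - 2 / sqrt pi * integral {z - 1..x} (\<lambda>t. exp (- t\<^sup>2)) = erfc x) (nhds z)"
  proof (rule eventually_mono[OF eventually_nhds_in_open[of "{z - 1<..}" z]])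
    fix x assume "x \<in> {z - 1<..}"
    then show "erfc (z - 1) - 2 / sqrt pi * integral {z - 1..x} (\<lambda>t. exp (- t\<^sup>2)) = erfc x"
      using erfc_diff[of "z - 1" x] by simp
  qed auto
  ultimately show ?thesis
    by (subst (asm) DERIV_cong_ev[OF refl _ refl]) auto
qed

lemma erfc_eq_normal: "erfc z = 2 * (LBINT y:{sqrt 2 * z..}. std_normal_density y)"
proof -
  have "(LBINT y:{sqrt 2 * z..}. std_normal_density y) =
      sqrt 2 * (LBINT t. indicator {sqrt 2 * z..} (0 + sqrt 2 * t) * std_normal_density (0 + sqrt 2 * t))"
    unfolding set_lebesgue_integral_def
    using lborel_integral_real_affine[of "sqrt 2" "\<lambda>y. indicator {sqrt 2 * z..} y * std_normal_density y" 0] by simp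
  also have "(LBINT t. indicator {sqrt 2 * z..} (0 + sqrt 2 * t) * std_normal_density (0 + sqrt 2 * t)) =
      (LBINT t. 1 / sqrt (2 * pi) * (indicator {z..} t * exp (- t\<^sup>2)))"
    by (intro Bochner_Integration.integral_cong)
       (auto simp: std_normal_density_def indicator_def power_mult_distrib)
  finally show ?thesis
    unfolding erfc_def set_lebesgue_integral_def by (simp add: real_sqrt_mult)
qed

lemma Iio_Un_Ici: "{..<a} \<union> {a..} = (UNIV :: real set)"
  by auto

lemma set_integrable_normal: "0 < \<sigma> \<Longrightarrow> A \<in> sets borel \<Longrightarrow> set_integrable lborel A (normal_density \<mu> \<sigma>)"
  unfolding set_integrable_def
  by (rule integrable_mult_indicator) auto

lemma erfc_nonneg: "0 \<le> erfc z"
  unfolding erfc_def set_lebesgue_integral_def by (intro mult_nonneg_nonneg integral_nonneg_AE) auto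

lemma erfc_strict_antimono: "a < b \<Longrightarrow> erfc b < erfc a"
proof (rule DERIV_neg_imp_decreasing, assumption)
  fix x
  have "- 2 / sqrt pi * exp (- x\<^sup>2) < 0" by simp
  with erfc_deriv show "\<exists>y. (erfc has_real_derivative y) (at x) \<and> y < 0" by blast
qed

lemma erfc_pos: "0 < erfc z"
  using erfc_strict_antimono[of z "z + 1"] erfc_nonneg[of "z + 1"] by simp

lemma erfc_uminus: "erfc (- z) = 2 - erfc z"
proof -
  have "(LBINT y:{sqrt 2 * z..}. std_normal_density y) =
      (LBINT t. indicator {sqrt 2 * z..} (0 + (-1) * t) * std_normal_density (0 + (-1) * t))"
    unfolding set_lebesgue_integral_def
    using lborel_integral_real_affine[of "-1" "\<lambda>y. indicator {sqrt 2 * z..} y * std_normal_density y" 0] by simp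
  also have "\<dots> = (LBINT y:{..- (sqrt 2 * z)}. std_normal_density y)"
    unfolding set_lebesgue_integral_def
    by (intro Bochner_Integration.integral_cong) (auto simp: std_normal_density_def indicator_def)
  also have "\<dots> = (LBINT y:{..<- (sqrt 2 * z)}. std_normal_density y)"
    by (intro set_integral_cong_set)
       (auto simp: set_borel_measurable_def intro: eventually_mono[OF AE_lborel_singleton[of "- (sqrt 2 * z)"]])
  also have "\<dots> + (LBINT y:{- (sqrt 2 * z)..}. std_normal_density y) =
      (LBINT y:{..<- (sqrt 2 * z)} \<union> {- (sqrt 2 * z)..}. std_normal_density y)"
    by (intro set_integral_Un[symmetric] set_integrable_normal) auto
  also have "\<dots> = 1" by (simp add: Iio_Un_Ici set_lebesgue_integral_def)
  finally show ?thesis by (simp add: erfc_eq_normal)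
qed

lemma erfc_0: "erfc 0 = 1"
  using erfc_uminus[of 0] by simp

text \<open>Symmetry doubles the half-line \<open>{0..}\<close>, on which the exponential shifts the
  mean of the density to \<open>a\<close>; what is left is a normal tail starting at
  \<open>- a\<close>. This is how \<open>erfc\<close> enters the bound.\<close>

lemma integral_std_gauss_exp_abs: "(\<integral>y. exp (a * \<bar>y\<bar>) \<partial>std_gauss) = exp (a\<^sup>2 / 2) * erfc (- a / sqrt 2)"
proof -
  have m: "(\<lambda>y. exp (a * \<bar>y\<bar>)) \<in> borel_measurable borel" by measurable
  let ?f = "\<lambda>y. std_normal_density y * exp (a * \<bar>y\<bar>)"
  have int: "integrable lborel ?f"
    using integrable_std_gauss_exp_abs[of a] by (simp add: integrable_std_gauss_iff)
  have si: "set_integrable lborel A ?f" if "A \<in> sets borel" for A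
    unfolding set_integrable_def by (rule integrable_mult_indicator) (use that int in auto)
  have "(\<integral>y. exp (a * \<bar>y\<bar>) \<partial>std_gauss) = (LBINT y:{..<0} \<union> {0..}. ?f y)"
    by (simp add: integral_std_gauss[OF m] Iio_Un_Ici set_lebesgue_integral_def)
  also have "\<dots> = (LBINT y:{..<0}. ?f y) + (LBINT y:{0..}. ?f y)"
    by (intro set_integral_Un si) auto
  also have "(LBINT y:{..<0}. ?f y) = (LBINT y:{..0}. ?f y)"
    by (intro set_integral_cong_set)
       (auto simp: set_borel_measurable_def intro: eventually_mono[OF AE_lborel_singleton[of 0]])
  also have "\<dots> = (LBINT t. indicator {..0} (0 + (-1) * t) * ?f (0 + (-1) * t))"
    unfolding set_lebesgue_integral_def
    using lborel_integral_real_affine[of "-1" "\<lambda>y. indicator {..0} y * ?f y" 0] by simp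
  also have "\<dots> = (LBINT y:{0..}. ?f y)"
    unfolding set_lebesgue_integral_def
    by (intro Bochner_Integration.integral_cong) (auto simp: std_normal_density_def indicator_def)
  also have "(LBINT y:{0..}. ?f y) = (LBINT y. exp (a\<^sup>2 / 2) * (indicator {0..} y * normal_density a 1 y))"
    unfolding set_lebesgue_integral_def
    by (intro Bochner_Integration.integral_cong)
       (auto simp: indicator_def std_normal_density_mult_exp[symmetric])
  also have "\<dots> = exp (a\<^sup>2 / 2) * (LBINT y:{0..}. normal_density a 1 y)"
    by (simp add: set_lebesgue_integral_def)
  also have "(LBINT y:{0..}. normal_density a 1 y) =
      (LBINT t. indicator {0..} (a + 1 * t) * normal_density a 1 (a + 1 * t))"
    unfolding set_lebesgue_integral_def
    using lborel_integral_real_affine[of 1 "\<lambda>y. indicator {0..} y * normal_density a 1 y" a] by simp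
  also have "\<dots> = (LBINT y:{- a..}. std_normal_density y)"
    unfolding set_lebesgue_integral_def
    by (intro Bochner_Integration.integral_cong) (auto simp: normal_density_def indicator_def)
  finally show ?thesis using erfc_eq_normal[of "- a / sqrt 2"] by simp
qed

lemma erfc_le_inverse_square:
  assumes "0 < u"
  shows "erfc u \<le> 1 / u\<^sup>2"
proof -
  have "(LBINT y:{sqrt 2 * u..}. std_normal_density y) \<le> (LBINT y. 1 / (2 * u\<^sup>2) * (std_normal_density y * y ^ 2))"
    unfolding set_lebesgue_integral_def
  proof (rule integral_mono)
    show "integrable lborel (\<lambda>y. indicat_real {sqrt 2 * u..} y *\<^sub>R std_normal_density y)"
      using set_integrable_normal[of 1 "{sqrt 2 * u..}" 0] by (simp add: set_integrable_def)
    show "integrable lborel (\<lambda>y. 1 / (2 * u\<^sup>2) * (std_normal_density y * y ^ 2))"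
      by (intro integrable_mult_right integrable_std_normal_moment)
    fix y
    show "indicat_real {sqrt 2 * u..} y *\<^sub>R std_normal_density y \<le> 1 / (2 * u\<^sup>2) * (std_normal_density y * y ^ 2)"
    proof (cases "sqrt 2 * u \<le> y")
      case True
      then have "(sqrt 2 * u)\<^sup>2 \<le> y\<^sup>2" using assms by (intro power_mono) auto
      then have "1 \<le> y\<^sup>2 / (2 * u\<^sup>2)" using assms by (simp add: power_mult_distrib)
      from mult_left_mono[OF this, of "std_normal_density y"] show ?thesis using True by (simp add: mult_ac)
    qed simp
  qed
  also have "\<dots> = 1 / (2 * u\<^sup>2)"
    using integral_std_normal_moment_even[of 1] by (simp add: numeral_2_eq_2)
  finally show ?thesis by (simp add: erfc_eq_normal)
qed

lemma erfc_at_top: "(erfc \<longlongrightarrow> 0) at_top"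
proof (rule tendsto_sandwich[OF _ _ tendsto_const])
  show "eventually (\<lambda>u. 0 \<le> erfc u) at_top" by (simp add: erfc_nonneg)
  show "eventually (\<lambda>u. erfc u \<le> 1 / u\<^sup>2) at_top"
    using eventually_gt_at_top[of 0] by eventually_elim (rule erfc_le_inverse_square)
  show "((\<lambda>u::real. 1 / u\<^sup>2) \<longlongrightarrow> 0) at_top"
    by (intro tendsto_divide_0[OF tendsto_const] filterlim_at_top_imp_at_infinity
        filterlim_pow_at_top filterlim_ident) simp
qed

text \<open>The function \<open>g\<close> has derivative \<open>- exp (- u^2) / u^2\<close>, hence
  is nonincreasing, and it is bounded below by \<open>- (sqrt pi * erfc u)\<close>, which tends to
  0.\<close>

lemma erfc_mills_upper:
  assumes "0 < z"
  shows "erfc z \<le> exp (- z\<^sup>2) / (z * sqrt pi)"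
proof -
  define g where "g u = exp (- u\<^sup>2) / u - sqrt pi * erfc u" for u
  have dec: "g b \<le> g a" if "z \<le> a" "a \<le> b" for a b
  proof (rule DERIV_nonpos_imp_nonincreasing[OF that(2)])
    fix x assume "a \<le> x" "x \<le> b"
    then have x: "0 < x" using that assms by simp
    have "(g has_real_derivative - exp (- x\<^sup>2) / x\<^sup>2) (at x)"
      unfolding g_def using x
      by (auto intro!: derivative_eq_intros erfc_deriv simp: field_simps power2_eq_square)
    moreover have "- exp (- x\<^sup>2) / x\<^sup>2 \<le> 0" by (simp add: divide_nonpos_nonneg)
    ultimately show "\<exists>y. (g has_real_derivative y) (at x) \<and> y \<le> 0" by blast
  qed
  have "0 \<le> g z"
  proof (rule tendsto_upperbound)
    show "((\<lambda>u. - (sqrt pi * erfc u)) \<longlongrightarrow> 0) at_top"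
      using tendsto_mult_right_zero[OF erfc_at_top, of "- sqrt pi"] by simp
    show "eventually (\<lambda>u. - (sqrt pi * erfc u) \<le> g z) at_top"
      using eventually_ge_at_top[of z]
    proof eventually_elim
      case (elim u)
      have "0 \<le> exp (- u\<^sup>2) / u" using elim assms by simp
      then have "- (sqrt pi * erfc u) \<le> g u" by (simp add: g_def)
      then show ?case using dec[of z u] elim by simp
    qed
  qed simp
  then show ?thesis using assms by (simp add: g_def field_simps)
qed

lemma integral_std_gauss_exp_minus_abs_le:
  assumes "0 < a"
  shows "(\<integral>y. exp (- a * \<bar>y\<bar>) \<partial>std_gauss) \<le> 1 / a"
proof -
  have "(\<integral>y. exp (- a * \<bar>y\<bar>) \<partial>std_gauss) = exp (a\<^sup>2 / 2) * erfc (a / sqrt 2)"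
    using integral_std_gauss_exp_abs[of "- a"] by simp
  also have "\<dots> \<le> exp (a\<^sup>2 / 2) * (exp (- (a / sqrt 2)\<^sup>2) / ((a / sqrt 2) * sqrt pi))"
    using assms by (intro mult_left_mono erfc_mills_upper) auto
  also have "\<dots> = (sqrt 2 / sqrt pi) / a"
    by (simp add: exp_minus power_divide field_simps)
  also have "\<dots> \<le> 1 / a"
    using assms pi_gt3 by (intro divide_right_mono) (auto simp: field_simps)
  finally show ?thesis .
qed


subsection \<open>A smooth absolute value\<close>

text \<open>This is \<open>\<epsilon> * ln (exp (u / \<epsilon>) + exp (- u / \<epsilon>))\<close>,
  the smooth maximum of \<open>u\<close> and \<open>- u\<close>; its derivative
  \<open>tanh (u / \<epsilon>)\<close> is a smoothed sign.\<close>

definition softabs :: "real \<Rightarrow> real \<Rightarrow> real" where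
  "softabs \<epsilon> u = \<epsilon> * ln (2 * cosh (u / \<epsilon>))"

lemma softabs_deriv:
  assumes "0 < \<epsilon>"
  shows "(softabs \<epsilon> has_real_derivative tanh (u / \<epsilon>)) (at u)"
  unfolding softabs_def using assms cosh_real_pos[of "u / \<epsilon>"]
  by (auto intro!: derivative_eq_intros simp: tanh_def field_simps)

lemma tanh_scaled_deriv:
  fixes \<epsilon> u :: real
  assumes "0 < \<epsilon>"
  shows "((\<lambda>u. tanh (u / \<epsilon>)) has_real_derivative (1 - (tanh (u / \<epsilon>))\<^sup>2) / \<epsilon>) (at u)"
  using assms cosh_real_pos[of "u / \<epsilon>"] by (auto intro!: derivative_eq_intros)

lemma abs_tanh_le: "\<bar>tanh (x :: real)\<bar> \<le> 1"
  using tanh_real_bounds[of x] by (simp add: abs_le_iff less_imp_le)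

lemma tanh_sq_le: "(tanh (x :: real))\<^sup>2 \<le> 1"
  using abs_tanh_le[of x] by (simp add: abs_square_le_1)

lemma softabs_eq: "0 < \<epsilon> \<Longrightarrow> softabs \<epsilon> u = \<bar>u\<bar> + \<epsilon> * ln (1 + exp (- 2 * \<bar>u\<bar> / \<epsilon>))"
proof -
  assume e: "0 < \<epsilon>"
  have "2 * cosh (u / \<epsilon>) = 2 * cosh (\<bar>u\<bar> / \<epsilon>)" using e by (cases "u \<ge> 0") auto
  also have "\<dots> = exp (\<bar>u\<bar> / \<epsilon>) + exp (- (\<bar>u\<bar> / \<epsilon>))" by (simp add: cosh_def)
  also have "\<dots> = exp (\<bar>u\<bar> / \<epsilon>) * (1 + exp (- 2 * \<bar>u\<bar> / \<epsilon>))"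
    by (simp add: distrib_left exp_add[symmetric])
  finally have *: "2 * cosh (u / \<epsilon>) = exp (\<bar>u\<bar> / \<epsilon>) * (1 + exp (- 2 * \<bar>u\<bar> / \<epsilon>))" .
  have "0 < 1 + exp (- 2 * \<bar>u\<bar> / \<epsilon>)" by (intro add_pos_pos) auto
  then show ?thesis unfolding softabs_def * using e by (subst ln_mult) (auto simp: distrib_left)
qed

lemma softabs_ge: "0 < \<epsilon> \<Longrightarrow> \<bar>u\<bar> \<le> softabs \<epsilon> u"
  unfolding softabs_eq by simp

lemma softabs_nonneg: "0 < \<epsilon> \<Longrightarrow> 0 \<le> softabs \<epsilon> u"
  using softabs_ge[of \<epsilon> u] abs_ge_zero[of u] by linarith

lemma softabs_le:
  assumes "0 < \<epsilon>"
  shows "softabs \<epsilon> u \<le> \<bar>u\<bar> + \<epsilon> * ln 2"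
proof -
  have "exp (- 2 * \<bar>u\<bar> / \<epsilon>) \<le> 1" using assms by simp
  moreover have "0 < 1 + exp (- 2 * \<bar>u\<bar> / \<epsilon>)" by (intro add_pos_pos) auto
  ultimately have "ln (1 + exp (- 2 * \<bar>u\<bar> / \<epsilon>)) \<le> ln 2" by (intro ln_mono) auto
  then show ?thesis unfolding softabs_eq[OF assms] using assms by (intro add_left_mono mult_left_mono) auto
qed

text \<open>With \<open>q = exp (- 2 * \<bar>u\<bar> / \<epsilon>)\<close> the excess over the
  modulus is \<epsilon> times
  \<open>ln (1 + q) \<le> q \<le> 4 * q / (1 + q)^2 = 1 - tanh^2\<close>. The last quantity is
  \<epsilon> times the derivative of \<open>tanh (u / \<epsilon>)\<close>, so its average can be
  integrated by parts; this yields a second factor \<epsilon> that a pointwise bound by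
  \<open>ln 2\<close> misses.\<close>

lemma softabs_le_tanh:
  assumes "0 < \<epsilon>"
  shows "softabs \<epsilon> u \<le> \<bar>u\<bar> + \<epsilon> * (1 - (tanh (u / \<epsilon>))\<^sup>2)"
proof -
  let ?e = "exp (- 2 * \<bar>u\<bar> / \<epsilon>)"
  have e1: "?e \<le> 1" "0 < ?e" using assms by auto
  have t: "(tanh (u / \<epsilon>))\<^sup>2 = ((1 - ?e) / (1 + ?e))\<^sup>2"
  proof -
    have "(tanh (u / \<epsilon>))\<^sup>2 = (tanh (\<bar>u\<bar> / \<epsilon>))\<^sup>2" by (cases "u \<ge> 0") auto
    also have "tanh (\<bar>u\<bar> / \<epsilon>) = (1 - ?e) / (1 + ?e)" by (simp add: tanh_real_altdef)
    finally show ?thesis .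
  qed
  have "ln (1 + ?e) \<le> ?e" using e1 by (intro ln_add_one_self_le_self) auto
  also have "?e \<le> 1 - ((1 - ?e) / (1 + ?e))\<^sup>2"
  proof -
    have "(1 + ?e)\<^sup>2 \<noteq> 0" using e1(2) by (simp add: add_pos_pos less_imp_neq[THEN not_sym])
    then have "1 - ((1 - ?e) / (1 + ?e))\<^sup>2 = ((1 + ?e)\<^sup>2 - (1 - ?e)\<^sup>2) / (1 + ?e)\<^sup>2"
      unfolding power_divide by (simp only: diff_divide_distrib divide_self_if if_False)
    also have "(1 + ?e)\<^sup>2 - (1 - ?e)\<^sup>2 = 4 * ?e" by algebra
    finally have eq: "1 - ((1 - ?e) / (1 + ?e))\<^sup>2 = ?e * (4 / (1 + ?e)\<^sup>2)" by simp
    have "(1 + ?e)\<^sup>2 \<le> 2\<^sup>2" using e1 by (intro power_mono) auto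
    moreover have "0 < (1 + ?e)\<^sup>2" using e1(2) by (intro zero_less_power add_pos_pos) auto
    ultimately have "1 \<le> 4 / (1 + ?e)\<^sup>2" by (simp only: pos_le_divide_eq) simp
    from mult_left_mono[OF this, of ?e] show ?thesis unfolding eq by simp
  qed
  finally have "ln (1 + ?e) \<le> 1 - (tanh (u / \<epsilon>))\<^sup>2" unfolding t .
  then show ?thesis unfolding softabs_eq[OF assms] using assms by (intro add_left_mono mult_left_mono) auto
qed

text \<open>After rescaling, the claim is \<open>z * (1 - tanh z) \<le> 1\<close> for
  \<open>z \<ge> 0\<close>, which follows from \<open>2 * z * exp (- 2 * z) \<le> 1\<close>.\<close>

lemma mult_tanh_ge:
  fixes \<epsilon> u :: real
  assumes "0 < \<epsilon>"
  shows "\<bar>u\<bar> - \<epsilon> \<le> u * tanh (u / \<epsilon>)"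
proof -
  have z: "z - 1 \<le> z * tanh z" if "0 \<le> z" for z :: real
  proof -
    have "2 * z \<le> exp (2 * z)" using exp_ge_add_one_self[of "2 * z"] by linarith
    then have "2 * z * exp (- 2 * z) \<le> exp (2 * z) * exp (- 2 * z)" by (intro mult_right_mono) auto
    also have "\<dots> = 1" by (simp add: exp_add[symmetric])
    finally have "2 * z * exp (- 2 * z) \<le> 1 + exp (- 2 * z)" using exp_ge_zero[of "- 2 * z"] by linarith
    then have "(z - 1) * (1 + exp (- 2 * z)) \<le> z * (1 - exp (- 2 * z))" by (simp add: algebra_simps)
    moreover have "0 < 1 + exp (- 2 * z)" by (intro add_pos_pos) auto
    ultimately have "z - 1 \<le> z * (1 - exp (- 2 * z)) / (1 + exp (- 2 * z))"
      by (simp add: pos_le_divide_eq)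
    then show ?thesis by (simp add: tanh_real_altdef)
  qed
  have "\<bar>u\<bar> / \<epsilon> - 1 \<le> \<bar>u\<bar> / \<epsilon> * tanh (\<bar>u\<bar> / \<epsilon>)" using z[of "\<bar>u\<bar> / \<epsilon>"] assms by simp
  then have "\<epsilon> * (\<bar>u\<bar> / \<epsilon> - 1) \<le> \<epsilon> * (\<bar>u\<bar> / \<epsilon> * tanh (\<bar>u\<bar> / \<epsilon>))"
    using assms by (intro mult_left_mono) auto
  moreover have "\<bar>u\<bar> * tanh (\<bar>u\<bar> / \<epsilon>) = u * tanh (u / \<epsilon>)"
    by (cases "u \<ge> 0") auto
  ultimately show ?thesis using assms by (simp add: right_diff_distrib)
qed

text \<open>Because \<open>a * b \<le> \<bar>a\<bar>\<close> and
  \<open>1 - a^2 = (1 - \<bar>a\<bar>) * (1 + \<bar>a\<bar>)\<close>. It trades a one-replica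
  quantity for the two-replica deficit that appears in the derivative of \<open>F\<close>.\<close>

lemma one_minus_mult_ge:
  fixes a b :: real
  assumes "\<bar>a\<bar> \<le> 1" "\<bar>b\<bar> \<le> 1"
  shows "1 - a\<^sup>2 \<le> 2 * (1 - a * b)"
proof -
  have "a * b \<le> \<bar>a\<bar> * \<bar>b\<bar>" by (metis abs_ge_self abs_mult)
  also have "\<dots> \<le> \<bar>a\<bar> * 1" using assms by (intro mult_left_mono) auto
  finally have "a * b \<le> \<bar>a\<bar>" by simp
  moreover have "1 - a\<^sup>2 \<le> 2 * (1 - \<bar>a\<bar>)"
  proof -
    have "1 - a\<^sup>2 = (1 - \<bar>a\<bar>) * (1 + \<bar>a\<bar>)" by (simp add: power2_eq_square algebra_simps)
    also have "\<dots> \<le> (1 - \<bar>a\<bar>) * 2" using assms by (intro mult_left_mono) auto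
    finally show ?thesis by simp
  qed
  ultimately show ?thesis by simp
qed


subsection \<open>The comparison process\<close>

definition spins :: "nat \<Rightarrow> (nat \<Rightarrow> real) set" where
  "spins n = (\<lambda>x. x(n := 1)) ` cube n"

lemma finite_cube: "finite (cube n)"
  unfolding cube_def by (intro finite_PiE) auto

lemma cube_nonempty: "cube n \<noteq> {}"
  unfolding cube_def by (simp add: PiE_eq_empty_iff)

lemma cube_cases: "x \<in> cube n \<Longrightarrow> j < n \<Longrightarrow> x j = - (1 / sqrt n) \<or> x j = 1 / sqrt n"
  unfolding cube_def by (auto simp: PiE_iff)

lemma finite_spins: "finite (spins n)"
  unfolding spins_def using finite_cube by simp

lemma spins_nonempty: "spins n \<noteq> {}"
  unfolding spins_def using cube_nonempty by simp

lemma spins_last: "x \<in> spins n \<Longrightarrow> x n = 1"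
  unfolding spins_def by auto

lemma spins_cases: "x \<in> spins n \<Longrightarrow> j < n \<Longrightarrow> x j = - (1 / sqrt n) \<or> x j = 1 / sqrt n"
  unfolding spins_def using cube_cases by fastforce

lemma spins_sq: "x \<in> spins n \<Longrightarrow> j < n \<Longrightarrow> x j * x j = 1 / n"
  using spins_cases[of x n j] by auto

lemma spins_abs: "x \<in> spins n \<Longrightarrow> j < n \<Longrightarrow> \<bar>x j\<bar> = 1 / sqrt n"
  using spins_cases[of x n j] by auto

lemma spins_abs_le: "x \<in> spins n \<Longrightarrow> j < Suc n \<Longrightarrow> \<bar>x j\<bar> \<le> 1"
  using spins_abs[of x n j] spins_last[of x n] by (cases "j = n") (auto simp: divide_le_eq_1)

lemma card_spins: "card (spins n) = 2 ^ n"
proof (cases "n = 0")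
  case True
  then show ?thesis by (simp add: spins_def cube_def)
next
  case False
  then have "- (1 / sqrt (real n)) \<noteq> 1 / sqrt (real n)" by (simp add: field_simps)
  then have "card {- (1 / sqrt (real n)), 1 / sqrt (real n)} = 2" by simp
  then have "card (cube n) = 2 ^ n" unfolding cube_def by (simp add: card_PiE del: insert_iff)
  moreover have "inj_on (\<lambda>x. x(n := 1)) (cube n)"
  proof (rule inj_onI)
    fix x y assume xy: "x \<in> cube n" "y \<in> cube n" "x(n := 1) = y(n := (1 :: real))"
    show "x = y"
    proof (rule PiE_ext[OF xy(1,2)[unfolded cube_def]])
      fix j assume "j \<in> {..<n}"
      then show "x j = y j" using fun_cong[OF xy(3), of j] by simp
    qed
  qed
  ultimately show ?thesis unfolding spins_def by (simp add: card_image)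
qed

definition overlap :: "nat \<Rightarrow> (nat \<Rightarrow> real) \<Rightarrow> (nat \<Rightarrow> real) \<Rightarrow> real" where
  "overlap n x y = (\<Sum>j<n. x j * y j)"

lemma abs_overlap_le:
  assumes "0 < n" "x \<in> spins n" "y \<in> spins n"
  shows "\<bar>overlap n x y\<bar> \<le> 1"
proof -
  have "\<bar>overlap n x y\<bar> \<le> (\<Sum>j<n. \<bar>x j * y j\<bar>)" unfolding overlap_def by (rule sum_abs)
  also have "\<dots> = 1" using assms by (simp add: abs_mult spins_abs)
  finally show ?thesis .
qed

text \<open>
  All Gaussian variables sit in one matrix with one additional row and column: the entries with \<open>i < m\<close> and
  \<open>j < n\<close> form \<open>H\<close>, column \<open>n\<close> is \<open>g\<close>, row \<open>m\<close> is \<open>h\<close>, and the corner is \<open>g\<^sub>0\<close>. This is why spins carry the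
  additional coordinate \<open>x n = 1\<close>. The parameter \<open>v\<close> of \<open>sc\<close> removes a part of the variance of \<open>h\<close>.
\<close>

locale gordon =
  fixes m n :: nat and c p \<epsilon> :: real
  assumes m: "0 < m" and n: "0 < n" and c: "0 < c" and p01: "0 < p" "p < 1" and \<epsilon>: "0 < \<epsilon>"
begin

definition b :: real where "b = c / p"

text \<open>Maximizing over \<open>y\<close> turns \<open>H x\<close> into its norm
  \<open>l1\<close> divided by \<open>sqrt m\<close>, so with this \<beta> the first
  \<open>m\<close> rows carry \<open>b * sqrt n\<close> times the maximum. The same choice gives
  \<open>\<beta>^2 * m = b^2 * n\<close>, the balance between these rows and the last one.\<close>

definition \<beta> :: real where "\<beta> = b * sqrt (n / m)"

definition psi :: "nat \<Rightarrow> real \<Rightarrow> real" where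
  "psi i u = (if i < m then \<beta> * softabs \<epsilon> u else b * sqrt n * u)"

definition psi' :: "nat \<Rightarrow> real \<Rightarrow> real" where
  "psi' i u = (if i < m then \<beta> * tanh (u / \<epsilon>) else b * sqrt n)"

definition psi'' :: "nat \<Rightarrow> real \<Rightarrow> real" where
  "psi'' i u = (if i < m then \<beta> * ((1 - (tanh (u / \<epsilon>))\<^sup>2) / \<epsilon>) else 0)"

lemma b_pos: "0 < b" and \<beta>_pos: "0 < \<beta>"
  using c p01 m n by (auto simp: b_def \<beta>_def)

lemma pb: "p * b = c"
  using p01 by (simp add: b_def)

lemma \<beta>_sq: "\<beta>\<^sup>2 * m = b\<^sup>2 * n"
  using m n by (simp add: \<beta>_def power_mult_distrib)

sublocale gibbs "{..<Suc m}" "{..<Suc n}" "spins n" psi psi' psi'' p "\<beta> + b * sqrt n + \<beta> / \<epsilon>"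
proof
  have B: "0 \<le> \<beta>" "0 \<le> b * sqrt n" "0 \<le> \<beta> / \<epsilon>" using b_pos \<beta>_pos \<epsilon> by auto
  show "(psi i has_real_derivative psi' i u) (at u)" for i u
    unfolding psi_def[abs_def] psi'_def
    by (cases "i < m") (auto intro!: derivative_eq_intros softabs_deriv \<epsilon>)
  show "(psi' i has_real_derivative psi'' i u) (at u)" for i u
    unfolding psi'_def[abs_def] psi''_def
    using DERIV_cmult[OF tanh_scaled_deriv[OF \<epsilon>], of \<beta> u] by (cases "i < m") auto
  show "continuous_on UNIV (psi'' i)" for i
    unfolding psi''_def[abs_def] using \<epsilon>
    by (cases "i < m") (auto intro!: continuous_intros)
  show "\<bar>psi' i u\<bar> \<le> \<beta> + b * sqrt n + \<beta> / \<epsilon>" for i u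
    unfolding psi'_def using B abs_tanh_le[of "u / \<epsilon>"] \<beta>_pos b_pos
    by (auto simp: abs_mult intro!: add_increasing2 mult_left_le)
  show "\<bar>psi'' i u\<bar> \<le> \<beta> + b * sqrt n + \<beta> / \<epsilon>" for i u
  proof -
    have "\<beta> * ((1 - (tanh (u / \<epsilon>))\<^sup>2) / \<epsilon>) \<le> \<beta> * (1 / \<epsilon>)" "0 \<le> \<beta> * ((1 - (tanh (u / \<epsilon>))\<^sup>2) / \<epsilon>)"
      using \<beta>_pos \<epsilon> tanh_sq_le[of "u / \<epsilon>"]
      by (auto intro!: mult_left_mono divide_right_mono)
    then show ?thesis unfolding psi''_def using B by auto
  qed
qed (use finite_spins spins_nonempty spins_abs_le p01 in auto)

definition sc :: "real \<Rightarrow> real \<Rightarrow> nat \<times> nat \<Rightarrow> real" where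
  "sc v t k = (if fst k < m \<longleftrightarrow> snd k < n then sqrt t else if fst k < m then sqrt (1 - t) else sqrt (1 - t - v))"

definition F :: "real \<Rightarrow> real \<Rightarrow> real" where
  "F v t = (\<integral>z. \<Phi> (lin (sc v t) z) \<partial>\<gamma>)"

definition slack :: "real \<Rightarrow> real \<Rightarrow> real" where
  "slack v t = (\<integral>z. \<Phi> (lin (sc v t) z) * avg (lin (sc v t) z) (\<lambda>x y. (1 - overlap n x y) *
     (\<Sum>i<m. 1 - tanh (lin (sc v t) z i x / \<epsilon>) * tanh (lin (sc v t) z i y / \<epsilon>))) \<partial>\<gamma>)"

text \<open>Along the path the first \<open>m\<close> fields keep variance 1 and the last one keeps
  variance \<open>1 - v\<close>, because the first \<open>n\<close> coordinates of a state have norm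
  one and its last coordinate is 1. The half-derivatives of the covariances are opposite,
  \<open>(overlap - 1) / 2\<close> and \<open>(1 - overlap) / 2\<close>, and
  \<open>\<beta>_sq\<close> merges their contributions into the sum of deficits in
  \<open>slack\<close>.\<close>

lemma F_deriv:
  assumes v: "0 \<le> v" and t: "0 < t" "t < 1 - v"
  shows "(F v has_real_derivative - (p * (1 - p) * \<beta>\<^sup>2 / 2) * slack v t) (at t)"
proof -
  define s' where "s' t k = (if fst k < m \<longleftrightarrow> snd k < n then 1 / (2 * sqrt t)
      else if fst k < m then - 1 / (2 * sqrt (1 - t)) else - 1 / (2 * sqrt (1 - t - v)))"
    for t and k :: "nat \<times> nat"
  \<comment> \<open>Half the distance from \<open>t\<close> to the right end. On the interval from
    \<open>t / 2\<close> to \<open>t + d\<close> the arguments of all three square roots stay away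
    from 0, so \<open>s'\<close> is bounded there.\<close>
  define d where "d = (1 - v - t) / 2"
  have d: "0 < d" using t by (simp add: d_def)
  define S where "S = 1 + 1 / (2 * sqrt (t / 2)) + 1 / (2 * sqrt d)"
  have Sp: "0 \<le> 1 / (2 * sqrt (t / 2))" "0 \<le> 1 / (2 * sqrt d)" using t d by auto
  have D: "((\<lambda>t. \<integral>z. \<Phi> (lin (sc v t) z) \<partial>\<gamma>) has_real_derivative
    - (p * (1 - p)) * (\<integral>z. \<Phi> (lin (sc v t) z) * avg (lin (sc v t) z)
       (\<lambda>x y. \<Sum>i<Suc m. psi' i (lin (sc v t) z i x) * psi' i (lin (sc v t) z i y)
           * (\<Sum>j<Suc n. sc v t (i, j) * s' t (i, j) * x j * y j)) \<partial>\<gamma>)) (at t)"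
  proof (rule interpolation_deriv[where a = "t / 2" and b = "t + d" and S = S])
    show "t / 2 < t" "t < t + d" "0 \<le> S" using t d Sp by (auto simp: S_def)
    fix r k assume r: "t / 2 < r" "r < t + d"
    have r': "0 < r" "r < 1 - v" "d \<le> 1 - r - v" "d \<le> 1 - r" "r < 1"
      using r t v by (auto simp: d_def field_simps)
    show "((\<lambda>t. sc v t k) has_real_derivative s' r k) (at r)"
      unfolding sc_def s'_def using r'
      by (auto intro!: derivative_eq_intros simp: field_simps)
    have "\<bar>sc v r k\<bar> \<le> 1" unfolding sc_def using r' v by auto
    then show "\<bar>sc v r k\<bar> \<le> S" unfolding S_def using Sp by linarith
    have "1 / (2 * sqrt r) \<le> 1 / (2 * sqrt (t / 2))" using r t by (intro divide_left_mono) auto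
    moreover have "1 / (2 * sqrt (1 - r)) \<le> 1 / (2 * sqrt d)" using r' d by (intro divide_left_mono) auto
    moreover have "1 / (2 * sqrt (1 - r - v)) \<le> 1 / (2 * sqrt d)" using r' d by (intro divide_left_mono) auto
    moreover have "0 \<le> 1 / (2 * sqrt r)" "0 \<le> 1 / (2 * sqrt (1 - r))" "0 \<le> 1 / (2 * sqrt (1 - r - v))"
      using r' by auto
    moreover have "s' r k = 1 / (2 * sqrt r) \<or> s' r k = - (1 / (2 * sqrt (1 - r)))
        \<or> s' r k = - (1 / (2 * sqrt (1 - r - v)))"
      by (auto simp: s'_def)
    ultimately show "\<bar>s' r k\<bar> \<le> S" unfolding S_def using Sp by (elim disjE) linarith+
  next
    fix i x assume "i \<in> {..<Suc m}" and x: "x \<in> spins n"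
    then consider "i < m" | "i = m" by fastforce
    then show "(\<Sum>j\<in>{..<Suc n}. sc v t (i, j) * s' t (i, j) * (x j)\<^sup>2) = 0"
      using t v spins_last[OF x] n
      by cases (simp_all add: sc_def s'_def power2_eq_square spins_sq[OF x])
  qed
  have ss: "(\<Sum>j<Suc n. sc v t (i, j) * s' t (i, j) * x j * y j) =
      (if i < m then (overlap n x y - 1) / 2 else (1 - overlap n x y) / 2)"
    if "x \<in> spins n" "y \<in> spins n" "i < Suc m" for x y i
    using t v spins_last[OF that(1)] spins_last[OF that(2)] that(3)
    by (auto simp: sc_def s'_def overlap_def sum_negf sum_divide_distrib[symmetric] field_simps less_Suc_eq)
  have "(\<integral>z. \<Phi> (lin (sc v t) z) * avg (lin (sc v t) z)
       (\<lambda>x y. \<Sum>i<Suc m. psi' i (lin (sc v t) z i x) * psi' i (lin (sc v t) z i y)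
           * (\<Sum>j<Suc n. sc v t (i, j) * s' t (i, j) * x j * y j)) \<partial>\<gamma>) =
      (\<integral>z. \<beta>\<^sup>2 / 2 * (\<Phi> (lin (sc v t) z) * avg (lin (sc v t) z) (\<lambda>x y. (1 - overlap n x y) *
     (\<Sum>i<m. 1 - tanh (lin (sc v t) z i x / \<epsilon>) * tanh (lin (sc v t) z i y / \<epsilon>)))) \<partial>\<gamma>)"
  proof (rule Bochner_Integration.integral_cong[OF refl])
    fix z
    let ?l = "lin (sc v t) z"
    have "avg ?l (\<lambda>x y. \<Sum>i<Suc m. psi' i (?l i x) * psi' i (?l i y)
           * (\<Sum>j<Suc n. sc v t (i, j) * s' t (i, j) * x j * y j)) =
        avg ?l (\<lambda>x y. \<beta>\<^sup>2 / 2 * ((1 - overlap n x y) * (\<Sum>i<m. 1 - tanh (?l i x / \<epsilon>) * tanh (?l i y / \<epsilon>))))"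
    proof (rule avg_cong)
      fix x y assume xy: "x \<in> spins n" "y \<in> spins n"
      have "(\<Sum>i<Suc m. psi' i (?l i x) * psi' i (?l i y)
           * (\<Sum>j<Suc n. sc v t (i, j) * s' t (i, j) * x j * y j)) =
         (\<Sum>i<Suc m. psi' i (?l i x) * psi' i (?l i y)
           * (if i < m then (overlap n x y - 1) / 2 else (1 - overlap n x y) / 2))"
        by (intro sum.cong refl) (simp only: ss[OF xy] lessThan_iff)
      also have "\<dots> = (\<Sum>i<m. \<beta>\<^sup>2 * (tanh (?l i x / \<epsilon>) * tanh (?l i y / \<epsilon>)) * ((overlap n x y - 1) / 2))
          + (b * sqrt n)\<^sup>2 * ((1 - overlap n x y) / 2)"
        by (simp add: psi'_def power2_eq_square mult_ac)
      also have "(b * sqrt n)\<^sup>2 = \<beta>\<^sup>2 * m" by (simp add: \<beta>_sq power_mult_distrib)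
      also have "(\<Sum>i<m. \<beta>\<^sup>2 * (tanh (?l i x / \<epsilon>) * tanh (?l i y / \<epsilon>)) * ((overlap n x y - 1) / 2)) =
          \<beta>\<^sup>2 * (\<Sum>i<m. tanh (?l i x / \<epsilon>) * tanh (?l i y / \<epsilon>)) * ((overlap n x y - 1) / 2)"
        by (simp only: sum_distrib_left sum_distrib_right)
      also have "(\<Sum>i<m. tanh (?l i x / \<epsilon>) * tanh (?l i y / \<epsilon>)) =
          m - (\<Sum>i<m. 1 - tanh (?l i x / \<epsilon>) * tanh (?l i y / \<epsilon>))"
        by (simp add: sum_subtractf)
      finally show "(\<Sum>i<Suc m. psi' i (?l i x) * psi' i (?l i y)
           * (\<Sum>j<Suc n. sc v t (i, j) * s' t (i, j) * x j * y j)) =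
         \<beta>\<^sup>2 / 2 * ((1 - overlap n x y) * (\<Sum>i<m. 1 - tanh (?l i x / \<epsilon>) * tanh (?l i y / \<epsilon>)))"
        by (simp add: field_simps del: sum_subtractf)
    qed
    then show "\<Phi> ?l * avg ?l (\<lambda>x y. \<Sum>i<Suc m. psi' i (?l i x) * psi' i (?l i y)
           * (\<Sum>j<Suc n. sc v t (i, j) * s' t (i, j) * x j * y j)) =
        \<beta>\<^sup>2 / 2 * (\<Phi> ?l * avg ?l (\<lambda>x y. (1 - overlap n x y) * (\<Sum>i<m. 1 - tanh (?l i x / \<epsilon>) * tanh (?l i y / \<epsilon>))))"
      unfolding avg_cmult by (simp only: mult.left_commute[of "\<Phi> ?l" "\<beta>\<^sup>2 / 2"])
  qed
  also have "\<dots> = \<beta>\<^sup>2 / 2 * slack v t" unfolding slack_def by simp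
  finally have e: "(\<integral>z. \<Phi> (lin (sc v t) z) * avg (lin (sc v t) z)
       (\<lambda>x y. \<Sum>i<Suc m. psi' i (lin (sc v t) z i x) * psi' i (lin (sc v t) z i y)
           * (\<Sum>j<Suc n. sc v t (i, j) * s' t (i, j) * x j * y j)) \<partial>\<gamma>) = \<beta>\<^sup>2 / 2 * slack v t" .
  show ?thesis unfolding F_def[abs_def] by (rule DERIV_cong[OF D[unfolded e]]) simp
qed

end

section \<open>Continuity, monotonicity and initial value of the comparison process\<close>

lemma (in gibbs) continuous_on_integral_\<Phi>:
  fixes A :: "real set"
  assumes S: "\<And>t k. t \<in> A \<Longrightarrow> k \<in> I \<times> J \<Longrightarrow> \<bar>s t k\<bar> \<le> S"
    and s: "\<And>k. k \<in> I \<times> J \<Longrightarrow> continuous_on A (\<lambda>t. s t k)"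
  shows "continuous_on A (\<lambda>t. \<integral>z. \<Phi> (lin (s t) z) \<partial>\<gamma>)"
  unfolding continuous_on_sequentially comp_def
proof (intro allI ballI impI, elim conjE)
  fix X :: "nat \<Rightarrow> real" and a
  assume X: "a \<in> A" "\<forall>i. X i \<in> A" "X \<longlonglongrightarrow> a"
  show "(\<lambda>i. \<integral>z. \<Phi> (lin (s (X i)) z) \<partial>\<gamma>) \<longlonglongrightarrow> (\<integral>z. \<Phi> (lin (s a) z) \<partial>\<gamma>)"
  proof (rule integral_dominated_convergence)
    show "integrable \<gamma> (\<lambda>z. C0 * exp (B * S * l1 (I \<times> J) z))"
      using fin by (intro integrable_gauss_exp_l1) auto
    show "AE z in \<gamma>. norm (\<Phi> (lin (s (X i)) z)) \<le> C0 * exp (B * S * l1 (I \<times> J) z)" for i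
      using \<Phi>_le[of "s (X i)" S] S X(2) \<Phi>_pos by (auto simp: less_imp_le)
    show "AE z in \<gamma>. (\<lambda>i. \<Phi> (lin (s (X i)) z)) \<longlonglongrightarrow> \<Phi> (lin (s a) z)"
    proof (rule AE_I2)
      fix z
      have \<psi>c: "continuous_on UNIV (\<psi> i)" for i
        using \<psi>_der by (intro continuous_at_imp_continuous_on ballI DERIV_isCont)
      have "continuous_on A (\<lambda>t. lin (s t) z i x)" if "i \<in> I" for i x
        unfolding lin_def using s that by (intro continuous_intros) auto
      then have "continuous_on A (\<lambda>t. W (lin (s t) z))"
        unfolding W_def energy_def
        by (intro continuous_intros continuous_on_compose2[OF \<psi>c]) auto
      then have "continuous_on A (\<lambda>t. \<Phi> (lin (s t) z))"
        unfolding \<Phi>_def using W_pos by (intro continuous_on_powr continuous_intros) (auto simp: less_imp_neq[THEN not_sym])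
      then show "(\<lambda>i. \<Phi> (lin (s (X i)) z)) \<longlonglongrightarrow> \<Phi> (lin (s a) z)"
        using X by (auto simp: continuous_on_sequentially comp_def)
    qed
  qed simp_all
qed

text \<open>As \<open>p - 1\<close> is nonpositive, \<open>W l\<close> may be replaced by the single
  weight of \<open>x\<close>. The partition function disappears, and Gibbs averages weighted by
  \<open>\<Phi>\<close> are bounded by sums of plain Gaussian moments.\<close>

lemma (in gibbs) \<Phi>_pr_le:
  assumes "x \<in> X"
  shows "\<Phi> l * pr l x \<le> exp (- p * energy l x)"
proof -
  have le: "exp (- energy l x) \<le> W l"
    unfolding W_def using fin assms by (intro member_le_sum) auto
  have "\<Phi> l * pr l x = exp (- energy l x) * W l powr (p - 1)"
    unfolding \<Phi>_def pr_def using W_pos[of l] by (simp add: powr_diff)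
  also have "\<dots> \<le> exp (- energy l x) * exp (- energy l x) powr (p - 1)"
    using le p W_pos[of l] by (intro mult_left_mono powr_mono2') auto
  also have "\<dots> = exp (- p * energy l x)"
    by (simp add: powr_def exp_add[symmetric] algebra_simps)
  finally show ?thesis .
qed

lemma (in gibbs) \<Phi>_ge:
  assumes "x \<in> X"
  shows "exp (- p * energy l x) \<le> \<Phi> l"
proof -
  have le: "exp (- energy l x) \<le> W l"
    unfolding W_def using fin assms by (intro member_le_sum) auto
  have "exp (- p * energy l x) = exp (- energy l x) powr p" by (simp add: powr_def)
  also have "\<dots> \<le> \<Phi> l" unfolding \<Phi>_def using le p by (intro powr_mono2) auto
  finally show ?thesis .
qed

lemma (in gibbs) avg_nonneg: "(\<And>x y. x \<in> X \<Longrightarrow> y \<in> X \<Longrightarrow> 0 \<le> f x y) \<Longrightarrow> 0 \<le> avg l f"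
  using avg_mono[of "\<lambda>_ _. 0" f l] by simp

context gordon
begin

lemma overlap_bounds: "x \<in> spins n \<Longrightarrow> y \<in> spins n \<Longrightarrow> 0 \<le> 1 - overlap n x y"
    "x \<in> spins n \<Longrightarrow> y \<in> spins n \<Longrightarrow> 1 - overlap n x y \<le> 2"
  using abs_overlap_le[OF n, of x y] by (auto simp: abs_le_iff)

lemma tanh_prod_le: "tanh x * tanh (y :: real) \<le> 1"
proof -
  have "\<bar>tanh x * tanh y\<bar> \<le> 1 * 1" unfolding abs_mult by (intro mult_mono abs_tanh_le) auto
  then show ?thesis by simp
qed

lemma slack_nonneg: "0 \<le> slack v t"
  unfolding slack_def
  by (intro integral_nonneg_AE AE_I2 mult_nonneg_nonneg avg_nonneg sum_nonneg less_imp_le[OF \<Phi>_pos])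
     (use overlap_bounds tanh_prod_le in auto)

text \<open>The square roots in \<open>sc\<close> are not differentiable at the ends of the
  interval, so monotonicity up to \<open>t = 0\<close> and \<open>t = 1 - v\<close> rests on
  continuity there.\<close>

lemma F_cont:
  assumes "0 \<le> v" "v \<le> 1"
  shows "continuous_on {0..1 - v} (F v)"
  unfolding F_def[abs_def]
proof (rule continuous_on_integral_\<Phi>[where S = 1])
  show "\<bar>sc v t k\<bar> \<le> 1" if "t \<in> {0..1 - v}" for t k
    using that assms by (auto simp: sc_def)
  show "continuous_on {0..1 - v} (\<lambda>t. sc v t k)" for k
    unfolding sc_def by (cases "fst k < m"; cases "snd k < n"; simp; intro continuous_intros)
qed

lemma F_antimono:
  assumes "0 \<le> v" "v \<le> 1" "0 \<le> t" "t \<le> u" "u \<le> 1 - v"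
  shows "F v u \<le> F v t"
proof (cases "t = u")
  case False
  then have "t < u" using assms by simp
  show ?thesis
  proof (rule DERIV_nonpos_imp_decreasing_open[OF \<open>t \<le> u\<close>])
    fix x assume "t < x" "x < u"
    then have "(F v has_real_derivative - (p * (1 - p) * \<beta>\<^sup>2 / 2) * slack v x) (at x)"
      using assms by (intro F_deriv) auto
    moreover have "- (p * (1 - p) * \<beta>\<^sup>2 / 2) * slack v x \<le> 0"
      using slack_nonneg[of v x] p01 by simp
    ultimately show "\<exists>y. (F v has_real_derivative y) (at x) \<and> y \<le> 0" by blast
  next
    show "continuous_on {t..u} (F v)"
      by (rule continuous_on_subset[OF F_cont[OF assms(1,2)]]) (use assms in auto)
  qed
qed simp

lemma F_pos: "0 < F v t"
proof -
  have "F v t \<noteq> 0"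
  proof
    assume "F v t = 0"
    then have "AE z in \<gamma>. \<Phi> (lin (sc v t) z) = 0"
      unfolding F_def
      by (subst (asm) integral_nonneg_eq_0_iff_AE[OF integrable_\<Phi>]) (auto intro: less_imp_le[OF \<Phi>_pos])
    moreover have "\<Phi> (lin (sc v t) z) \<noteq> 0" for z
      using \<Phi>_pos[of "lin (sc v t) z"] by simp
    ultimately have "AE z in \<gamma>. False" by simp
    then show False by (simp only: gauss.P.AE_False)
  qed
  moreover have "0 \<le> F v t" unfolding F_def
    by (intro integral_nonneg_AE AE_I2 less_imp_le[OF \<Phi>_pos])
  ultimately show ?thesis by simp
qed

end

lemma prod_grid:
  fixes f :: "nat \<times> nat \<Rightarrow> real"
  shows "(\<Prod>k\<in>{..<Suc m} \<times> {..<Suc n}. f k) =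
    (\<Prod>i<m. (\<Prod>j<n. f (i, j)) * f (i, n)) * ((\<Prod>j<n. f (m, j)) * f (m, n))"
proof -
  have "(\<Prod>k\<in>{..<Suc m} \<times> {..<Suc n}. f k) = (\<Prod>i<Suc m. \<Prod>j<Suc n. f (i, j))"
    by (subst prod.cartesian_product) (simp add: case_prod_beta')
  then show ?thesis by simp
qed

lemma integrable_std_gauss_cosh:
  assumes "0 < (p::real)" "p \<le> 1"
  shows "integrable std_gauss (\<lambda>y. (2 * cosh (a * y)) powr p)"
proof (rule integrable_std_gauss_bound[where A = 2 and B = "\<bar>a\<bar>"])
  have pos: "0 < 2 * cosh (a * y)" for y by (simp add: cosh_real_pos)
  show "(\<lambda>y. (2 * cosh (a * y)) powr p) \<in> borel_measurable borel"
    using pos by (intro borel_measurable_continuous_onI continuous_intros)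
      (auto simp: less_imp_neq[THEN not_sym])
  fix y
  have "2 * cosh (a * y) = exp (a * y) + exp (- (a * y))" by (simp add: cosh_def)
  also have "\<dots> \<le> exp (\<bar>a\<bar> * \<bar>y\<bar>) + exp (\<bar>a\<bar> * \<bar>y\<bar>)"
    unfolding abs_mult[symmetric] by (intro add_mono) auto
  finally have le: "2 * cosh (a * y) \<le> 2 * exp (\<bar>a\<bar> * \<bar>y\<bar>)" by simp
  have "1 \<le> 2 * cosh (a * y)" using cosh_real_ge_1[of "a * y"] by simp
  then have "(2 * cosh (a * y)) powr p \<le> 2 * cosh (a * y)" using powr_mono[of p 1] assms by simp
  with le show "\<bar>(2 * cosh (a * y)) powr p\<bar> \<le> 2 * exp (\<bar>a\<bar> * \<bar>y\<bar>)" by simp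
qed

lemma sum_spins_exp:
  "(\<Sum>x\<in>spins n. exp (\<Sum>j<n. a j * x j)) = (\<Prod>j<n. 2 * cosh (a j / sqrt n))"
proof -
  have inj: "inj_on (\<lambda>x. x(n := 1 :: real)) (cube n)"
  proof (rule inj_onI)
    fix x y assume xy: "x \<in> cube n" "y \<in> cube n" "x(n := 1) = y(n := (1 :: real))"
    show "x = y"
    proof (rule PiE_ext[OF xy(1,2)[unfolded cube_def]])
      fix j assume "j \<in> {..<n}"
      then show "x j = y j" using fun_cong[OF xy(3), of j] by simp
    qed
  qed
  have "(\<Sum>x\<in>spins n. exp (\<Sum>j<n. a j * x j)) = (\<Sum>x\<in>cube n. \<Prod>j<n. exp (a j * x j))"
    unfolding spins_def sum.reindex[OF inj] comp_def by (intro sum.cong) (auto simp: exp_sum)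
  also have "\<dots> = (\<Prod>j<n. \<Sum>u\<in>{- (1 / sqrt n), 1 / sqrt n}. exp (a j * u))"
    unfolding cube_def by (rule prod_sum_PiE[symmetric]) auto
  also have "\<dots> = (\<Prod>j<n. 2 * cosh (a j / sqrt n))"
  proof (rule prod.cong[OF refl])
    fix j assume "j \<in> {..<n}"
    then have "- (1 / sqrt (real n)) \<noteq> 1 / sqrt (real n)" by (simp add: field_simps)
    then show "(\<Sum>u\<in>{- (1 / sqrt n), 1 / sqrt n}. exp (a j * u)) = 2 * cosh (a j / sqrt n)"
      by (simp add: cosh_def)
  qed
  finally show ?thesis .
qed

context gordon
begin

text \<open>At \<open>t = 0\<close> the first \<open>m\<close> fields are pure noise, the same for
  all states, and leave the sum; the last one is linear in \<open>x\<close>, so the sum over the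
  cube factorizes into hyperbolic cosines. The power \<open>p\<close> of this product is a product
  over independent coordinates.\<close>

lemma F_zero:
  assumes v: "0 \<le> v" "v \<le> 1"
  shows "F v 0 = (\<integral>y. exp (- (p * \<beta> * softabs \<epsilon> y)) \<partial>std_gauss) ^ m
    * (\<integral>y. (2 * cosh (b * sqrt (1 - v) * y)) powr p \<partial>std_gauss) ^ n"
proof -
  let ?a = "\<lambda>y. exp (- (p * \<beta> * softabs \<epsilon> y))"
  let ?h = "\<lambda>y. (2 * cosh (b * sqrt (1 - v) * y)) powr p"
  define f where "f k = (if fst k < m then if snd k < n then (\<lambda>_. 1) else ?a
      else if snd k < n then ?h else (\<lambda>_. 1))" for k :: "nat \<times> nat"
  have W: "W (lin (sc v 0) z) = (\<Prod>i<m. exp (- (\<beta> * softabs \<epsilon> (z (i, n))))) *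
      (\<Prod>j<n. 2 * cosh (b * sqrt (1 - v) * z (m, j)))" for z
  proof -
    have "exp (- energy (lin (sc v 0) z) x) = (\<Prod>i<m. exp (- (\<beta> * softabs \<epsilon> (z (i, n))))) *
        exp (\<Sum>j<n. (- (b * sqrt n * sqrt (1 - v)) * z (m, j)) * x j)" if "x \<in> spins n" for x
    proof -
      have "- energy (lin (sc v 0) z) x = (\<Sum>i<m. - (\<beta> * softabs \<epsilon> (z (i, n)))) +
          (\<Sum>j<n. (- (b * sqrt n * sqrt (1 - v)) * z (m, j)) * x j)"
        using spins_last[OF that]
        by (simp add: energy_def psi_def lin_def sc_def sum_distrib_left sum_negf mult_ac)
      then show ?thesis by (simp only: exp_add exp_sum finite_lessThan)
    qed
    then have "W (lin (sc v 0) z) = (\<Prod>i<m. exp (- (\<beta> * softabs \<epsilon> (z (i, n))))) *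
       (\<Prod>j<n. 2 * cosh (- (b * sqrt n * sqrt (1 - v)) * z (m, j) / sqrt n))"
      unfolding W_def sum_spins_exp[symmetric] by (simp add: sum_distrib_left)
    also have "(\<lambda>j. cosh (- (b * sqrt n * sqrt (1 - v)) * z (m, j) / sqrt n)) =
       (\<lambda>j. cosh (b * sqrt (1 - v) * z (m, j)))" using n by (simp add: field_simps)
    finally show ?thesis .
  qed
  have \<Phi>: "\<Phi> (lin (sc v 0) z) = (\<Prod>k\<in>{..<Suc m} \<times> {..<Suc n}. f k (z k))" for z
  proof -
    have "\<Phi> (lin (sc v 0) z) = (\<Prod>i<m. exp (- (\<beta> * softabs \<epsilon> (z (i, n)))) powr p) * (\<Prod>j<n. ?h (z (m, j)))"
      unfolding \<Phi>_def W
      by (subst powr_mult) (auto simp: prod_powr_distrib cosh_real_nonneg intro!: prod_nonneg)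
    also have "\<dots> = (\<Prod>i<m. ?a (z (i, n))) * (\<Prod>j<n. ?h (z (m, j)))"
      by (simp add: exp_powr_real mult_ac)
    finally show ?thesis unfolding prod_grid f_def by simp
  qed
  have "integrable std_gauss ?a"
  proof (rule integrable_std_gauss_bound[where A = 1 and B = 0])
    have "continuous_on UNIV (softabs \<epsilon>)"
      using softabs_deriv[OF \<epsilon>] by (intro continuous_at_imp_continuous_on ballI DERIV_isCont)
    then show "?a \<in> borel_measurable borel" by (intro borel_measurable_continuous_onI continuous_intros)
    show "\<bar>?a y\<bar> \<le> 1 * exp (0 * \<bar>y\<bar>)" for y
      using softabs_nonneg[OF \<epsilon>, of y] \<beta>_pos p01 by simp
  qed
  moreover have "integrable std_gauss ?h" using p01 by (intro integrable_std_gauss_cosh) auto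
  ultimately have "integrable std_gauss (f k)" for k by (auto simp: f_def)
  then have "F v 0 = (\<Prod>k\<in>{..<Suc m} \<times> {..<Suc n}. integral\<^sup>L std_gauss (f k))"
    unfolding F_def \<Phi> by (intro integral_gauss_prod) auto
  also have "\<dots> = (\<Prod>i<m. integral\<^sup>L std_gauss ?a) * (\<Prod>j<n. integral\<^sup>L std_gauss ?h)"
    unfolding prod_grid f_def using gauss.M.prob_space by simp
  finally show ?thesis by simp
qed

end

section \<open>Integration by parts in the noise and in the external field\<close>

lemma (in gibbs) integral_\<Phi>_mono:
  assumes "f \<in> borel_measurable \<gamma>" "g \<in> borel_measurable \<gamma>"
    and "\<And>z. \<bar>f z\<bar> \<le> C" "\<And>z. \<bar>g z\<bar> \<le> D" "\<And>z. f z \<le> g z"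
  shows "(\<integral>z. \<Phi> (lin s z) * f z \<partial>\<gamma>) \<le> (\<integral>z. \<Phi> (lin s z) * g z \<partial>\<gamma>)"
  using assms
  by (intro integral_mono integrable_\<Phi>_mult mult_left_mono less_imp_le[OF \<Phi>_pos]) auto

lemma (in gibbs) integrable_comp_\<Phi>_mult:
  assumes k: "k \<in> I \<times> J" and F: "F \<in> borel_measurable \<gamma>" "\<And>z. \<bar>F z\<bar> \<le> C"
  shows "integrable \<gamma> (\<lambda>z. z k * (\<Phi> (lin s z) * F z))"
proof -
  obtain S where S: "\<And>k. k \<in> I \<times> J \<Longrightarrow> \<bar>s k\<bar> \<le> S" using finite_s_bound[of s] by auto
  show ?thesis
    using fin k by (intro integrable_gauss_bound[OF _ _ mult_l1_bound[OF _ _ \<Phi>_mult_bound[OF S F(2)]]]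
      borel_measurable_times \<Phi>_measurable F(1)) auto
qed

context gordon
begin

definition Tn :: "(nat \<Rightarrow> (nat \<Rightarrow> real) \<Rightarrow> real) \<Rightarrow> nat \<Rightarrow> (nat \<Rightarrow> real) \<Rightarrow> real" where
  "Tn l i x = tanh (l i x / \<epsilon>)"

lemma Tn_le: "\<bar>Tn l i x\<bar> \<le> 1"
  unfolding Tn_def by (rule abs_tanh_le)

lemma tanh_measurable[measurable]: "(tanh :: real \<Rightarrow> real) \<in> borel_measurable borel"
  by (intro borel_measurable_continuous_onI continuous_intros) (simp add: cosh_real_pos less_imp_neq[THEN not_sym])

lemma Tn_measurable[measurable]: "i < Suc m \<Longrightarrow> (\<lambda>z. Tn (lin s z) i x) \<in> borel_measurable \<gamma>"
  unfolding Tn_def using lin_measurable[of i s x] by simp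

lemma abs_one_minus_overlap: "x \<in> spins n \<Longrightarrow> y \<in> spins n \<Longrightarrow> \<bar>1 - overlap n x y\<bar> \<le> 2"
  using overlap_bounds[of x y] by simp

lemma Tn_prod_le: "\<bar>Tn l i x * Tn l i y\<bar> \<le> 1"
  unfolding abs_mult using mult_mono[OF Tn_le Tn_le, of l i x l i y] by (simp add: mult.commute)

text \<open>Read from right to left, this bounds the slack below by the correlation between the
  noise and the smoothed sign. The derivative of \<open>tanh\<close> yields
  \<open>(1 - T^2) / \<epsilon>\<close>, the Gibbs weights yield \<beta> times products of smoothed
  signs, and \<open>one_minus_mult_ge\<close> reduces everything to the two-replica deficit.\<close>

lemma ibp_noise_overlap:
  assumes t: "0 \<le> t" "t \<le> 1" and i: "i < m"
  shows "(\<integral>z. z (i, n) * (\<Phi> (lin (sc 0 t) z) * avg (lin (sc 0 t) z) (\<lambda>x y. (1 - overlap n x y) * Tn (lin (sc 0 t) z) i x)) \<partial>\<gamma>)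
    \<le> (2 / \<epsilon> + 3 * \<beta>) * (\<integral>z. \<Phi> (lin (sc 0 t) z) * avg (lin (sc 0 t) z)
         (\<lambda>x y. (1 - overlap n x y) * (1 - Tn (lin (sc 0 t) z) i x * Tn (lin (sc 0 t) z) i y)) \<partial>\<gamma>)"
proof -
  let ?l = "lin (sc 0 t)"
  let ?q = "\<lambda>x y. 1 - overlap n x y"
  define N where "N z = avg (?l z) (\<lambda>x y. ?q x y * ((1 - (Tn (?l z) i x)\<^sup>2) / \<epsilon> * x n
          - Tn (?l z) i x * (psi' i (?l z i x) * x n + psi' i (?l z i y) * y n)))
       + (2 - p) * avg1 (?l z) (\<lambda>x. psi' i (?l z i x) * x n) * avg (?l z) (\<lambda>x y. ?q x y * Tn (?l z) i x)" for z
  define R where "R z = avg (?l z) (\<lambda>x y. ?q x y * (1 - Tn (?l z) i x * Tn (?l z) i y))" for z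
  note [measurable] = lin_measurable[of i]
  have "(\<integral>z. z (i, n) * (\<Phi> (?l z) * avg (?l z) (\<lambda>x y. ?q x y * Tn (?l z) i x)) \<partial>\<gamma>)
      = sc 0 t (i, n) * (\<integral>z. \<Phi> (?l z) * N z \<partial>\<gamma>)"
    unfolding N_def Tn_def
  proof (rule ibp[where C = "2 + 1 / \<epsilon>"])
    have e: "0 < 1 / \<epsilon>" using \<epsilon> by simp
    show "\<bar>1 - overlap n x y\<bar> \<le> 2 + 1 / \<epsilon>" if "x \<in> spins n" "y \<in> spins n" for x y
      using abs_one_minus_overlap[OF that] e by linarith
    show "\<bar>tanh (u / \<epsilon>)\<bar> \<le> 2 + 1 / \<epsilon>" for u using abs_tanh_le[of "u / \<epsilon>"] e by linarith
    show "\<bar>(1 - (tanh (u / \<epsilon>))\<^sup>2) / \<epsilon>\<bar> \<le> 2 + 1 / \<epsilon>" for u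
    proof -
      have "\<bar>(1 - (tanh (u / \<epsilon>))\<^sup>2) / \<epsilon>\<bar> \<le> 1 / \<epsilon>"
        using tanh_sq_le[of "u / \<epsilon>"] \<epsilon> by (simp add: divide_right_mono)
      then show ?thesis by linarith
    qed
    show "continuous_on UNIV (\<lambda>u. (1 - (tanh (u / \<epsilon>))\<^sup>2) / \<epsilon>)"
      using \<epsilon> by (intro continuous_intros) auto
  qed (use i \<epsilon> in \<open>auto intro: tanh_scaled_deriv\<close>)
  also have "\<dots> \<le> sc 0 t (i, n) * (\<integral>z. \<Phi> (?l z) * ((2 / \<epsilon> + 3 * \<beta>) * R z) \<partial>\<gamma>)"
  proof (intro mult_left_mono integral_\<Phi>_mono)
    show "0 \<le> sc 0 t (i, n)" using t by (simp add: sc_def)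
    have pm: "(\<lambda>z. psi' i (?l z i x)) \<in> borel_measurable \<gamma>" for x
      using i by (intro measurable_compose[OF lin_measurable \<psi>_measurable(2)]) auto
    show "N \<in> borel_measurable \<gamma>" unfolding N_def using i
      by (intro borel_measurable_add borel_measurable_times avg_measurable avg1_measurable borel_measurable_diff
          borel_measurable_divide borel_measurable_power borel_measurable_const pm Tn_measurable) auto
    show "(\<lambda>z. (2 / \<epsilon> + 3 * \<beta>) * R z) \<in> borel_measurable \<gamma>" unfolding R_def using i
      by (intro borel_measurable_times avg_measurable borel_measurable_diff
          borel_measurable_const Tn_measurable) auto
    have qT: "\<bar>?q x y * (1 - Tn l i x * Tn l i y)\<bar> \<le> 4" if "x \<in> spins n" "y \<in> spins n" for x y l
    proof -
      have "\<bar>1 - Tn l i x * Tn l i y\<bar> \<le> 2" using Tn_prod_le[of l i x y] by (auto simp: abs_le_iff)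
      from mult_mono[OF abs_one_minus_overlap[OF that] this] show ?thesis by (simp add: abs_mult)
    qed
    have R4: "\<bar>R z\<bar> \<le> 4" for z unfolding R_def by (rule abs_avg_le[OF qT])
    show "\<bar>(2 / \<epsilon> + 3 * \<beta>) * R z\<bar> \<le> (2 / \<epsilon> + 3 * \<beta>) * 4" for z
      unfolding abs_mult using R4[of z] \<epsilon> \<beta>_pos by (intro mult_mono) auto
    have pT: "psi' i (l i x) = \<beta> * Tn l i x" for l x using i by (simp add: psi'_def Tn_def)
    have avgT: "\<bar>avg1 l (\<lambda>x. \<beta> * Tn l i x)\<bar> \<le> \<beta>" for l
      using \<beta>_pos Tn_le[of l i] by (intro abs_avg1_le) (auto simp: abs_mult)
    have N': "N z = avg (?l z) (\<lambda>x y. ?q x y * ((1 - (Tn (?l z) i x)\<^sup>2) / \<epsilon>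
          - \<beta> * (Tn (?l z) i x * Tn (?l z) i x + Tn (?l z) i x * Tn (?l z) i y)))
       + (2 - p) * avg1 (?l z) (\<lambda>x. \<beta> * Tn (?l z) i x) * avg (?l z) (\<lambda>x y. ?q x y * Tn (?l z) i x)" for z
    proof -
      have "avg (?l z) (\<lambda>x y. ?q x y * ((1 - (Tn (?l z) i x)\<^sup>2) / \<epsilon> * x n
          - Tn (?l z) i x * (psi' i (?l z i x) * x n + psi' i (?l z i y) * y n))) =
        avg (?l z) (\<lambda>x y. ?q x y * ((1 - (Tn (?l z) i x)\<^sup>2) / \<epsilon>
          - \<beta> * (Tn (?l z) i x * Tn (?l z) i x + Tn (?l z) i x * Tn (?l z) i y)))"
        by (rule avg_cong) (simp add: spins_last pT algebra_simps)
      moreover have "avg1 (?l z) (\<lambda>x. psi' i (?l z i x) * x n) = avg1 (?l z) (\<lambda>x. \<beta> * Tn (?l z) i x)"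
        by (rule avg1_cong) (simp add: spins_last pT)
      ultimately show ?thesis unfolding N_def by (simp only:)
    qed
    have avgq: "\<bar>avg l (\<lambda>x y. ?q x y * Tn l i x)\<bar> \<le> avg l ?q" for l
    proof -
      have "avg l (\<lambda>x y. ?q x y * Tn l i x) \<le> avg l ?q"
        using overlap_bounds(1) Tn_le[of l i] by (intro avg_mono mult_left_le) (auto simp: abs_le_iff)
      moreover have "- avg l ?q \<le> avg l (\<lambda>x y. ?q x y * Tn l i x)"
      proof -
        have "- avg l ?q = avg l (\<lambda>x y. ?q x y * (- 1))"
          using avg_cmult[of l "-1" ?q] by (simp add: algebra_simps)
        also have "\<dots> \<le> avg l (\<lambda>x y. ?q x y * Tn l i x)"
          using overlap_bounds(1) Tn_le[of l i] by (intro avg_mono mult_left_mono) (auto simp: abs_le_iff minus_le_iff)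
        finally show ?thesis .
      qed
      ultimately show ?thesis by (simp add: abs_le_iff minus_le_iff)
    qed
    have avgq2: "0 \<le> avg l ?q" "avg l ?q \<le> 2" for l
      using abs_avg_le[of ?q 2 l, OF abs_one_minus_overlap] avg_nonneg[of ?q l] overlap_bounds(1) by auto
    have third: "\<bar>(2 - p) * avg1 l (\<lambda>x. \<beta> * Tn l i x) * avg l (\<lambda>x y. ?q x y * Tn l i x)\<bar> \<le> 2 * \<beta> * avg l ?q" for l
      unfolding abs_mult using p01 avgT[of l] avgq[of l] \<beta>_pos by (intro mult_mono) auto
    show Nle: "N z \<le> (2 / \<epsilon> + 3 * \<beta>) * R z" for z
    proof -
      have "N z \<le> avg (?l z) (\<lambda>x y. ?q x y * ((1 - (Tn (?l z) i x)\<^sup>2) / \<epsilon>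
          - \<beta> * (Tn (?l z) i x * Tn (?l z) i x + Tn (?l z) i x * Tn (?l z) i y))) + 2 * \<beta> * avg (?l z) ?q"
        unfolding N' using third[of "?l z"] by linarith
      also have "\<dots> = avg (?l z) (\<lambda>x y. ?q x y * ((1 - (Tn (?l z) i x)\<^sup>2) / \<epsilon>
          - \<beta> * (Tn (?l z) i x * Tn (?l z) i x + Tn (?l z) i x * Tn (?l z) i y)) + 2 * \<beta> * ?q x y)"
        by (simp only: avg_add avg_cmult)
      also have "\<dots> \<le> avg (?l z) (\<lambda>x y. (2 / \<epsilon> + 3 * \<beta>) * (?q x y * (1 - Tn (?l z) i x * Tn (?l z) i y)))"
      proof (rule avg_mono)
        fix x y assume xy: "x \<in> spins n" "y \<in> spins n"
        let ?a = "Tn (?l z) i x" and ?c = "Tn (?l z) i y"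
        have k: "1 - ?a\<^sup>2 \<le> 2 * (1 - ?a * ?c)" by (rule one_minus_mult_ge[OF Tn_le Tn_le])
        \<comment> \<open>The term from the normalizations was estimated by
          \<open>2 * \<beta>\<close>, which exactly completes
          \<open>- \<beta> * (T^2 + T * T')\<close> to a sum of two nonnegative deficits.\<close>
        have "(1 - ?a\<^sup>2) / \<epsilon> - \<beta> * (?a * ?a + ?a * ?c) + 2 * \<beta>
            = (1 / \<epsilon> + \<beta>) * (1 - ?a\<^sup>2) + \<beta> * (1 - ?a * ?c)"
          by (simp add: power2_eq_square algebra_simps diff_divide_distrib)
        also have "\<dots> \<le> (1 / \<epsilon> + \<beta>) * (2 * (1 - ?a * ?c)) + \<beta> * (1 - ?a * ?c)"
          using \<epsilon> \<beta>_pos by (intro add_right_mono mult_left_mono k) auto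
        also have "\<dots> = (2 / \<epsilon> + 3 * \<beta>) * (1 - ?a * ?c)" by (simp add: algebra_simps)
        finally have "?q x y * ((1 - ?a\<^sup>2) / \<epsilon> - \<beta> * (?a * ?a + ?a * ?c) + 2 * \<beta>)
            \<le> ?q x y * ((2 / \<epsilon> + 3 * \<beta>) * (1 - ?a * ?c))"
          using overlap_bounds(1)[OF xy] by (rule mult_left_mono)
        then show "?q x y * ((1 - ?a\<^sup>2) / \<epsilon> - \<beta> * (?a * ?a + ?a * ?c)) + 2 * \<beta> * ?q x y
            \<le> (2 / \<epsilon> + 3 * \<beta>) * (?q x y * (1 - ?a * ?c))"
          by (simp only: distrib_left mult.left_commute mult.commute)
      qed
      also have "\<dots> = (2 / \<epsilon> + 3 * \<beta>) * R z" by (simp only: avg_cmult R_def)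
      finally show ?thesis .
    qed
    show "\<bar>N z\<bar> \<le> 2 * (1 / \<epsilon> + 2 * \<beta>) + 2 * \<beta> * 2" for z
    proof -
      have "\<bar>avg (?l z) (\<lambda>x y. ?q x y * ((1 - (Tn (?l z) i x)\<^sup>2) / \<epsilon>
          - \<beta> * (Tn (?l z) i x * Tn (?l z) i x + Tn (?l z) i x * Tn (?l z) i y)))\<bar> \<le> 2 * (1 / \<epsilon> + 2 * \<beta>)"
      proof (rule abs_avg_le)
        fix x y assume xy: "x \<in> spins n" "y \<in> spins n"
        let ?a = "Tn (?l z) i x" and ?c = "Tn (?l z) i y"
        have "\<bar>(1 - ?a\<^sup>2) / \<epsilon>\<bar> \<le> 1 / \<epsilon>"
          using \<epsilon> tanh_sq_le[of "?l z i x / \<epsilon>"] by (simp add: Tn_def divide_right_mono)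
        moreover have "\<bar>\<beta> * (?a * ?a + ?a * ?c)\<bar> \<le> \<beta> * 2"
        proof -
          have "\<bar>?a * ?a + ?a * ?c\<bar> \<le> 2"
            using Tn_prod_le[of "?l z" i x x] Tn_prod_le[of "?l z" i x y]
            by (intro order_trans[OF abs_triangle_ineq]) linarith
          then show ?thesis unfolding abs_mult[of \<beta>] using \<beta>_pos by (simp add: mult_left_mono)
        qed
        ultimately have "\<bar>(1 - ?a\<^sup>2) / \<epsilon> - \<beta> * (?a * ?a + ?a * ?c)\<bar> \<le> 1 / \<epsilon> + 2 * \<beta>" by linarith
        then show "\<bar>?q x y * ((1 - ?a\<^sup>2) / \<epsilon> - \<beta> * (?a * ?a + ?a * ?c))\<bar> \<le> 2 * (1 / \<epsilon> + 2 * \<beta>)"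
          unfolding abs_mult[of "?q x y"] using abs_one_minus_overlap[OF xy] by (intro mult_mono) auto
      qed
      moreover have "\<bar>(2 - p) * avg1 (?l z) (\<lambda>x. \<beta> * Tn (?l z) i x) * avg (?l z) (\<lambda>x y. ?q x y * Tn (?l z) i x)\<bar> \<le> 2 * \<beta> * 2"
        using third[of "?l z"] mult_left_mono[OF avgq2(2)[of "?l z"], of "2 * \<beta>"] \<beta>_pos by linarith
      ultimately show ?thesis unfolding N' by linarith
    qed
  qed
  also have "\<dots> \<le> 1 * (\<integral>z. \<Phi> (?l z) * ((2 / \<epsilon> + 3 * \<beta>) * R z) \<partial>\<gamma>)"
  proof (rule mult_right_mono)
    show "sc 0 t (i, n) \<le> 1" using t i by (simp add: sc_def)
    show "0 \<le> (\<integral>z. \<Phi> (?l z) * ((2 / \<epsilon> + 3 * \<beta>) * R z) \<partial>\<gamma>)"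
    proof (intro integral_nonneg_AE AE_I2 mult_nonneg_nonneg less_imp_le[OF \<Phi>_pos])
      show "0 \<le> R z" for z unfolding R_def Tn_def using overlap_bounds(1) tanh_prod_le
        by (intro avg_nonneg mult_nonneg_nonneg) auto
    qed (use \<epsilon> \<beta>_pos in auto)
  qed
  also have "\<dots> = (2 / \<epsilon> + 3 * \<beta>) * (\<integral>z. \<Phi> (?l z) * R z \<partial>\<gamma>)"
    by (simp add: mult.left_commute)
  finally show ?thesis unfolding R_def .
qed

end

context gordon
begin

text \<open>Since \<open>(1 - tanh^2) / e\<close> is the derivative of \<open>tanh (u / e)\<close>,
  integration by parts turns its average into the correlation of a bounded function with the noise.
  So a local field lies within \<open>e\<close> of 0 only with weight of order \<open>e\<close>,
  although the Gibbs measure has its own width \<epsilon>. The constant \<open>4 * \<beta>\<close>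
  bounds the derivative of the weights and that of the normalizations by \<open>2 * \<beta>\<close>
  each.\<close>

lemma ibp_noise_scale:
  assumes t: "0 \<le> t" "t < 1" and i: "i < m" and e: "0 < e"
  shows "(\<integral>z. \<Phi> (lin (sc 0 t) z) * avg1 (lin (sc 0 t) z) (\<lambda>x. 1 - (tanh (lin (sc 0 t) z i x / e))\<^sup>2) \<partial>\<gamma>)
    \<le> e * ((\<integral>z. \<bar>z (i, n)\<bar> * \<Phi> (lin (sc 0 t) z) \<partial>\<gamma>) / sqrt (1 - t) + 4 * \<beta> * F 0 t)"
proof -
  let ?l = "lin (sc 0 t)"
  let ?T = "\<lambda>z x. tanh (?l z i x / e)"
  define N where "N z = avg (?l z) (\<lambda>x y. 1 * ((1 - (?T z x)\<^sup>2) / e * x n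
          - ?T z x * (psi' i (?l z i x) * x n + psi' i (?l z i y) * y n)))
       + (2 - p) * avg1 (?l z) (\<lambda>x. psi' i (?l z i x) * x n) * avg (?l z) (\<lambda>x y. 1 * ?T z x)" for z
  define D where "D z = avg1 (?l z) (\<lambda>x. 1 - (?T z x)\<^sup>2)" for z
  have i': "i \<in> {..<Suc m}" using i by simp
  have in': "(i, n) \<in> {..<Suc m} \<times> {..<Suc n}" using i by simp
  note [measurable] = lin_measurable[OF i']
  have pm: "(\<lambda>z. psi' i (?l z i x)) \<in> borel_measurable \<gamma>" for x
    by (intro measurable_compose[OF lin_measurable[OF i'] \<psi>_measurable(2)])
  have T1: "\<bar>?T z x\<bar> \<le> 1" for z x by (rule abs_tanh_le)
  have ibp: "(\<integral>z. z (i, n) * (\<Phi> (?l z) * avg (?l z) (\<lambda>x y. 1 * ?T z x)) \<partial>\<gamma>)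
      = sc 0 t (i, n) * (\<integral>z. \<Phi> (?l z) * N z \<partial>\<gamma>)"
    unfolding N_def
  proof (rule ibp[where C = "2 + 1 / e"])
    have e': "0 < 1 / e" using e by simp
    show "\<bar>1 :: real\<bar> \<le> 2 + 1 / e" using e' by simp
    show "\<bar>tanh (u / e)\<bar> \<le> 2 + 1 / e" for u using abs_tanh_le[of "u / e"] e' by linarith
    show "\<bar>(1 - (tanh (u / e))\<^sup>2) / e\<bar> \<le> 2 + 1 / e" for u
    proof -
      have "\<bar>(1 - (tanh (u / e))\<^sup>2) / e\<bar> \<le> 1 / e"
        using tanh_sq_le[of "u / e"] e by (simp add: divide_right_mono)
      then show ?thesis by linarith
    qed
    show "continuous_on UNIV (\<lambda>u. (1 - (tanh (u / e))\<^sup>2) / e)"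
      using e by (intro continuous_intros) auto
  qed (use i e in \<open>auto intro: tanh_scaled_deriv\<close>)
  have pT: "psi' i (l i x) = \<beta> * Tn l i x" for l x using i by (simp add: psi'_def Tn_def)
  have bT: "\<bar>\<beta> * Tn l i x\<bar> \<le> \<beta>" for l x
    using \<beta>_pos Tn_le[of l i x] by (simp add: abs_mult)
  have t12: "\<bar>(2 - p) * avg1 (?l z) (\<lambda>x. psi' i (?l z i x) * x n) * avg (?l z) (\<lambda>x y. 1 * ?T z x)\<bar> \<le> 2 * \<beta> * 1" for z
  proof -
    have "\<bar>avg1 (?l z) (\<lambda>x. psi' i (?l z i x) * x n)\<bar> \<le> \<beta>"
      using bT by (intro abs_avg1_le) (auto simp: spins_last pT)
    moreover have "\<bar>avg (?l z) (\<lambda>x y. 1 * ?T z x)\<bar> \<le> 1" using T1 by (intro abs_avg_le) auto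
    ultimately show ?thesis unfolding abs_mult using p01 \<beta>_pos by (intro mult_mono) auto
  qed
  have N1: "avg (?l z) (\<lambda>x y. 1 * ((1 - (?T z x)\<^sup>2) / e * x n
          - ?T z x * (psi' i (?l z i x) * x n + psi' i (?l z i y) * y n))) =
      D z / e - avg (?l z) (\<lambda>x y. ?T z x * (\<beta> * Tn (?l z) i x + \<beta> * Tn (?l z) i y))" for z
  proof -
    have "avg (?l z) (\<lambda>x y. 1 * ((1 - (?T z x)\<^sup>2) / e * x n
          - ?T z x * (psi' i (?l z i x) * x n + psi' i (?l z i y) * y n))) =
        avg (?l z) (\<lambda>x y. (1 / e) * (1 - (?T z x)\<^sup>2) - ?T z x * (\<beta> * Tn (?l z) i x + \<beta> * Tn (?l z) i y))"
      by (rule avg_cong) (simp add: spins_last pT)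
    also have "\<dots> = (1 / e) * avg (?l z) (\<lambda>x y. 1 - (?T z x)\<^sup>2)
        - avg (?l z) (\<lambda>x y. ?T z x * (\<beta> * Tn (?l z) i x + \<beta> * Tn (?l z) i y))"
      by (simp only: avg_diff[of _ "\<lambda>x y. (1 / e) * (1 - (?T z x)\<^sup>2)"] avg_cmult)
    finally show ?thesis by (simp add: D_def avg_def)
  qed
  have TT: "\<bar>avg (?l z) (\<lambda>x y. ?T z x * (\<beta> * Tn (?l z) i x + \<beta> * Tn (?l z) i y))\<bar> \<le> 1 * (\<beta> + \<beta>)" for z
  proof (rule abs_avg_le)
    fix x y
    have "\<bar>\<beta> * Tn (?l z) i x + \<beta> * Tn (?l z) i y\<bar> \<le> \<beta> + \<beta>"
      using bT[of "?l z" x] bT[of "?l z" y] by linarith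
    then show "\<bar>?T z x * (\<beta> * Tn (?l z) i x + \<beta> * Tn (?l z) i y)\<bar> \<le> 1 * (\<beta> + \<beta>)"
      unfolding abs_mult[of "?T z x"] using T1 \<beta>_pos by (intro mult_mono) auto
  qed
  have D01: "\<bar>D z\<bar> \<le> 1" for z
    unfolding D_def using tanh_sq_le by (intro abs_avg1_le) auto
  define Y where "Y z = (2 - p) * avg1 (?l z) (\<lambda>x. psi' i (?l z i x) * x n) * avg (?l z) (\<lambda>x y. 1 * ?T z x)" for z
  define E where "E z = avg (?l z) (\<lambda>x y. ?T z x * (\<beta> * Tn (?l z) i x + \<beta> * Tn (?l z) i y))" for z
  have NDEY: "N z = D z / e - E z + Y z" for z
    unfolding N_def N1 E_def Y_def ..
  have EY: "\<bar>E z\<bar> \<le> 2 * \<beta>" "\<bar>Y z\<bar> \<le> 2 * \<beta>" for z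
    using TT[of z] t12[of z] by (simp_all add: E_def Y_def)
  have Nge: "D z / e - 4 * \<beta> \<le> N z" for z
    unfolding NDEY using EY[of z] by linarith
  have Nabs: "\<bar>N z\<bar> \<le> 1 / e + 4 * \<beta>" for z
  proof -
    have "\<bar>D z / e\<bar> \<le> 1 / e" using D01[of z] e by (simp add: abs_divide divide_right_mono)
    then show ?thesis unfolding NDEY using EY[of z] by linarith
  qed
  have Dm: "D \<in> borel_measurable \<gamma>"
    unfolding D_def by (intro avg1_measurable) measurable
  have Nm: "N \<in> borel_measurable \<gamma>" unfolding N_def
    by (intro borel_measurable_add borel_measurable_times avg_measurable avg1_measurable borel_measurable_diff
          borel_measurable_divide borel_measurable_power borel_measurable_const pm
          measurable_compose[OF _ tanh_measurable] lin_measurable i')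
  have s: "sc 0 t (i, n) = sqrt (1 - t)" "0 < sqrt (1 - t)" using i t by (auto simp: sc_def)
  have s1: "(\<integral>z. \<Phi> (?l z) * D z \<partial>\<gamma>) = e * (\<integral>z. \<Phi> (?l z) * (D z / e - 4 * \<beta>) \<partial>\<gamma>) + e * 4 * \<beta> * F 0 t"
  proof -
    have "integrable \<gamma> (\<lambda>z. \<Phi> (?l z) * (D z / e))"
    proof (rule integrable_\<Phi>_mult[where C = "1 / e"])
      show "\<bar>D z / e\<bar> \<le> 1 / e" for z using D01[of z] e by (simp add: abs_divide divide_right_mono)
    qed (use Dm in measurable)
    then have "(\<integral>z. \<Phi> (?l z) * (D z / e - 4 * \<beta>) \<partial>\<gamma>) = (\<integral>z. \<Phi> (?l z) * D z \<partial>\<gamma>) / e - 4 * \<beta> * F 0 t"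
      unfolding right_diff_distrib F_def
      by (subst Bochner_Integration.integral_diff) (auto intro: integrable_\<Phi>)
    then show ?thesis using e by (simp add: field_simps)
  qed
  have s2: "(\<integral>z. \<Phi> (?l z) * (D z / e - 4 * \<beta>) \<partial>\<gamma>) \<le> (\<integral>z. \<Phi> (?l z) * N z \<partial>\<gamma>)"
  proof (rule integral_\<Phi>_mono[OF _ Nm _ Nabs Nge])
    show "(\<lambda>z. D z / e - 4 * \<beta>) \<in> borel_measurable \<gamma>" using Dm by measurable
    show "\<bar>D z / e - 4 * \<beta>\<bar> \<le> 1 / e + 4 * \<beta>" for z
    proof -
      have "\<bar>D z / e\<bar> \<le> 1 / e" using D01[of z] e by (simp add: abs_divide divide_right_mono)
      then show ?thesis using \<beta>_pos by linarith
    qed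
  qed
  have s3: "(\<integral>z. \<Phi> (?l z) * N z \<partial>\<gamma>) = (\<integral>z. z (i, n) * (\<Phi> (?l z) * avg (?l z) (\<lambda>x y. 1 * ?T z x)) \<partial>\<gamma>) / sqrt (1 - t)"
    unfolding ibp s(1) using s(2) by simp
  have s4: "(\<integral>z. z (i, n) * (\<Phi> (?l z) * avg (?l z) (\<lambda>x y. 1 * ?T z x)) \<partial>\<gamma>)
      \<le> (\<integral>z. \<bar>z (i, n)\<bar> * \<Phi> (?l z) \<partial>\<gamma>)"
  proof (rule integral_mono)
    have b1: "\<bar>avg (?l z) (\<lambda>x y. 1 * ?T z x)\<bar> \<le> 1" for z using T1 by (intro abs_avg_le) auto
    show "integrable \<gamma> (\<lambda>z. z (i, n) * (\<Phi> (?l z) * avg (?l z) (\<lambda>x y. 1 * ?T z x)))"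
      by (rule integrable_comp_\<Phi>_mult[OF in' _ b1]) (intro avg_measurable; measurable)
    show "integrable \<gamma> (\<lambda>z. \<bar>z (i, n)\<bar> * \<Phi> (?l z))"
      using integrable_abs[OF integrable_comp_\<Phi>_mult[OF in', of "\<lambda>_. 1" 1 "sc 0 t"]]
      by (simp add: abs_mult less_imp_le[OF \<Phi>_pos])
    fix z
    have "z (i, n) * (\<Phi> (?l z) * avg (?l z) (\<lambda>x y. 1 * ?T z x)) \<le> \<bar>z (i, n) * (\<Phi> (?l z) * avg (?l z) (\<lambda>x y. 1 * ?T z x))\<bar>"
      by (rule abs_ge_self)
    also have "\<dots> = \<bar>z (i, n)\<bar> * \<Phi> (?l z) * \<bar>avg (?l z) (\<lambda>x y. 1 * ?T z x)\<bar>"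
      by (simp add: abs_mult less_imp_le[OF \<Phi>_pos])
    also have "\<dots> \<le> \<bar>z (i, n)\<bar> * \<Phi> (?l z)"
      using b1[of z] \<Phi>_pos[of "?l z"] by (intro mult_left_le) auto
    finally show "z (i, n) * (\<Phi> (?l z) * avg (?l z) (\<lambda>x y. 1 * ?T z x)) \<le> \<bar>z (i, n)\<bar> * \<Phi> (?l z)" .
  qed
  have "(\<integral>z. \<Phi> (?l z) * (D z / e - 4 * \<beta>) \<partial>\<gamma>) \<le> (\<integral>z. \<bar>z (i, n)\<bar> * \<Phi> (?l z) \<partial>\<gamma>) / sqrt (1 - t)"
    using s2 s3 divide_right_mono[OF s4, of "sqrt (1 - t)"] s(2) by linarith
  from mult_left_mono[OF this, of e] show ?thesis
    using s1 e unfolding D_def by (simp add: distrib_left mult.assoc)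
qed

text \<open>Up to the factor \<open>b * sqrt n\<close>, coordinate \<open>j\<close> contributes
  \<open>- 1 / n\<close> from the state itself and \<open>(1 - p) * x j * y j\<close> from replica
  pairs, in total \<open>- 1 + (1 - p) * overlap\<close>. The mean of the field energy thus reveals
  the average of \<open>1 - overlap\<close>.\<close>

lemma ibp_field:
  assumes t: "0 \<le> t" "t \<le> 1"
  shows "(\<integral>z. \<Phi> (lin (sc 0 t) z) * avg1 (lin (sc 0 t) z) (\<lambda>x. \<Sum>j<n. z (m, j) * x j) \<partial>\<gamma>) =
    - (sqrt (1 - t) * (b * sqrt n)) * (\<integral>z. \<Phi> (lin (sc 0 t) z) *
        (p + (1 - p) * avg (lin (sc 0 t) z) (\<lambda>x y. 1 - overlap n x y)) \<partial>\<gamma>)"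
    and integrable_field: "integrable \<gamma> (\<lambda>z. \<Phi> (lin (sc 0 t) z) * avg1 (lin (sc 0 t) z) (\<lambda>x. \<Sum>j<n. z (m, j) * x j))"
proof -
  let ?l = "lin (sc 0 t)"
  let ?K = "b * sqrt n"
  define P where "P j z = avg (?l z) (\<lambda>x y. x j * y j)" for j z
  have pm: "psi' m u = ?K" for u by (simp add: psi'_def)
  have Pb: "\<bar>P j z\<bar> \<le> 1" if "j < n" for j z
    unfolding P_def
  proof (rule abs_avg_le)
    fix x y assume "x \<in> spins n" "y \<in> spins n"
    then show "\<bar>x j * y j\<bar> \<le> 1"
      using spins_abs_le[of x n j] spins_abs_le[of y n j] that
      by (auto simp: abs_mult intro!: mult_le_one)
  qed
  have Pm: "P j \<in> borel_measurable \<gamma>" for j unfolding P_def by (intro avg_measurable) simp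
  have xb: "\<bar>avg (?l z) (\<lambda>x y. x j * 1)\<bar> \<le> 1" if "j < n" for j z
    using spins_abs_le[of _ n j] that by (intro abs_avg_le) auto
  have int: "integrable \<gamma> (\<lambda>z. z (m, j) * (\<Phi> (?l z) * avg (?l z) (\<lambda>x y. x j * 1)))" if "j < n" for j
    by (rule integrable_comp_\<Phi>_mult[OF _ _ xb[OF that]]) (use that in \<open>auto intro!: avg_measurable\<close>)
  have intP: "integrable \<gamma> (\<lambda>z. \<Phi> (?l z) * (?K * (- (1 / n) + (1 - p) * P j z)))" if "j < n" for j
  proof (rule integrable_\<Phi>_mult[where C = "?K * (1 / n + 1 * 1)"])
    show "(\<lambda>z. ?K * (- (1 / n) + (1 - p) * P j z)) \<in> borel_measurable \<gamma>" using Pm by measurable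
    fix z
    have "\<bar>(1 - p) * P j z\<bar> \<le> 1 * 1" unfolding abs_mult using p01 Pb[OF that] by (intro mult_mono) auto
    moreover have "0 \<le> 1 / real n" by simp
    ultimately have "\<bar>- (1 / n) + (1 - p) * P j z\<bar> \<le> 1 / n + 1 * 1" by linarith
    then show "\<bar>?K * (- (1 / n) + (1 - p) * P j z)\<bar> \<le> ?K * (1 / n + 1 * 1)"
      unfolding abs_mult[of ?K] using b_pos by (simp add: mult_left_mono)
  qed
  have one: "(\<integral>z. z (m, j) * (\<Phi> (?l z) * avg (?l z) (\<lambda>x y. x j * 1)) \<partial>\<gamma>) =
      sqrt (1 - t) * (\<integral>z. \<Phi> (?l z) * (?K * (- (1 / n) + (1 - p) * P j z)) \<partial>\<gamma>)" if j: "j < n" for j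
  proof -
    have "(\<integral>z. z (m, j) * (\<Phi> (?l z) * avg (?l z) (\<lambda>x y. x j * 1)) \<partial>\<gamma>) =
      sc 0 t (m, j) * (\<integral>z. \<Phi> (?l z) *
      (avg (?l z) (\<lambda>x y. x j * (0 * x j - 1 * (psi' m (?l z m x) * x j + psi' m (?l z m y) * y j)))
       + (2 - p) * avg1 (?l z) (\<lambda>x. psi' m (?l z m x) * x j) * avg (?l z) (\<lambda>x y. x j * 1)) \<partial>\<gamma>)"
      by (rule ibp[where C = 1 and A = "\<lambda>_. 1" and A' = "\<lambda>_. 0"]) (use j spins_abs_le[of _ n j] in auto)
    also have "sc 0 t (m, j) = sqrt (1 - t)" using j by (simp add: sc_def)
    also have "(\<lambda>z. \<Phi> (?l z) * (avg (?l z) (\<lambda>x y. x j * (0 * x j - 1 * (psi' m (?l z m x) * x j + psi' m (?l z m y) * y j)))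
       + (2 - p) * avg1 (?l z) (\<lambda>x. psi' m (?l z m x) * x j) * avg (?l z) (\<lambda>x y. x j * 1))) =
       (\<lambda>z. \<Phi> (?l z) * (?K * (- (1 / n) + (1 - p) * P j z)))"
    proof
      fix z
      have "avg (?l z) (\<lambda>x y. x j * (0 * x j - 1 * (psi' m (?l z m x) * x j + psi' m (?l z m y) * y j))) =
          avg (?l z) (\<lambda>x y. - (?K / n) - ?K * (x j * y j))"
      proof (rule avg_cong)
        fix x y assume "x \<in> spins n" "y \<in> spins n"
        then have "x j * x j = 1 / n" using spins_sq j by blast
        then have "?K * (x j * x j) = ?K / n" by simp
        then show "x j * (0 * x j - 1 * (psi' m (?l z m x) * x j + psi' m (?l z m y) * y j)) = - (?K / n) - ?K * (x j * y j)"
          unfolding pm by (simp add: algebra_simps)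
      qed
      also have "\<dots> = - (?K / n) - ?K * P j z" unfolding P_def by (simp only: avg_diff avg_const avg_cmult)
      finally have 1: "avg (?l z) (\<lambda>x y. x j * (0 * x j - 1 * (psi' m (?l z m x) * x j + psi' m (?l z m y) * y j))) = - (?K / n) - ?K * P j z" .
      have 2: "avg1 (?l z) (\<lambda>x. psi' m (?l z m x) * x j) * avg (?l z) (\<lambda>x y. x j * 1) = ?K * P j z"
        unfolding pm P_def avg_prod by (simp add: avg1_cmult)
      show "\<Phi> (?l z) * (avg (?l z) (\<lambda>x y. x j * (0 * x j - 1 * (psi' m (?l z m x) * x j + psi' m (?l z m y) * y j)))
       + (2 - p) * avg1 (?l z) (\<lambda>x. psi' m (?l z m x) * x j) * avg (?l z) (\<lambda>x y. x j * 1)) =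
         \<Phi> (?l z) * (?K * (- (1 / n) + (1 - p) * P j z))"
        unfolding 1 mult.assoc 2 by (simp add: algebra_simps)
    qed
    finally show ?thesis .
  qed
  have eq: "\<Phi> (?l z) * avg1 (?l z) (\<lambda>x. \<Sum>j<n. z (m, j) * x j) =
      (\<Sum>j<n. z (m, j) * (\<Phi> (?l z) * avg (?l z) (\<lambda>x y. x j * 1)))" for z
    unfolding avg_def avg1_sum avg1_cmult sum_distrib_left by (simp add: avg1_multc mult_ac)
  show "integrable \<gamma> (\<lambda>z. \<Phi> (?l z) * avg1 (?l z) (\<lambda>x. \<Sum>j<n. z (m, j) * x j))"
    unfolding eq using int by (intro Bochner_Integration.integrable_sum) auto
  have "(\<integral>z. \<Phi> (?l z) * avg1 (?l z) (\<lambda>x. \<Sum>j<n. z (m, j) * x j) \<partial>\<gamma>) =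
      (\<Sum>j<n. sqrt (1 - t) * (\<integral>z. \<Phi> (?l z) * (?K * (- (1 / n) + (1 - p) * P j z)) \<partial>\<gamma>))"
    unfolding eq using int one by (subst Bochner_Integration.integral_sum) auto
  also have "\<dots> = sqrt (1 - t) * (\<integral>z. (\<Sum>j<n. \<Phi> (?l z) * (?K * (- (1 / n) + (1 - p) * P j z))) \<partial>\<gamma>)"
    using intP by (subst Bochner_Integration.integral_sum) (auto simp: sum_distrib_left)
  also have "(\<lambda>z. \<Sum>j<n. \<Phi> (?l z) * (?K * (- (1 / n) + (1 - p) * P j z))) =
      (\<lambda>z. - ?K * (\<Phi> (?l z) * (p + (1 - p) * avg (?l z) (\<lambda>x y. 1 - overlap n x y))))"
  proof
    fix z
    have "(\<Sum>j<n. P j z) = avg (?l z) (overlap n)"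
      unfolding P_def overlap_def[abs_def] avg_sum[symmetric] ..
    also have "\<dots> = 1 - avg (?l z) (\<lambda>x y. 1 - overlap n x y)" by (simp add: avg_diff)
    finally have "(\<Sum>j<n. - (1 / n) + (1 - p) * P j z) = - 1 + (1 - p) * (1 - avg (?l z) (\<lambda>x y. 1 - overlap n x y))"
      unfolding sum.distrib sum_distrib_left[symmetric] using n by simp
    then have s: "(\<Sum>j<n. - (1 / n) + (1 - p) * P j z) = - (p + (1 - p) * avg (?l z) (\<lambda>x y. 1 - overlap n x y))"
      by (simp add: algebra_simps)
    show "(\<Sum>j<n. \<Phi> (?l z) * (?K * (- (1 / n) + (1 - p) * P j z))) =
        - ?K * (\<Phi> (?l z) * (p + (1 - p) * avg (?l z) (\<lambda>x y. 1 - overlap n x y)))"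
      unfolding sum_distrib_left[symmetric] s by (simp only: mult_minus_left mult_minus_right mult.left_commute)
  qed
  finally show "(\<integral>z. \<Phi> (?l z) * avg1 (?l z) (\<lambda>x. \<Sum>j<n. z (m, j) * x j) \<partial>\<gamma>) =
    - (sqrt (1 - t) * ?K) * (\<integral>z. \<Phi> (?l z) * (p + (1 - p) * avg (?l z) (\<lambda>x y. 1 - overlap n x y)) \<partial>\<gamma>)"
    by simp
qed

text \<open>The moduli of the row sums are removed by summing over all \<open>2 ^ m\<close> sign
  vectors; each summand is a product over independent coordinates. A signed row consists of
  \<open>n\<close> entries of variance \<open>1 / n\<close> and gives \<open>exp (1 / 2)\<close>;
  the last row gives \<open>exp (c^2 * n / 2)\<close> for every \<open>t\<close>, because its
  variance does not move.\<close>

lemma integral_exp_field_le: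
  assumes t: "0 \<le> t" "t \<le> 1" and x: "x \<in> spins n"
  shows "integrable \<gamma> (\<lambda>z. exp (- (c * sqrt n) * lin (sc 0 t) z m x + (\<Sum>i<m. a * \<bar>z (i, n)\<bar> + \<bar>\<Sum>j<n. z (i, j) * x j\<bar>)))"
      (is "integrable _ ?E")
    and "(\<integral>z. exp (- (c * sqrt n) * lin (sc 0 t) z m x + (\<Sum>i<m. a * \<bar>z (i, n)\<bar> + \<bar>\<Sum>j<n. z (i, j) * x j\<bar>)) \<partial>\<gamma>)
      \<le> exp (c\<^sup>2 * n / 2) * (2 * exp (1 / 2) * (\<integral>y. exp (a * \<bar>y\<bar>) \<partial>std_gauss)) ^ m"
proof -
  define Sg where "Sg = {..<m} \<rightarrow>\<^sub>E {- 1, 1 :: real}"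
  have finS: "finite Sg" unfolding Sg_def by (intro finite_PiE) auto
  have cardS: "card Sg = 2 ^ m" unfolding Sg_def by (simp add: card_PiE numeral_2_eq_2)
  define f where "f \<tau> k = (if fst k < m then if snd k < n then (\<lambda>y. exp ((\<tau> (fst k) * x (snd k)) * y)) else (\<lambda>y. exp (a * \<bar>y\<bar>))
      else if snd k < n then (\<lambda>y. exp ((- (c * sqrt n) * sqrt (1 - t) * x (snd k)) * y)) else (\<lambda>y. exp ((- (c * sqrt n) * sqrt t) * y)))"
    for \<tau> :: "nat \<Rightarrow> real" and k :: "nat \<times> nat"
  let ?I = "{..<Suc m} \<times> {..<Suc n}"
  have fi: "integrable std_gauss (f \<tau> k)" for \<tau> k
    by (simp only: f_def integrable_std_gauss_exp integrable_std_gauss_exp_abs split: if_split) simp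
  have intp: "integrable \<gamma> (\<lambda>z. \<Prod>k\<in>?I. f \<tau> k (z k))" for \<tau>
    by (intro integrable_gauss_prod fi) auto
  have prod: "(\<Prod>k\<in>?I. f \<tau> k (z k)) = exp (- (c * sqrt n) * lin (sc 0 t) z m x +
      (\<Sum>i<m. a * \<bar>z (i, n)\<bar> + \<tau> i * (\<Sum>j<n. z (i, j) * x j)))" for \<tau> z
  proof -
    have e: "- (c * sqrt n) * lin (sc 0 t) z m x + (\<Sum>i<m. a * \<bar>z (i, n)\<bar> + \<tau> i * (\<Sum>j<n. z (i, j) * x j)) =
        (\<Sum>i<m. (\<Sum>j<n. (\<tau> i * x j) * z (i, j)) + a * \<bar>z (i, n)\<bar>) +
        ((\<Sum>j<n. (- (c * sqrt n) * sqrt (1 - t) * x j) * z (m, j)) + (- (c * sqrt n) * sqrt t) * z (m, n))"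
      using spins_last[OF x]
      by (simp add: lin_def sc_def sum_distrib_left sum.distrib sum_negf distrib_left mult_ac)
    show ?thesis
      unfolding prod_grid e exp_add exp_sum[OF finite_lessThan]
      by (intro arg_cong2[where f = "(*)"] prod.cong refl) (auto simp: f_def)
  qed
  have le: "?E z \<le> (\<Sum>\<tau>\<in>Sg. \<Prod>k\<in>?I. f \<tau> k (z k))" for z
  proof -
    \<comment> \<open>The vector of signs of the row sums turns the modulus in every row into an
      equality.\<close>
    define \<tau> where "\<tau> = (\<lambda>i\<in>{..<m}. if 0 \<le> (\<Sum>j<n. z (i, j) * x j) then 1 else - 1 :: real)"
    have "\<tau> \<in> Sg" unfolding \<tau>_def Sg_def by auto
    have "?E z = (\<Prod>k\<in>?I. f \<tau> k (z k))"
      unfolding prod by (intro arg_cong[where f = exp] arg_cong2[where f = "(+)"] refl sum.cong) (auto simp: \<tau>_def)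
    also have "\<dots> \<le> (\<Sum>\<tau>\<in>Sg. \<Prod>k\<in>?I. f \<tau> k (z k))"
      by (rule member_le_sum[OF \<open>\<tau> \<in> Sg\<close>]) (auto simp: finS prod)
    finally show ?thesis .
  qed
  have ints: "integrable \<gamma> (\<lambda>z. \<Sum>\<tau>\<in>Sg. \<Prod>k\<in>?I. f \<tau> k (z k))"
    by (intro Bochner_Integration.integrable_sum intp)
  have Em: "?E \<in> borel_measurable \<gamma>"
  proof -
    have comp: "(\<lambda>z. z (i, j)) \<in> borel_measurable \<gamma>" if "i < Suc m" "j < Suc n" for i j
      using measurable_component_singleton[of "(i, j)" ?I "\<lambda>_. std_gauss"] that by simp
    show ?thesis
      by (intro borel_measurable_exp[THEN measurable_compose[rotated]] borel_measurable_add borel_measurable_times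
         borel_measurable_const borel_measurable_sum borel_measurable_abs comp lin_measurable) auto
  qed
  show int: "integrable \<gamma> ?E"
  proof (rule Bochner_Integration.integrable_bound[OF ints Em], rule AE_I2)
    fix z
    show "norm (?E z) \<le> norm (\<Sum>\<tau>\<in>Sg. \<Prod>k\<in>?I. f \<tau> k (z k))"
      using le[of z] by (simp add: order_trans[OF _ abs_ge_self])
  qed
  have "integral\<^sup>L \<gamma> ?E \<le> (\<integral>z. (\<Sum>\<tau>\<in>Sg. \<Prod>k\<in>?I. f \<tau> k (z k)) \<partial>\<gamma>)"
    by (intro integral_mono int ints le)
  also have "\<dots> = (\<Sum>\<tau>\<in>Sg. \<Prod>k\<in>?I. integral\<^sup>L std_gauss (f \<tau> k))"
    using fi by (subst Bochner_Integration.integral_sum) (auto intro!: intp sum.cong integral_gauss_prod)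
  also have "\<dots> = (\<Sum>\<tau>\<in>Sg. exp (c\<^sup>2 * n / 2) * (exp (1 / 2) * (\<integral>y. exp (a * \<bar>y\<bar>) \<partial>std_gauss)) ^ m)"
  proof (rule sum.cong[OF refl])
    fix \<tau> assume \<tau>: "\<tau> \<in> Sg"
    have h: "integral\<^sup>L std_gauss (f \<tau> (i, j)) = exp (1 / (2 * n))" if "i < m" "j < n" for i j
    proof -
      have "\<tau> i = - 1 \<or> \<tau> i = 1" using \<tau> that unfolding Sg_def by (auto simp: PiE_iff)
      then have "(\<tau> i * x j)\<^sup>2 = 1 / n" using spins_sq[OF x that(2)] by (auto simp: power2_eq_square)
      then show ?thesis using that by (simp add: f_def integral_std_gauss_exp)
    qed
    have hm: "integral\<^sup>L std_gauss (f \<tau> (m, j)) = exp (c\<^sup>2 * (1 - t) / 2)" if "j < n" for j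
    proof -
      have "(- (c * sqrt n) * sqrt (1 - t) * x j)\<^sup>2 = c\<^sup>2 * n * (1 - t) * (x j * x j)"
        using t by (simp add: power_mult_distrib power2_eq_square[of "x j"])
      also have "\<dots> = c\<^sup>2 * (1 - t)" using spins_sq[OF x that] n by simp
      finally have e: "(- (c * sqrt n) * sqrt (1 - t) * x j)\<^sup>2 = c\<^sup>2 * (1 - t)" .
      have "integral\<^sup>L std_gauss (f \<tau> (m, j)) = exp ((- (c * sqrt n) * sqrt (1 - t) * x j)\<^sup>2 / 2)"
        unfolding f_def using that by (simp only: fst_conv snd_conv if_True if_False less_irrefl integral_std_gauss_exp)
      then show ?thesis unfolding e .
    qed
    have hn: "integral\<^sup>L std_gauss (f \<tau> (m, n)) = exp (c\<^sup>2 * n * t / 2)"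
    proof -
      have e: "(- (c * sqrt n) * sqrt t)\<^sup>2 = c\<^sup>2 * n * t" using t by (simp add: power_mult_distrib)
      have "integral\<^sup>L std_gauss (f \<tau> (m, n)) = exp ((- (c * sqrt n) * sqrt t)\<^sup>2 / 2)"
        unfolding f_def by (simp only: fst_conv snd_conv if_True if_False less_irrefl integral_std_gauss_exp)
      then show ?thesis unfolding e .
    qed
    have hg: "integral\<^sup>L std_gauss (f \<tau> (i, n)) = (\<integral>y. exp (a * \<bar>y\<bar>) \<partial>std_gauss)" if "i < m" for i
      using that by (simp add: f_def)
    have "exp (1 / (2 * real n)) ^ n = exp (1 / 2)" using n by (simp add: exp_of_nat_mult[symmetric])
    moreover have "exp (c\<^sup>2 * (1 - t) / 2) ^ n * exp (c\<^sup>2 * n * t / 2) = exp (c\<^sup>2 * n / 2)"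
      by (simp add: exp_of_nat_mult[symmetric] exp_add[symmetric] field_simps)
    ultimately show "(\<Prod>k\<in>?I. integral\<^sup>L std_gauss (f \<tau> k)) =
        exp (c\<^sup>2 * n / 2) * (exp (1 / 2) * (\<integral>y. exp (a * \<bar>y\<bar>) \<partial>std_gauss)) ^ m"
      unfolding prod_grid by (simp add: h hm hn hg)
  qed
  also have "\<dots> = exp (c\<^sup>2 * n / 2) * (2 * exp (1 / 2) * (\<integral>y. exp (a * \<bar>y\<bar>) \<partial>std_gauss)) ^ m"
    by (simp add: cardS power_mult_distrib)
  finally show "integral\<^sup>L \<gamma> ?E \<le> exp (c\<^sup>2 * n / 2) * (2 * exp (1 / 2) * (\<integral>y. exp (a * \<bar>y\<bar>) \<partial>std_gauss)) ^ m" .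
qed

end

section \<open>Jensen bounds, the slack from below, and the response to a weaker field\<close>

lemma exp_tangent: "exp a * (1 + y - a) \<le> exp (y :: real)"
proof -
  have "exp a * (1 + (y - a)) \<le> exp a * exp (y - a)" by (intro mult_left_mono) auto
  then show ?thesis by (simp add: exp_add[symmetric] algebra_simps)
qed

text \<open>Jensen's inequality for the measure with density \<open>\<phi>\<close>: the tangent of
  \<open>exp\<close> at the mean of \<open>Y\<close> under this measure is integrated, so
  integrability is asked only of the majorant \<open>G\<close>.\<close>

lemma integral_ge_exp:
  fixes \<phi> G Y :: "'a \<Rightarrow> real"
  assumes int: "integrable M \<phi>" "integrable M (\<lambda>z. \<phi> z * Y z)" "integrable M G"
    and ge: "\<And>z. \<phi> z * exp (Y z) \<le> G z" and \<phi>: "\<And>z. 0 \<le> \<phi> z" and pos: "0 < integral\<^sup>L M \<phi>"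
  shows "integral\<^sup>L M \<phi> * exp ((\<integral>z. \<phi> z * Y z \<partial>M) / integral\<^sup>L M \<phi>) \<le> integral\<^sup>L M G"
proof -
  let ?F = "integral\<^sup>L M \<phi>" and ?a = "(\<integral>z. \<phi> z * Y z \<partial>M) / integral\<^sup>L M \<phi>"
  have "(\<integral>z. exp ?a * (1 - ?a) * \<phi> z + exp ?a * (\<phi> z * Y z) \<partial>M) \<le> integral\<^sup>L M G"
  proof (rule integral_mono)
    show "integrable M (\<lambda>z. exp ?a * (1 - ?a) * \<phi> z + exp ?a * (\<phi> z * Y z))" using int by simp
    show "exp ?a * (1 - ?a) * \<phi> z + exp ?a * (\<phi> z * Y z) \<le> G z" for z
      using order_trans[OF mult_left_mono[OF exp_tangent[of ?a "Y z"] \<phi>[of z]] ge[of z]]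
      by (simp add: algebra_simps)
  qed fact
  also have "(\<integral>z. exp ?a * (1 - ?a) * \<phi> z + exp ?a * (\<phi> z * Y z) \<partial>M) =
      exp ?a * (1 - ?a) * ?F + exp ?a * (\<integral>z. \<phi> z * Y z \<partial>M)"
    using int by simp
  also have "\<dots> = ?F * exp ?a" using pos by (simp add: field_simps)
  finally show ?thesis .
qed

context gibbs
begin

lemma avg1_exp_ge: "exp (avg1 l f) \<le> avg1 l (\<lambda>x. exp (f x))"
proof -
  have "avg1 l (\<lambda>x. exp (avg1 l f) * (1 + f x - avg1 l f)) \<le> avg1 l (\<lambda>x. exp (f x))"
    by (intro avg1_mono exp_tangent)
  moreover have "avg1 l (\<lambda>x. exp (avg1 l f) * (1 + f x - avg1 l f)) = exp (avg1 l f)"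
    by (simp add: avg1_cmult avg1_diff avg1_add)
  ultimately show ?thesis by simp
qed

text \<open>Lowering the energy by \<open>D\<close> multiplies the partition function at least by
  the exponential of the Gibbs mean of \<open>D\<close>. Only an upper bound for the new energy
  enters, so the same bound covers a change of the smoothing width and a weakening of the
  field.\<close>

lemma \<Phi>_Jensen:
  assumes "\<And>x. x \<in> X \<Longrightarrow> en x \<le> energy l x - D x"
  shows "\<Phi> l * exp (p * avg1 l D) \<le> (\<Sum>x\<in>X. exp (- en x)) powr p"
proof -
  have "W l * exp (avg1 l D) \<le> W l * avg1 l (\<lambda>x. exp (D x))"
    using W_pos[of l] by (intro mult_left_mono avg1_exp_ge) auto
  also have "\<dots> = (\<Sum>x\<in>X. exp (- (energy l x - D x)))"
    unfolding avg1_def pr_def sum_distrib_left using W_pos[of l]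
    by (intro sum.cong refl) (simp add: exp_add[symmetric])
  also have "\<dots> \<le> (\<Sum>x\<in>X. exp (- en x))"
    by (intro sum_mono) (use assms in force)
  finally have "(W l * exp (avg1 l D)) powr p \<le> (\<Sum>x\<in>X. exp (- en x)) powr p"
    using p W_pos[of l] by (intro powr_mono2) auto
  then show ?thesis unfolding \<Phi>_def using W_pos[of l]
    by (simp add: powr_mult exp_powr_real mult.commute)
qed

end

context gordon
begin

lemma energy_ge:
  "c * sqrt n * l m x \<le> p * energy l x"
proof -
  have "p * energy l x = (\<Sum>i<m. p * (\<beta> * softabs \<epsilon> (l i x))) + (p * b) * sqrt n * l m x"
    by (simp add: energy_def psi_def distrib_left sum_distrib_left mult.assoc)
  moreover have "0 \<le> (\<Sum>i<m. p * (\<beta> * softabs \<epsilon> (l i x)))"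
    using p01 \<beta>_pos softabs_nonneg[OF \<epsilon>] by (intro sum_nonneg) auto
  ultimately show ?thesis by (simp add: pb)
qed

lemma \<Phi>_pr_le_exp: "x \<in> spins n \<Longrightarrow> \<Phi> l * pr l x \<le> exp (- (c * sqrt n) * l m x)"
  using order_trans[OF \<Phi>_pr_le[of x l]] energy_ge[of l x] by simp

lemma lin_row:
  assumes "i < m" "x \<in> spins n"
  shows "lin (sc v t) z i x = sqrt t * (\<Sum>j<n. z (i, j) * x j) + sqrt (1 - t) * z (i, n)"
  using assms spins_last[OF assms(2)] by (simp add: lin_def sc_def sum_distrib_left mult.assoc)

text \<open>The smoothed sign \<open>T\<close> follows the field
  \<open>u = sqrt t * \<zeta> + s * g\<close>, as
  \<open>u * T \<ge> \<bar>u\<bar> - \<epsilon>\<close>. The part with \<zeta> is lost twice, in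
  \<open>u * T\<close> and in \<open>\<bar>u\<bar>\<close>; dividing by \<open>s \<ge> 1 / 2\<close>
  produces the constants 4 and 2.\<close>

lemma tanh_noise_ge:
  assumes t: "0 \<le> t" "t \<le> 1 / 2" and i: "i < m" and x: "x \<in> spins n"
  shows "\<bar>z (i, n)\<bar> - 4 * sqrt t * \<bar>\<Sum>j<n. z (i, j) * x j\<bar> - 2 * \<epsilon> \<le> Tn (lin (sc 0 t) z) i x * z (i, n)"
proof -
  define \<zeta> where "\<zeta> = (\<Sum>j<n. z (i, j) * x j)"
  define g where "g = z (i, n)"
  define u where "u = lin (sc 0 t) z i x"
  define T where "T = Tn (lin (sc 0 t) z) i x"
  define s where "s = sqrt (1 - t)"
  have u: "u = sqrt t * \<zeta> + s * g" unfolding u_def \<zeta>_def g_def s_def by (rule lin_row[OF i x])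
  have s: "1 / 2 \<le> s" using t real_le_rsqrt[of "1/2" "1 - t"] by (simp add: s_def power2_eq_square)
  have T1: "\<bar>T\<bar> \<le> 1" unfolding T_def by (rule Tn_le)
  have "\<bar>u\<bar> - \<epsilon> \<le> u * T" unfolding T_def Tn_def u_def[symmetric] by (rule mult_tanh_ge[OF \<epsilon>])
  moreover have "u * T = sqrt t * (\<zeta> * T) + s * (T * g)" unfolding u by (simp add: algebra_simps)
  moreover have "sqrt t * (\<zeta> * T) \<le> sqrt t * \<bar>\<zeta>\<bar>"
  proof -
    have "\<zeta> * T \<le> \<bar>\<zeta>\<bar> * \<bar>T\<bar>" by (metis abs_ge_self abs_mult)
    also have "\<dots> \<le> \<bar>\<zeta>\<bar>" using T1 by (intro mult_left_le) auto
    finally show ?thesis using t by (intro mult_left_mono) auto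
  qed
  moreover have "s * \<bar>g\<bar> - sqrt t * \<bar>\<zeta>\<bar> \<le> \<bar>u\<bar>"
  proof -
    have "\<bar>s * g\<bar> \<le> \<bar>u\<bar> + \<bar>sqrt t * \<zeta>\<bar>" unfolding u by linarith
    then show ?thesis using s t by (simp add: abs_mult)
  qed
  ultimately have a: "s * \<bar>g\<bar> - 2 * (sqrt t * \<bar>\<zeta>\<bar>) - \<epsilon> \<le> s * (T * g)" by linarith
  have "s * (\<bar>g\<bar> - 4 * sqrt t * \<bar>\<zeta>\<bar> - 2 * \<epsilon>) \<le> s * (T * g)"
  proof -
    have "(1 / 2) * (4 * sqrt t * \<bar>\<zeta>\<bar> + 2 * \<epsilon>) \<le> s * (4 * sqrt t * \<bar>\<zeta>\<bar> + 2 * \<epsilon>)"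
      using s t \<epsilon> by (intro mult_right_mono add_nonneg_nonneg) auto
    then show ?thesis using a by (simp add: algebra_simps)
  qed
  then have "\<bar>g\<bar> - 4 * sqrt t * \<bar>\<zeta>\<bar> - 2 * \<epsilon> \<le> T * g"
    by (rule mult_left_le_imp_le) (use s in linarith)
  then show ?thesis unfolding g_def \<zeta>_def T_def .
qed

lemma component_measurable: "i < Suc m \<Longrightarrow> j < Suc n \<Longrightarrow> (\<lambda>z. z (i, j)) \<in> borel_measurable \<gamma>"
  using measurable_component_singleton[of "(i, j)" "{..<Suc m} \<times> {..<Suc n}" "\<lambda>_. std_gauss"] by simp

text \<open>A union bound over the \<open>2 ^ n\<close> states: \<open>\<Phi>_pr_le_exp\<close>
  removes the partition function from each term and leaves the Gaussian moment of
  \<open>integral_exp_field_le\<close>.\<close>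

lemma integral_\<Phi>_avg1_exp_le:
  assumes t: "0 \<le> t" "t \<le> 1"
    and fm: "\<And>x. x \<in> spins n \<Longrightarrow> (\<lambda>z. f z x) \<in> borel_measurable \<gamma>"
    and le: "\<And>z x. x \<in> spins n \<Longrightarrow> f z x \<le> d + (\<Sum>i<m. a * \<bar>z (i, n)\<bar> + \<bar>\<Sum>j<n. z (i, j) * x j\<bar>)"
  shows "integrable \<gamma> (\<lambda>z. \<Phi> (lin (sc 0 t) z) * avg1 (lin (sc 0 t) z) (\<lambda>x. exp (f z x)))"
    and "(\<integral>z. \<Phi> (lin (sc 0 t) z) * avg1 (lin (sc 0 t) z) (\<lambda>x. exp (f z x)) \<partial>\<gamma>) \<le>
      2 ^ n * (exp d * (exp (c\<^sup>2 * n / 2) * (2 * exp (1 / 2) * (\<integral>y. exp (a * \<bar>y\<bar>) \<partial>std_gauss)) ^ m))"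
proof -
  let ?l = "lin (sc 0 t)"
  let ?E = "\<lambda>x z. exp (- (c * sqrt n) * lin (sc 0 t) z m x + (\<Sum>i<m. a * \<bar>z (i, n)\<bar> + \<bar>\<Sum>j<n. z (i, j) * x j\<bar>))"
  let ?L = "\<lambda>z. \<Phi> (?l z) * avg1 (?l z) (\<lambda>x. exp (f z x))"
  have pw: "?L z \<le> (\<Sum>x\<in>spins n. exp d * ?E x z)" for z
    unfolding avg1_def sum_distrib_left
  proof (rule sum_mono)
    fix x assume x: "x \<in> spins n"
    have "\<Phi> (?l z) * (pr (?l z) x * exp (f z x)) = (\<Phi> (?l z) * pr (?l z) x) * exp (f z x)" by simp
    also have "\<dots> \<le> exp (- (c * sqrt n) * ?l z m x) * exp (d + (\<Sum>i<m. a * \<bar>z (i, n)\<bar> + \<bar>\<Sum>j<n. z (i, j) * x j\<bar>))"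
      using \<Phi>_pr_le_exp[OF x] le[OF x] by (intro mult_mono) auto
    also have "\<dots> = exp d * ?E x z" by (simp add: exp_add[symmetric] algebra_simps)
    finally show "\<Phi> (?l z) * (pr (?l z) x * exp (f z x)) \<le> exp d * ?E x z" .
  qed
  have intS: "integrable \<gamma> (\<lambda>z. \<Sum>x\<in>spins n. exp d * ?E x z)"
    by (intro Bochner_Integration.integrable_sum integrable_mult_right integral_exp_field_le(1) t)
  show int: "integrable \<gamma> ?L"
  proof (rule Bochner_Integration.integrable_bound[OF intS])
    show "?L \<in> borel_measurable \<gamma>"
      by (intro borel_measurable_times \<Phi>_measurable avg1_measurable measurable_compose[OF fm borel_measurable_exp])
    show "AE z in \<gamma>. norm (?L z) \<le> norm (\<Sum>x\<in>spins n. exp d * ?E x z)"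
    proof (rule AE_I2)
      fix z
      have "0 \<le> ?L z" unfolding avg1_def
        by (intro mult_nonneg_nonneg sum_nonneg pr_nonneg less_imp_le[OF \<Phi>_pos]) auto
      then show "norm (?L z) \<le> norm (\<Sum>x\<in>spins n. exp d * ?E x z)"
        using pw[of z] by (simp add: order_trans[OF _ abs_ge_self])
    qed
  qed
  have "integral\<^sup>L \<gamma> ?L \<le> (\<integral>z. (\<Sum>x\<in>spins n. exp d * ?E x z) \<partial>\<gamma>)"
    by (intro integral_mono int intS pw)
  also have "\<dots> = (\<Sum>x\<in>spins n. exp d * integral\<^sup>L \<gamma> (?E x))"
  proof -
    have "(\<integral>z. (\<Sum>x\<in>spins n. exp d * ?E x z) \<partial>\<gamma>) = (\<Sum>x\<in>spins n. \<integral>z. exp d * ?E x z \<partial>\<gamma>)"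
      by (rule Bochner_Integration.integral_sum) (intro integrable_mult_right integral_exp_field_le(1) t)
    then show ?thesis by (simp only: integral_mult_right_zero)
  qed
  also have "\<dots> \<le> (\<Sum>x\<in>spins n. exp d * (exp (c\<^sup>2 * n / 2) * (2 * exp (1 / 2) * (\<integral>y. exp (a * \<bar>y\<bar>) \<partial>std_gauss)) ^ m))"
    by (intro sum_mono mult_left_mono integral_exp_field_le(2) t) auto
  also have "\<dots> = 2 ^ n * (exp d * (exp (c\<^sup>2 * n / 2) * (2 * exp (1 / 2) * (\<integral>y. exp (a * \<bar>y\<bar>) \<partial>std_gauss)) ^ m))"
    by (simp add: card_spins)
  finally show "integral\<^sup>L \<gamma> ?L \<le> 2 ^ n * (exp d * (exp (c\<^sup>2 * n / 2) * (2 * exp (1 / 2) * (\<integral>y. exp (a * \<bar>y\<bar>) \<partial>std_gauss)) ^ m))" .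
qed

definition Q :: "real \<Rightarrow> real" where
  "Q t = (\<integral>z. \<Phi> (lin (sc 0 t) z) * avg (lin (sc 0 t) z) (\<lambda>x y. 1 - overlap n x y) \<partial>\<gamma>)"

text \<open>The alignment \<open>?Y z x\<close> of smoothed signs with the noise falls below
  \<open>m / lam\<close> only with small weight: \<open>u \<le> exp u\<close> for
  \<open>u = m - lam * ?Y z x\<close> bounds the shortfall by \<open>exp u / lam\<close>, and the
  mean of this exponential is small for large \<open>lam\<close>, each row bringing a factor
  \<open>1 / lam\<close>. Multiplying by \<open>1 - overlap\<close>, which lies between 0 and 2, and
  applying \<open>ibp_noise_overlap\<close> in every row leads to the slack.\<close>

lemma slack_ge:
  assumes t: "0 \<le> t" "t \<le> 1 / 2" and lam: "0 < lam" "4 * lam * sqrt t \<le> 1" "2 * lam * \<epsilon> \<le> 1"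
  shows "m / lam * Q t - 2 / lam * (2 ^ n * exp (c\<^sup>2 * n / 2) * (2 * exp (5 / 2) / lam) ^ m)
    \<le> (2 / \<epsilon> + 3 * \<beta>) * slack 0 t"
proof -
  let ?l = "lin (sc 0 t)"
  let ?q = "\<lambda>x y. 1 - overlap n x y"
  let ?Y = "\<lambda>z x. \<Sum>i<m. Tn (?l z) i x * z (i, n)"
  have t1: "t \<le> 1" using t by simp
  have Tm: "(\<lambda>z. Tn (?l z) i x) \<in> borel_measurable \<gamma>" if "i < m" for i x using that by simp
  \<comment> \<open>In each row the hypotheses on \<open>lam\<close> turn the errors of
    \<open>tanh_noise_ge\<close> into 1 plus the modulus of the row sum; the units add up to the
    second \<open>m\<close> on the right.\<close>
  have le: "real m - lam * ?Y z x \<le> 2 * m + (\<Sum>i<m. - lam * \<bar>z (i, n)\<bar> + \<bar>\<Sum>j<n. z (i, j) * x j\<bar>)"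
    if x: "x \<in> spins n" for z x
  proof -
    have "(\<Sum>i<m. - lam * (Tn (?l z) i x * z (i, n))) \<le> (\<Sum>i<m. 1 + (- lam * \<bar>z (i, n)\<bar> + \<bar>\<Sum>j<n. z (i, j) * x j\<bar>))"
    proof (rule sum_mono)
      fix i assume "i \<in> {..<m}"
      then have i: "i < m" by simp
      let ?z = "\<bar>\<Sum>j<n. z (i, j) * x j\<bar>"
      have "lam * (\<bar>z (i, n)\<bar> - 4 * sqrt t * ?z - 2 * \<epsilon>) \<le> lam * (Tn (?l z) i x * z (i, n))"
        using lam by (intro mult_left_mono tanh_noise_ge t i x) auto
      moreover have "(4 * lam * sqrt t) * ?z \<le> 1 * ?z" by (intro mult_right_mono lam) auto
      ultimately show "- lam * (Tn (?l z) i x * z (i, n)) \<le> 1 + (- lam * \<bar>z (i, n)\<bar> + ?z)"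
        using lam(3) by (simp add: algebra_simps)
    qed
    then show ?thesis by (simp add: sum.distrib sum_distrib_left sum_negf)
  qed
  have fm: "(\<lambda>z. real m - lam * ?Y z x) \<in> borel_measurable \<gamma>" for x
    by (intro borel_measurable_diff borel_measurable_const borel_measurable_times borel_measurable_sum Tm component_measurable) auto
  note D = integral_\<Phi>_avg1_exp_le[OF t(1) t1 fm le]
  let ?D = "\<lambda>z. \<Phi> (?l z) * avg1 (?l z) (\<lambda>x. exp (real m - lam * ?Y z x))"
  have Dle: "integral\<^sup>L \<gamma> ?D \<le> 2 ^ n * exp (c\<^sup>2 * n / 2) * (2 * exp (5 / 2) / lam) ^ m"
  proof -
    have "integral\<^sup>L \<gamma> ?D \<le> 2 ^ n * (exp (2 * m) * (exp (c\<^sup>2 * n / 2) * (2 * exp (1 / 2) * (\<integral>y. exp (- lam * \<bar>y\<bar>) \<partial>std_gauss)) ^ m))"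
      by (rule D(2))
    also have "\<dots> \<le> 2 ^ n * (exp (2 * m) * (exp (c\<^sup>2 * n / 2) * (2 * exp (1 / 2) * (1 / lam)) ^ m))"
      using integral_std_gauss_exp_minus_abs_le[OF lam(1)]
      by (intro mult_left_mono power_mono mult_nonneg_nonneg integral_nonneg_AE) auto
    also have "\<dots> = 2 ^ n * exp (c\<^sup>2 * n / 2) * (2 * exp (5 / 2) / lam) ^ m"
    proof -
      have "exp (2 * real m) = exp 2 ^ m" by (simp add: exp_of_nat_mult mult.commute)
      moreover have "exp 2 * exp (1 / 2) = exp (5 / 2 :: real)" by (simp add: exp_add[symmetric])
      ultimately show ?thesis by (simp add: power_mult_distrib[symmetric] mult_ac)
    qed
    finally show ?thesis .
  qed
  have intT: "integrable \<gamma> (\<lambda>z. z (i, n) * (\<Phi> (?l z) * avg (?l z) (\<lambda>x y. ?q x y * Tn (?l z) i x)))" if i: "i < m" for i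
  proof (rule integrable_comp_\<Phi>_mult[where C = "2 * 1"])
    show "(\<lambda>z. avg (?l z) (\<lambda>x y. ?q x y * Tn (?l z) i x)) \<in> borel_measurable \<gamma>"
      by (intro avg_measurable borel_measurable_times borel_measurable_const Tm i)
    show "\<bar>avg (?l z) (\<lambda>x y. ?q x y * Tn (?l z) i x)\<bar> \<le> 2 * 1" for z
    proof (rule abs_avg_le)
      fix x y assume "x \<in> spins n" "y \<in> spins n"
      then show "\<bar>?q x y * Tn (?l z) i x\<bar> \<le> 2 * 1"
        unfolding abs_mult by (intro mult_mono abs_one_minus_overlap Tn_le) auto
    qed
  qed (use i in auto)
  have intq: "integrable \<gamma> (\<lambda>z. \<Phi> (?l z) * avg (?l z) ?q)"
    by (rule integrable_\<Phi>_mult[OF avg_measurable abs_avg_le[OF abs_one_minus_overlap]]) auto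
  have intS: "integrable \<gamma> (\<lambda>z. \<Phi> (?l z) * avg (?l z) (\<lambda>x y. ?q x y * (1 - Tn (?l z) i x * Tn (?l z) i y)))" if i: "i < m" for i
  proof (rule integrable_\<Phi>_mult[where C = "2 * 2"])
    show "(\<lambda>z. avg (?l z) (\<lambda>x y. ?q x y * (1 - Tn (?l z) i x * Tn (?l z) i y))) \<in> borel_measurable \<gamma>"
      by (intro avg_measurable borel_measurable_times borel_measurable_diff borel_measurable_const Tm i)
    show "\<bar>avg (?l z) (\<lambda>x y. ?q x y * (1 - Tn (?l z) i x * Tn (?l z) i y))\<bar> \<le> 2 * 2" for z
    proof (rule abs_avg_le)
      fix x y assume xy: "x \<in> spins n" "y \<in> spins n"
      have "\<bar>1 - Tn (?l z) i x * Tn (?l z) i y\<bar> \<le> 2" using Tn_prod_le[of "?l z" i x y] by (auto simp: abs_le_iff)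
      then show "\<bar>?q x y * (1 - Tn (?l z) i x * Tn (?l z) i y)\<bar> \<le> 2 * 2"
        unfolding abs_mult using xy by (intro mult_mono abs_one_minus_overlap) auto
    qed
  qed
  have "m / lam * Q t - 2 / lam * integral\<^sup>L \<gamma> ?D =
      (\<integral>z. m / lam * (\<Phi> (?l z) * avg (?l z) ?q) - 2 / lam * ?D z \<partial>\<gamma>)"
    unfolding Q_def using intq D(1) by (subst Bochner_Integration.integral_diff) auto
  also have "\<dots> \<le> (\<integral>z. (\<Sum>i<m. z (i, n) * (\<Phi> (?l z) * avg (?l z) (\<lambda>x y. ?q x y * Tn (?l z) i x))) \<partial>\<gamma>)"
  proof (rule integral_mono)
    show "integrable \<gamma> (\<lambda>z. m / lam * (\<Phi> (?l z) * avg (?l z) ?q) - 2 / lam * ?D z)"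
      by (intro Bochner_Integration.integrable_diff integrable_mult_right intq D(1))
    show "integrable \<gamma> (\<lambda>z. \<Sum>i<m. z (i, n) * (\<Phi> (?l z) * avg (?l z) (\<lambda>x y. ?q x y * Tn (?l z) i x)))"
      by (intro Bochner_Integration.integrable_sum intT) auto
    fix z
    have "m / lam * avg (?l z) ?q - 2 / lam * avg1 (?l z) (\<lambda>x. exp (real m - lam * ?Y z x)) =
        avg (?l z) (\<lambda>x y. m / lam * ?q x y - 2 / lam * exp (real m - lam * ?Y z x))"
      by (simp only: avg_diff[of _ "\<lambda>x y. m / lam * ?q x y"] avg_cmult) (simp add: avg_def)
    also have "\<dots> \<le> avg (?l z) (\<lambda>x y. \<Sum>i<m. z (i, n) * (?q x y * Tn (?l z) i x))"
    proof (rule avg_mono)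
      fix x y assume xy: "x \<in> spins n" "y \<in> spins n"
      let ?e = "exp (real m - lam * ?Y z x)"
      have "m - lam * ?Y z x \<le> ?e" using exp_ge_add_one_self[of "real m - lam * ?Y z x"] by linarith
      then have "(m - lam * ?Y z x) / lam \<le> ?e / lam" using lam(1) by (intro divide_right_mono) auto
      then have "m / lam - ?Y z x \<le> ?e / lam" using lam(1) by (simp only: diff_divide_distrib) simp
      then have "?q x y * (m / lam - ?Y z x) \<le> ?q x y * (?e / lam)"
        using overlap_bounds(1)[OF xy] by (rule mult_left_mono)
      also have "\<dots> \<le> 2 * (?e / lam)" using overlap_bounds(2)[OF xy] lam by (intro mult_right_mono) auto
      finally show "m / lam * ?q x y - 2 / lam * ?e \<le> (\<Sum>i<m. z (i, n) * (?q x y * Tn (?l z) i x))"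
        by (simp add: algebra_simps sum_distrib_left)
    qed
    also have "\<dots> = (\<Sum>i<m. z (i, n) * avg (?l z) (\<lambda>x y. ?q x y * Tn (?l z) i x))"
      by (simp only: avg_sum avg_cmult)
    finally have "\<Phi> (?l z) * (m / lam * avg (?l z) ?q - 2 / lam * avg1 (?l z) (\<lambda>x. exp (real m - lam * ?Y z x)))
        \<le> \<Phi> (?l z) * (\<Sum>i<m. z (i, n) * avg (?l z) (\<lambda>x y. ?q x y * Tn (?l z) i x))"
      by (rule mult_left_mono[OF _ less_imp_le[OF \<Phi>_pos]])
    then show "m / lam * (\<Phi> (?l z) * avg (?l z) ?q) - 2 / lam * ?D z
        \<le> (\<Sum>i<m. z (i, n) * (\<Phi> (?l z) * avg (?l z) (\<lambda>x y. ?q x y * Tn (?l z) i x)))"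
      by (simp add: right_diff_distrib sum_distrib_left mult.left_commute)
  qed
  also have "\<dots> = (\<Sum>i<m. \<integral>z. z (i, n) * (\<Phi> (?l z) * avg (?l z) (\<lambda>x y. ?q x y * Tn (?l z) i x)) \<partial>\<gamma>)"
    by (intro Bochner_Integration.integral_sum intT) auto
  also have "\<dots> \<le> (\<Sum>i<m. (2 / \<epsilon> + 3 * \<beta>) * (\<integral>z. \<Phi> (?l z) * avg (?l z) (\<lambda>x y. ?q x y * (1 - Tn (?l z) i x * Tn (?l z) i y)) \<partial>\<gamma>))"
    by (intro sum_mono ibp_noise_overlap t(1) t1) auto
  also have "\<dots> = (2 / \<epsilon> + 3 * \<beta>) * slack 0 t"
  proof -
    have "(\<Sum>i<m. (\<integral>z. \<Phi> (?l z) * avg (?l z) (\<lambda>x y. ?q x y * (1 - Tn (?l z) i x * Tn (?l z) i y)) \<partial>\<gamma>)) =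
        (\<integral>z. (\<Sum>i<m. \<Phi> (?l z) * avg (?l z) (\<lambda>x y. ?q x y * (1 - Tn (?l z) i x * Tn (?l z) i y))) \<partial>\<gamma>)"
      by (intro Bochner_Integration.integral_sum[symmetric] intS) auto
    also have "\<dots> = slack 0 t"
      unfolding slack_def sum_distrib_left avg_sum Tn_def ..
    finally show ?thesis by (simp only: sum_distrib_left[symmetric])
  qed
  finally have "m / lam * Q t - 2 / lam * integral\<^sup>L \<gamma> ?D \<le> (2 / \<epsilon> + 3 * \<beta>) * slack 0 t" .
  moreover have "2 / lam * integral\<^sup>L \<gamma> ?D \<le> 2 / lam * (2 ^ n * exp (c\<^sup>2 * n / 2) * (2 * exp (5 / 2) / lam) ^ m)"
    using lam by (intro mult_left_mono Dle) auto
  ultimately show ?thesis by linarith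
qed

end

context gordon
begin

text \<open>By Jensen, a bound \<open>exp a\<close> on the normalized exponential moment of the
  total noise bounds its normalized mean by \<open>a\<close>. The tilt by \<open>\<Phi>\<close>
  therefore cannot inflate the noise much unless \<open>F 0 t\<close> is extremely small.\<close>

lemma integral_noise_le:
  assumes t: "0 \<le> t" "t \<le> 1"
    and a: "2 ^ n * (exp (c\<^sup>2 * n / 2) * (2 * exp (1 / 2) * (\<integral>y. exp (1 * \<bar>y\<bar>) \<partial>std_gauss)) ^ m) \<le> exp a * F 0 t"
  shows "(\<Sum>i<m. \<integral>z. \<bar>z (i, n)\<bar> * \<Phi> (lin (sc 0 t) z) \<partial>\<gamma>) \<le> a * F 0 t"
proof -
  let ?l = "lin (sc 0 t)"
  let ?Y = "\<lambda>z. \<Sum>i<m. \<bar>z (i, n)\<bar>"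
  have Ym: "?Y \<in> borel_measurable \<gamma>"
    by (intro borel_measurable_sum borel_measurable_abs component_measurable) auto
  have le: "?Y z \<le> 0 + (\<Sum>i<m. 1 * \<bar>z (i, n)\<bar> + \<bar>\<Sum>j<n. z (i, j) * x j\<bar>)" for z :: "nat \<times> nat \<Rightarrow> real" and x
    unfolding add_0_left by (intro sum_mono) auto
  note D = integral_\<Phi>_avg1_exp_le[OF t Ym le]
  have inti: "integrable \<gamma> (\<lambda>z. \<bar>z (i, n)\<bar> * \<Phi> (?l z))" if "i < m" for i
    using integrable_abs[OF integrable_comp_\<Phi>_mult[of "(i, n)" "\<lambda>_. 1" 1 "sc 0 t"]] that
    by (simp add: abs_mult less_imp_le[OF \<Phi>_pos])
  have eq: "\<Phi> (?l z) * ?Y z = (\<Sum>i<m. \<bar>z (i, n)\<bar> * \<Phi> (?l z))" for z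
    unfolding sum_distrib_left by (simp add: mult.commute)
  have intY: "integrable \<gamma> (\<lambda>z. \<Phi> (?l z) * ?Y z)"
    unfolding eq by (intro Bochner_Integration.integrable_sum inti) auto
  have "F 0 t * exp ((\<integral>z. \<Phi> (?l z) * ?Y z \<partial>\<gamma>) / F 0 t) \<le> (\<integral>z. \<Phi> (?l z) * avg1 (?l z) (\<lambda>x. exp (?Y z)) \<partial>\<gamma>)"
    unfolding F_def
    by (rule integral_ge_exp[OF integrable_\<Phi> intY D(1)])
       (use F_pos[of 0 t] in \<open>auto simp: F_def less_imp_le[OF \<Phi>_pos]\<close>)
  also have "\<dots> \<le> exp a * F 0 t" using order_trans[OF D(2)] a by simp
  finally have "exp ((\<integral>z. \<Phi> (?l z) * ?Y z \<partial>\<gamma>) / F 0 t) \<le> exp a"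
    using F_pos[of 0 t] by (simp add: mult.commute)
  then have "(\<integral>z. \<Phi> (?l z) * ?Y z \<partial>\<gamma>) \<le> a * F 0 t"
    using F_pos[of 0 t] by (simp add: pos_divide_le_eq)
  moreover have "(\<integral>z. \<Phi> (?l z) * ?Y z \<partial>\<gamma>) = (\<Sum>i<m. \<integral>z. \<bar>z (i, n)\<bar> * \<Phi> (?l z) \<partial>\<gamma>)"
    unfolding eq by (intro Bochner_Integration.integral_sum inti) auto
  ultimately show ?thesis by simp
qed

text \<open>Since \<open>softabs \<epsilon>\<close> lies above the modulus, \<open>softabs e\<close>
  exceeds it by at most \<open>e * (1 - tanh^2)\<close>, whichever of the two widths is larger. The
  Jensen perturbation bound then needs only the Gibbs mean of that excess.\<close>

lemma F_scale_ge:
  assumes e: "0 < e"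
  shows "F 0 t * exp (- (p * \<beta> * e * (\<Sum>i<m. \<integral>z. \<Phi> (lin (sc 0 t) z) *
      avg1 (lin (sc 0 t) z) (\<lambda>x. 1 - (tanh (lin (sc 0 t) z i x / e))\<^sup>2) \<partial>\<gamma>)) / F 0 t)
    \<le> gordon.F m n c p e 0 t"
proof -
  interpret G: gordon m n c p e by unfold_locales (use m n c p01 e in auto)
  let ?l = "lin (sc 0 t)"
  define A where "A i z = avg1 (?l z) (\<lambda>x. 1 - (tanh (?l z i x / e))\<^sup>2)" for i z
  define D where "D z x = - (\<beta> * e) * (\<Sum>i<m. 1 - (tanh (?l z i x / e))\<^sup>2)" for z x
  have Am: "A i \<in> borel_measurable \<gamma>" if "i < m" for i
    unfolding A_def using that
    by (intro avg1_measurable borel_measurable_diff borel_measurable_const borel_measurable_power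
        measurable_compose[OF _ tanh_measurable] borel_measurable_divide lin_measurable) auto
  have A1: "\<bar>A i z\<bar> \<le> 1" for i z
    unfolding A_def using tanh_sq_le by (intro abs_avg1_le) auto
  have intA: "integrable \<gamma> (\<lambda>z. \<Phi> (?l z) * A i z)" if "i < m" for i
    by (rule integrable_\<Phi>_mult[OF Am[OF that] A1])
  have pD: "p * avg1 (?l z) (D z) = (\<Sum>i<m. - (p * \<beta> * e) * A i z)" for z
    unfolding D_def A_def by (simp only: avg1_cmult avg1_sum sum_distrib_left) (simp add: mult.assoc)
  have eq: "\<Phi> (?l z) * (p * avg1 (?l z) (D z)) = (\<Sum>i<m. - (p * \<beta> * e) * (\<Phi> (?l z) * A i z))" for z
    unfolding pD sum_distrib_left by (simp add: mult.left_commute)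
  have intD: "integrable \<gamma> (\<lambda>z. \<Phi> (?l z) * (p * avg1 (?l z) (D z)))"
    unfolding eq by (intro Bochner_Integration.integrable_sum integrable_mult_right intA) auto
  have ge: "\<Phi> (?l z) * exp (p * avg1 (?l z) (D z)) \<le> G.\<Phi> (?l z)" for z
    unfolding G.\<Phi>_def G.W_def
  proof (rule \<Phi>_Jensen)
    fix x
    have "(\<Sum>i<m. \<beta> * softabs e (?l z i x)) \<le> (\<Sum>i<m. \<beta> * softabs \<epsilon> (?l z i x) + (\<beta> * e) * (1 - (tanh (?l z i x / e))\<^sup>2))"
    proof (rule sum_mono)
      fix i
      have "softabs e (?l z i x) \<le> softabs \<epsilon> (?l z i x) + e * (1 - (tanh (?l z i x / e))\<^sup>2)"
        using softabs_le_tanh[OF e, of "?l z i x"] softabs_ge[OF \<epsilon>, of "?l z i x"] by linarith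
      from mult_left_mono[OF this, of \<beta>]
      show "\<beta> * softabs e (?l z i x) \<le> \<beta> * softabs \<epsilon> (?l z i x) + (\<beta> * e) * (1 - (tanh (?l z i x / e))\<^sup>2)"
        using \<beta>_pos by (simp add: distrib_left mult.assoc)
    qed
    then show "G.energy (?l z) x \<le> energy (?l z) x - D z x"
      unfolding G.energy_def energy_def D_def
      by (simp add: psi_def G.psi_def sum.distrib sum_distrib_left sum_negf)
  qed
  have "F 0 t * exp ((\<integral>z. \<Phi> (?l z) * (p * avg1 (?l z) (D z)) \<partial>\<gamma>) / F 0 t) \<le> G.F 0 t"
    unfolding F_def G.F_def
    by (rule integral_ge_exp[OF integrable_\<Phi> intD G.integrable_\<Phi> ge])
       (use F_pos[of 0 t] in \<open>auto simp: F_def less_imp_le[OF \<Phi>_pos]\<close>)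
  moreover have "(\<integral>z. \<Phi> (?l z) * (p * avg1 (?l z) (D z)) \<partial>\<gamma>) = - (p * \<beta> * e * (\<Sum>i<m. \<integral>z. \<Phi> (?l z) * A i z \<partial>\<gamma>))"
  proof -
    have "(\<integral>z. \<Phi> (?l z) * (p * avg1 (?l z) (D z)) \<partial>\<gamma>) = (\<Sum>i<m. \<integral>z. - (p * \<beta> * e) * (\<Phi> (?l z) * A i z) \<partial>\<gamma>)"
      unfolding eq by (intro Bochner_Integration.integral_sum integrable_mult_right intA) auto
    then show ?thesis by (simp only: integral_mult_right_zero sum_distrib_left[symmetric]) simp
  qed
  ultimately show ?thesis unfolding A_def by simp
qed

text \<open>Weakening the field subtracts a multiple of the scalar product of \<open>h\<close> and
  \<open>x\<close> from the last row. Jensen gives the tangent bound at full strength, and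
  \<open>ibp_field\<close> evaluates the slope: the summand \<open>c\<close> in the last factor is
  the response at overlap 1, the rest measures the deviation from it.\<close>

lemma field_response:
  assumes t: "0 \<le> t" and v: "0 \<le> v" "v \<le> 1 - t"
  shows "ln (F 0 t) - ln (F v t) \<le>
    c * n * (sqrt (1 - t) * (sqrt (1 - t) - sqrt (1 - t - v))) * (c + b * (1 - p) * (Q t / F 0 t))"
proof -
  let ?l = "lin (sc 0 t)"
  define k where "k = b * sqrt n * (sqrt (1 - t) - sqrt (1 - t - v))"
  define D where "D z x = k * (\<Sum>j<n. z (m, j) * x j)" for z :: "nat \<times> nat \<Rightarrow> real" and x :: "nat \<Rightarrow> real"
  have t1: "t \<le> 1" using v by simp
  have ge: "\<Phi> (?l z) * exp (p * avg1 (?l z) (D z)) \<le> \<Phi> (lin (sc v t) z)" for z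
    unfolding \<Phi>_def[of "lin (sc v t) z"] W_def[of "lin (sc v t) z"]
  proof (rule \<Phi>_Jensen)
    fix x assume x: "x \<in> spins n"
    have "lin (sc v t) z i x = ?l z i x" if "i < m" for i
      using that x by (simp add: lin_row)
    moreover have "lin (sc v t) z m x = ?l z m x - (sqrt (1 - t) - sqrt (1 - t - v)) * (\<Sum>j<n. z (m, j) * x j)"
      by (simp add: lin_def sc_def sum_distrib_left left_diff_distrib sum_subtractf mult.assoc)
    then have "b * sqrt n * lin (sc v t) z m x = b * sqrt n * ?l z m x - D z x"
      unfolding D_def k_def by algebra
    ultimately show "energy (lin (sc v t) z) x \<le> energy (?l z) x - D z x"
      by (simp add: energy_def psi_def)
  qed
  have pD: "\<Phi> (?l z) * (p * avg1 (?l z) (D z)) = p * k * (\<Phi> (?l z) * avg1 (?l z) (\<lambda>x. \<Sum>j<n. z (m, j) * x j))" for z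
    unfolding D_def avg1_cmult by (simp add: mult_ac)
  have intD: "integrable \<gamma> (\<lambda>z. \<Phi> (?l z) * (p * avg1 (?l z) (D z)))"
    unfolding pD by (intro integrable_mult_right integrable_field t t1)
  have main: "F 0 t * exp ((\<integral>z. \<Phi> (?l z) * (p * avg1 (?l z) (D z)) \<partial>\<gamma>) / F 0 t) \<le> F v t"
    unfolding F_def
    by (rule integral_ge_exp[OF integrable_\<Phi> intD integrable_\<Phi> ge])
       (use F_pos[of 0 t] in \<open>auto simp: F_def less_imp_le[OF \<Phi>_pos]\<close>)
  have intq: "integrable \<gamma> (\<lambda>z. \<Phi> (?l z) * avg (?l z) (\<lambda>x y. 1 - overlap n x y))"
    by (rule integrable_\<Phi>_mult[OF avg_measurable abs_avg_le[OF abs_one_minus_overlap]]) auto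
  have "(\<integral>z. \<Phi> (?l z) * (p + (1 - p) * avg (?l z) (\<lambda>x y. 1 - overlap n x y)) \<partial>\<gamma>) =
      (\<integral>z. p * \<Phi> (?l z) + (1 - p) * (\<Phi> (?l z) * avg (?l z) (\<lambda>x y. 1 - overlap n x y)) \<partial>\<gamma>)"
    by (rule Bochner_Integration.integral_cong) (auto simp: algebra_simps)
  also have "\<dots> = p * F 0 t + (1 - p) * Q t"
    unfolding F_def Q_def using intq integrable_\<Phi> by simp
  finally have I: "(\<integral>z. \<Phi> (?l z) * (p * avg1 (?l z) (D z)) \<partial>\<gamma>) =
      p * k * (- (sqrt (1 - t) * (b * sqrt n)) * (p * F 0 t + (1 - p) * Q t))"
    unfolding pD by (simp only: integral_mult_right_zero ibp_field[OF t t1])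
  have "ln (F 0 t * exp ((\<integral>z. \<Phi> (?l z) * (p * avg1 (?l z) (D z)) \<partial>\<gamma>) / F 0 t)) \<le> ln (F v t)"
    using main F_pos by (intro ln_mono) (auto intro!: mult_pos_pos)
  then have "ln (F 0 t) + (\<integral>z. \<Phi> (?l z) * (p * avg1 (?l z) (D z)) \<partial>\<gamma>) / F 0 t \<le> ln (F v t)"
    using F_pos[of 0 t] by (simp add: ln_mult)
  moreover have "(\<integral>z. \<Phi> (?l z) * (p * avg1 (?l z) (D z)) \<partial>\<gamma>) / F 0 t =
      - (c * n * (sqrt (1 - t) * (sqrt (1 - t) - sqrt (1 - t - v))) * (c + b * (1 - p) * (Q t / F 0 t)))"
  proof -
    have "p * k * (- (sqrt (1 - t) * (b * sqrt n)) * (p * F 0 t + (1 - p) * Q t)) =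
       - ((p * b) * (sqrt n * sqrt n) * (sqrt (1 - t) * (sqrt (1 - t) - sqrt (1 - t - v))) * ((p * b) * F 0 t + b * (1 - p) * Q t))"
      unfolding k_def by algebra
    also have "\<dots> = - (c * n * (sqrt (1 - t) * (sqrt (1 - t) - sqrt (1 - t - v))) * (c * F 0 t + b * (1 - p) * Q t))"
      unfolding pb by simp
    also have "c * F 0 t + b * (1 - p) * Q t = (c + b * (1 - p) * (Q t / F 0 t)) * F 0 t"
      using F_pos[of 0 t] by (simp add: distrib_right)
    finally have E: "p * k * (- (sqrt (1 - t) * (b * sqrt n)) * (p * F 0 t + (1 - p) * Q t)) =
      - (c * n * (sqrt (1 - t) * (sqrt (1 - t) - sqrt (1 - t - v))) * ((c + b * (1 - p) * (Q t / F 0 t)) * F 0 t))" .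
    have "- (x * (y * F 0 t)) / F 0 t = - (x * y)" for x y using F_pos[of 0 t] by simp
    then show ?thesis unfolding I E .
  qed
  ultimately show ?thesis by linarith
qed

end


subsection \<open>The min-max as a limit of the comparison process\<close>

lemma abs_cube_le:
  assumes "x \<in> cube k" "i < k"
  shows "\<bar>x i\<bar> \<le> 1"
  using cube_cases[OF assms] assms(2) by (auto simp: divide_le_eq_1)

lemma abs_bilin_le:
  assumes "x \<in> cube n" "y \<in> cube m"
  shows "\<bar>bilin m n A y x\<bar> \<le> (\<Sum>i<m. \<Sum>j<n. \<bar>A i j\<bar>)"
proof -
  have "\<bar>bilin m n A y x\<bar> \<le> (\<Sum>i<m. \<bar>\<Sum>j<n. y i * A i j * x j\<bar>)" unfolding bilin_def by (rule sum_abs)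
  also have "\<dots> \<le> (\<Sum>i<m. \<Sum>j<n. \<bar>y i * A i j * x j\<bar>)" by (intro sum_mono sum_abs)
  also have "\<dots> \<le> (\<Sum>i<m. \<Sum>j<n. \<bar>A i j\<bar>)"
  proof (intro sum_mono)
    fix i j assume ij: "i \<in> {..<m}" "j \<in> {..<n}"
    have "\<bar>y i\<bar> * \<bar>A i j\<bar> * \<bar>x j\<bar> \<le> 1 * \<bar>A i j\<bar> * 1"
      using abs_cube_le[OF assms(1)] abs_cube_le[OF assms(2)] ij by (intro mult_mono) auto
    then show "\<bar>y i * A i j * x j\<bar> \<le> \<bar>A i j\<bar>" by (simp add: abs_mult)
  qed
  finally show ?thesis .
qed

lemma xi_attained: "\<exists>x\<in>cube n. xi m n A = Max ((\<lambda>y. bilin m n A y x) ` cube m)"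
proof -
  have "xi m n A \<in> (\<lambda>x. Max ((\<lambda>y. bilin m n A y x) ` cube m)) ` cube n"
    unfolding xi_def using finite_cube cube_nonempty by (intro Min_in) auto
  then show ?thesis by auto
qed

lemma abs_xi_le: "\<bar>xi m n A\<bar> \<le> (\<Sum>i<m. \<Sum>j<n. \<bar>A i j\<bar>)"
proof -
  obtain x where x: "x \<in> cube n" "xi m n A = Max ((\<lambda>y. bilin m n A y x) ` cube m)"
    using xi_attained by blast
  have "Max ((\<lambda>y. bilin m n A y x) ` cube m) \<in> (\<lambda>y. bilin m n A y x) ` cube m"
    using finite_cube cube_nonempty by (intro Max_in) auto
  then obtain y where "y \<in> cube m" "xi m n A = bilin m n A y x" using x by auto
  then show ?thesis using abs_bilin_le[OF x(1)] by simp
qed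

lemma sum_abs_le_Max_bilin:
  assumes "x \<in> cube n"
  shows "(\<Sum>i<m. \<bar>\<Sum>j<n. A i j * x j\<bar>) / sqrt m \<le> Max ((\<lambda>y. bilin m n A y x) ` cube m)"
proof -
  define y where "y = (\<lambda>i\<in>{..<m}. if 0 \<le> (\<Sum>j<n. A i j * x j) then 1 / sqrt m else - (1 / sqrt m))"
  have y: "y \<in> cube m" unfolding y_def cube_def by auto
  have "bilin m n A y x = (\<Sum>i<m. y i * (\<Sum>j<n. A i j * x j))"
    unfolding bilin_def by (simp add: sum_distrib_left mult.assoc)
  also have "\<dots> = (\<Sum>i<m. \<bar>\<Sum>j<n. A i j * x j\<bar> / sqrt m)"
    by (intro sum.cong refl) (auto simp: y_def)
  finally have "(\<Sum>i<m. \<bar>\<Sum>j<n. A i j * x j\<bar>) / sqrt m = bilin m n A y x"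
    by (simp add: sum_divide_distrib)
  also have "\<dots> \<le> Max ((\<lambda>y. bilin m n A y x) ` cube m)"
    using y finite_cube by (intro Max_ge) auto
  finally show ?thesis .
qed

lemma xi_cong:
  assumes "\<And>i j. i < m \<Longrightarrow> j < n \<Longrightarrow> A i j = A' i j"
  shows "xi m n A = xi m n A'"
proof -
  have "bilin m n A = bilin m n A'"
    unfolding bilin_def by (intro ext sum.cong refl) (use assms in auto)
  then show ?thesis unfolding xi_def by simp
qed

lemma xi_measurable:
  assumes "\<And>i j. i < m \<Longrightarrow> j < n \<Longrightarrow> (\<lambda>w. A w i j) \<in> borel_measurable M"
  shows "(\<lambda>w. xi m n (A w)) \<in> borel_measurable M"
  unfolding xi_def bilin_def
  by (intro borel_measurable_Min borel_measurable_Max finite_cube cube_nonempty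
      borel_measurable_sum borel_measurable_times borel_measurable_const assms) auto

text \<open>Independence of one coordinate and a disjoint block, by Fubini; at \<open>t = 1\<close>
  it separates the corner variable from \<open>H\<close>.\<close>

lemma gauss_split:
  fixes f :: "real \<Rightarrow> real" and g :: "('k \<Rightarrow> real) \<Rightarrow> real"
  assumes K: "finite K" "L \<subseteq> K" "k \<in> K" "k \<notin> L"
    and g: "g \<in> borel_measurable (gauss L)"
    and int: "integrable (gauss K) (\<lambda>z. f (z k) * g (restrict z L))"
  shows "(\<integral>z. f (z k) * g (restrict z L) \<partial>gauss K) = integral\<^sup>L std_gauss f * integral\<^sup>L (gauss L) g"
proof -
  define K' where "K' = K - {k}"
  have K': "K = insert k K'" "finite K'" "k \<notin> K'" "L \<subseteq> K'" using K by (auto simp: K'_def)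
  have "(\<integral>z. f (z k) * g (restrict z L) \<partial>gauss K) =
      (\<integral>z. (\<integral>y. f y * g (restrict z L) \<partial>std_gauss) \<partial>gauss K')"
  proof -
    have "restrict (z(k := y)) L = restrict z L" for z :: "'k \<Rightarrow> real" and y
      using K(4) by (auto simp: restrict_def fun_eq_iff)
    then show ?thesis
      using gauss.product_integral_insert[OF K'(2,3), of "\<lambda>z. f (z k) * g (restrict z L)"] int K'(1) by simp
  qed
  also have "\<dots> = integral\<^sup>L std_gauss f * (\<integral>z. g (restrict z L) \<partial>gauss K')" by simp
  also have "(\<integral>z. g (restrict z L) \<partial>gauss K') = integral\<^sup>L (gauss L) g"
    using integral_distr[of "\<lambda>z. restrict z L" "gauss K'" "gauss L" g] g K'(4)
      gauss.distr_restrict[OF K'(4,2)]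
    by (simp add: measurable_restrict_subset)
  finally show ?thesis .
qed

context gordon
begin

text \<open>At \<open>t = 1\<close> only \<open>H\<close> and the corner remain, and a single state,
  one that attains the minimum, bounds \<open>\<Phi>\<close> from below. There
  \<open>p * b = c\<close>, the norm \<open>l1\<close> of \<open>H x\<close> is at most
  \<open>sqrt m\<close> times the min-max value, smoothing costs \<open>\<epsilon> * ln 2\<close>
  per row, and the independent corner variable integrates to
  \<open>exp (c^2 * n / 2)\<close>.\<close>

lemma F_one_ge:
  "exp (c\<^sup>2 * n / 2) * exp (- (c * sqrt (n * m) * (\<epsilon> * ln 2))) *
      (\<integral>z. exp (- (c * sqrt n) * xi m n (\<lambda>i j. z (i, j))) \<partial>gauss ({..<m} \<times> {..<n})) \<le> F 0 1"
proof -
  let ?l = "lin (sc 0 1)"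
  let ?L = "{..<m} \<times> {..<n}"
  define g where "g z = exp (- (c * sqrt n) * xi m n (\<lambda>i j. z (i, j)))" for z :: "nat \<times> nat \<Rightarrow> real"
  define f where "f y = exp ((- (c * sqrt n)) * y)" for y :: real
  define \<kappa> where "\<kappa> = c * sqrt (n * m) * (\<epsilon> * ln 2)"
  have gr: "g (restrict z ?L) = g z" for z
    unfolding g_def by (intro arg_cong[where f = exp] arg_cong2[where f = "(*)"] refl xi_cong) auto
  have ptw: "f (z (m, n)) * g z * exp (- \<kappa>) \<le> \<Phi> (?l z)" for z
  proof -
    obtain x0 where x0: "x0 \<in> cube n" "xi m n (\<lambda>i j. z (i, j)) = Max ((\<lambda>y. bilin m n (\<lambda>i j. z (i, j)) y x0) ` cube m)"
      using xi_attained by blast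
    define x where "x = x0(n := 1)"
    have x: "x \<in> spins n" unfolding x_def spins_def using x0 by auto
    define N where "N = (\<Sum>i<m. \<bar>\<Sum>j<n. z (i, j) * x0 j\<bar>)"
    have li: "?l z i x = (\<Sum>j<n. z (i, j) * x0 j)" if "i < m" for i
      using lin_row[OF that x, of 0 1 z] by (simp add: x_def)
    have lm: "?l z m x = z (m, n)" using spins_last[OF x] by (simp add: lin_def sc_def)
    have "p * energy (?l z) x = (p * b) * (sqrt (n / m) * (\<Sum>i<m. softabs \<epsilon> (?l z i x)) + sqrt n * z (m, n))"
      by (simp add: energy_def psi_def \<beta>_def lm distrib_left sum_distrib_left mult.assoc)
    also have "\<dots> \<le> (p * b) * (sqrt (n / m) * (N + m * (\<epsilon> * ln 2)) + sqrt n * z (m, n))"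
    proof -
      have "(\<Sum>i<m. softabs \<epsilon> (?l z i x)) \<le> (\<Sum>i<m. \<bar>?l z i x\<bar> + \<epsilon> * ln 2)"
        by (intro sum_mono softabs_le \<epsilon>)
      also have "\<dots> = N + m * (\<epsilon> * ln 2)" by (simp add: sum.distrib N_def li)
      finally show ?thesis using p01 b_pos by (intro mult_left_mono add_right_mono) auto
    qed
    also have "\<dots> = c * sqrt n * (N / sqrt m) + \<kappa> + c * sqrt n * z (m, n)"
    proof -
      have "sqrt (n / m) * (m * (\<epsilon> * ln 2)) = sqrt (n * m) * (\<epsilon> * ln 2)"
        using m by (simp add: real_sqrt_divide real_sqrt_mult) (simp add: field_simps)
      then show ?thesis unfolding pb \<kappa>_def by (simp add: real_sqrt_divide algebra_simps)
    qed
    also have "\<dots> \<le> c * sqrt n * xi m n (\<lambda>i j. z (i, j)) + \<kappa> + c * sqrt n * z (m, n)"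
      unfolding x0(2) N_def using c
      by (intro add_right_mono mult_left_mono sum_abs_le_Max_bilin x0) auto
    finally have "p * energy (?l z) x \<le> c * sqrt n * xi m n (\<lambda>i j. z (i, j)) + \<kappa> + c * sqrt n * z (m, n)" .
    then have "f (z (m, n)) * g z * exp (- \<kappa>) \<le> exp (- p * energy (?l z) x)"
      unfolding f_def g_def by (simp add: exp_add[symmetric])
    also have "\<dots> \<le> \<Phi> (?l z)" by (rule \<Phi>_ge[OF x])
    finally show ?thesis .
  qed
  have gm: "g \<in> borel_measurable (gauss ?L)"
    unfolding g_def
    by (intro measurable_compose[OF _ borel_measurable_exp] borel_measurable_times borel_measurable_const xi_measurable)
       (use measurable_component_singleton[of _ ?L "\<lambda>_. std_gauss"] in auto)
  have gm2: "g \<in> borel_measurable \<gamma>"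
    unfolding g_def
    by (intro measurable_compose[OF _ borel_measurable_exp] borel_measurable_times borel_measurable_const xi_measurable)
       (use component_measurable in auto)
  have int: "integrable \<gamma> (\<lambda>z. f (z (m, n)) * g z)"
  proof (rule integrable_gauss_bound[where A = 1 and B = "2 * (c * sqrt n)"])
    show "(\<lambda>z. f (z (m, n)) * g z) \<in> borel_measurable \<gamma>"
      unfolding f_def using gm2 component_measurable[of m n]
      by (intro borel_measurable_times measurable_compose[OF _ borel_measurable_exp]) auto
    fix z :: "nat \<times> nat \<Rightarrow> real"
    let ?K = "{..<Suc m} \<times> {..<Suc n}"
    have "\<bar>xi m n (\<lambda>i j. z (i, j))\<bar> \<le> (\<Sum>i<m. \<Sum>j<n. \<bar>z (i, j)\<bar>)" by (rule abs_xi_le)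
    also have "\<dots> = (\<Sum>k\<in>?L. \<bar>z k\<bar>)" by (simp add: sum.cartesian_product)
    also have "\<dots> \<le> l1 ?K z" unfolding l1_def by (intro sum_mono2) auto
    finally have "- xi m n (\<lambda>i j. z (i, j)) \<le> l1 ?K z" by simp
    moreover have "- z (m, n) \<le> l1 ?K z" using l1_ge_component[of ?K "(m, n)" z] by auto
    ultimately have "(c * sqrt n) * (- z (m, n)) + (c * sqrt n) * (- xi m n (\<lambda>i j. z (i, j))) \<le> (c * sqrt n) * l1 ?K z + (c * sqrt n) * l1 ?K z"
      using c by (intro add_mono mult_left_mono) auto
    then show "\<bar>f (z (m, n)) * g z\<bar> \<le> 1 * exp (2 * (c * sqrt n) * l1 ?K z)"
      unfolding f_def g_def by (simp add: exp_add[symmetric])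
  qed simp
  have "(\<integral>z. f (z (m, n)) * g z \<partial>\<gamma>) = integral\<^sup>L std_gauss f * integral\<^sup>L (gauss ?L) g"
    using gauss_split[of "{..<Suc m} \<times> {..<Suc n}" ?L "(m, n)" g f] gm int unfolding gr
    by (auto simp: subset_iff)
  also have "integral\<^sup>L std_gauss f = exp (c\<^sup>2 * n / 2)"
    unfolding f_def integral_std_gauss_exp by (simp add: power_mult_distrib)
  finally have "exp (c\<^sup>2 * n / 2) * exp (- \<kappa>) * integral\<^sup>L (gauss ?L) g = (\<integral>z. f (z (m, n)) * g z * exp (- \<kappa>) \<partial>\<gamma>)"
    by simp
  also have "\<dots> \<le> F 0 1" unfolding F_def
    by (intro integral_mono integrable_mult_left int integrable_\<Phi> ptw)
  finally show ?thesis unfolding \<kappa>_def g_def .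
qed

end


subsection \<open>The Gaussian moment generating functions of the bound\<close>

definition abs_mgf :: "real \<Rightarrow> real" where
  "abs_mgf a = (\<integral>y. exp (a * \<bar>y\<bar>) \<partial>std_gauss)"

lemma abs_mgf_eq: "abs_mgf a = exp (a\<^sup>2 / 2) * erfc (- a / sqrt 2)"
  unfolding abs_mgf_def by (rule integral_std_gauss_exp_abs)

lemma abs_mgf_pos: "0 < abs_mgf a"
  unfolding abs_mgf_eq using erfc_pos by simp

lemma abs_mgf_ge_1: "0 \<le> a \<Longrightarrow> 1 \<le> abs_mgf a"
proof -
  assume a: "0 \<le> a"
  have "(\<integral>y. 1 \<partial>std_gauss) \<le> abs_mgf a"
    unfolding abs_mgf_def using a by (intro integral_mono integrable_std_gauss_exp_abs) auto
  then show ?thesis using gauss.M.prob_space by simp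
qed

lemma one_plus_powr_le:
  fixes p z :: real
  assumes "0 \<le> p" "p \<le> 1" "0 \<le> z" "z \<le> 1"
  shows "(1 + z) powr p \<le> 1 + 2 * p * z"
proof -
  have "(1 + z) powr p = exp (p * ln (1 + z))" using assms by (simp add: powr_def)
  also have "\<dots> \<le> exp (p * z)" using assms by (simp add: mult_left_mono ln_add_one_self_le_self)
  also have "\<dots> \<le> 1 + p * z + (p * z)\<^sup>2" using assms by (intro exp_bound) (auto simp: mult_le_one)
  also have "(p * z)\<^sup>2 \<le> p * z" using assms by (simp add: power2_eq_square mult_le_one mult_left_le)
  finally show ?thesis by simp
qed

lemma two_cosh_eq: "2 * cosh x = exp \<bar>x\<bar> * (1 + exp (- 2 * \<bar>x :: real\<bar>))"
  by (cases "x \<ge> 0") (auto simp: cosh_def distrib_left exp_add[symmetric])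

text \<open>Writing \<open>2 * cosh x\<close> as
  \<open>exp \<bar>x\<bar> * (1 + exp (- 2 * \<bar>x\<bar>))\<close> shows that the correction to
  the power is at most \<open>2 * p * exp (- b * \<bar>y\<bar>)\<close>, and this exponential has
  Gaussian mean at most \<open>1 / b\<close>. For \<open>b = c / p\<close> the error is quadratic in
  \<open>p\<close>, small against a gain that is linear in \<open>p\<close>.\<close>

lemma integral_cosh_powr_le:
  fixes b p :: real
  assumes "0 < b" "0 < p" "p < 1"
  shows "(\<integral>y. (2 * cosh (b * y)) powr p \<partial>std_gauss) \<le> abs_mgf (p * b) + 2 * p / b"
proof -
  have "(\<integral>y. (2 * cosh (b * y)) powr p \<partial>std_gauss) \<le> (\<integral>y. exp ((p * b) * \<bar>y\<bar>) + 2 * p * exp (- b * \<bar>y\<bar>) \<partial>std_gauss)"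
  proof (rule integral_mono)
    show "integrable std_gauss (\<lambda>y. (2 * cosh (b * y)) powr p)" using assms by (intro integrable_std_gauss_cosh) auto
    show "integrable std_gauss (\<lambda>y. exp ((p * b) * \<bar>y\<bar>) + 2 * p * exp (- b * \<bar>y\<bar>))"
      by (intro Bochner_Integration.integrable_add integrable_mult_right integrable_std_gauss_exp_abs)
    fix y
    have "(2 * cosh (b * y)) powr p = exp ((p * b) * \<bar>y\<bar>) * (1 + exp (- 2 * (b * \<bar>y\<bar>))) powr p"
      unfolding two_cosh_eq using assms by (simp add: powr_mult exp_powr_real abs_mult mult_ac)
    also have "\<dots> \<le> exp ((p * b) * \<bar>y\<bar>) * (1 + 2 * p * exp (- 2 * (b * \<bar>y\<bar>)))"
      using assms by (intro mult_left_mono one_plus_powr_le) auto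
    also have "\<dots> = exp ((p * b) * \<bar>y\<bar>) + 2 * p * exp ((p * b) * \<bar>y\<bar> - 2 * (b * \<bar>y\<bar>))"
      by (simp add: distrib_left exp_diff exp_minus field_simps)
    also have "\<dots> \<le> exp ((p * b) * \<bar>y\<bar>) + 2 * p * exp (- b * \<bar>y\<bar>)"
    proof -
      have "p * (b * \<bar>y\<bar>) \<le> 1 * (b * \<bar>y\<bar>)" using assms by (intro mult_right_mono) auto
      then show ?thesis using assms by simp
    qed
    finally show "(2 * cosh (b * y)) powr p \<le> exp ((p * b) * \<bar>y\<bar>) + 2 * p * exp (- b * \<bar>y\<bar>)" .
  qed
  also have "\<dots> = abs_mgf (p * b) + 2 * p * (\<integral>y. exp (- b * \<bar>y\<bar>) \<partial>std_gauss)"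
    unfolding abs_mgf_def
    by (simp only: Bochner_Integration.integral_add[OF integrable_std_gauss_exp_abs
          integrable_mult_right[OF integrable_std_gauss_exp_abs]] integral_mult_right_zero)
  also have "\<dots> \<le> abs_mgf (p * b) + 2 * p * (1 / b)"
    using assms by (intro add_left_mono mult_left_mono integral_std_gauss_exp_minus_abs_le) auto
  finally show ?thesis by simp
qed

text \<open>Coarser, with relative error \<open>2 powr p\<close>, but valid down to
  \<open>b = 0\<close>, as weakened fields require.\<close>

lemma integral_cosh_powr_le2:
  fixes b p :: real
  assumes "0 \<le> b" "0 < p" "p < 1"
  shows "(\<integral>y. (2 * cosh (b * y)) powr p \<partial>std_gauss) \<le> 2 powr p * abs_mgf (p * b)"
proof -
  have "(\<integral>y. (2 * cosh (b * y)) powr p \<partial>std_gauss) \<le> (\<integral>y. 2 powr p * exp ((p * b) * \<bar>y\<bar>) \<partial>std_gauss)"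
  proof (rule integral_mono)
    show "integrable std_gauss (\<lambda>y. (2 * cosh (b * y)) powr p)" using assms by (intro integrable_std_gauss_cosh) auto
    show "integrable std_gauss (\<lambda>y. 2 powr p * exp ((p * b) * \<bar>y\<bar>))"
      by (intro integrable_mult_right integrable_std_gauss_exp_abs)
    fix y
    have "exp (- 2 * \<bar>b * y\<bar>) \<le> 1" by simp
    then have "(1 + exp (- 2 * \<bar>b * y\<bar>)) powr p \<le> 2 powr p" using assms by (intro powr_mono2) auto
    then have "exp (p * b * \<bar>y\<bar>) * (1 + exp (- 2 * \<bar>b * y\<bar>)) powr p \<le> exp (p * b * \<bar>y\<bar>) * 2 powr p"
      by (intro mult_left_mono) auto
    then show "(2 * cosh (b * y)) powr p \<le> 2 powr p * exp ((p * b) * \<bar>y\<bar>)"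
      unfolding two_cosh_eq using assms by (simp add: powr_mult exp_powr_real abs_mult mult_ac)
  qed
  then show ?thesis by (simp add: abs_mgf_def)
qed

text \<open>The Gaussian factor of \<open>abs_mgf\<close> alone accounts for
  \<open>c^2 * v / 2\<close>; the surplus comes from the strict monotonicity of \<open>erfc\<close>.
  Its constant combines \<open>1 - sqrt (1 - v) \<ge> v / 2\<close>,
  \<open>sqrt (2 / pi) \<ge> 2 / 3\<close> and \<open>erfc \<le> 2\<close>. This surplus later
  forces replicas to disagree.\<close>

lemma abs_mgf_gap:
  assumes c: "0 < c" and v: "0 \<le> v" "v \<le> 1"
  shows "c\<^sup>2 * v / 2 + c * exp (- c\<^sup>2 / 2) / 6 * v \<le> ln (abs_mgf c) - ln (abs_mgf (c * sqrt (1 - v)))"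
proof -
  define s where "s = sqrt (1 - v)"
  have s: "0 \<le> s" "s \<le> 1" "s\<^sup>2 = 1 - v" using v by (auto simp: s_def)
  have "v = (1 - s) * (1 + s)" using s by (simp add: power2_eq_square algebra_simps)
  also have "\<dots> \<le> (1 - s) * 2" using s by (intro mult_left_mono) auto
  finally have sv: "v / 2 \<le> 1 - s" by simp
  define x y where "x = erfc (- c / sqrt 2)" and "y = erfc (- (c * s) / sqrt 2)"
  have xy: "0 < x" "0 < y" by (simp_all add: x_def y_def erfc_pos)
  have x2: "x \<le> 2" using erfc_uminus[of "c / sqrt 2"] erfc_pos[of "c / sqrt 2"] by (simp add: x_def)
  have diff: "c * exp (- c\<^sup>2 / 2) / 3 * v \<le> x - y"
  proof (cases "s = 1")
    case True
    then have "v = 0" using s by simp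
    then show ?thesis by (simp add: x_def y_def True)
  next
    case False
    then have lt: "- c / sqrt 2 < - (c * s) / sqrt 2" using s c by (simp add: divide_strict_right_mono)
    obtain w where w: "- c / sqrt 2 < w" "w < - (c * s) / sqrt 2"
      "erfc (- (c * s) / sqrt 2) - erfc (- c / sqrt 2) = (- (c * s) / sqrt 2 - - c / sqrt 2) * (- 2 / sqrt pi * exp (- w\<^sup>2))"
      using MVT2[OF lt, of erfc "\<lambda>w. - 2 / sqrt pi * exp (- w\<^sup>2)"] erfc_deriv by blast
    have "w\<^sup>2 \<le> (c / sqrt 2)\<^sup>2"
    proof -
      have "w < 0" using w(2) s c by (simp add: order_less_le_trans divide_nonpos_nonneg)
      then have "\<bar>w\<bar> \<le> \<bar>c / sqrt 2\<bar>" using w(1) c by simp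
      then show ?thesis by (simp only: abs_le_square_iff)
    qed
    then have ew: "exp (- c\<^sup>2 / 2) \<le> exp (- w\<^sup>2)" by (simp add: power_divide)
    have pi': "sqrt 2 / sqrt pi \<ge> 2 / 3"
    proof -
      have "(2 / 3)\<^sup>2 \<le> 2 / pi" using pi_less_4 by (simp add: power2_eq_square field_simps)
      then have "2 / 3 \<le> sqrt (2 / pi)" by (rule real_le_rsqrt)
      then show ?thesis by (simp add: real_sqrt_divide)
    qed
    have "x - y = (c * (1 - s)) * (sqrt 2 / sqrt pi * exp (- w\<^sup>2))"
    proof -
      have "x - y = (c - c * s) / sqrt 2 * (2 / sqrt pi * exp (- w\<^sup>2))"
        using w(3) unfolding x_def y_def by (simp add: diff_divide_distrib algebra_simps)
      also have "\<dots> = (c * (1 - s)) * (2 / sqrt 2 / sqrt pi * exp (- w\<^sup>2))" by (simp add: algebra_simps)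
      also have "2 / sqrt 2 = sqrt 2" by (simp add: real_div_sqrt)
      finally show ?thesis .
    qed
    also have "\<dots> \<ge> (c * (v / 2)) * (2 / 3 * exp (- c\<^sup>2 / 2))"
      using c sv s v pi' ew by (intro mult_mono mult_left_mono mult_nonneg_nonneg) auto
    finally show ?thesis by (simp add: field_simps)
  qed
  have "0 \<le> c * exp (- c\<^sup>2 / 2) / 3 * v" using c v by simp
  with diff have "y \<le> x" by linarith
  have "ln (y / x) \<le> y / x - 1" using xy by (intro ln_le_minus_one) auto
  then have "(x - y) / x \<le> ln x - ln y" using xy by (simp add: ln_div diff_divide_distrib)
  from order_trans[OF _ this]
  have lnxy: "d \<le> ln x - ln y" if "d \<le> (x - y) / x" for d using that .
  have "c * exp (- c\<^sup>2 / 2) / 6 * v = (c * exp (- c\<^sup>2 / 2) / 3 * v) / 2" by simp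
  also have "\<dots> \<le> (x - y) / 2" using diff by (rule divide_right_mono) simp
  also have "\<dots> \<le> (x - y) / x" using x2 xy \<open>y \<le> x\<close> by (intro divide_left_mono) auto
  finally have "c * exp (- c\<^sup>2 / 2) / 6 * v \<le> ln x - ln y" by (rule lnxy)
  moreover have "ln (abs_mgf c) = c\<^sup>2 / 2 + ln x"
    unfolding abs_mgf_eq x_def[symmetric] using xy by (simp add: ln_mult)
  moreover have "ln (abs_mgf (c * s)) = c\<^sup>2 * (1 - v) / 2 + ln y"
    unfolding abs_mgf_eq y_def[symmetric] using xy s by (simp add: ln_mult power_mult_distrib)
  ultimately show ?thesis unfolding s_def[symmetric] by (simp add: field_simps)
qed


subsection \<open>The comparison bound at fixed aspect ratio\<close>

lemma le_divide_mult_imp: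
  fixes X C e s :: real
  assumes "X \<le> C / e * s" "0 < C" "0 < e"
  shows "X * e / C \<le> s"
  using assms by (simp add: pos_divide_le_eq pos_le_divide_eq mult_ac)

lemma rate_identity:
  fixes C :: real
  assumes "0 < b" "0 < \<alpha>" "0 < C" "0 < lam"
  shows "c * \<delta> / (8 * lam * C) * \<epsilon> * n * F = c * b / (4 * \<alpha>) * (\<alpha> * n * \<delta> / (2 * b) / lam * F * \<epsilon> / C)"
  using assms by (simp add: field_simps)

locale gordon_ratio = gordon +
  fixes \<alpha> :: real
  assumes \<alpha>: "0 < \<alpha>" and m_eq: "real m = \<alpha> * real n"
begin

definition Ag :: real where "Ag = abs_mgf (- c / sqrt \<alpha>)"

definition rate0 :: real where "rate0 = ln (abs_mgf c) + \<alpha> * ln Ag"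

lemma Ag_pos: "0 < Ag" unfolding Ag_def by (rule abs_mgf_pos)

lemma \<beta>_eq: "\<beta> = b / sqrt \<alpha>"
proof -
  have "real n / real m = 1 / \<alpha>" using m_eq n \<alpha> by simp
  then show ?thesis unfolding \<beta>_def by (simp add: real_sqrt_divide)
qed

lemma p\<beta>: "p * \<beta> = c / sqrt \<alpha>"
  unfolding \<beta>_eq using pb by simp

lemma softabs_mgf_le: "(\<integral>y. exp (- (p * \<beta> * softabs \<epsilon> y)) \<partial>std_gauss) \<le> Ag"
  unfolding Ag_def abs_mgf_def
proof (rule integral_mono)
  have "continuous_on UNIV (softabs \<epsilon>)"
    using softabs_deriv[OF \<epsilon>] by (intro continuous_at_imp_continuous_on ballI DERIV_isCont)
  then have meas: "(\<lambda>y. exp (- (p * \<beta> * softabs \<epsilon> y))) \<in> borel_measurable borel"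
    by (intro borel_measurable_continuous_onI continuous_intros)
  have c': "0 \<le> c / sqrt \<alpha>" using c \<alpha> by simp
  show "integrable std_gauss (\<lambda>y. exp (- (p * \<beta> * softabs \<epsilon> y)))"
    by (rule integrable_std_gauss_bound[OF meas, where A = 1 and B = 0])
       (use softabs_nonneg[OF \<epsilon>] \<beta>_pos p01 in auto)
  show "integrable std_gauss (\<lambda>y. exp (- c / sqrt \<alpha> * \<bar>y\<bar>))" by (rule integrable_std_gauss_exp_abs)
  show "exp (- (p * \<beta> * softabs \<epsilon> y)) \<le> exp (- c / sqrt \<alpha> * \<bar>y\<bar>)" for y
    unfolding p\<beta> using mult_left_mono[OF softabs_ge[OF \<epsilon>, of y] c'] by simp
qed

lemma softabs_mgf_nonneg: "0 \<le> (\<integral>y. exp (- (p * \<beta> * softabs \<epsilon> y)) \<partial>std_gauss)"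
  by (intro integral_nonneg_AE) auto

lemma Ag_power: "Ag ^ m = exp (n * (\<alpha> * ln Ag))"
proof -
  have "Ag ^ m = exp (m * ln Ag)" using Ag_pos by (simp add: exp_of_nat_mult)
  then show ?thesis by (simp add: m_eq mult_ac)
qed

lemma F_zero_le:
  assumes "c \<le> b"
  shows "F 0 0 \<le> exp (n * (rate0 + 2 * p\<^sup>2 / c))"
proof -
  let ?H = "\<integral>y. (2 * cosh (b * y)) powr p \<partial>std_gauss"
  have "?H \<le> abs_mgf c + 2 * p / b"
    using integral_cosh_powr_le[OF b_pos p01] by (simp add: pb)
  also have "2 * p / b = 2 * p\<^sup>2 / c" using p01 c by (simp add: b_def power2_eq_square)
  also have "abs_mgf c + 2 * p\<^sup>2 / c \<le> abs_mgf c * (1 + 2 * p\<^sup>2 / c)"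
  proof -
    have "1 * (2 * p\<^sup>2 / c) \<le> abs_mgf c * (2 * p\<^sup>2 / c)"
      using c abs_mgf_ge_1[of c] by (intro mult_right_mono) auto
    then show ?thesis by (simp add: distrib_left)
  qed
  also have "\<dots> \<le> abs_mgf c * exp (2 * p\<^sup>2 / c)"
    using abs_mgf_pos[of c] by (intro mult_left_mono) auto
  also have "\<dots> = exp (ln (abs_mgf c) + 2 * p\<^sup>2 / c)" using abs_mgf_pos[of c] by (simp add: exp_add)
  finally have H: "?H \<le> exp (ln (abs_mgf c) + 2 * p\<^sup>2 / c)" .
  have H0: "0 \<le> ?H" by (intro integral_nonneg_AE) auto
  have "F 0 0 = (\<integral>y. exp (- (p * \<beta> * softabs \<epsilon> y)) \<partial>std_gauss) ^ m * ?H ^ n"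
    using F_zero[of 0] by simp
  also have "\<dots> \<le> Ag ^ m * exp (ln (abs_mgf c) + 2 * p\<^sup>2 / c) ^ n"
    using softabs_mgf_le softabs_mgf_nonneg H H0 Ag_pos by (intro mult_mono power_mono) auto
  also have "\<dots> = exp (n * (rate0 + 2 * p\<^sup>2 / c))"
    unfolding Ag_power exp_of_nat_mult[symmetric] exp_add[symmetric] rate0_def by (simp add: algebra_simps)
  finally show ?thesis .
qed

lemma F_field_zero_le:
  assumes v: "0 \<le> v" "v \<le> 1"
  shows "F v 0 \<le> exp (n * (\<alpha> * ln Ag + ln (abs_mgf (c * sqrt (1 - v))) + p * ln 2))"
proof -
  let ?H = "\<integral>y. (2 * cosh (b * sqrt (1 - v) * y)) powr p \<partial>std_gauss"
  let ?G = "abs_mgf (c * sqrt (1 - v))"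
  have "?H \<le> 2 powr p * abs_mgf (p * (b * sqrt (1 - v)))"
    using v b_pos p01 by (intro integral_cosh_powr_le2) auto
  also have "p * (b * sqrt (1 - v)) = c * sqrt (1 - v)" using pb by simp
  also have "2 powr p * ?G = exp (ln ?G + p * ln 2)"
    using abs_mgf_pos[of "c * sqrt (1 - v)"] by (simp add: powr_def exp_add)
  finally have H: "?H \<le> exp (ln ?G + p * ln 2)" .
  have H0: "0 \<le> ?H" by (intro integral_nonneg_AE) auto
  have "F v 0 \<le> Ag ^ m * exp (ln ?G + p * ln 2) ^ n"
    unfolding F_zero[OF v] using softabs_mgf_le softabs_mgf_nonneg H H0 Ag_pos
    by (intro mult_mono power_mono) auto
  also have "\<dots> = exp (n * (\<alpha> * ln Ag + ln ?G + p * ln 2))"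
    unfolding Ag_power exp_of_nat_mult[symmetric] exp_add[symmetric] by (simp add: algebra_simps)
  finally show ?thesis .
qed

definition \<kappa> :: real where "\<kappa> = c * exp (- c\<^sup>2 / 2) / 6"

lemma \<kappa>_pos: "0 < \<kappa>" using c by (simp add: \<kappa>_def)

text \<open>Two estimates of \<open>ln (F 0 t) - ln (F v t)\<close> collide. From below,
  \<open>F v t \<le> F v 0\<close> is explicit and \<open>F 0 t\<close> is assumed large, so per
  dimension the difference is at least \<open>c^2 * v / 2 + \<kappa> * v\<close> up to small errors.
  From above, \<open>field_response\<close> gives \<open>c * (c + Z)\<close> times a factor close to
  \<open>v / 2\<close>. The terms \<open>c^2 * v / 2\<close> cancel to first order in
  \<open>v\<close>, and the surplus \<open>\<kappa>\<close> has to come from the average of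
  \<open>1 - overlap\<close>.\<close>

lemma susceptibility_ge:
  assumes t: "0 \<le> t" "t \<le> 1 / 2" and v: "0 < v" "v \<le> 1 / 4"
    and F: "exp (n * (rate0 - \<epsilon>1)) \<le> F 0 t"
    and small: "p * ln 2 + \<epsilon>1 \<le> v * \<kappa> / 4" "v * (c + 2 * \<kappa> / c) \<le> \<kappa> / (2 * c)"
  shows "\<kappa> / c * F 0 t \<le> b * Q t"
proof -
  define Z where "Z = b * (1 - p) * (Q t / F 0 t)"
  define s0 s1 where "s0 = sqrt (1 - t)" and "s1 = sqrt (1 - t - v)"
  have Q0: "0 \<le> Q t" unfolding Q_def
    by (intro integral_nonneg_AE AE_I2 mult_nonneg_nonneg less_imp_le[OF \<Phi>_pos] avg_nonneg overlap_bounds)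
  have Z0: "0 \<le> Z" unfolding Z_def using b_pos p01 Q0 F_pos[of 0 t] by auto
  have s0: "0 < s0" "s0\<^sup>2 = 1 - t" using t by (auto simp: s0_def)
  have s1: "0 \<le> s1" "s1\<^sup>2 = 1 - t - v" using t v by (auto simp: s1_def)
  have ratio: "s0 * (1 - 2 * v) \<le> s1"
  proof -
    have "(s0 * (1 - 2 * v))\<^sup>2 = (1 - t) * (1 - 2 * v)\<^sup>2" by (simp add: power_mult_distrib s0)
    also have "\<dots> \<le> (1 - t) * (1 - 2 * v)"
      using t v by (intro mult_left_mono) (auto simp: power2_eq_square mult_left_le)
    also have "\<dots> \<le> 1 - t - v"
    proof -
      have "(1 / 2) * v \<le> (1 - t) * v" using t v by (intro mult_right_mono) auto
      then show ?thesis by (simp add: algebra_simps)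
    qed
    finally have "(s0 * (1 - 2 * v))\<^sup>2 \<le> s1\<^sup>2" using s1 by simp
    then show ?thesis using s1(1) by (rule power2_le_imp_le)
  qed
  \<comment> \<open>The difference of squares is \<open>v\<close>, and \<open>ratio\<close> bounds
    \<open>s0 + s1\<close> below by \<open>s0 * (2 - 2 * v)\<close>. The excess over
    \<open>v / 2\<close> is of second order in \<open>v\<close> and is absorbed by
    \<open>small(2)\<close>.\<close>
  have d: "(s0 * (s0 - s1)) * (1 - v) \<le> v / 2"
  proof -
    have "s0\<^sup>2 - s1\<^sup>2 = v" using s0 s1 by simp
    then have "(s0 - s1) * (s0 + s1) = v" by (simp add: power2_eq_square algebra_simps)
    moreover have "(s0 - s1) * (s0 * (2 - 2 * v)) \<le> (s0 - s1) * (s0 + s1)"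
      using ratio t v by (intro mult_left_mono) (auto simp: algebra_simps s0_def s1_def)
    ultimately have "(s0 - s1) * (s0 * (2 - 2 * v)) \<le> v" by simp
    moreover have "(s0 - s1) * (s0 * (2 - 2 * v)) = 2 * ((s0 * (s0 - s1)) * (1 - v))" by algebra
    ultimately show ?thesis by simp
  qed
  have d0: "0 \<le> s0 * (s0 - s1)" using s0 v by (intro mult_nonneg_nonneg) (auto simp: s0_def s1_def)
  have "F v t \<le> F v 0" using t v by (intro F_antimono) auto
  also have "\<dots> \<le> exp (n * (\<alpha> * ln Ag + ln (abs_mgf (c * sqrt (1 - v))) + p * ln 2))"
    using v by (intro F_field_zero_le) auto
  finally have "ln (F v t) \<le> n * (\<alpha> * ln Ag + ln (abs_mgf (c * sqrt (1 - v))) + p * ln 2)"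
    using F_pos[of v t] by (metis ln_exp ln_mono)
  moreover have "n * (rate0 - \<epsilon>1) \<le> ln (F 0 t)"
    using F F_pos[of 0 t] ln_mono[of "exp (n * (rate0 - \<epsilon>1))" "F 0 t"] by simp
  moreover have "ln (F 0 t) - ln (F v t) \<le> c * n * (s0 * (s0 - s1)) * (c + Z)"
    unfolding s0_def s1_def Z_def using t v by (intro field_response) auto
  ultimately have "n * (rate0 - \<epsilon>1) - n * (\<alpha> * ln Ag + ln (abs_mgf (c * sqrt (1 - v))) + p * ln 2)
      \<le> n * (c * (s0 * (s0 - s1)) * (c + Z))" by (simp add: mult_ac)
  then have "n * ((rate0 - \<epsilon>1) - (\<alpha> * ln Ag + ln (abs_mgf (c * sqrt (1 - v))) + p * ln 2))
      \<le> n * (c * (s0 * (s0 - s1)) * (c + Z))" by (simp add: right_diff_distrib)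
  then have "ln (abs_mgf c) - ln (abs_mgf (c * sqrt (1 - v))) - (p * ln 2 + \<epsilon>1) \<le> c * (s0 * (s0 - s1)) * (c + Z)"
    using n unfolding rate0_def by (simp add: mult_le_cancel_left)
  moreover have "c\<^sup>2 * v / 2 + \<kappa> * v \<le> ln (abs_mgf c) - ln (abs_mgf (c * sqrt (1 - v)))"
    unfolding \<kappa>_def using abs_mgf_gap[OF c, of v] v by simp
  ultimately have "c\<^sup>2 * v / 2 + \<kappa> * v - v * \<kappa> / 4 \<le> c * (s0 * (s0 - s1)) * (c + Z)"
    using small(1) by linarith
  then have "(c\<^sup>2 * v / 2 + \<kappa> * v - v * \<kappa> / 4) * (1 - v) \<le> c * (s0 * (s0 - s1)) * (c + Z) * (1 - v)"
    using v by (intro mult_right_mono) auto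
  also have "\<dots> = c * (c + Z) * ((s0 * (s0 - s1)) * (1 - v))" by (simp add: mult_ac)
  also have "\<dots> \<le> c * (c + Z) * (v / 2)" using d c Z0 by (intro mult_left_mono) auto
  also have "c * (c + Z) * (v / 2) = v * (c * (c + Z) / 2)" by simp
  also have "(c\<^sup>2 * v / 2 + \<kappa> * v - v * \<kappa> / 4) * (1 - v) = v * ((c\<^sup>2 / 2 + 3 / 4 * \<kappa>) * (1 - v))"
    by (simp add: field_simps)
  finally have "v * ((c\<^sup>2 / 2 + 3 / 4 * \<kappa>) * (1 - v)) \<le> v * (c * (c + Z) / 2)" .
  then have "(c\<^sup>2 / 2 + 3 / 4 * \<kappa>) * (1 - v) \<le> c * (c + Z) / 2"
    using v by (simp only: mult_le_cancel_left_pos)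
  moreover have "2 * ((c\<^sup>2 / 2 + 3 / 4 * \<kappa>) * (1 - v)) = c\<^sup>2 + 3 / 2 * \<kappa> - v * (c\<^sup>2 + 3 / 2 * \<kappa>)"
    by (simp add: field_simps)
  moreover have "2 * (c * (c + Z) / 2) = c\<^sup>2 + c * Z" by (simp add: power2_eq_square distrib_left)
  ultimately have "3 / 2 * \<kappa> - v * (c\<^sup>2 + 3 / 2 * \<kappa>) \<le> c * Z" by linarith
  moreover have "v * (c\<^sup>2 + 3 / 2 * \<kappa>) \<le> \<kappa> / 2"
  proof -
    have "c * (v * (c + 2 * \<kappa> / c)) \<le> c * (\<kappa> / (2 * c))" using small(2) c by (intro mult_left_mono) auto
    moreover have "c * (v * (c + 2 * \<kappa> / c)) = v * (c\<^sup>2 + 2 * \<kappa>)"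
      using c by (simp add: distrib_left power2_eq_square mult.left_commute)
    moreover have "c * (\<kappa> / (2 * c)) = \<kappa> / 2" using c by simp
    ultimately have "v * (c\<^sup>2 + 2 * \<kappa>) \<le> \<kappa> / 2" by simp
    moreover have "v * (c\<^sup>2 + 3 / 2 * \<kappa>) \<le> v * (c\<^sup>2 + 2 * \<kappa>)" using v \<kappa>_pos by (intro mult_left_mono) auto
    ultimately show ?thesis by linarith
  qed
  ultimately have "\<kappa> \<le> c * Z" by linarith
  then have "\<kappa> / c \<le> Z" using c by (simp add: field_simps)
  also have "Z \<le> b * Q t / F 0 t"
  proof -
    have "(1 - p) * (b * Q t / F 0 t) \<le> 1 * (b * Q t / F 0 t)"
      using p01 b_pos Q0 F_pos[of 0 t] by (intro mult_right_mono) auto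
    then show ?thesis unfolding Z_def by (simp add: mult_ac)
  qed
  finally show ?thesis using F_pos[of 0 t] by (simp add: field_simps)
qed

text \<open>Gronwall's argument with the integrating factor \<open>exp (r * t)\<close>; continuity
  takes care of the end points.\<close>

lemma F_decay:
  assumes \<tau>: "0 < \<tau>" "\<tau> \<le> 1"
    and r: "\<And>t. 0 < t \<Longrightarrow> t < \<tau> \<Longrightarrow> r * F 0 t \<le> p * (1 - p) * \<beta>\<^sup>2 / 2 * slack 0 t"
  shows "F 0 \<tau> \<le> exp (- r * \<tau>) * F 0 0"
proof -
  have "exp (r * \<tau>) * F 0 \<tau> \<le> exp (r * 0) * F 0 0"
  proof (rule DERIV_nonpos_imp_decreasing_open[where f = "\<lambda>t. exp (r * t) * F 0 t"])
    show "0 \<le> \<tau>" using \<tau> by simp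
    show "continuous_on {0..\<tau>} (\<lambda>t. exp (r * t) * F 0 t)"
      by (intro continuous_intros continuous_on_subset[OF F_cont[of 0]]) (use \<tau> in auto)
    fix t assume t: "0 < t" "t < \<tau>"
    have "((\<lambda>t. exp (r * t) * F 0 t) has_real_derivative
        exp (r * t) * (r * F 0 t - p * (1 - p) * \<beta>\<^sup>2 / 2 * slack 0 t)) (at t)"
    proof -
      have "((\<lambda>t. exp (r * t)) has_real_derivative r * exp (r * t)) (at t)"
        by (auto intro!: derivative_eq_intros)
      from DERIV_mult[OF this F_deriv[of 0 t]] show ?thesis
        using t \<tau> by (auto elim!: DERIV_cong simp: algebra_simps)
    qed
    moreover have "exp (r * t) * (r * F 0 t - p * (1 - p) * \<beta>\<^sup>2 / 2 * slack 0 t) \<le> 0"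
      using r[OF t] by (intro mult_nonneg_nonpos) auto
    ultimately show "\<exists>y. ((\<lambda>t. exp (r * t) * F 0 t) has_real_derivative y) (at t) \<and> y \<le> 0" by blast
  qed
  from mult_left_mono[OF this, of "exp (- r * \<tau>)"] show ?thesis
    by (simp add: mult.assoc[symmetric] exp_add[symmetric])
qed

text \<open>The prefactor \<open>p * \<beta>^2\<close> equals \<open>c * b / \<alpha>\<close>, while
  the lower bound for \<open>Q t\<close> carries \<open>1 / b\<close>: the powers of
  \<open>b\<close> cancel, and the rate is linear in \<epsilon> with a constant free of
  \<open>p\<close>. The condition \<open>\<epsilon> * b \<le> 1\<close> keeps \<beta> comparable to
  \<open>1 / \<epsilon>\<close> at most.\<close>

lemma slack_rate:
  assumes t: "0 \<le> t" "t \<le> 1 / 2" and lam: "0 < lam" "4 * lam * sqrt t \<le> 1" "2 * lam * \<epsilon> \<le> 1"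
    and \<epsilon>b: "\<epsilon> * b \<le> 1" and p2: "p \<le> 1 / 2"
    and \<delta>: "0 < \<delta>" "\<delta> * F 0 t \<le> b * Q t"
    and dev: "2 ^ n * exp (c\<^sup>2 * n / 2) * (2 * exp (5 / 2) / lam) ^ m \<le> exp (- real n) * F 0 t"
    and big: "2 * exp (- real n) \<le> \<alpha> * n * \<delta> / (2 * b)"
  shows "(c * \<delta> / (8 * lam * (2 + 3 / sqrt \<alpha>)) * \<epsilon> * n) * F 0 t \<le> p * (1 - p) * \<beta>\<^sup>2 / 2 * slack 0 t"
proof -
  let ?C = "2 + 3 / sqrt \<alpha>"
  have C: "0 < ?C" using \<alpha> by (simp add: add_pos_pos)
  have A: "2 / \<epsilon> + 3 * \<beta> \<le> ?C / \<epsilon>"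
  proof -
    have "3 * \<beta> * \<epsilon> = 3 / sqrt \<alpha> * (\<epsilon> * b)" by (simp add: \<beta>_eq)
    also have "\<dots> \<le> 3 / sqrt \<alpha>" using \<epsilon>b \<alpha> by (intro mult_left_le) auto
    finally have "3 * \<beta> \<le> 3 / sqrt \<alpha> / \<epsilon>" using \<epsilon> by (simp only: pos_le_divide_eq)
    then show ?thesis by (simp add: add_divide_distrib)
  qed
  have "\<alpha> * n * \<delta> / (2 * b) / lam * F 0 t \<le> m / lam * Q t - 2 / lam * (exp (- real n) * F 0 t)"
  proof -
    have "m / lam * (\<delta> / b * F 0 t) \<le> m / lam * Q t"
      using \<delta>(2) b_pos lam by (intro mult_left_mono) (auto simp: field_simps)
    moreover have "2 / lam * (exp (- real n) * F 0 t) = (2 * exp (- real n)) * (F 0 t / lam)" by simp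
    moreover have "(2 * exp (- real n)) * (F 0 t / lam) \<le> \<alpha> * n * \<delta> / (2 * b) * (F 0 t / lam)"
      using big lam F_pos[of 0 t] by (intro mult_right_mono) auto
    moreover have "m / lam * (\<delta> / b * F 0 t) = \<alpha> * n * \<delta> / (2 * b) * (F 0 t / lam) + \<alpha> * n * \<delta> / (2 * b) / lam * F 0 t"
      by (simp add: m_eq field_simps)
    ultimately show ?thesis by linarith
  qed
  also have "\<dots> \<le> m / lam * Q t - 2 / lam * (2 ^ n * exp (c\<^sup>2 * n / 2) * (2 * exp (5 / 2) / lam) ^ m)"
    using dev lam by (intro diff_left_mono mult_left_mono) auto
  also have "\<dots> \<le> (2 / \<epsilon> + 3 * \<beta>) * slack 0 t" by (rule slack_ge[OF t lam])
  also have "\<dots> \<le> ?C / \<epsilon> * slack 0 t" by (intro mult_right_mono A slack_nonneg)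
  finally have S: "\<alpha> * n * \<delta> / (2 * b) / lam * F 0 t * \<epsilon> / ?C \<le> slack 0 t"
    using C \<epsilon> by (rule le_divide_mult_imp)
  have P: "c * b / (4 * \<alpha>) \<le> p * (1 - p) * \<beta>\<^sup>2 / 2"
  proof -
    have "p * (1 - p) * \<beta>\<^sup>2 / 2 = (p * \<beta>) * \<beta> * (1 - p) / 2" by (simp add: power2_eq_square)
    also have "\<dots> = c * b / \<alpha> * ((1 - p) / 2)"
      unfolding p\<beta> unfolding \<beta>_eq using \<alpha> by simp
    also have "\<dots> \<ge> c * b / \<alpha> * (1 / 4)" using p2 c b_pos \<alpha> by (intro mult_left_mono) auto
    finally show ?thesis by simp
  qed
  have "(c * \<delta> / (8 * lam * ?C) * \<epsilon> * n) * F 0 t = c * b / (4 * \<alpha>) * (\<alpha> * n * \<delta> / (2 * b) / lam * F 0 t * \<epsilon> / ?C)"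
    by (rule rate_identity[OF b_pos \<alpha> C lam(1)])
  also have "\<dots> \<le> p * (1 - p) * \<beta>\<^sup>2 / 2 * slack 0 t"
  proof (rule mult_mono[OF P S])
    show "0 \<le> \<alpha> * n * \<delta> / (2 * b) / lam * F 0 t * \<epsilon> / ?C"
      using \<alpha> \<delta>(1) b_pos lam(1) F_pos[of 0 t] \<epsilon> C by (intro divide_nonneg_pos mult_nonneg_nonneg) auto
  qed (use p01 in auto)
  finally show ?thesis .
qed

text \<open>One factor \<open>e\<close> comes from the perturbation of the energy, another from
  \<open>ibp_noise_scale\<close>, summed over the rows with the mean noise controlled by
  \<open>integral_noise_le\<close>. So the change of width costs \<open>e^2\<close> times a constant
  multiple of \<open>1 + b\<close> per dimension, not a multiple of \<open>e\<close>.\<close>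

lemma F_scale_le:
  fixes C :: real
  assumes \<tau>: "0 \<le> \<tau>" "\<tau> \<le> 1 / 2" and e: "0 < e"
    and a: "2 ^ n * (exp (c\<^sup>2 * n / 2) * (2 * exp (1 / 2) * abs_mgf 1) ^ m) \<le> exp (n * C) * F 0 \<tau>"
  shows "F 0 \<tau> \<le> gordon.F m n c p e 0 \<tau> * exp (n * (c / sqrt \<alpha> * e\<^sup>2 * (2 * C + 4 * sqrt \<alpha> * b)))"
proof -
  let ?l = "lin (sc 0 \<tau>)"
  let ?N = "\<lambda>i. \<integral>z. \<bar>z (i, n)\<bar> * \<Phi> (?l z) \<partial>\<gamma>"
  let ?S = "\<Sum>i<m. \<integral>z. \<Phi> (?l z) * avg1 (?l z) (\<lambda>x. 1 - (tanh (?l z i x / e))\<^sup>2) \<partial>\<gamma>"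
  have Fp: "0 < F 0 \<tau>" by (rule F_pos)
  have nl: "sum ?N {..<m} \<le> n * C * F 0 \<tau>"
    using \<tau> a by (intro integral_noise_le) (auto simp: abs_mgf_def)
  have N0: "0 \<le> sum ?N {..<m}"
    by (intro sum_nonneg integral_nonneg_AE AE_I2 mult_nonneg_nonneg less_imp_le[OF \<Phi>_pos]) auto
  have s: "1 / 2 \<le> sqrt (1 - \<tau>)" using \<tau> real_le_rsqrt[of "1/2" "1 - \<tau>"] by (simp add: power2_eq_square)
  have "?S \<le> (\<Sum>i<m. e * (?N i / sqrt (1 - \<tau>) + 4 * \<beta> * F 0 \<tau>))"
    using \<tau> e by (intro sum_mono ibp_noise_scale) auto
  also have "\<dots> = e * (sum ?N {..<m} / sqrt (1 - \<tau>) + m * (4 * \<beta> * F 0 \<tau>))"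
    by (simp add: sum_distrib_left[symmetric] sum.distrib sum_divide_distrib)
  also have "\<dots> \<le> e * (2 * (n * C * F 0 \<tau>) + m * (4 * \<beta> * F 0 \<tau>))"
  proof -
    have "sum ?N {..<m} / sqrt (1 - \<tau>) \<le> sum ?N {..<m} / (1 / 2)"
      using s N0 \<tau> by (intro divide_left_mono) auto
    then show ?thesis using nl e by (intro mult_left_mono add_right_mono) auto
  qed
  also have "\<dots> = e * n * (2 * C + 4 * sqrt \<alpha> * b) * F 0 \<tau>"
  proof -
    have "m * \<beta> = n * (sqrt \<alpha> * b)"
      unfolding \<beta>_eq m_eq using \<alpha> by (simp add: field_simps)
    moreover have "m * (4 * \<beta> * F 0 \<tau>) = 4 * (m * \<beta>) * F 0 \<tau>" by simp
    ultimately have "m * (4 * \<beta> * F 0 \<tau>) = 4 * (n * (sqrt \<alpha> * b)) * F 0 \<tau>" by (simp only:)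
    then show ?thesis by (simp add: algebra_simps)
  qed
  finally have S: "?S / F 0 \<tau> \<le> e * n * (2 * C + 4 * sqrt \<alpha> * b)"
    using Fp by (simp add: pos_divide_le_eq)
  have pe: "0 \<le> p * \<beta> * e" using p01 \<beta>_pos e by simp
  have "- (n * (c / sqrt \<alpha> * e\<^sup>2 * (2 * C + 4 * sqrt \<alpha> * b))) \<le> - (p * \<beta> * e * ?S) / F 0 \<tau>"
    using mult_left_mono[OF S pe] unfolding p\<beta> by (simp add: power2_eq_square mult_ac)
  then have "F 0 \<tau> * exp (- (n * (c / sqrt \<alpha> * e\<^sup>2 * (2 * C + 4 * sqrt \<alpha> * b)))) \<le> F 0 \<tau> * exp (- (p * \<beta> * e * ?S) / F 0 \<tau>)"
    using Fp by (intro mult_left_mono) auto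
  also have "\<dots> \<le> gordon.F m n c p e 0 \<tau>" by (rule F_scale_ge[OF e])
  finally show ?thesis by (simp add: exp_minus field_simps)
qed

end

section \<open>Exponential moments of the min-max value: the plain and the strict bound\<close>

definition comparison_rate :: "real \<Rightarrow> real \<Rightarrow> real" where
  "comparison_rate \<alpha> c = ln (abs_mgf c) + \<alpha> * ln (abs_mgf (- c / sqrt \<alpha>))"

definition exp_moment :: "real \<Rightarrow> nat \<Rightarrow> nat \<Rightarrow> real" where
  "exp_moment c m n = (\<integral>z. exp (- (c * sqrt n) * xi m n (\<lambda>i j. z (i, j))) \<partial>gauss ({..<m} \<times> {..<n}))"

lemma (in gordon_ratio) rate0_eq: "rate0 = comparison_rate \<alpha> c"
  unfolding rate0_def Ag_def comparison_rate_def ..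

lemma (in gordon_ratio) exp_moment_le_F:
  "exp (c\<^sup>2 * n / 2) * exp_moment c m n \<le> exp (n * (c * sqrt \<alpha> * (\<epsilon> * ln 2))) * F 0 1"
proof -
  have "sqrt (n * m) = sqrt \<alpha> * n"
  proof -
    have "real (n * m) = \<alpha> * (real n)\<^sup>2" by (simp add: m_eq power2_eq_square)
    then show ?thesis by (simp only: real_sqrt_mult real_sqrt_abs abs_of_nat)
  qed
  then have e: "c * sqrt (n * m) * (\<epsilon> * ln 2) = n * (c * sqrt \<alpha> * (\<epsilon> * ln 2))" by (simp only: mult_ac)
  have "exp (c\<^sup>2 * n / 2) * exp (- (n * (c * sqrt \<alpha> * (\<epsilon> * ln 2)))) * exp_moment c m n \<le> F 0 1"
    using F_one_ge unfolding e exp_moment_def .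
  from mult_left_mono[OF this, of "exp (n * (c * sqrt \<alpha> * (\<epsilon> * ln 2)))"] show ?thesis
    by (simp add: exp_minus field_simps)
qed

lemma le_of_all_small:
  fixes x y K :: real
  assumes "\<And>d. 0 < d \<Longrightarrow> d < 1 \<Longrightarrow> x \<le> y + K * d" "0 \<le> K"
  shows "x \<le> y"
proof (rule field_le_epsilon)
  fix e :: real assume e: "0 < e"
  define d where "d = min (1 / 2) (e / (K + 1))"
  have d: "0 < d" "d < 1" using e assms(2) by (auto simp: d_def)
  have "K * d \<le> K * (e / (K + 1))" using assms(2) by (intro mult_left_mono) (auto simp: d_def)
  also have "\<dots> \<le> e" using assms(2) e by (simp add: field_simps)
  finally show "x \<le> y + e" using assms(1)[OF d] by simp
qed

text \<open>Power and smoothing width are both set to \<open>d\<close>. All errors in the exponent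
  are at most linear in \<open>d\<close>, and \<open>d\<close> tends to 0 with \<open>n\<close>
  fixed.\<close>

theorem exp_moment_le:
  assumes \<alpha>: "0 < \<alpha>" and c: "0 < c" and n: "0 < n" and m: "real m = \<alpha> * real n"
  shows "exp (c\<^sup>2 * n / 2) * exp_moment c m n \<le> exp (n * comparison_rate \<alpha> c)"
proof -
  have m0: "0 < m" using m \<alpha> n by (metis mult_pos_pos of_nat_0_less_iff)
  have bound: "exp (c\<^sup>2 * n / 2) * exp_moment c m n \<le>
      exp (n * comparison_rate \<alpha> c + (n * (2 / c + c * sqrt \<alpha>)) * d)" if d: "0 < d" "d < 1" for d
  proof -
    interpret G: gordon_ratio m n c d d \<alpha> by unfold_locales (use m0 n c d \<alpha> m in auto)
    have cb: "c \<le> G.b" using c d by (simp add: G.b_def pos_le_divide_eq mult_left_le)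
    have "G.F 0 1 \<le> G.F 0 0" by (intro G.F_antimono) auto
    also have "\<dots> \<le> exp (n * (comparison_rate \<alpha> c + 2 * d\<^sup>2 / c))"
      using G.F_zero_le[OF cb] unfolding G.rate0_eq .
    finally have "exp (n * (c * sqrt \<alpha> * (d * ln 2))) * G.F 0 1 \<le>
        exp (n * (c * sqrt \<alpha> * (d * ln 2))) * exp (n * (comparison_rate \<alpha> c + 2 * d\<^sup>2 / c))"
      by (intro mult_left_mono) auto
    also have "\<dots> \<le> exp (n * comparison_rate \<alpha> c + (n * (2 / c + c * sqrt \<alpha>)) * d)"
    proof -
      have "d\<^sup>2 \<le> d" using d by (simp add: power2_eq_square mult_left_le)
      then have f1: "2 * d\<^sup>2 / c \<le> 2 / c * d" using c by (simp add: divide_right_mono)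
      have f2: "c * sqrt \<alpha> * (d * ln 2) \<le> c * sqrt \<alpha> * (d * 1)"
        using c \<alpha> d ln_2_less_1 by (intro mult_left_mono) auto
      have "n * (c * sqrt \<alpha> * (d * ln 2)) + n * (2 * d\<^sup>2 / c) \<le> n * (c * sqrt \<alpha> * (d * 1)) + n * (2 / c * d)"
        by (intro add_mono mult_left_mono[OF f1] mult_left_mono[OF f2]) auto
      then show ?thesis unfolding exp_add[symmetric] by (simp add: algebra_simps)
    qed
    finally show ?thesis using G.exp_moment_le_F by linarith
  qed
  let ?X = "exp (c\<^sup>2 * n / 2) * exp_moment c m n"
  show ?thesis
  proof (cases "0 < ?X")
    case True
    have "ln ?X \<le> n * comparison_rate \<alpha> c"
    proof (rule le_of_all_small[where K = "n * (2 / c + c * sqrt \<alpha>)"])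
      fix d :: real assume "0 < d" "d < 1"
      from ln_mono[OF bound[OF this]] True
      show "ln ?X \<le> n * comparison_rate \<alpha> c + n * (2 / c + c * sqrt \<alpha>) * d" by simp
    qed (use c \<alpha> in auto)
    then have "exp (ln ?X) \<le> exp (n * comparison_rate \<alpha> c)" by simp
    then show ?thesis using True by simp
  next
    case False
    then show ?thesis using exp_ge_zero[of "n * comparison_rate \<alpha> c"] by linarith
  qed
qed

text \<open>If the process of width \<open>e\<close> is not yet exponentially small at \<tau>, then
  changing the width to \<epsilon> at that time and monotonicity in \<open>t\<close> keep the
  process of width \<epsilon> large on all of \<open>{0..\<tau>}\<close>. There susceptibility and
  slack are bounded below, and Gronwall yields decay at rate \<open>C9 * \<epsilon>\<close> per
  dimension. The term \<open>C6 * \<epsilon> * \<eta>\<close> pays for the change of width.\<close>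

lemma F_tau_le:
  fixes \<alpha> c p e \<epsilon> \<eta> \<kappa> R b v C4 C5 C6 C9 lam \<tau> \<epsilon>0 :: real and m n :: nat
  defines "\<kappa> \<equiv> c * exp (- c\<^sup>2 / 2) / 6" and "R \<equiv> comparison_rate \<alpha> c" and "b \<equiv> c / p"
  assumes \<alpha>: "0 < \<alpha>" and c: "0 < c" and n: "0 < n" and m: "real m = \<alpha> * real n"
    and p: "0 < p" "p \<le> 1 / 2" "p \<le> c" and e: "0 < e"
    and \<eta>: "0 < \<eta>" "\<eta> \<le> 1" and \<epsilon>: "\<epsilon> = \<eta> / b"
    and v: "0 < v" "v \<le> 1 / 4" "v * (c + 2 * \<kappa> / c) \<le> \<kappa> / (2 * c)"
    and C4: "- C4 \<le> R - 1"
    and C5: "0 \<le> C5" "2 ^ n * (exp (c\<^sup>2 * n / 2) * (2 * exp (1 / 2) * abs_mgf 1) ^ m) \<le> exp (n * C5) * exp (- real n * C4)"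
    and lam: "0 < lam" "2 * lam * \<epsilon> \<le> 1" "2 ^ n * exp (c\<^sup>2 * n / 2) * (2 * exp (5 / 2) / lam) ^ m \<le> exp (- real n) * exp (- real n * C4)"
    and \<tau>: "0 < \<tau>" "\<tau> \<le> 1 / 4" "4 * lam * sqrt \<tau> \<le> 1"
    and C6: "C6 = c / sqrt \<alpha> * (2 * C5 + 4 * sqrt \<alpha>)"
    and C9: "C9 = c * (\<kappa> / c) / (8 * lam * (2 + 3 / sqrt \<alpha>))"
    and \<epsilon>0: "0 < \<epsilon>0" "\<epsilon>0 + C6 * \<epsilon> * \<eta> \<le> 1" "p * ln 2 + (\<epsilon>0 + C6 * \<epsilon> * \<eta>) \<le> v * \<kappa> / 4"
    and big: "2 * exp (- real n) \<le> \<alpha> * n * (\<kappa> / c) / (2 * b)"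
  shows "gordon.F m n c p e 0 \<tau> \<le> exp (n * (R - \<epsilon>0)) \<or>
    gordon.F m n c p e 0 \<tau> \<le> exp (n * (R + 2 * p\<^sup>2 / c - C9 * \<epsilon> * \<tau> + C6 * \<epsilon> * \<eta>))"
proof (cases "gordon.F m n c p e 0 \<tau> \<le> exp (n * (R - \<epsilon>0))")
  case False
  have m0: "0 < m" using m \<alpha> n by (metis mult_pos_pos of_nat_0_less_iff)
  have b0: "0 < b" "1 \<le> b" using c p by (auto simp: b_def)
  have e0: "0 < \<epsilon>" using \<epsilon> \<eta> b0 by simp
  have p1: "p < 1" using p by simp
  \<comment> \<open>\<open>D\<close> has the width \<open>e\<close> of the comparison with the
    min-max value, \<open>G\<close> the width \<epsilon> at which the decay is proved.\<close>
  interpret D: gordon_ratio m n c p e \<alpha> by unfold_locales (use m0 n c p e \<alpha> m in auto)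
  interpret G: gordon_ratio m n c p \<epsilon> \<alpha> by unfold_locales (use m0 n c p e0 \<alpha> m in auto)
  have bb: "D.b = b" "G.b = b" by (simp_all add: D.b_def G.b_def b_def)
  have \<kappa>\<kappa>: "G.\<kappa> = \<kappa>" by (simp add: G.\<kappa>_def \<kappa>_def)
  have RR: "G.rate0 = R" by (simp add: G.rate0_eq R_def)
  have \<kappa>0: "0 < \<kappa>" using c by (simp add: \<kappa>_def)
  have \<epsilon>b: "\<epsilon> * b = \<eta>" using \<epsilon> b0 by simp
  have C60: "0 \<le> C6 * \<epsilon> * \<eta>" using C6 c \<alpha> C5 e0 \<eta> by simp
  have DF: "exp (n * (R - \<epsilon>0)) \<le> D.F 0 \<tau>" using False by simp
  have lower: "exp (- real n * C4) \<le> exp (n * (R - \<epsilon>1))" if "\<epsilon>1 \<le> 1" for \<epsilon>1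
  proof -
    have "n * (- C4) \<le> n * (R - \<epsilon>1)" using C4 that by (intro mult_left_mono) auto
    then show ?thesis by simp
  qed
  have D4: "exp (- real n * C4) \<le> D.F 0 \<tau>"
    using lower[of \<epsilon>0] \<epsilon>0 C60 DF by linarith
  have "D.F 0 \<tau> \<le> gordon.F m n c p \<epsilon> 0 \<tau> * exp (n * (c / sqrt \<alpha> * \<epsilon>\<^sup>2 * (2 * C5 + 4 * sqrt \<alpha> * D.b)))"
  proof (rule D.F_scale_le)
    show "2 ^ n * (exp (c\<^sup>2 * n / 2) * (2 * exp (1 / 2) * abs_mgf 1) ^ m) \<le> exp (n * C5) * D.F 0 \<tau>"
      by (rule order_trans[OF C5(2) mult_left_mono[OF D4]]) simp
  qed (use \<tau> e0 in auto)
  also have "\<dots> \<le> gordon.F m n c p \<epsilon> 0 \<tau> * exp (n * (C6 * \<epsilon> * \<eta>))"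
  proof -
    have "c / sqrt \<alpha> * \<epsilon>\<^sup>2 * (2 * C5 + 4 * sqrt \<alpha> * b) \<le> c / sqrt \<alpha> * \<epsilon>\<^sup>2 * ((2 * C5 + 4 * sqrt \<alpha>) * b)"
    proof -
      have "2 * C5 * 1 \<le> 2 * C5 * b" using C5 b0 by (intro mult_left_mono) auto
      then show ?thesis using c \<alpha> by (intro mult_left_mono) (auto simp: distrib_right)
    qed
    also have "\<dots> = C6 * \<epsilon> * (\<epsilon> * b)" unfolding C6 by (simp add: power2_eq_square mult_ac)
    also have "\<dots> = C6 * \<epsilon> * \<eta>" unfolding \<epsilon>b ..
    finally have "n * (c / sqrt \<alpha> * \<epsilon>\<^sup>2 * (2 * C5 + 4 * sqrt \<alpha> * b)) \<le> n * (C6 * \<epsilon> * \<eta>)"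
      by (rule mult_left_mono) simp
    then have "exp (n * (c / sqrt \<alpha> * \<epsilon>\<^sup>2 * (2 * C5 + 4 * sqrt \<alpha> * b))) \<le> exp (n * (C6 * \<epsilon> * \<eta>))"
      by (simp only: exp_le_cancel_iff)
    then show ?thesis unfolding bb by (rule mult_left_mono[OF _ less_imp_le[OF G.F_pos]])
  qed
  finally have scale: "D.F 0 \<tau> \<le> G.F 0 \<tau> * exp (n * (C6 * \<epsilon> * \<eta>))" .
  have GF: "exp (n * (R - (\<epsilon>0 + C6 * \<epsilon> * \<eta>))) \<le> G.F 0 t" if "0 \<le> t" "t \<le> \<tau>" for t
  proof -
    have "exp (n * (R - \<epsilon>0)) \<le> G.F 0 \<tau> * exp (n * (C6 * \<epsilon> * \<eta>))" using DF scale by linarith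
    then have "exp (n * (R - \<epsilon>0)) * exp (- (n * (C6 * \<epsilon> * \<eta>))) \<le> G.F 0 \<tau>"
      by (simp add: exp_minus field_simps)
    also have "G.F 0 \<tau> \<le> G.F 0 t" using that \<tau> by (intro G.F_antimono) auto
    finally show ?thesis unfolding exp_add[symmetric] by (simp add: algebra_simps)
  qed
  have "G.F 0 \<tau> \<le> exp (- (C9 * \<epsilon> * n) * \<tau>) * G.F 0 0"
  proof (rule G.F_decay)
    fix t assume t: "0 < t" "t < \<tau>"
    have sus: "\<kappa> / c * G.F 0 t \<le> G.b * G.Q t"
      unfolding \<kappa>\<kappa>[symmetric]
      by (rule G.susceptibility_ge[where v = v and ?\<epsilon>1.0 = "\<epsilon>0 + C6 * \<epsilon> * \<eta>"])
         (use t \<tau> v \<epsilon>0 GF[of t] in \<open>auto simp: \<kappa>\<kappa> RR\<close>)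
    have F4: "exp (- real n * C4) \<le> G.F 0 t" using lower[OF \<epsilon>0(2)] GF[of t] t by linarith
    have "4 * lam * sqrt t \<le> 4 * lam * sqrt \<tau>" using lam t by (intro mult_left_mono) auto
    with \<tau> have lt: "4 * lam * sqrt t \<le> 1" by linarith
    show "C9 * \<epsilon> * n * G.F 0 t \<le> p * (1 - p) * G.\<beta>\<^sup>2 / 2 * G.slack 0 t"
      unfolding C9
    proof (rule G.slack_rate)
      show "2 ^ n * exp (c\<^sup>2 * n / 2) * (2 * exp (5 / 2) / lam) ^ m \<le> exp (- real n) * G.F 0 t"
        by (rule order_trans[OF lam(3) mult_left_mono[OF F4]]) simp
    qed (use t \<tau> lam lt p \<kappa>0 c sus big \<eta> \<epsilon>b in \<open>auto simp: bb\<close>)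
  qed (use \<tau> in auto)
  also have "\<dots> \<le> exp (- (C9 * \<epsilon> * n) * \<tau>) * exp (n * (R + 2 * p\<^sup>2 / c))"
  proof (rule mult_left_mono)
    have "c \<le> G.b" using c p by (simp add: bb b_def pos_le_divide_eq mult_left_le)
    then show "G.F 0 0 \<le> exp (n * (R + 2 * p\<^sup>2 / c))" using G.F_zero_le unfolding RR by blast
  qed simp
  finally have "G.F 0 \<tau> * exp (n * (C6 * \<epsilon> * \<eta>)) \<le> exp (- (C9 * \<epsilon> * n) * \<tau>) * exp (n * (R + 2 * p\<^sup>2 / c)) * exp (n * (C6 * \<epsilon> * \<eta>))"
    by (rule mult_right_mono) simp
  also have "\<dots> = exp (n * (R + 2 * p\<^sup>2 / c - C9 * \<epsilon> * \<tau> + C6 * \<epsilon> * \<eta>))"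
    unfolding exp_add[symmetric] by (simp add: algebra_simps)
  finally show ?thesis using scale by linarith
qed simp

text \<open>The order of the constants avoids circularity: all up to \<open>\<epsilon>0\<close>
  depend on \<alpha> and \<open>c\<close> alone; then \<open>p\<close> is taken small, which fixes
  \<open>b\<close> and \<open>\<epsilon> = \<eta> / b\<close>; the width \<open>e\<close> and the
  threshold \<open>N\<close> come last.\<close>

theorem exp_moment_strict:
  fixes \<alpha> c :: real
  assumes \<alpha>: "0 < \<alpha>" and c: "0 < c"
  obtains \<gamma> :: real and N :: nat where "0 < \<gamma>"
    "\<And>n m. N \<le> n \<Longrightarrow> 0 < n \<Longrightarrow> real m = \<alpha> * real n \<Longrightarrow>
      exp (c\<^sup>2 * n / 2) * exp_moment c m n \<le> exp (n * (comparison_rate \<alpha> c - \<gamma>))"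
proof -
  define R where "R = comparison_rate \<alpha> c"
  define \<kappa> where "\<kappa> = c * exp (- c\<^sup>2 / 2) / 6"
  have \<kappa>: "0 < \<kappa>" using c by (simp add: \<kappa>_def)
  \<comment> \<open>Small enough that the errors of second order in \<open>v\<close> leave a fixed
    part of the surplus \<open>\<kappa>\<close>.\<close>
  define v where "v = min (1 / 4) (\<kappa> / (2 * c) / (c + 2 * \<kappa> / c))"
  have cv: "0 < c + 2 * \<kappa> / c" using c \<kappa> by (simp add: add_pos_pos)
  have v: "0 < v" "v \<le> 1 / 4" "v * (c + 2 * \<kappa> / c) \<le> \<kappa> / (2 * c)"
  proof -
    show "0 < v" using c \<kappa> cv by (simp add: v_def)
    show "v \<le> 1 / 4" unfolding v_def by (rule min.cobounded1)
    have "v \<le> \<kappa> / (2 * c) / (c + 2 * \<kappa> / c)" unfolding v_def by (rule min.cobounded2)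
    then show "v * (c + 2 * \<kappa> / c) \<le> \<kappa> / (2 * c)" using cv by (simp only: pos_le_divide_eq)
  qed
  define C4 where "C4 = 1 + \<bar>R\<bar>"
  have C4: "- C4 \<le> R - 1" by (simp add: C4_def)
  define C5 where "C5 = ln 2 + c\<^sup>2 / 2 + \<alpha> * ln (2 * exp (1 / 2) * abs_mgf 1) + C4"
  have M: "1 \<le> 2 * exp (1 / 2) * abs_mgf 1"
  proof -
    have "1 * 1 \<le> (2 * exp (1 / 2)) * abs_mgf 1"
    proof (rule mult_mono)
      show "1 \<le> 2 * exp (1 / 2 :: real)" using exp_ge_add_one_self[of "1 / 2 :: real"] by linarith
    qed (use abs_mgf_ge_1[of 1] in auto)
    then show ?thesis by simp
  qed
  have C50: "0 \<le> C5" unfolding C5_def using \<alpha> M by (intro add_nonneg_nonneg mult_nonneg_nonneg) (auto simp: C4_def)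
  \<comment> \<open>Makes \<open>(2 * exp (5 / 2) / lam) ^ m\<close> equal to
    \<open>exp (- n * (ln 2 + c^2 / 2 + C4 + 1))\<close>: this cancels the number
    \<open>2 ^ n\<close> of states and the moment \<open>exp (c^2 * n / 2)\<close>, and it leaves a
    further \<open>exp (- n)\<close> relative to the lower bound \<open>exp (- n * C4)\<close> for
    the process.\<close>
  define K where "K = (ln 2 + c\<^sup>2 / 2 + C4 + 1) / \<alpha>"
  define lam where "lam = 2 * exp (5 / 2) * exp K"
  have lam: "0 < lam" by (simp add: lam_def)
  define \<tau> where "\<tau> = min (1 / 4) ((1 / (4 * lam))\<^sup>2)"
  have \<tau>: "0 < \<tau>" "\<tau> \<le> 1 / 4" "4 * lam * sqrt \<tau> \<le> 1"
  proof -
    show "0 < \<tau>" using lam by (simp add: \<tau>_def)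
    show "\<tau> \<le> 1 / 4" unfolding \<tau>_def by (rule min.cobounded1)
    have "sqrt \<tau> \<le> sqrt ((1 / (4 * lam))\<^sup>2)" unfolding \<tau>_def by (intro real_sqrt_le_mono min.cobounded2)
    also have "\<dots> = 1 / (4 * lam)" using lam by simp
    finally show "4 * lam * sqrt \<tau> \<le> 1" using lam by (simp add: field_simps)
  qed
  define C6 where "C6 = c / sqrt \<alpha> * (2 * C5 + 4 * sqrt \<alpha>)"
  have C6: "0 < C6" unfolding C6_def using c \<alpha> C50 by (intro mult_pos_pos divide_pos_pos add_nonneg_pos) auto
  define C9 where "C9 = c * (\<kappa> / c) / (8 * lam * (2 + 3 / sqrt \<alpha>))"
  have C9: "0 < C9" unfolding C9_def using c \<kappa> lam \<alpha> by (intro divide_pos_pos mult_pos_pos add_pos_pos) auto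
  \<comment> \<open>At most half of the decay \<open>C9 * \<tau>\<close> is given away to the cost
    \<open>C6 * \<eta>\<close> of changing the width.\<close>
  define \<eta> where "\<eta> = min 1 (C9 * \<tau> / (2 * C6))"
  have \<eta>: "0 < \<eta>" "\<eta> \<le> 1" using C6 C9 \<tau> by (auto simp: \<eta>_def)
  have \<eta>6: "C6 * \<eta> \<le> C9 * \<tau> / 2"
  proof -
    have "C6 * \<eta> \<le> C6 * (C9 * \<tau> / (2 * C6))" unfolding \<eta>_def using C6 by (intro mult_left_mono min.cobounded2) auto
    then show ?thesis using C6 by simp
  qed
  define \<epsilon>0 where "\<epsilon>0 = min (1 / 2) (v * \<kappa> / 16)"
  have \<epsilon>0: "0 < \<epsilon>0" "\<epsilon>0 \<le> 1 / 2" "\<epsilon>0 \<le> v * \<kappa> / 16"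
    using v \<kappa> unfolding \<epsilon>0_def by (auto simp only: min_less_iff_conj min_le_iff_disj) auto
  \<comment> \<open>\<open>p \<le> c\<close> yields \<open>1 \<le> b\<close>; the bound with
    \<open>lam\<close> yields \<open>2 * lam * \<epsilon> \<le> 1\<close>; the one with
    \<open>C9\<close> makes \<open>2 * p^2 / c\<close> at most half of the decay left after the
    change of width; the last two keep \<open>p * ln 2\<close> and
    \<open>C6 * \<epsilon> * \<eta>\<close> below \<open>\<epsilon>0\<close>.\<close>
  define p where "p = min (min (min (1 / 2) c) (min (c / (2 * lam)) (C9 * \<tau> * \<eta> / 8))) (min \<epsilon>0 (c * \<epsilon>0 / C6))"
  have p: "0 < p" "p \<le> 1 / 2" "p \<le> c" "p \<le> c / (2 * lam)" "p \<le> C9 * \<tau> * \<eta> / 8" "p \<le> \<epsilon>0" "p \<le> c * \<epsilon>0 / C6"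
  proof -
    show "0 < p" using c lam C9 C6 \<tau> \<eta> \<epsilon>0 by (simp add: p_def)
    show "p \<le> 1 / 2" "p \<le> c" "p \<le> c / (2 * lam)" "p \<le> C9 * \<tau> * \<eta> / 8" "p \<le> \<epsilon>0" "p \<le> c * \<epsilon>0 / C6"
      unfolding p_def by (simp_all only: min_le_iff_disj order_refl simp_thms)
  qed
  define b where "b = c / p"
  define \<epsilon> where "\<epsilon> = \<eta> / b"
  have \<epsilon>p: "\<epsilon> = \<eta> * p / c" using p c by (simp add: \<epsilon>_def b_def)
  have \<epsilon>: "0 < \<epsilon>" using \<epsilon>p \<eta> p c by simp
  have \<epsilon>le: "\<epsilon> \<le> p / c"
  proof -
    have "\<eta> * p \<le> 1 * p" using \<eta> p by (intro mult_right_mono) auto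
    then show ?thesis unfolding \<epsilon>p using c by (intro divide_right_mono) auto
  qed
  have lame: "2 * lam * \<epsilon> \<le> 1"
  proof -
    have "2 * lam * \<epsilon> \<le> 2 * lam * (p / c)" using lam \<epsilon>le by (intro mult_left_mono) auto
    also have "\<dots> \<le> 2 * lam * (c / (2 * lam) / c)" using p lam c by (intro mult_left_mono divide_right_mono) auto
    also have "\<dots> = 1" using lam c by simp
    finally show ?thesis .
  qed
  have C6e: "C6 * \<epsilon> * \<eta> \<le> \<epsilon>0"
  proof -
    have "C6 * \<epsilon> * \<eta> \<le> C6 * \<epsilon> * 1" using C6 \<epsilon> \<eta> by (intro mult_left_mono) auto
    also have "\<dots> \<le> C6 * (c * \<epsilon>0 / C6 / c) * 1"
      using \<epsilon>le p(7) c C6 by (intro mult_right_mono mult_left_mono order_trans[OF \<epsilon>le] divide_right_mono) auto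
    also have "\<dots> = \<epsilon>0" using C6 c by simp
    finally show ?thesis .
  qed
  have e1: "\<epsilon>0 + C6 * \<epsilon> * \<eta> \<le> 1" using C6e \<epsilon>0 by linarith
  have e2: "p * ln 2 + (\<epsilon>0 + C6 * \<epsilon> * \<eta>) \<le> v * \<kappa> / 4"
  proof -
    have "p * ln 2 \<le> p * 1" using p ln_2_less_1 by (intro mult_left_mono) auto
    moreover have "0 < v * \<kappa>" using v \<kappa> by simp
    ultimately show ?thesis using p(6) C6e \<epsilon>0 by linarith
  qed
  define \<gamma>1 where "\<gamma>1 = min \<epsilon>0 (p * (C9 * \<tau> * \<eta> / (4 * c)))"
  have \<gamma>1: "0 < \<gamma>1" using \<epsilon>0 p C9 \<tau> \<eta> c by (simp add: \<gamma>1_def)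
  have gain: "2 * p\<^sup>2 / c - C9 * \<epsilon> * \<tau> + C6 * \<epsilon> * \<eta> \<le> - \<gamma>1"
  proof -
    have "2 * p\<^sup>2 / c = p * (2 * p / c)" by (simp add: power2_eq_square)
    also have "\<dots> \<le> p * (2 * (C9 * \<tau> * \<eta> / 8) / c)" using p c by (intro mult_left_mono divide_right_mono) auto
    finally have 1: "2 * p\<^sup>2 / c \<le> p * (C9 * \<tau> * \<eta> / (4 * c))" by (simp add: mult_ac)
    have "C6 * \<epsilon> * \<eta> = \<epsilon> * (C6 * \<eta>)" by simp
    also have "\<dots> \<le> \<epsilon> * (C9 * \<tau> / 2)" using \<eta>6 \<epsilon> by (intro mult_left_mono) auto
    finally have 2: "C6 * \<epsilon> * \<eta> - C9 * \<epsilon> * \<tau> \<le> - (C9 * \<epsilon> * \<tau> / 2)" by (simp add: mult_ac)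
    have 3: "C9 * \<epsilon> * \<tau> / 2 = 2 * (p * (C9 * \<tau> * \<eta> / (4 * c)))" unfolding \<epsilon>p by (simp add: field_simps)
    have "\<gamma>1 \<le> p * (C9 * \<tau> * \<eta> / (4 * c))" unfolding \<gamma>1_def by (rule min.cobounded2)
    then show ?thesis using 1 2 3 by linarith
  qed
  \<comment> \<open>The pointwise smoothing cost at \<open>t = 1\<close> then takes at most half of
    the gain \<open>\<gamma>1\<close>.\<close>
  define e where "e = \<gamma>1 / (2 * (c * sqrt \<alpha>))"
  have e: "0 < e" using \<gamma>1 c \<alpha> by (simp add: e_def)
  have ce: "c * sqrt \<alpha> * (e * ln 2) \<le> \<gamma>1 / 2"
  proof -
    have "c * sqrt \<alpha> * (e * ln 2) \<le> c * sqrt \<alpha> * (e * 1)" using c \<alpha> e ln_2_less_1 by (intro mult_left_mono) auto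
    also have "\<dots> = \<gamma>1 / 2" using c \<alpha> by (simp add: e_def)
    finally show ?thesis .
  qed
  \<comment> \<open>Makes \<open>exp (- n)\<close> small against \<open>1 / b\<close>, so it can
    only be chosen after \<open>p\<close>.\<close>
  define N where "N = nat \<lceil>4 * b * c / (\<alpha> * \<kappa>)\<rceil>"
  show ?thesis
  proof (rule that[of "\<gamma>1 / 2" N])
    show "0 < \<gamma>1 / 2" using \<gamma>1 by simp
    fix n m :: nat
    assume nN: "N \<le> n" and n: "0 < n" and m: "real m = \<alpha> * real n"
    have m0: "0 < m" using m \<alpha> n by (metis mult_pos_pos of_nat_0_less_iff)
    have pow: "x ^ m = exp (n * (\<alpha> * ln x))" if "0 < x" for x :: real
    proof -
      have "x ^ m = exp (m * ln x)" using that by (simp add: exp_of_nat_mult)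
      then show ?thesis by (simp add: m mult_ac)
    qed
    have two: "(2 :: real) ^ n = exp (n * ln 2)" by (simp add: exp_of_nat_mult)
    have D5: "2 ^ n * (exp (c\<^sup>2 * n / 2) * (2 * exp (1 / 2) * abs_mgf 1) ^ m) \<le> exp (n * C5) * exp (- real n * C4)"
    proof -
      have "2 ^ n * (exp (c\<^sup>2 * n / 2) * (2 * exp (1 / 2) * abs_mgf 1) ^ m) =
          exp (n * ln 2 + (c\<^sup>2 * n / 2 + n * (\<alpha> * ln (2 * exp (1 / 2) * abs_mgf 1))))"
      proof -
        have "0 < 2 * exp (1 / 2) * abs_mgf 1" using M by linarith
        from pow[OF this] show ?thesis unfolding exp_add two by simp
      qed
      also have "n * ln 2 + (c\<^sup>2 * n / 2 + n * (\<alpha> * ln (2 * exp (1 / 2) * abs_mgf 1))) = n * C5 + - real n * C4"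
        unfolding C5_def by (simp add: algebra_simps)
      finally show ?thesis by (simp only: exp_add)
    qed
    have D6: "2 ^ n * exp (c\<^sup>2 * n / 2) * (2 * exp (5 / 2) / lam) ^ m \<le> exp (- real n) * exp (- real n * C4)"
    proof -
      have "2 * exp (5 / 2) / lam = exp (- K)" unfolding lam_def by (simp add: exp_minus field_simps)
      then have "(2 * exp (5 / 2) / lam) ^ m = exp (n * (\<alpha> * (- K)))" by (simp add: pow)
      also have "\<alpha> * (- K) = - (ln 2 + c\<^sup>2 / 2 + C4 + 1)" using \<alpha> by (simp add: K_def)
      finally have "2 ^ n * exp (c\<^sup>2 * n / 2) * (2 * exp (5 / 2) / lam) ^ m =
          exp (n * ln 2 + c\<^sup>2 * n / 2 + n * - (ln 2 + c\<^sup>2 / 2 + C4 + 1))"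
        unfolding exp_add two by simp
      also have "n * ln 2 + c\<^sup>2 * n / 2 + n * - (ln 2 + c\<^sup>2 / 2 + C4 + 1) = - real n + - real n * C4"
        by (simp add: algebra_simps)
      finally show ?thesis by (simp only: exp_add)
    qed
    have big: "2 * exp (- real n) \<le> \<alpha> * n * (\<kappa> / c) / (2 * b)"
    proof -
      have b0: "0 < b" using c p by (simp add: b_def)
      have "4 * b * c / (\<alpha> * \<kappa>) \<le> real N" unfolding N_def by (rule of_nat_ceiling)
      also have "\<dots> \<le> real n" using nN by simp
      also have "\<dots> \<le> exp (real n)" using exp_ge_add_one_self[of "real n"] by linarith
      finally have "4 * b * c / (\<alpha> * \<kappa>) * exp (- real n) \<le> exp (real n) * exp (- real n)"
        by (rule mult_right_mono) simp
      then have "4 * b * c / (\<alpha> * \<kappa>) * exp (- real n) \<le> 1" by (simp add: exp_add[symmetric])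
      then have "2 * exp (- real n) \<le> \<alpha> * \<kappa> / (2 * b * c)"
        using b0 c \<alpha> \<kappa> by (simp add: field_simps)
      also have "\<dots> \<le> n * (\<alpha> * \<kappa> / (2 * b * c))"
      proof -
        have "1 * (\<alpha> * \<kappa> / (2 * b * c)) \<le> n * (\<alpha> * \<kappa> / (2 * b * c))"
          using n b0 c \<alpha> \<kappa> by (intro mult_right_mono) auto
        then show ?thesis by simp
      qed
      finally show ?thesis by (simp add: field_simps)
    qed
    have F: "gordon.F m n c p e 0 \<tau> \<le> exp (n * (R - \<epsilon>0)) \<or>
      gordon.F m n c p e 0 \<tau> \<le> exp (n * (R + 2 * p\<^sup>2 / c - C9 * \<epsilon> * \<tau> + C6 * \<epsilon> * \<eta>))"
      by (rule F_tau_le[where c = c and p = p and \<alpha> = \<alpha> and n = n and m = m and \<epsilon> = \<epsilon> and \<eta> = \<eta>, folded \<kappa>_def b_def R_def,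
            OF \<alpha> c n m p(1-3) e \<eta> \<epsilon>_def v C4 C50 D5 lam lame D6 \<tau> C6_def C9_def \<epsilon>0(1) e1 e2 big])
    have F\<tau>: "gordon.F m n c p e 0 \<tau> \<le> exp (n * (R - \<gamma>1))"
      using F
    proof
      assume "gordon.F m n c p e 0 \<tau> \<le> exp (n * (R - \<epsilon>0))"
      moreover have "n * (R - \<epsilon>0) \<le> n * (R - \<gamma>1)" by (intro mult_left_mono diff_left_mono) (auto simp: \<gamma>1_def)
      ultimately show ?thesis by (meson exp_le_cancel_iff order_trans)
    next
      assume "gordon.F m n c p e 0 \<tau> \<le> exp (n * (R + 2 * p\<^sup>2 / c - C9 * \<epsilon> * \<tau> + C6 * \<epsilon> * \<eta>))"
      moreover have "n * (R + 2 * p\<^sup>2 / c - C9 * \<epsilon> * \<tau> + C6 * \<epsilon> * \<eta>) \<le> n * (R - \<gamma>1)"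
        using gain by (intro mult_left_mono) auto
      ultimately show ?thesis by (meson exp_le_cancel_iff order_trans)
    qed
    interpret D: gordon_ratio m n c p e \<alpha> by unfold_locales (use m0 n c p e \<alpha> m in auto)
    have "exp (c\<^sup>2 * n / 2) * exp_moment c m n \<le> exp (n * (c * sqrt \<alpha> * (e * ln 2))) * D.F 0 1"
      by (rule D.exp_moment_le_F)
    also have "\<dots> \<le> exp (n * (\<gamma>1 / 2)) * exp (n * (R - \<gamma>1))"
    proof (rule mult_mono)
      show "exp (n * (c * sqrt \<alpha> * (e * ln 2))) \<le> exp (n * (\<gamma>1 / 2))"
        using ce n by (simp add: mult_left_mono del: mult_le_cancel_left_pos)
      have "D.F 0 1 \<le> D.F 0 \<tau>" using \<tau> by (intro D.F_antimono) auto
      with F\<tau> show "D.F 0 1 \<le> exp (n * (R - \<gamma>1))" by linarith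
    qed (use D.F_pos[of 0 1] in auto)
    also have "\<dots> = exp (n * (R - \<gamma>1 / 2))" unfolding exp_add[symmetric] by (simp add: algebra_simps)
    finally show "exp (c\<^sup>2 * n / 2) * exp_moment c m n \<le> exp (n * (comparison_rate \<alpha> c - \<gamma>1 / 2))"
      unfolding R_def .
  qed
qed


subsection \<open>The lifted objective\<close>

text \<open>This is \<open>c\<close> times the objective. It is differentiable at 0 and vanishes
  there, so the limit of the objective at 0 becomes a derivative.\<close>

definition lift_num :: "real \<Rightarrow> real \<Rightarrow> real" where
  "lift_num \<alpha> c = - c\<^sup>2 / 2 - ln (erfc (- c / sqrt 2)) - \<alpha> * ln (erfc (c / sqrt (2 * \<alpha>)))"

lemma lift_expr_eq: "c \<noteq> 0 \<Longrightarrow> lift_expr \<alpha> c = lift_num \<alpha> c / c"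
  unfolding lift_expr_def lift_num_def by (simp add: diff_divide_distrib power2_eq_square)

definition haz1 :: "real \<Rightarrow> real" where
  "haz1 c = sqrt (2 / pi) * exp (- c\<^sup>2 / 2) / erfc (- c / sqrt 2)"

text \<open>\<alpha> times the hazard rate at \<open>c\<close> of the modulus of a centred normal
  variable with variance \<alpha>.\<close>

definition haz2 :: "real \<Rightarrow> real \<Rightarrow> real" where
  "haz2 \<alpha> c = sqrt \<alpha> * (sqrt (2 / pi) * exp (- c\<^sup>2 / (2 * \<alpha>))) / erfc (c / sqrt (2 * \<alpha>))"

lemma two_div_sqrt_pi: "2 / sqrt pi = sqrt 2 * sqrt (2 / pi)"
  by (simp add: real_sqrt_divide real_sqrt_mult[symmetric])

lemma erfc_left_deriv:
  "((\<lambda>c. erfc (- c / sqrt 2)) has_real_derivative sqrt (2 / pi) * exp (- c\<^sup>2 / 2)) (at c)"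
proof -
  have "((\<lambda>c. erfc (- c / sqrt 2)) has_real_derivative
      - 2 / sqrt pi * exp (- (- c / sqrt 2)\<^sup>2) * (- 1 / sqrt 2)) (at c)"
    by (rule DERIV_chain2[OF erfc_deriv DERIV_cdivide[OF DERIV_minus[OF DERIV_ident]]])
  also have "- 2 / sqrt pi * exp (- (- c / sqrt 2)\<^sup>2) * (- 1 / sqrt 2) = (2 / sqrt pi) / sqrt 2 * exp (- c\<^sup>2 / 2)"
    by (simp add: power_divide)
  finally show ?thesis unfolding two_div_sqrt_pi by simp
qed

lemma erfc_right_deriv:
  assumes "0 < \<alpha>"
  shows "((\<lambda>c. erfc (c / sqrt (2 * \<alpha>))) has_real_derivative
    - (sqrt (2 / pi) / sqrt \<alpha>) * exp (- c\<^sup>2 / (2 * \<alpha>))) (at c)"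
proof -
  have "((\<lambda>c. erfc (c / sqrt (2 * \<alpha>))) has_real_derivative
      - 2 / sqrt pi * exp (- (c / sqrt (2 * \<alpha>))\<^sup>2) * (1 / sqrt (2 * \<alpha>))) (at c)"
    by (rule DERIV_chain2[OF erfc_deriv DERIV_cdivide[OF DERIV_ident]])
  also have "- 2 / sqrt pi * exp (- (c / sqrt (2 * \<alpha>))\<^sup>2) * (1 / sqrt (2 * \<alpha>)) =
      - ((2 / sqrt pi) / (sqrt 2 * sqrt \<alpha>)) * exp (- c\<^sup>2 / (2 * \<alpha>))"
    using assms by (simp add: power_divide power_mult_distrib real_sqrt_mult)
  finally show ?thesis unfolding two_div_sqrt_pi by simp
qed

lemma ln_erfc_deriv:
  assumes "((\<lambda>c. erfc (f c)) has_real_derivative D) (at c)"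
  shows "((\<lambda>c. ln (erfc (f c))) has_real_derivative D / erfc (f c)) (at c)"
  using DERIV_chain2[of ln "1 / erfc (f c)" "\<lambda>c. erfc (f c)" c D UNIV, OF DERIV_ln_divide assms] erfc_pos by simp

lemma lift_num_deriv:
  assumes "0 < \<alpha>"
  shows "(lift_num \<alpha> has_real_derivative - c - haz1 c + haz2 \<alpha> c) (at c)"
proof -
  have d0: "((\<lambda>c. - c\<^sup>2 / 2) has_real_derivative - c) (at c)"
    by (auto intro!: derivative_eq_intros)
  have d1: "((\<lambda>c. ln (erfc (- c / sqrt 2))) has_real_derivative haz1 c) (at c)"
    unfolding haz1_def by (rule DERIV_cong[OF ln_erfc_deriv[OF erfc_left_deriv]]) simp
  have d2: "((\<lambda>c. \<alpha> * ln (erfc (c / sqrt (2 * \<alpha>)))) has_real_derivative - haz2 \<alpha> c) (at c)"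
  proof -
    let ?e = "exp (- c\<^sup>2 / (2 * \<alpha>))" and ?f = "erfc (c / sqrt (2 * \<alpha>))"
    have "((\<lambda>c. \<alpha> * ln (erfc (c / sqrt (2 * \<alpha>)))) has_real_derivative
      \<alpha> * (- (sqrt (2 / pi) / sqrt \<alpha>) * ?e / ?f)) (at c)"
      by (rule DERIV_cmult[OF ln_erfc_deriv[OF erfc_right_deriv[OF assms]]])
    also have "\<alpha> * (- (sqrt (2 / pi) / sqrt \<alpha>) * ?e / ?f) = - ((\<alpha> / sqrt \<alpha>) * (sqrt (2 / pi) * ?e) / ?f)"
      by simp
    also have "\<alpha> / sqrt \<alpha> = sqrt \<alpha>" using assms by (simp add: real_div_sqrt)
    finally show ?thesis unfolding haz2_def .
  qed
  have "((\<lambda>c. - c\<^sup>2 / 2 - ln (erfc (- c / sqrt 2)) - \<alpha> * ln (erfc (c / sqrt (2 * \<alpha>)))) has_real_derivative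
      - c - haz1 c - - haz2 \<alpha> c) (at c)"
    by (rule DERIV_diff[OF DERIV_diff[OF d0 d1] d2])
  then show ?thesis unfolding lift_num_def[abs_def] by simp
qed

lemma haz1_deriv_0: "(haz1 has_real_derivative - (2 / pi)) (at 0)"
proof -
  have "((\<lambda>c. sqrt (2 / pi) * exp (- c\<^sup>2 / 2) / erfc (- c / sqrt 2)) has_real_derivative
      ((sqrt (2 / pi) * (exp (- 0\<^sup>2 / 2) * (- 0))) * erfc (- 0 / sqrt 2)
        - sqrt (2 / pi) * exp (- 0\<^sup>2 / 2) * (sqrt (2 / pi) * exp (- 0\<^sup>2 / 2))) / (erfc (- 0 / sqrt 2) * erfc (- 0 / sqrt 2))) (at 0)"
    by (rule DERIV_divide[OF _ erfc_left_deriv less_imp_neq[OF erfc_pos, THEN not_sym]]) (auto intro!: derivative_eq_intros)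
  then show ?thesis unfolding haz1_def[abs_def] by (simp add: erfc_0)
qed

lemma haz2_deriv_0:
  assumes "0 < \<alpha>"
  shows "(haz2 \<alpha> has_real_derivative 2 / pi) (at 0)"
proof -
  have "((\<lambda>c. sqrt \<alpha> * (sqrt (2 / pi) * exp (- c\<^sup>2 / (2 * \<alpha>))) / erfc (c / sqrt (2 * \<alpha>))) has_real_derivative
      ((sqrt \<alpha> * (sqrt (2 / pi) * (exp (- 0\<^sup>2 / (2 * \<alpha>)) * (- 0)))) * erfc (0 / sqrt (2 * \<alpha>))
        - sqrt \<alpha> * (sqrt (2 / pi) * exp (- 0\<^sup>2 / (2 * \<alpha>))) * (- (sqrt (2 / pi) / sqrt \<alpha>) * exp (- 0\<^sup>2 / (2 * \<alpha>))))
        / (erfc (0 / sqrt (2 * \<alpha>)) * erfc (0 / sqrt (2 * \<alpha>)))) (at 0)"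
    by (rule DERIV_divide[OF _ erfc_right_deriv[OF assms] less_imp_neq[OF erfc_pos, THEN not_sym]])
      (use assms in \<open>auto intro!: derivative_eq_intros\<close>)
  then show ?thesis unfolding haz2_def[abs_def] using assms by (simp add: erfc_0)
qed

lemma lift_num_0: "lift_num \<alpha> 0 = 0"
  by (simp add: lift_num_def erfc_0)

text \<open>The value is \<open>sqrt (2 / pi) * (sqrt \<alpha> - 1)\<close>, which is not positive
  for \<alpha> \<le> 1.\<close>

definition lift_zero :: "real \<Rightarrow> real" where
  "lift_zero \<alpha> = - haz1 0 + haz2 \<alpha> 0"

lemma lift_expr_at_0:
  assumes "0 < \<alpha>"
  shows "(lift_expr \<alpha> \<longlongrightarrow> lift_zero \<alpha>) (at_right 0)"
proof -
  have "((\<lambda>h. (lift_num \<alpha> (0 + h) - lift_num \<alpha> 0) / h) \<longlongrightarrow> lift_zero \<alpha>) (at 0)"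
    using lift_num_deriv[OF assms, of 0] unfolding DERIV_def lift_zero_def by simp
  then have "((\<lambda>h. lift_num \<alpha> h / h) \<longlongrightarrow> lift_zero \<alpha>) (at_right 0)"
    by (simp add: lift_num_0 filterlim_at_split)
  then show ?thesis
    by (rule Lim_transform_eventually) (rule eventually_at_rightI[of 0 1], simp_all add: lift_expr_eq)
qed

lemma lift_obj_0: "0 < \<alpha> \<Longrightarrow> lift_obj \<alpha> 0 = lift_zero \<alpha>"
  unfolding lift_obj_def using tendsto_Lim[OF _ lift_expr_at_0] by simp

text \<open>The derivative of \<open>lift_num \<alpha>\<close> has itself the positive slope
  \<open>4 / pi - 1\<close> at 0, and by the mean value theorem
  \<open>lift_num \<alpha> c / c\<close> is a value of that derivative at a point between 0 and
  \<open>c\<close>.\<close>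

lemma lift_expr_gt_zero_limit:
  assumes "0 < \<alpha>"
  shows "\<exists>c>0. lift_zero \<alpha> < lift_expr \<alpha> c"
proof -
  have D: "((\<lambda>c. - c - haz1 c + haz2 \<alpha> c) has_real_derivative - 1 - - (2 / pi) + 2 / pi) (at 0)"
    by (rule DERIV_add[OF DERIV_diff[OF DERIV_minus[OF DERIV_ident] haz1_deriv_0] haz2_deriv_0[OF assms]])
  have "0 < - 1 - - (2 / pi) + 2 / pi" using pi_less_4 by (simp add: field_simps)
  from DERIV_pos_inc_right[OF D this]
  obtain d where d: "0 < d" "\<And>h. 0 < h \<Longrightarrow> h < d \<Longrightarrow> lift_zero \<alpha> < - h - haz1 h + haz2 \<alpha> h"
    unfolding lift_zero_def by auto
  obtain w where w: "0 < w" "w < d / 2" "lift_num \<alpha> (d / 2) - lift_num \<alpha> 0 = (d / 2 - 0) * (- w - haz1 w + haz2 \<alpha> w)"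
    using MVT2[of 0 "d / 2" "lift_num \<alpha>" "\<lambda>c. - c - haz1 c + haz2 \<alpha> c"] d(1) lift_num_deriv[OF assms] by auto
  have "lift_expr \<alpha> (d / 2) = - w - haz1 w + haz2 \<alpha> w"
    using w(3) d(1) by (simp add: lift_expr_eq lift_num_0)
  moreover have "lift_zero \<alpha> < - w - haz1 w + haz2 \<alpha> w" using w(1,2) d(1) by (intro d(2)) auto
  ultimately have "lift_zero \<alpha> < lift_expr \<alpha> (d / 2)" by simp
  moreover have "0 < d / 2" using d(1) by simp
  ultimately show ?thesis by (intro exI conjI)
qed

lemma erfc_le_2: "erfc z \<le> 2"
  using erfc_uminus[of "- z"] erfc_pos[of "- z"] by simp

lemma erfc_ge_1: "z \<le> 0 \<Longrightarrow> 1 \<le> erfc z"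
  using erfc_strict_antimono[of z 0] erfc_0 by (cases "z = 0") auto

text \<open>The Mills bound cancels \<open>c^2 / 2\<close> against \<open>\<alpha> * z^2\<close>,
  and \<open>ln z = ln 2 / \<alpha> + 1\<close> outweighs the \<open>ln 2\<close> from the other
  logarithm, leaving at least \<alpha>. For \<alpha> \<le> 1 positivity cannot be read off from the
  limit at 0.\<close>

lemma lift_expr_positive:
  assumes a: "0 < \<alpha>"
  shows "\<exists>c>0. 0 < lift_expr \<alpha> c"
proof -
  define z where "z = exp (ln 2 / \<alpha> + 1)"
  define c where "c = z * sqrt (2 * \<alpha>)"
  have z: "0 < z" by (simp add: z_def)
  have c: "0 < c" using z a by (simp add: c_def)
  have cz: "c / sqrt (2 * \<alpha>) = z" using a by (simp add: c_def)
  have c2: "c\<^sup>2 / 2 = \<alpha> * z\<^sup>2" using a by (simp add: c_def power_mult_distrib)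
  have "ln (erfc z) \<le> ln (exp (- z\<^sup>2) / (z * sqrt pi))"
    using erfc_mills_upper[OF z] erfc_pos[of z] by (rule ln_mono)
  also have "\<dots> = - z\<^sup>2 - (ln z + ln (sqrt pi))" using z by (simp add: ln_div ln_mult)
  also have "\<dots> \<le> - z\<^sup>2 - ln z" using pi_gt3 by simp
  finally have "\<alpha> * ln (erfc z) \<le> \<alpha> * (- z\<^sup>2 - ln z)" using a by (intro mult_left_mono) auto
  also have "\<dots> = - \<alpha> * z\<^sup>2 - ln 2 - \<alpha>" using a by (simp add: z_def algebra_simps)
  finally have 1: "\<alpha> * ln (erfc z) \<le> - \<alpha> * z\<^sup>2 - ln 2 - \<alpha>" .
  have 2: "ln (erfc (- c / sqrt 2)) \<le> ln 2" using erfc_le_2 erfc_pos by (rule ln_mono)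
  have "0 < lift_num \<alpha> c" unfolding lift_num_def cz using 1 2 a c2 by simp
  then show ?thesis using c by (intro exI[of _ c]) (simp add: lift_expr_eq)
qed

text \<open>Only the mass between \<open>z\<close> and \<open>z + 1 / z\<close> is kept; there the
  exponent is at most \<open>(z + 1 / z)^2 \<le> z^2 + 3\<close>.\<close>

lemma erfc_ge:
  assumes z: "1 \<le> z"
  shows "exp (- z\<^sup>2 - 3) / z \<le> erfc z"
proof -
  have z0: "z < z + 1 / z" using z by simp
  obtain w where w: "z < w" "w < z + 1 / z"
    "erfc (z + 1 / z) - erfc z = (z + 1 / z - z) * (- 2 / sqrt pi * exp (- w\<^sup>2))"
    using MVT2[OF z0, of erfc "\<lambda>w. - 2 / sqrt pi * exp (- w\<^sup>2)"] erfc_deriv by blast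
  have "w\<^sup>2 \<le> (z + 1 / z)\<^sup>2" using w z by (intro power_mono) auto
  also have "\<dots> = z\<^sup>2 + 2 + (1 / z)\<^sup>2" using z by (simp add: power2_eq_square field_simps)
  also have "\<dots> \<le> z\<^sup>2 + 3" using z power_le_one[of "1 / z" 2] by simp
  finally have "exp (- z\<^sup>2 - 3) \<le> exp (- w\<^sup>2)" by simp
  moreover have "1 \<le> 2 / sqrt pi"
  proof -
    have "sqrt pi \<le> sqrt 4" using pi_less_4 by (intro real_sqrt_le_mono) simp
    then show ?thesis by simp
  qed
  ultimately have "1 * exp (- z\<^sup>2 - 3) \<le> 2 / sqrt pi * exp (- w\<^sup>2)" by (intro mult_mono) auto
  then have "exp (- z\<^sup>2 - 3) / z \<le> 2 / sqrt pi * exp (- w\<^sup>2) / z" using z by (intro divide_right_mono) auto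
  also have "\<dots> = erfc z - erfc (z + 1 / z)" using w(3) by (simp add: mult.commute)
  also have "\<dots> \<le> erfc z" using erfc_nonneg[of "z + 1 / z"] by simp
  finally show ?thesis .
qed

text \<open>The lower bound for \<open>erfc\<close> cancels the quadratic terms, so
  \<open>lift_num \<alpha> c\<close> grows at most like \<open>\<alpha> * (3 + ln z)\<close>. With
  \<open>3 + ln z \<le> 5 * sqrt z\<close> the quotient by \<open>c\<close> is at most
  \<open>K / sqrt z\<close>, whence the square in \<open>Z\<close>.\<close>

lemma lift_expr_eventually_small:
  assumes a: "0 < \<alpha>" and V: "0 < V"
  shows "\<exists>C. \<forall>c\<ge>C. lift_expr \<alpha> c < V"
proof -
  define K where "K = 5 * \<alpha> / sqrt (2 * \<alpha>)"
  have K: "0 < K" using a by (simp add: K_def)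
  define Z where "Z = max 1 ((K / V + 1)\<^sup>2)"
  show ?thesis
  proof (intro exI allI impI)
    fix c assume c: "Z * sqrt (2 * \<alpha>) \<le> c"
    define z where "z = c / sqrt (2 * \<alpha>)"
    have cz: "c = z * sqrt (2 * \<alpha>)" using a by (simp add: z_def)
    have "Z \<le> z" using c a unfolding cz by simp
    then have z: "1 \<le> z" "(K / V + 1)\<^sup>2 \<le> z" by (auto simp: Z_def)
    have c0: "0 < c" unfolding cz using z a by simp
    have c2: "c\<^sup>2 / 2 = \<alpha> * z\<^sup>2" using a by (simp add: cz power_mult_distrib)
    have "- z\<^sup>2 - 3 - ln z = ln (exp (- z\<^sup>2 - 3) / z)" using z by (simp add: ln_div)
    also have "\<dots> \<le> ln (erfc z)" using erfc_ge[OF z(1)] z by (intro ln_mono) auto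
    finally have "\<alpha> * (- z\<^sup>2 - 3 - ln z) \<le> \<alpha> * ln (erfc z)" using a by (intro mult_left_mono) auto
    moreover have "0 \<le> ln (erfc (- c / sqrt 2))" using erfc_ge_1[of "- c / sqrt 2"] c0 by simp
    ultimately have g: "lift_num \<alpha> c \<le> \<alpha> * (3 + ln z)"
      unfolding lift_num_def z_def[symmetric] using c2 by (simp add: algebra_simps)
    have sz: "1 \<le> sqrt z" "sqrt z * sqrt z = z" using z by auto
    have "ln z = 2 * ln (sqrt z)" using z by (simp add: ln_sqrt)
    also have "ln (sqrt z) \<le> sqrt z" using ln_le_minus_one[of "sqrt z"] z by simp
    finally have "3 + ln z \<le> 5 * sqrt z" using sz by linarith
    then have "lift_num \<alpha> c \<le> \<alpha> * (5 * sqrt z)" using g a by (meson mult_left_mono less_imp_le order_trans)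
    then have "lift_num \<alpha> c / c \<le> \<alpha> * (5 * sqrt z) / c" using c0 by (intro divide_right_mono) auto
    also have "\<dots> = K / sqrt z"
    proof -
      have "\<alpha> * (5 * s) / ((s * s) * q) = (5 * \<alpha> / q) / s" if "s \<noteq> 0" for s q :: real
        using that by (simp add: mult.commute)
      from this[of "sqrt z" "sqrt (2 * \<alpha>)"] show ?thesis
        using sz(1) unfolding sz(2) cz[symmetric] K_def by simp
    qed
    also have "\<dots> < V"
    proof -
      have "K / V + 1 \<le> sqrt z" using real_sqrt_le_mono[OF z(2)] K V by simp
      then have "K / V < sqrt z" by linarith
      then show ?thesis using V sz(1) by (simp add: divide_less_eq mult.commute)
    qed
    finally show "lift_expr \<alpha> c < V" using c0 by (simp add: lift_expr_eq)
  qed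
qed

text \<open>\<open>V\<close> is a positive value of the objective that exceeds its limit at 0. Near
  0 and near infinity the objective stays below \<open>V\<close>, so its maximum over a compact
  interval in between is global, and \<open>GREATEST\<close> denotes it.\<close>

lemma xi_lift_attained:
  assumes a: "0 < \<alpha>"
  obtains c where "0 < c" "xi_lift \<alpha> = lift_expr \<alpha> c" "0 < xi_lift \<alpha>"
    "\<And>c'. 0 < c' \<Longrightarrow> lift_expr \<alpha> c' \<le> xi_lift \<alpha>"
proof -
  obtain c1 where c1: "0 < c1" "lift_zero \<alpha> < lift_expr \<alpha> c1" using lift_expr_gt_zero_limit[OF a] by blast
  obtain c2 where c2: "0 < c2" "0 < lift_expr \<alpha> c2" using lift_expr_positive[OF a] by blast
  define V where "V = max (lift_expr \<alpha> c1) (lift_expr \<alpha> c2)"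
  have V: "lift_zero \<alpha> < V" "0 < V" using c1 c2 by (auto simp: V_def)
  obtain C where C: "\<And>c. C \<le> c \<Longrightarrow> lift_expr \<alpha> c < V" using lift_expr_eventually_small[OF a V(2)] by blast
  have "eventually (\<lambda>c. lift_expr \<alpha> c < V) (at_right 0)"
    by (rule order_tendstoD(2)[OF lift_expr_at_0[OF a] V(1)])
  then obtain d where d: "0 < d" "\<And>c. 0 < c \<Longrightarrow> c < d \<Longrightarrow> lift_expr \<alpha> c < V"
    by (auto simp: eventually_at_right_field)
  define A where "A = {min (min c1 c2) d..max (max c1 c2) C}"
  have A0: "0 < c" if "c \<in> A" for c using that c1 c2 d by (auto simp: A_def)
  have "continuous_on A (\<lambda>c. lift_num \<alpha> c / c)"
    using A0 lift_num_deriv[OF a]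
    by (intro continuous_on_divide continuous_on_id continuous_at_imp_continuous_on ballI DERIV_isCont) auto
  then have cont: "continuous_on A (lift_expr \<alpha>)"
    by (rule continuous_on_eq) (use A0 lift_expr_eq in force)
  have cA: "c1 \<in> A" "c2 \<in> A" by (auto simp: A_def)
  then obtain c where c: "c \<in> A" "\<And>x. x \<in> A \<Longrightarrow> lift_expr \<alpha> x \<le> lift_expr \<alpha> c"
    using continuous_attains_sup[OF _ _ cont] unfolding A_def by (metis compact_Icc empty_iff)
  have Vc: "V \<le> lift_expr \<alpha> c" using c(2)[OF cA(1)] c(2)[OF cA(2)] by (simp add: V_def)
  have max: "lift_expr \<alpha> x \<le> lift_expr \<alpha> c" if x: "0 < x" for x
  proof (cases "x \<in> A")
    case False
    then have "x < d \<or> C \<le> x" by (auto simp: A_def)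
    then have "lift_expr \<alpha> x < V" using d(2)[OF x] C by blast
    then show ?thesis using Vc by simp
  qed (rule c(2))
  have c0: "0 < c" using A0[OF c(1)] .
  have "xi_lift \<alpha> = lift_expr \<alpha> c"
    unfolding xi_lift_def
  proof (rule Greatest_equality)
    show "\<exists>ca\<ge>0. lift_expr \<alpha> c = lift_obj \<alpha> ca" using c0 by (intro exI[of _ c]) (simp add: lift_obj_def)
    fix v assume "\<exists>ca\<ge>0. v = lift_obj \<alpha> ca"
    then obtain x where x: "0 \<le> x" "v = lift_obj \<alpha> x" by blast
    show "v \<le> lift_expr \<alpha> c"
    proof (cases "x = 0")
      case True
      then show ?thesis using x V Vc lift_obj_0[OF a] by simp
    next
      case False
      then show ?thesis using x max[of x] by (simp add: lift_obj_def)
    qed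
  qed
  then show thesis using that c0 V Vc max by (metis less_le_trans)
qed


subsection \<open>The numerical value for square matrices\<close>

text \<open>The Lagrange remainder has the sign of \<open>(- x) ^ n\<close>.\<close>

lemma exp_uminus_Taylor:
  fixes x :: real
  assumes x: "0 \<le> x"
  shows "even n \<Longrightarrow> (\<Sum>k<n. (- x) ^ k / fact k) \<le> exp (- x)"
    and "odd n \<Longrightarrow> exp (- x) \<le> (\<Sum>k<n. (- x) ^ k / fact k)"
proof -
  obtain t where t: "exp (- x) = (\<Sum>k<n. (- x) ^ k / fact k) + exp t / fact n * (- x) ^ n"
    using Maclaurin_exp_le[of "- x" n] by blast
  show "(\<Sum>k<n. (- x) ^ k / fact k) \<le> exp (- x)" if "even n"
    unfolding t using that by (simp add: zero_le_even_power)
  show "exp (- x) \<le> (\<Sum>k<n. (- x) ^ k / fact k)" if "odd n"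
    unfolding t using that x by (simp add: power_minus_odd)
qed

lemmas exp_uminus_Taylor_sum = lessThan_nat_numeral lessThan_Suc fact_numeral

text \<open>The derivative \<open>1 / (1 + t^2)\<close> is enclosed between partial sums of its
  geometric series. The degrees are chosen for Machin's formula.\<close>

lemma arctan_bounds:
  fixes x :: real
  assumes x: "0 \<le> x"
  shows "x - x^3/3 + x^5/5 - x^7/7 + x^9/9 - x^11/11 \<le> arctan x" "arctan x \<le> x - x^3/3 + x^5/5 - x^7/7 + x^9/9"
proof -
  have "arctan 0 - (0 - 0^3/3 + 0^5/5 - 0^7/7 + 0^9/9 - 0^11/11) \<le> arctan x - (x - x^3/3 + x^5/5 - x^7/7 + x^9/9 - x^11/11)"
  proof (rule DERIV_nonneg_imp_nondecreasing[OF x])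
    fix t :: real
    have "1 - t^2 + t^4 - t^6 + t^8 - t^10 = (1 - t^12) / (1 + t\<^sup>2)"
      by (subst eq_divide_eq) (auto simp: algebra_simps power_numeral_reduce add_nonneg_eq_0_iff)
    also have "\<dots> \<le> 1 / (1 + t\<^sup>2)" by (rule divide_right_mono) auto
    finally have "0 \<le> inverse (1 + t\<^sup>2) - (1 - t^2 + t^4 - t^6 + t^8 - t^10)" by (simp add: inverse_eq_divide)
    then show "\<exists>y. ((\<lambda>x. arctan x - (x - x^3/3 + x^5/5 - x^7/7 + x^9/9 - x^11/11)) has_real_derivative y) (at t) \<and> 0 \<le> y"
      by (intro exI conjI) (auto intro!: derivative_eq_intros)
  qed
  then show "x - x^3/3 + x^5/5 - x^7/7 + x^9/9 - x^11/11 \<le> arctan x" by simp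
  have "(0 - 0^3/3 + 0^5/5 - 0^7/7 + 0^9/9) - arctan 0 \<le> (x - x^3/3 + x^5/5 - x^7/7 + x^9/9) - arctan x"
  proof (rule DERIV_nonneg_imp_nondecreasing[OF x])
    fix t :: real
    have "1 / (1 + t\<^sup>2) \<le> (1 + t^10) / (1 + t\<^sup>2)" by (rule divide_right_mono) auto
    also have "\<dots> = 1 - t^2 + t^4 - t^6 + t^8"
      by (subst divide_eq_eq) (auto simp: algebra_simps power_numeral_reduce add_nonneg_eq_0_iff)
    finally have "0 \<le> (1 - t^2 + t^4 - t^6 + t^8) - inverse (1 + t\<^sup>2)" by (simp add: inverse_eq_divide)
    then show "\<exists>y. ((\<lambda>x. (x - x^3/3 + x^5/5 - x^7/7 + x^9/9) - arctan x) has_real_derivative y) (at t) \<and> 0 \<le> y"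
      by (intro exI conjI) (auto intro!: derivative_eq_intros)
  qed
  then show "arctan x \<le> x - x^3/3 + x^5/5 - x^7/7 + x^9/9" by simp
qed

lemma pi_bounds: "3.1415926 \<le> pi" "pi \<le> 3.1415927"
  using machin arctan_bounds[of "1 / 5"] arctan_bounds[of "1 / 239"] by (simp_all add: power_divide)

lemma sqrt_2_pi_bounds: "0.7978845 \<le> sqrt (2 / pi)" "sqrt (2 / pi) \<le> 0.7978846"
proof -
  have "(0.7978845::real)\<^sup>2 \<le> 2 / 3.1415927" by (simp add: power2_eq_square)
  also have "\<dots> \<le> 2 / pi" using pi_bounds by (intro divide_left_mono) auto
  finally show "0.7978845 \<le> sqrt (2 / pi)" by (rule real_le_rsqrt)
  have "2 / pi \<le> 2 / 3.1415926" using pi_bounds by (intro divide_left_mono) auto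
  also have "\<dots> \<le> (0.7978846::real)\<^sup>2" by (simp add: power2_eq_square)
  finally show "sqrt (2 / pi) \<le> 0.7978846" by (rule real_le_lsqrt[rotated]) simp
qed

text \<open>Once \<open>g\<close> is nonnegative it stays so, hence \<open>f\<close> first falls and
  then rises, and its maximum over the interval lies at an end. The sign condition concerns
  \<open>g\<close> alone because \<open>w\<close> will be a Gaussian or exponential factor.\<close>

lemma valley_le_max:
  fixes f g w :: "real \<Rightarrow> real"
  assumes "x \<le> c" "c \<le> y"
    and der: "\<And>t. x \<le> t \<Longrightarrow> t \<le> y \<Longrightarrow> (f has_real_derivative w t * g t) (at t)"
    and w: "\<And>t. 0 \<le> w t"
    and g: "\<And>s u. x \<le> s \<Longrightarrow> s \<le> u \<Longrightarrow> u \<le> y \<Longrightarrow> 0 \<le> g s \<Longrightarrow> 0 \<le> g u"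
  shows "f c \<le> max (f x) (f y)"
proof (cases "0 \<le> g c")
  case True
  have "f c \<le> f y"
  proof (rule DERIV_nonneg_imp_nondecreasing[OF assms(2)])
    fix t assume t: "c \<le> t" "t \<le> y"
    then have "0 \<le> w t * g t" using g[of c t] assms(1) True by (intro mult_nonneg_nonneg w) auto
    moreover have "(f has_real_derivative w t * g t) (at t)" using der t assms(1) by simp
    ultimately show "\<exists>y. (f has_real_derivative y) (at t) \<and> 0 \<le> y" by (intro exI conjI)
  qed
  then show ?thesis by simp
next
  case False
  have "f c \<le> f x"
  proof (rule DERIV_nonpos_imp_nonincreasing[OF assms(1)])
    fix t assume t: "x \<le> t" "t \<le> c"
    then have "g t \<le> 0" using g[of t c] assms(2) False by linarith
    then have "w t * g t \<le> 0" by (rule mult_nonneg_nonpos[OF w])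
    moreover have "(f has_real_derivative w t * g t) (at t)" using der t assms(2) by simp
    ultimately show "\<exists>y. (f has_real_derivative y) (at t) \<and> y \<le> 0" by (intro exI conjI)
  qed
  then show ?thesis by simp
qed

lemma hill_ge_min:
  fixes f g w :: "real \<Rightarrow> real"
  assumes "x \<le> c" "c \<le> y"
    and der: "\<And>t. x \<le> t \<Longrightarrow> t \<le> y \<Longrightarrow> (f has_real_derivative w t * g t) (at t)"
    and w: "\<And>t. 0 \<le> w t"
    and g: "\<And>s u. x \<le> s \<Longrightarrow> s \<le> u \<Longrightarrow> u \<le> y \<Longrightarrow> g s \<le> 0 \<Longrightarrow> g u \<le> 0"
  shows "min (f x) (f y) \<le> f c"
proof -
  have "- f c \<le> max (- f x) (- f y)"
  proof (rule valley_le_max[OF assms(1,2), where g = "\<lambda>t. - g t" and w = w])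
    show "((\<lambda>t. - f t) has_real_derivative w t * - g t) (at t)" if "x \<le> t" "t \<le> y" for t
      using DERIV_minus[OF der[OF that]] by simp
  qed (use w g in auto)
  then show ?thesis by (simp add: min_def max_def split: if_splits)
qed

section \<open>The two-sided normal tail and its rational bounds\<close>

definition tail :: "real \<Rightarrow> real" where
  "tail c = erfc (c / sqrt 2)"

lemma tail_deriv: "(tail has_real_derivative - sqrt (2 / pi) * exp (- c\<^sup>2 / 2)) (at c)"
  using erfc_right_deriv[of 1 c] unfolding tail_def[abs_def] by simp

lemma tail_pos: "0 < tail c"
  by (simp add: tail_def erfc_pos)

lemma tail_0: "tail 0 = 1"
  by (simp add: tail_def erfc_0)

lemma tail_at_top: "(tail \<longlongrightarrow> 0) at_top"
  unfolding tail_def[abs_def] by (rule filterlim_compose[OF erfc_at_top]) real_asymp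

lemma nonneg_of_nonincreasing_to_0:
  fixes f f' :: "real \<Rightarrow> real"
  assumes "\<And>t. c \<le> t \<Longrightarrow> (f has_real_derivative f' t) (at t)" "\<And>t. c \<le> t \<Longrightarrow> f' t \<le> 0" "(f \<longlongrightarrow> 0) at_top"
  shows "0 \<le> f c"
proof (rule tendsto_upperbound[OF assms(3)])
  show "eventually (\<lambda>x. f x \<le> f c) at_top"
  proof (rule eventually_at_top_linorderI[of c])
    fix x assume x: "c \<le> x"
    show "f x \<le> f c"
    proof (rule DERIV_nonpos_imp_nonincreasing[where f = f, OF x])
      fix t assume "c \<le> t"
      then show "\<exists>y. (f has_real_derivative y) (at t) \<and> y \<le> 0"
        using assms(1,2)[of t] by blast
    qed
  qed
qed simp

text \<open>Differentiation removes \<open>tail\<close> and leaves a rational function times the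
  Gaussian factor. For a convergent the numerator is a constant, whose sign decides on which side of
  \<open>tail\<close> the approximation lies.\<close>

lemma tail_rational_deriv:
  assumes p: "(p has_real_derivative p') (at t)" and q: "(q has_real_derivative q') (at t)" and q0: "0 < q t"
  shows "((\<lambda>t. sqrt (2 / pi) * exp (- t\<^sup>2 / 2) * (p t / q t) - tail t) has_real_derivative
    sqrt (2 / pi) * exp (- t\<^sup>2 / 2) * (((q t)\<^sup>2 - t * p t * q t + p' * q t - p t * q') / (q t)\<^sup>2)) (at t)"
proof -
  have 1: "((\<lambda>t. sqrt (2 / pi) * exp (- t\<^sup>2 / 2)) has_real_derivative sqrt (2 / pi) * exp (- t\<^sup>2 / 2) * (- t)) (at t)"
    by (auto intro!: derivative_eq_intros)
  have 2: "((\<lambda>t. p t / q t) has_real_derivative (p' * q t - p t * q') / (q t * q t)) (at t)"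
    using DERIV_divide[OF p q] q0 by simp
  show ?thesis
    by (rule DERIV_cong[OF DERIV_diff[OF DERIV_mult[OF 1 2] tail_deriv]])
      (use q0 in \<open>simp add: field_simps power2_eq_square\<close>)
qed

text \<open>Consecutive convergents of Laplace's continued fraction for the Mills ratio.\<close>

lemma mills_convergent_7:
  fixes t :: real
  shows "(t^7 + 21 * t^5 + 105 * t^3 + 105 * t)\<^sup>2 - t * (t^6 + 20 * t^4 + 87 * t\<^sup>2 + 48) * (t^7 + 21 * t^5 + 105 * t^3 + 105 * t) + (6 * t^5 + 80 * t^3 + 174 * t) * (t^7 + 21 * t^5 + 105 * t^3 + 105 * t)
        - (t^6 + 20 * t^4 + 87 * t\<^sup>2 + 48) * (7 * t^6 + 105 * t^4 + 315 * t\<^sup>2 + 105) = - 5040"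
proof -
  define u where "u = t\<^sup>2"
  define w where "w = u^3 + 21 * u\<^sup>2 + 105 * u + 105"
  have e: "t^7 + 21 * t^5 + 105 * t^3 + 105 * t = t * w" "6 * t^5 + 80 * t^3 + 174 * t = t * (6 * u\<^sup>2 + 80 * u + 174)"
    "t^6 + 20 * t^4 + 87 * t\<^sup>2 + 48 = u^3 + 20 * u\<^sup>2 + 87 * u + 48"
    "7 * t^6 + 105 * t^4 + 315 * t\<^sup>2 + 105 = 7 * u^3 + 105 * u\<^sup>2 + 315 * u + 105"
    unfolding w_def u_def by (simp_all add: power_numeral_reduce algebra_simps)
  have k: "u * (w * w - (u^3 + 20 * u\<^sup>2 + 87 * u + 48) * w + (6 * u\<^sup>2 + 80 * u + 174) * w)
      - (u^3 + 20 * u\<^sup>2 + 87 * u + 48) * (7 * u^3 + 105 * u\<^sup>2 + 315 * u + 105) = - 5040"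
    unfolding w_def by (simp add: power_numeral_reduce algebra_simps)
  show ?thesis unfolding e k[symmetric] by (simp add: u_def power2_eq_square algebra_simps)
qed
lemma mills_convergent_6:
  fixes t :: real
  shows "(t^6 + 15 * t^4 + 45 * t\<^sup>2 + 15)\<^sup>2 - t * (t^5 + 14 * t^3 + 33 * t) * (t^6 + 15 * t^4 + 45 * t\<^sup>2 + 15)
    + (5 * t^4 + 42 * t\<^sup>2 + 33) * (t^6 + 15 * t^4 + 45 * t\<^sup>2 + 15) - (t^5 + 14 * t^3 + 33 * t) * (6 * t^5 + 60 * t^3 + 90 * t) = 720"
proof -
  define u where "u = t\<^sup>2"
  define p where "p = u\<^sup>2 + 14 * u + 33"
  have e: "t^6 + 15 * t^4 + 45 * t\<^sup>2 + 15 = u^3 + 15 * u\<^sup>2 + 45 * u + 15"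
    "t^5 + 14 * t^3 + 33 * t = t * p" "5 * t^4 + 42 * t\<^sup>2 + 33 = 5 * u\<^sup>2 + 42 * u + 33"
    "6 * t^5 + 60 * t^3 + 90 * t = t * (6 * u\<^sup>2 + 60 * u + 90)"
    unfolding p_def u_def by (simp_all add: power_numeral_reduce algebra_simps)
  have k: "(u^3 + 15 * u\<^sup>2 + 45 * u + 15)\<^sup>2 - u * p * (u^3 + 15 * u\<^sup>2 + 45 * u + 15)
      + (5 * u\<^sup>2 + 42 * u + 33) * (u^3 + 15 * u\<^sup>2 + 45 * u + 15) - u * p * (6 * u\<^sup>2 + 60 * u + 90) = 720"
    unfolding p_def by (simp add: power_numeral_reduce algebra_simps)
  show ?thesis unfolding e k[symmetric] by (simp add: u_def power2_eq_square algebra_simps)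
qed

text \<open>By the constant numerator \<open>- 5040\<close> the difference is decreasing; since it
  tends to 0 at infinity, it is nonnegative.\<close>

lemma tail_upper:
  assumes c: "0 < c"
  shows "tail c \<le> sqrt (2 / pi) * exp (- c\<^sup>2 / 2) * ((c^6 + 20 * c^4 + 87 * c\<^sup>2 + 48) / (c^7 + 21 * c^5 + 105 * c^3 + 105 * c))"
    (is "_ \<le> _ * (?p c / ?q c)")
proof -
  have "0 \<le> sqrt (2 / pi) * exp (- c\<^sup>2 / 2) * (?p c / ?q c) - tail c"
  proof (rule nonneg_of_nonincreasing_to_0[where c = c and f = "\<lambda>c. sqrt (2 / pi) * exp (- c\<^sup>2 / 2) * (?p c / ?q c) - tail c"
      and f' = "\<lambda>t. sqrt (2 / pi) * exp (- t\<^sup>2 / 2) * (((?q t)\<^sup>2 - t * ?p t * ?q t + (6 * t^5 + 80 * t^3 + 174 * t) * ?q t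
        - ?p t * (7 * t^6 + 105 * t^4 + 315 * t\<^sup>2 + 105)) / (?q t)\<^sup>2)"])
    fix t :: real assume "c \<le> t"
    with c have t: "0 < t" by simp
    have q0: "0 < ?q t" using t by (intro add_pos_pos mult_pos_pos) auto
    have p: "(?p has_real_derivative 6 * t^5 + 80 * t^3 + 174 * t) (at t)"
      by (auto intro!: derivative_eq_intros)
    have q: "(?q has_real_derivative 7 * t^6 + 105 * t^4 + 315 * t\<^sup>2 + 105) (at t)"
      by (auto intro!: derivative_eq_intros)
    show "((\<lambda>c. sqrt (2 / pi) * exp (- c\<^sup>2 / 2) * (?p c / ?q c) - tail c) has_real_derivative
      sqrt (2 / pi) * exp (- t\<^sup>2 / 2) * (((?q t)\<^sup>2 - t * ?p t * ?q t + (6 * t^5 + 80 * t^3 + 174 * t) * ?q t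
        - ?p t * (7 * t^6 + 105 * t^4 + 315 * t\<^sup>2 + 105)) / (?q t)\<^sup>2)) (at t)"
      by (rule tail_rational_deriv[OF p q q0])
    have "(?q t)\<^sup>2 - t * ?p t * ?q t + (6 * t^5 + 80 * t^3 + 174 * t) * ?q t
        - ?p t * (7 * t^6 + 105 * t^4 + 315 * t\<^sup>2 + 105) = - 5040"
      by (rule mills_convergent_7)
    then show "sqrt (2 / pi) * exp (- t\<^sup>2 / 2) * (((?q t)\<^sup>2 - t * ?p t * ?q t + (6 * t^5 + 80 * t^3 + 174 * t) * ?q t
        - ?p t * (7 * t^6 + 105 * t^4 + 315 * t\<^sup>2 + 105)) / (?q t)\<^sup>2) \<le> 0"
      by (simp add: mult_nonneg_nonpos)
  next
    have "((\<lambda>c. exp (- c\<^sup>2 / 2) * (?p c / ?q c)) \<longlongrightarrow> 0) at_top" by real_asymp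
    from tendsto_diff[OF tendsto_mult[OF tendsto_const this, of "sqrt (2 / pi)"] tail_at_top]
    show "((\<lambda>c. sqrt (2 / pi) * exp (- c\<^sup>2 / 2) * (?p c / ?q c) - tail c) \<longlongrightarrow> 0) at_top" by (simp add: mult.assoc)
  qed
  then show ?thesis by simp
qed

lemma tail_lower:
  assumes c: "0 < c"
  shows "sqrt (2 / pi) * exp (- c\<^sup>2 / 2) * ((c^5 + 14 * c^3 + 33 * c) / (c^6 + 15 * c^4 + 45 * c\<^sup>2 + 15)) \<le> tail c"
    (is "_ * (?p c / ?q c) \<le> _")
proof -
  have "0 \<le> - (sqrt (2 / pi) * exp (- c\<^sup>2 / 2) * (?p c / ?q c) - tail c)"
  proof (rule nonneg_of_nonincreasing_to_0[where c = c and f = "\<lambda>c. - (sqrt (2 / pi) * exp (- c\<^sup>2 / 2) * (?p c / ?q c) - tail c)"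
      and f' = "\<lambda>t. - (sqrt (2 / pi) * exp (- t\<^sup>2 / 2) * (((?q t)\<^sup>2 - t * ?p t * ?q t + (5 * t^4 + 42 * t\<^sup>2 + 33) * ?q t
        - ?p t * (6 * t^5 + 60 * t^3 + 90 * t)) / (?q t)\<^sup>2))"])
    fix t :: real assume "c \<le> t"
    with c have t: "0 < t" by simp
    have q0: "0 < ?q t" using t by (intro add_pos_pos mult_pos_pos) auto
    have p: "(?p has_real_derivative 5 * t^4 + 42 * t\<^sup>2 + 33) (at t)"
      by (auto intro!: derivative_eq_intros)
    have q: "(?q has_real_derivative 6 * t^5 + 60 * t^3 + 90 * t) (at t)"
      by (auto intro!: derivative_eq_intros)
    show "((\<lambda>c. - (sqrt (2 / pi) * exp (- c\<^sup>2 / 2) * (?p c / ?q c) - tail c)) has_real_derivative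
      - (sqrt (2 / pi) * exp (- t\<^sup>2 / 2) * (((?q t)\<^sup>2 - t * ?p t * ?q t + (5 * t^4 + 42 * t\<^sup>2 + 33) * ?q t
        - ?p t * (6 * t^5 + 60 * t^3 + 90 * t)) / (?q t)\<^sup>2))) (at t)"
      by (rule DERIV_minus[OF tail_rational_deriv[OF p q q0]])
    have "(?q t)\<^sup>2 - t * ?p t * ?q t + (5 * t^4 + 42 * t\<^sup>2 + 33) * ?q t
        - ?p t * (6 * t^5 + 60 * t^3 + 90 * t) = 720"
      by (rule mills_convergent_6)
    then show "- (sqrt (2 / pi) * exp (- t\<^sup>2 / 2) * (((?q t)\<^sup>2 - t * ?p t * ?q t + (5 * t^4 + 42 * t\<^sup>2 + 33) * ?q t
        - ?p t * (6 * t^5 + 60 * t^3 + 90 * t)) / (?q t)\<^sup>2)) \<le> 0"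
      by simp
  next
    have "((\<lambda>c. exp (- c\<^sup>2 / 2) * (?p c / ?q c)) \<longlongrightarrow> 0) at_top" by real_asymp
    from tendsto_minus[OF tendsto_diff[OF tendsto_mult[OF tendsto_const this, of "sqrt (2 / pi)"] tail_at_top]]
    show "((\<lambda>c. - (sqrt (2 / pi) * exp (- c\<^sup>2 / 2) * (?p c / ?q c) - tail c)) \<longlongrightarrow> 0) at_top" by (simp add: mult.assoc)
  qed
  then show ?thesis by simp
qed

lemma exp_bound_361: "0.413844 \<le> exp (- (0.244395 * 3.61) :: real)" "exp (- (0.244395 * 3.61) :: real) \<le> 0.4138442"
  using exp_uminus_Taylor(1)[of "0.244395 * 3.61" 10] exp_uminus_Taylor(2)[of "0.244395 * 3.61" 11]
  by (simp_all add: exp_uminus_Taylor_sum power_divide)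

lemma exp_bound_361': "0.413858938 \<le> exp (- (0.244385 * 3.61) :: real)"
  using exp_uminus_Taylor(1)[of "0.244385 * 3.61" 12] by (simp add: exp_uminus_Taylor_sum power_divide)

lemma exp_bound_3625: "0.4123296 \<le> exp (- (0.244395 * 3.625) :: real)"
  using exp_uminus_Taylor(1)[of "0.244395 * 3.625" 10] by (simp add: exp_uminus_Taylor_sum power_divide)

lemma exp_bound_37: "0.4048 \<le> exp (- (0.244395 * 3.7) :: real)"
  using exp_uminus_Taylor(1)[of "0.244395 * 3.7" 8] by (simp add: exp_uminus_Taylor_sum power_divide)

lemma gauss_bound_361: "0.442857 ^ 8 \<le> exp (- (3.61 :: real)\<^sup>2 / 2)" "exp (- (3.61 :: real)\<^sup>2 / 2) \<le> 0.442859 ^ 8"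
proof -
  \<comment> \<open>An eighth root brings the argument of the exponential below 1, where few Taylor
    terms suffice.\<close>
  have e: "exp (- (3.61 :: real)\<^sup>2 / 2) = exp (- (3.61\<^sup>2 / 16)) ^ 8"
    using exp_of_nat_mult[of 8 "- ((3.61::real)\<^sup>2 / 16)"] by simp
  have "0.442857 \<le> exp (- ((3.61::real)\<^sup>2 / 16))" "exp (- ((3.61::real)\<^sup>2 / 16)) \<le> 0.442859"
    using exp_uminus_Taylor(1)[of "3.61\<^sup>2 / 16" 10] exp_uminus_Taylor(2)[of "3.61\<^sup>2 / 16" 9]
    by (simp_all add: exp_uminus_Taylor_sum power_divide)
  then show "0.442857 ^ 8 \<le> exp (- (3.61 :: real)\<^sup>2 / 2)" "exp (- (3.61 :: real)\<^sup>2 / 2) \<le> 0.442859 ^ 8"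
    unfolding e by (intro power_mono; simp)+
qed

lemma gauss_bound_3625: "0.43986 ^ 8 \<le> exp (- (3.625 :: real)\<^sup>2 / 2)"
proof -
  have e: "exp (- (3.625 :: real)\<^sup>2 / 2) = exp (- (3.625\<^sup>2 / 16)) ^ 8"
    using exp_of_nat_mult[of 8 "- ((3.625::real)\<^sup>2 / 16)"] by simp
  have "0.43986 \<le> exp (- ((3.625::real)\<^sup>2 / 16))"
    using exp_uminus_Taylor(1)[of "3.625\<^sup>2 / 16" 10] by (simp_all add: exp_uminus_Taylor_sum power_divide)
  then show ?thesis unfolding e by (intro power_mono; simp)
qed

lemma tail_bound_361: "0.000306 \<le> tail 3.61" "tail 3.61 \<le> 0.0003063"
proof -
  have "0.000306 \<le> 0.7978845 * 0.442857 ^ 8 * (0.25938 :: real)" by (simp add: power_divide)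
  also have "\<dots> \<le> sqrt (2 / pi) * exp (- 3.61\<^sup>2 / 2) * ((3.61^5 + 14 * 3.61^3 + 33 * 3.61) / (3.61^6 + 15 * 3.61^4 + 45 * 3.61\<^sup>2 + 15))"
    by (intro mult_mono sqrt_2_pi_bounds gauss_bound_361 mult_nonneg_nonneg) (simp_all add: power_divide)
  also have "\<dots> \<le> tail 3.61" by (rule tail_lower) simp
  finally show "0.000306 \<le> tail 3.61" .
  have "tail 3.61 \<le> sqrt (2 / pi) * exp (- 3.61\<^sup>2 / 2) * ((3.61^6 + 20 * 3.61^4 + 87 * 3.61\<^sup>2 + 48) / (3.61^7 + 21 * 3.61^5 + 105 * 3.61^3 + 105 * 3.61))"
    by (rule tail_upper) simp
  also have "\<dots> \<le> 0.7978846 * 0.442859 ^ 8 * 0.25939"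
    by (intro mult_mono sqrt_2_pi_bounds gauss_bound_361 mult_nonneg_nonneg) (simp_all add: power_divide)
  also have "\<dots> \<le> (0.0003063 :: real)" by (simp add: power_divide)
  finally show "tail 3.61 \<le> 0.0003063" .
qed

lemma tail_bound_3625: "0.0002888 \<le> tail 3.625"
proof -
  have "0.0002888 \<le> 0.7978845 * 0.43986 ^ 8 * (0.25843 :: real)" by (simp add: power_divide)
  also have "\<dots> \<le> sqrt (2 / pi) * exp (- 3.625\<^sup>2 / 2) * ((3.625^5 + 14 * 3.625^3 + 33 * 3.625) / (3.625^6 + 15 * 3.625^4 + 45 * 3.625\<^sup>2 + 15))"
    by (intro mult_mono sqrt_2_pi_bounds gauss_bound_3625 mult_nonneg_nonneg) (simp_all add: power_divide)
  also have "\<dots> \<le> tail 3.625" by (rule tail_lower) simp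
  finally show ?thesis .
qed

text \<open>The arguments are opposite, so the two values of \<open>erfc\<close> add up to 2. This
  is what makes \<alpha> = 1 tractable: a single tail function remains.\<close>

lemma ln_tail: "ln (erfc (- c / sqrt 2)) + ln (erfc (c / sqrt 2)) = ln (tail c * (2 - tail c))"
  using ln_mult_pos[OF erfc_pos erfc_pos, of "- c / sqrt 2" "c / sqrt 2"] erfc_uminus[of "c / sqrt 2"]
  by (simp add: tail_def mult.commute)

lemma tail_less_2: "tail c < 2"
  using erfc_uminus[of "c / sqrt 2"] erfc_pos[of "- (c / sqrt 2)"] by (simp add: tail_def)

section \<open>Sign analysis that locates the maximum for square matrices\<close>

text \<open>
  Up to a positive factor each of the next three functions is the derivative of its predecessor, so sign changes
  propagate from the last one, an elementary function, to the first. The maximizer of \<open>lift_expr 1\<close> is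
  about 3.6156, and 3.61 serves as the test point for both bounds.
\<close>

definition gap :: "real \<Rightarrow> real \<Rightarrow> real" where
  "gap v c = tail c * (2 - tail c) - exp (- c\<^sup>2 / 2 - v * c)"

definition gap1 :: "real \<Rightarrow> real \<Rightarrow> real" where
  "gap1 v c = (c + v) * exp (- (v * c)) - 2 * sqrt (2 / pi) * (1 - tail c)"

definition gap2 :: "real \<Rightarrow> real \<Rightarrow> real" where
  "gap2 v c = (1 - v\<^sup>2 - v * c) * exp (c\<^sup>2 / 2 - v * c) - 4 / pi"

lemma lift_expr_1_le_iff:
  assumes "0 < c"
  shows "lift_expr 1 c \<le> v \<longleftrightarrow> 0 \<le> gap v c"
proof -
  have pos: "0 < tail c * (2 - tail c)" using tail_pos tail_less_2 by simp
  have "lift_expr 1 c = (- c\<^sup>2 / 2 - ln (tail c * (2 - tail c))) / c"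
    using assms ln_tail[of c] by (simp add: lift_expr_eq lift_num_def)
  then have "lift_expr 1 c \<le> v \<longleftrightarrow> - c\<^sup>2 / 2 - v * c \<le> ln (tail c * (2 - tail c))"
    using assms by (simp add: pos_divide_le_eq) linarith
  also have "\<dots> \<longleftrightarrow> 0 \<le> gap v c" using pos by (simp add: gap_def ln_ge_iff)
  finally show ?thesis .
qed

lemma gap_deriv: "(gap v has_real_derivative exp (- c\<^sup>2 / 2) * gap1 v c) (at c)"
proof -
  have e: "exp (- c\<^sup>2 / 2 - v * c) = exp (- c\<^sup>2 / 2) * exp (- (v * c))" by (simp add: exp_add[symmetric])
  have "((\<lambda>c. exp (- c\<^sup>2 / 2 - v * c)) has_real_derivative exp (- c\<^sup>2 / 2 - v * c) * (- c - v)) (at c)"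
    by (auto intro!: derivative_eq_intros)
  from DERIV_diff[OF DERIV_mult[OF tail_deriv DERIV_diff[OF DERIV_const tail_deriv]] this]
  have "(gap v has_real_derivative - sqrt (2 / pi) * exp (- c\<^sup>2 / 2) * (2 - tail c)
      + (0 - - sqrt (2 / pi) * exp (- c\<^sup>2 / 2)) * tail c - exp (- c\<^sup>2 / 2 - v * c) * (- c - v)) (at c)"
    unfolding gap_def[abs_def] .
  then show ?thesis
    by (rule DERIV_cong) (unfold gap1_def e, simp add: algebra_simps)
qed

lemma gap1_deriv: "(gap1 v has_real_derivative exp (- c\<^sup>2 / 2) * gap2 v c) (at c)"
proof -
  have "((\<lambda>c. (c + v) * exp (- (v * c))) has_real_derivative (1 - v\<^sup>2 - v * c) * exp (- (v * c))) (at c)"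
    by (auto intro!: derivative_eq_intros simp: algebra_simps power2_eq_square)
  from DERIV_diff[OF this DERIV_cmult[OF DERIV_diff[OF DERIV_const tail_deriv]]]
  have "(gap1 v has_real_derivative (1 - v\<^sup>2 - v * c) * exp (- (v * c))
      - 2 * sqrt (2 / pi) * (0 - - sqrt (2 / pi) * exp (- c\<^sup>2 / 2))) (at c)"
    unfolding gap1_def[abs_def] .
  also have "2 * sqrt (2 / pi) * (0 - - sqrt (2 / pi) * exp (- c\<^sup>2 / 2)) = 2 * (sqrt (2 / pi) * sqrt (2 / pi)) * exp (- c\<^sup>2 / 2)"
    by (simp only: diff_minus_eq_add add_0_left mult_minus_left mult.assoc minus_minus diff_0)
  also have "sqrt (2 / pi) * sqrt (2 / pi) = 2 / pi" by simp
  also have "exp (- (v * c)) = exp (- c\<^sup>2 / 2) * exp (c\<^sup>2 / 2 - v * c)" by (simp add: exp_add[symmetric])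
  finally show ?thesis by (rule DERIV_cong) (simp add: gap2_def algebra_simps)
qed

lemma gap2_deriv: "(gap2 v has_real_derivative exp (c\<^sup>2 / 2 - v * c) * (- v * c\<^sup>2 + c - 2 * v + v^3)) (at c)"
  unfolding gap2_def[abs_def]
  by (auto intro!: derivative_eq_intros simp: algebra_simps power2_eq_square power3_eq_cube)

lemma gap_0: "gap v 0 = 0"
  by (simp add: gap_def tail_0)

lemma gap_at_top: "0 < v \<Longrightarrow> (gap v \<longlongrightarrow> 0) at_top"
proof -
  assume v: "0 < v"
  have "((\<lambda>c. exp (- c\<^sup>2 / 2 - v * c)) \<longlongrightarrow> 0) at_top" using v by real_asymp
  from tendsto_diff[OF tendsto_mult[OF tail_at_top tendsto_diff[OF tendsto_const tail_at_top]] this]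
  show ?thesis unfolding gap_def[abs_def] by simp
qed

text \<open>\<open>tail_upper\<close> carries the same factor \<open>exp (- c^2 / 2)\<close> as the
  subtracted term of \<open>gap\<close>. Once it is cancelled, the sign depends on the rational
  bound for the Mills ratio and on one moderate exponential.\<close>

lemma lift_expr_1_ge: "0.244385 \<le> lift_expr 1 3.61"
proof -
  let ?r = "(3.61^6 + 20 * 3.61^4 + 87 * 3.61\<^sup>2 + 48) / (3.61^7 + 21 * 3.61^5 + 105 * 3.61^3 + 105 * 3.61) :: real"
  have "tail 3.61 * (2 - tail 3.61) \<le> (sqrt (2 / pi) * exp (- 3.61\<^sup>2 / 2) * ?r) * (2 - 0.000306)"
    using tail_bound_361 tail_pos[of "3.61"] by (intro mult_mono tail_upper) auto
  also have "\<dots> = exp (- 3.61\<^sup>2 / 2) * (sqrt (2 / pi) * (?r * (2 - 0.000306)))" by simp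
  also have "\<dots> \<le> exp (- 3.61\<^sup>2 / 2) * (0.7978846 * (?r * (2 - 0.000306)))"
    by (intro mult_left_mono mult_right_mono sqrt_2_pi_bounds) simp_all
  also have "\<dots> < exp (- 3.61\<^sup>2 / 2) * exp (- (0.244385 * 3.61))"
    by (intro mult_strict_left_mono less_le_trans[OF _ exp_bound_361']) (simp_all add: power_divide)
  also have "\<dots> = exp (- 3.61\<^sup>2 / 2 - 0.244385 * 3.61)" unfolding exp_add[symmetric] by simp
  finally have "gap 0.244385 3.61 < 0" by (simp add: gap_def)
  then show ?thesis using lift_expr_1_le_iff[of "3.61" "0.244385"] by simp
qed

abbreviation (input) v0 :: real where "v0 \<equiv> 0.244395"

lemma gap_361: "exp (- 3.61\<^sup>2 / 2) * 0.000005 \<le> gap v0 3.61"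
proof -
  let ?r = "(3.61^5 + 14 * 3.61^3 + 33 * 3.61) / (3.61^6 + 15 * 3.61^4 + 45 * 3.61\<^sup>2 + 15) :: real"
  have "exp (- 3.61\<^sup>2 / 2) * (0.000005 + exp (- (v0 * 3.61))) \<le> exp (- 3.61\<^sup>2 / 2) * (0.7978845 * (?r * (2 - 0.0003063)))"
    by (intro mult_left_mono order_trans[OF add_left_mono[OF exp_bound_361(2)]]) (simp_all add: power_divide)
  also have "\<dots> \<le> exp (- 3.61\<^sup>2 / 2) * (sqrt (2 / pi) * (?r * (2 - 0.0003063)))"
    by (intro mult_left_mono mult_right_mono sqrt_2_pi_bounds) simp_all
  also have "\<dots> = (sqrt (2 / pi) * exp (- 3.61\<^sup>2 / 2) * ?r) * (2 - 0.0003063)" by simp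
  also have "\<dots> \<le> tail 3.61 * (2 - tail 3.61)"
    using tail_bound_361 tail_pos[of "3.61"] by (intro mult_mono tail_lower) auto
  finally show ?thesis unfolding gap_def diff_conv_add_uminus exp_add by (simp add: distrib_left)
qed

lemma gap1_361: "- 0.000163 \<le> gap1 v0 3.61" "gap1 v0 3.61 \<le> 0"
proof -
  have "sqrt (2 / pi) * (1 - tail 3.61) \<le> 0.7978846 * (1 - 0.000306)"
    "0.7978845 * (1 - 0.0003063) \<le> sqrt (2 / pi) * (1 - tail 3.61)"
    using tail_bound_361 by (intro mult_mono sqrt_2_pi_bounds; simp)+
  then show "- 0.000163 \<le> gap1 v0 3.61" "gap1 v0 3.61 \<le> 0"
    using exp_bound_361 by (simp_all add: gap1_def)
qed

lemma gap1_3625: "0 \<le> gap1 v0 3.625"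
proof -
  have "sqrt (2 / pi) * (1 - tail 3.625) \<le> 0.7978846 * (1 - 0.0002888)"
    by (rule order_trans[OF mult_left_mono mult_right_mono]) (use tail_bound_3625 sqrt_2_pi_bounds in simp_all)
  then show ?thesis using exp_bound_3625 by (simp add: gap1_def)
qed

lemma gap2_0: "gap2 v0 0 < 0"
proof -
  have "1 < 4 / pi" using pi_less_4 by simp
  moreover have "gap2 v0 0 = 1 - v0\<^sup>2 - 4 / pi" by (simp add: gap2_def)
  ultimately show ?thesis using zero_le_power2[of v0] by linarith
qed

lemma four_div_pi: "4 / pi \<le> 4 / 3"
  using pi_gt3 by (intro divide_left_mono) auto

lemma gap2_2: "0 \<le> gap2 v0 2"
proof -
  have "4 / 3 \<le> (1 - v0\<^sup>2 - v0 * 2) * (1 + (2\<^sup>2 / 2 - v0 * 2) + (2\<^sup>2 / 2 - v0 * 2)\<^sup>2 / 2)"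
    by (simp add: power2_eq_square)
  also have "\<dots> \<le> (1 - v0\<^sup>2 - v0 * 2) * exp (2\<^sup>2 / 2 - v0 * 2)"
    by (intro mult_left_mono exp_lower_Taylor_quadratic) (simp_all add: power2_eq_square)
  finally show ?thesis using four_div_pi by (simp add: gap2_def)
qed

lemma gap2_37: "0 \<le> gap2 v0 3.7"
proof -
  let ?y = "(3.7\<^sup>2 / 2 - v0 * 3.7) / 3"
  have "4 / 3 \<le> (1 - v0\<^sup>2 - v0 * 3.7) * (1 + ?y + ?y\<^sup>2 / 2) ^ 3" by (simp add: power_divide)
  also have "\<dots> \<le> (1 - v0\<^sup>2 - v0 * 3.7) * exp ?y ^ 3"
    by (intro mult_left_mono power_mono exp_lower_Taylor_quadratic) (simp_all add: power2_eq_square)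
  also have "exp ?y ^ 3 = exp (3.7\<^sup>2 / 2 - v0 * 3.7)" by (subst exp_of_nat_mult[symmetric]) (simp add: power_divide)
  finally show ?thesis using four_div_pi by (simp add: gap2_def)
qed

lemma quadratic_diff:
  fixes v x y :: real
  shows "(- v * y\<^sup>2 + y - 2 * v + v^3) - (- v * x\<^sup>2 + x - 2 * v + v^3) = (y - x) * (1 - v * (x + y))"
  by (simp add: power2_eq_square algebra_simps)

text \<open>The polynomial factor of the derivative is increasing on \<open>{0..2}\<close>, so it changes sign only once there.\<close>

lemma gap2_up_2:
  assumes "0 \<le> s" "s \<le> u" "u \<le> 2" "0 \<le> gap2 v0 s"
  shows "0 \<le> gap2 v0 u"
proof -
  let ?q = "\<lambda>c::real. - v0 * c\<^sup>2 + c - 2 * v0 + v0^3"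
  have q: "?q x \<le> ?q y" if "x \<le> y" "y \<le> 2" "0 \<le> x" for x y
  proof -
    have "0 \<le> (y - x) * (1 - v0 * (x + y))" using that by (intro mult_nonneg_nonneg) simp_all
    then show ?thesis unfolding quadratic_diff[symmetric] by simp
  qed
  have "gap2 v0 s \<le> max (gap2 v0 0) (gap2 v0 u)"
    by (rule valley_le_max[OF assms(1,2), where w = "\<lambda>c. exp (c\<^sup>2 / 2 - v0 * c)" and g = ?q, OF gap2_deriv])
      (use q assms in \<open>auto intro: order_trans\<close>)
  then show ?thesis using gap2_0 assms(4) by (simp add: max_def split: if_splits)
qed

lemma gap2_nonneg:
  assumes "2 \<le> c" "c \<le> 3.7"
  shows "0 \<le> gap2 v0 c"
proof -
  let ?q = "\<lambda>c::real. - v0 * c\<^sup>2 + c - 2 * v0 + v0^3"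
  have q: "?q y \<le> ?q x" if "?q x \<le> 0" "x \<le> y" "2 \<le> x" for x y
  \<comment> \<open>\<open>1 / v0\<close> is twice the abscissa of the vertex. In the first case the
    value at \<open>x\<close> is at least the positive value at 2, which contradicts the assumption;
    in the second the parabola does not increase from \<open>x\<close> to \<open>y\<close>.\<close>
  proof (cases "x + y \<le> 1 / v0")
    case True
    have "0 < ?q 2" by (simp add: power2_eq_square power3_eq_cube)
    moreover have "0 \<le> (x - 2) * (1 - v0 * (2 + x))" using that True by (intro mult_nonneg_nonneg) simp_all
    ultimately show ?thesis using that(1) quadratic_diff[of v0 x 2] by linarith
  next
    case False
    then have "(y - x) * (1 - v0 * (x + y)) \<le> 0" using that by (intro mult_nonneg_nonpos) simp_all
    then show ?thesis unfolding quadratic_diff[symmetric] by simp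
  qed
  have "min (gap2 v0 2) (gap2 v0 3.7) \<le> gap2 v0 c"
  proof (rule hill_ge_min[OF assms, where w = "\<lambda>c. exp (c\<^sup>2 / 2 - v0 * c)" and g = ?q, OF gap2_deriv])
    fix x y :: real assume xy: "2 \<le> x" "x \<le> y" and x: "?q x \<le> 0"
    show "?q y \<le> 0" by (rule order_trans[OF q[OF x xy(2,1)] x])
  qed simp
  then show ?thesis using gap2_2 gap2_37 by (simp add: min_def split: if_splits)
qed

lemma gap2_up:
  assumes "0 \<le> s" "s \<le> u" "u \<le> 3.7" "0 \<le> gap2 v0 s"
  shows "0 \<le> gap2 v0 u"
  using gap2_up_2[OF assms(1,2) _ assms(4)] gap2_nonneg[OF _ assms(3)] by (cases "u \<le> 2") auto

text \<open>\<open>gap2 v0\<close> passes from negative to nonnegative, so \<open>gap1 v0\<close> is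
  a valley and is bounded by its end values; being nonpositive at 3.61, it stays nonpositive once it
  is so. Hence \<open>gap v0\<close> rises and then falls, and it is nonnegative at both
  ends.\<close>

lemma gap_nonneg_left:
  assumes "0 \<le> c" "c \<le> 3.61"
  shows "0 \<le> gap v0 c"
proof -
  have down: "gap1 v0 u \<le> 0" if "0 \<le> s" "s \<le> u" "u \<le> 3.61" "gap1 v0 s \<le> 0" for s u
  proof -
    have "gap1 v0 u \<le> max (gap1 v0 s) (gap1 v0 3.61)"
    proof (rule valley_le_max[OF that(2,3), where w = "\<lambda>c. exp (- c\<^sup>2 / 2)" and g = "gap2 v0", OF gap1_deriv])
      fix x y assume xy: "s \<le> x" "x \<le> y" "y \<le> 3.61" "0 \<le> gap2 v0 x"
      show "0 \<le> gap2 v0 y" by (rule gap2_up[OF _ xy(2) _ xy(4)]) (use xy(1,3) that(1) in simp_all)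
    qed simp
    then show ?thesis using that(4) gap1_361(2) by (simp add: max_def split: if_splits)
  qed
  have "min (gap v0 0) (gap v0 3.61) \<le> gap v0 c"
    by (rule hill_ge_min[OF assms, where w = "\<lambda>c. exp (- c\<^sup>2 / 2)" and g = "gap1 v0", OF gap_deriv])
      (use down in auto)
  moreover have "0 \<le> gap v0 3.61" by (rule order_trans[OF _ gap_361]) simp
  ultimately show ?thesis by (simp add: gap_0 min_def split: if_splits)
qed

lemma gap1_mono:
  assumes "2 \<le> x" "x \<le> y" "y \<le> 3.7"
  shows "gap1 v0 x \<le> gap1 v0 y"
proof (rule DERIV_nonneg_imp_nondecreasing[OF assms(2)])
  fix t assume t: "x \<le> t" "t \<le> y"
  have "0 \<le> exp (- t\<^sup>2 / 2) * gap2 v0 t" using t assms by (intro mult_nonneg_nonneg gap2_nonneg) auto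
  then show "\<exists>y. (gap1 v0 has_real_derivative y) (at t) \<and> 0 \<le> y" using gap1_deriv by blast
qed

text \<open>\<open>gap1 v0\<close> changes sign on this interval, so \<open>gap v0\<close> may fall
  before it rises. As \<open>gap1 v0\<close> is increasing and starts above
  \<open>- 0.000163\<close>, the fall is at most \<open>0.015 * 0.000163\<close> times the Gaussian
  factor at 3.61, less than half of the value guaranteed by \<open>gap_361\<close>.\<close>

lemma gap_nonneg_middle:
  assumes "3.61 \<le> c" "c \<le> 3.625"
  shows "0 \<le> gap v0 c"
proof (cases "c = 3.61")
  case True
  then show ?thesis using gap_nonneg_left[of c] by simp
next
  case False
  then have "3.61 < c" using assms by simp
  from MVT2[OF this gap_deriv]
  obtain z where z: "3.61 < z" "z < c" "gap v0 c - gap v0 3.61 = (c - 3.61) * (exp (- z\<^sup>2 / 2) * gap1 v0 z)" by blast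
  have "- 0.000163 \<le> gap1 v0 z" using gap1_mono[of "3.61" z] z assms gap1_361(1) by simp
  then have "exp (- z\<^sup>2 / 2) * - 0.000163 \<le> exp (- z\<^sup>2 / 2) * gap1 v0 z" by (intro mult_left_mono) simp_all
  moreover have "exp (- z\<^sup>2 / 2) \<le> exp (- 3.61\<^sup>2 / 2)" using power_mono[of "3.61" z 2] z(1) by simp
  then have "- 0.000163 * exp (- 3.61\<^sup>2 / 2) \<le> exp (- z\<^sup>2 / 2) * - 0.000163" by simp
  ultimately have "- 0.000163 * exp (- 3.61\<^sup>2 / 2) \<le> exp (- z\<^sup>2 / 2) * gap1 v0 z" by (rule order_trans[rotated])
  then have l: "(c - 3.61) * (- 0.000163 * exp (- 3.61\<^sup>2 / 2)) \<le> (c - 3.61) * (exp (- z\<^sup>2 / 2) * gap1 v0 z)"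
    using assms by (intro mult_left_mono) simp_all
  have u: "(c - 3.61) * (0.000163 * exp (- 3.61\<^sup>2 / 2)) \<le> 0.015 * (0.000163 * exp (- 3.61\<^sup>2 / 2))"
    using assms by (intro mult_right_mono) simp_all
  \<comment> \<open>Stated with variables in place of the decimals and of the Gaussian factor, so
    that only the listed relations are used.\<close>
  have "0 \<le> g" if "(c - a) * (- k * E) \<le> X" "(c - a) * (k * E) \<le> d * (k * E)" "g - h = X" "E * l \<le> h" "d * k \<le> l" "0 < E"
    for a d g h k l E X :: real
  proof -
    have "d * (k * E) = E * (d * k)" by simp
    also have "\<dots> \<le> E * l" using that by (intro mult_left_mono) auto
    finally have "d * (k * E) \<le> E * l" .
    moreover have "(c - a) * (- k * E) = - ((c - a) * (k * E))" by simp
    ultimately show ?thesis using that by linarith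
  qed
  from this[OF l u z(3) gap_361] show ?thesis by simp
qed

text \<open>The upper end of the range is the peak of \<open>(c + v0) * exp (- (v0 * c))\<close>. Up
  to there this term is at least its value at 3.7, which already exceeds
  \<open>2 * sqrt (2 / pi)\<close>.\<close>

lemma gap1_plateau:
  assumes "3.7 \<le> c" "c \<le> (1 - v0\<^sup>2) / v0"
  shows "0 \<le> gap1 v0 c"
proof -
  have "(3.7 + v0) * exp (- (v0 * 3.7)) \<le> (c + v0) * exp (- (v0 * c))"
  proof (rule DERIV_nonneg_imp_nondecreasing[where f = "\<lambda>c. (c + v0) * exp (- (v0 * c))", OF assms(1)])
    fix t :: real assume t: "3.7 \<le> t" "t \<le> c"
    then have "0 \<le> 1 - v0\<^sup>2 - v0 * t" using assms(2) by (simp add: pos_le_divide_eq power2_eq_square)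
    then have "0 \<le> (1 - v0\<^sup>2 - v0 * t) * exp (- (v0 * t))" by simp
    moreover have "((\<lambda>c. (c + v0) * exp (- (v0 * c))) has_real_derivative (1 - v0\<^sup>2 - v0 * t) * exp (- (v0 * t))) (at t)"
      by (auto intro!: derivative_eq_intros simp: algebra_simps power2_eq_square)
    ultimately show "\<exists>y. ((\<lambda>c. (c + v0) * exp (- (v0 * c))) has_real_derivative y) (at t) \<and> 0 \<le> y" by blast
  qed
  moreover have "sqrt (2 / pi) * (1 - tail c) \<le> 0.7978846 * 1"
  proof (cases "tail c \<le> 1")
    case True
    then show ?thesis using tail_pos[of c] by (intro mult_mono sqrt_2_pi_bounds) simp_all
  next
    case False
    then have "sqrt (2 / pi) * (1 - tail c) \<le> 0" by (intro mult_nonneg_nonpos) auto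
    then show ?thesis by (rule order_trans) simp
  qed
  ultimately show ?thesis using exp_bound_37 by (simp add: gap1_def)
qed

lemma gap_mono:
  assumes "x \<le> y" "\<And>t. x \<le> t \<Longrightarrow> t \<le> y \<Longrightarrow> 0 \<le> gap1 v t"
  shows "gap v x \<le> gap v y"
proof (rule DERIV_nonneg_imp_nondecreasing[OF assms(1)])
  fix t assume t: "x \<le> t" "t \<le> y"
  have "0 \<le> exp (- t\<^sup>2 / 2) * gap1 v t" using t assms(2) by simp
  then show "\<exists>y. (gap v has_real_derivative y) (at t) \<and> 0 \<le> y" using gap_deriv by blast
qed

lemma gap_nonneg_right:
  assumes "3.625 \<le> c" "c \<le> (1 - v0\<^sup>2) / v0"
  shows "0 \<le> gap v0 c"
proof -
  have "gap v0 3.625 \<le> gap v0 c"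
  proof (rule gap_mono[OF assms(1)])
    fix t assume t: "3.625 \<le> t" "t \<le> c"
    show "0 \<le> gap1 v0 t"
    proof (cases "t \<le> 3.7")
      case True
      then show ?thesis using gap1_mono[of "3.625" t] gap1_3625 t by simp
    next
      case False
      then show ?thesis using t assms(2) by (intro gap1_plateau) linarith+
    qed
  qed
  then show ?thesis using gap_nonneg_middle[of "3.625"] by simp
qed

text \<open>Beyond the peak \<open>gap1 v0\<close> is nonincreasing. Either it is still nonnegative
  at \<open>c\<close>, and then \<open>gap v0\<close> has not decreased since the peak; or it stays
  negative from \<open>c\<close> on, and \<open>gap v0\<close> decreases to its limit 0.\<close>

lemma gap_nonneg_tail:
  assumes c: "(1 - v0\<^sup>2) / v0 \<le> c"
  shows "0 \<le> gap v0 c"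
proof -
  have anti: "gap1 v0 y \<le> gap1 v0 x" if "(1 - v0\<^sup>2) / v0 \<le> x" "x \<le> y" for x y
  proof (rule DERIV_nonpos_imp_nonincreasing[OF that(2)])
    fix t assume t: "x \<le> t" "t \<le> y"
    have "1 - v0\<^sup>2 - v0 * t \<le> 0" using t(1) that(1) by (simp add: pos_divide_le_eq power2_eq_square)
    then have "(1 - v0\<^sup>2 - v0 * t) * exp (t\<^sup>2 / 2 - v0 * t) \<le> 0" by (intro mult_nonpos_nonneg) auto
    then have "gap2 v0 t \<le> 0" unfolding gap2_def using divide_nonneg_pos[OF _ pi_gt_zero, of 4] by linarith
    then have "exp (- t\<^sup>2 / 2) * gap2 v0 t \<le> 0" by (intro mult_nonneg_nonpos) auto
    then show "\<exists>y. (gap1 v0 has_real_derivative y) (at t) \<and> y \<le> 0" using gap1_deriv by blast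
  qed
  show ?thesis
  proof (cases "0 \<le> gap1 v0 c")
    case True
    have "gap v0 ((1 - v0\<^sup>2) / v0) \<le> gap v0 c"
      by (rule gap_mono[OF c]) (use anti True in \<open>blast intro: order_trans\<close>)
    then show ?thesis using gap_nonneg_right[of "(1 - v0\<^sup>2) / v0"] by (simp add: power2_eq_square)
  next
    case False
    show ?thesis
    proof (rule nonneg_of_nonincreasing_to_0[where f = "gap v0" and c = c, OF gap_deriv])
      fix t assume "c \<le> t"
      then have "gap1 v0 t \<le> 0" using anti[OF c] False by fastforce
      then show "exp (- t\<^sup>2 / 2) * gap1 v0 t \<le> 0" by (intro mult_nonneg_nonpos) auto
    qed (rule gap_at_top, simp)
  qed
qed

lemma lift_expr_1_le:
  assumes "0 < c"
  shows "lift_expr 1 c \<le> 0.244395"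
  unfolding lift_expr_1_le_iff[OF assms]
  using assms gap_nonneg_left[of c] gap_nonneg_middle[of c] gap_nonneg_right[of c] gap_nonneg_tail[of c]
  by linarith

lemma xi_lift_1: "\<bar>xi_lift 1 - 0.24439\<bar> \<le> 0.000005"
proof -
  obtain c where c: "0 < c" "xi_lift 1 = lift_expr 1 c" "\<And>c'. 0 < c' \<Longrightarrow> lift_expr 1 c' \<le> xi_lift 1"
    using xi_lift_attained[of 1] by auto
  have "0.244385 \<le> xi_lift 1" using lift_expr_1_ge c(3)[of "3.61"] by simp
  moreover have "xi_lift 1 \<le> 0.244395" using lift_expr_1_le[OF c(1)] c(2) by simp
  ultimately show ?thesis unfolding abs_le_iff by simp
qed


subsection \<open>Gaussian matrices on an arbitrary probability space\<close>

text \<open>After division by \<open>exp (c^2 * n / 2)\<close>, the moment of the corner variable,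
  the moment bound reads \<open>exp (- n * c * lift_expr \<alpha> c)\<close>. Optimizing the
  resulting threshold over \<open>c\<close> is exactly the maximization that defines
  \<open>xi_lift\<close>.\<close>

lemma comparison_rate_eq:
  assumes "0 < \<alpha>" "c \<noteq> 0"
  shows "comparison_rate \<alpha> c = c\<^sup>2 / 2 - c * lift_expr \<alpha> c"
proof -
  have 1: "ln (abs_mgf c) = c\<^sup>2 / 2 + ln (erfc (- c / sqrt 2))"
    unfolding abs_mgf_eq by (subst ln_mult_pos) (simp_all add: erfc_pos)
  have "ln (abs_mgf (- c / sqrt \<alpha>)) = (- c / sqrt \<alpha>)\<^sup>2 / 2 + ln (erfc (- (- c / sqrt \<alpha>) / sqrt 2))"
    unfolding abs_mgf_eq by (subst ln_mult_pos) (simp_all add: erfc_pos)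
  also have "(- c / sqrt \<alpha>)\<^sup>2 = c\<^sup>2 / \<alpha>" using assms by (simp add: power_divide)
  also have "- (- c / sqrt \<alpha>) / sqrt 2 = c / sqrt (2 * \<alpha>)" by (simp add: real_sqrt_mult mult.commute)
  finally have "\<alpha> * ln (abs_mgf (- c / sqrt \<alpha>)) = c\<^sup>2 / 2 + \<alpha> * ln (erfc (c / sqrt (2 * \<alpha>)))"
    using assms by (simp add: distrib_left)
  then show ?thesis
    unfolding comparison_rate_def lift_expr_eq[OF assms(2)] lift_num_def 1 using assms(2) by simp
qed

lemma distributed_std_normal:
  assumes "distributed M lborel X std_normal_density"
  shows "X \<in> borel_measurable M" "distr M borel X = std_gauss"
proof -
  show "X \<in> borel_measurable M" using distributed_measurable[OF assms] by simp
  have "distr M borel X = distr M lborel X" by (rule distr_cong) simp_all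
  then show "distr M borel X = std_gauss" using distributed_distr_eq_density[OF assms] by simp
qed

lemma gauss_eq_borel: "sets (gauss K) = sets (PiM K (\<lambda>_. borel))"
  by (rule sets_PiM_cong) auto

lemma std_gaussian_matrix_measurable:
  assumes "std_gaussian_matrix M m n H" "i < m" "j < n"
  shows "H i j \<in> borel_measurable M"
  using assms distributed_std_normal(1) unfolding std_gaussian_matrix_def by blast

lemma std_gaussian_matrix_xi_measurable:
  assumes "std_gaussian_matrix M m n H"
  shows "(\<lambda>\<omega>. xi m n (\<lambda>i j. H i j \<omega>)) \<in> borel_measurable M"
  by (intro xi_measurable std_gaussian_matrix_measurable[OF assms])

text \<open>Independence identifies the joint law of the entries with the product measure, so
  moments computed on \<open>gauss\<close> transfer to any probability space.\<close>

lemma std_gaussian_matrix_distr: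
  assumes "prob_space M" and H: "std_gaussian_matrix M m n H" and mn: "0 < m" "0 < n"
  shows "distr M (gauss ({..<m} \<times> {..<n})) (\<lambda>\<omega>. \<lambda>k\<in>{..<m} \<times> {..<n}. H (fst k) (snd k) \<omega>) = gauss ({..<m} \<times> {..<n})"
proof -
  interpret prob_space M by fact
  let ?K = "{..<m} \<times> {..<n}" and ?X = "\<lambda>(i, j). H i j"
  have "indep_vars (\<lambda>_. borel) ?X ?K" using H unfolding std_gaussian_matrix_def by blast
  then have "distr M (PiM ?K (\<lambda>_. borel)) (\<lambda>\<omega>. \<lambda>k\<in>?K. ?X k \<omega>) = PiM ?K (\<lambda>k. distr M borel (?X k))"
    using mn by (subst (asm) indep_vars_iff_distr_eq_PiM') (use std_gaussian_matrix_measurable[OF H] in auto)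
  also have "\<dots> = gauss ?K"
  proof (rule PiM_cong[OF refl])
    fix k assume "k \<in> ?K"
    then show "distr M borel (?X k) = std_gauss"
      using H distributed_std_normal(2) unfolding std_gaussian_matrix_def by auto
  qed
  finally show ?thesis
    using distr_cong[OF refl gauss_eq_borel[of ?K], of M "\<lambda>\<omega>. \<lambda>k\<in>?K. ?X k \<omega>"] by (simp add: case_prod_unfold)
qed

lemma std_gaussian_matrix_integral:
  fixes f :: "real \<Rightarrow> real"
  assumes "prob_space M" and H: "std_gaussian_matrix M m n H" and mn: "0 < m" "0 < n"
    and f: "f \<in> borel_measurable borel"
  shows "(\<integral>\<omega>. f (xi m n (\<lambda>i j. H i j \<omega>)) \<partial>M) = (\<integral>z. f (xi m n (\<lambda>i j. z (i, j))) \<partial>gauss ({..<m} \<times> {..<n}))" (is ?eq)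
    and "integrable (gauss ({..<m} \<times> {..<n})) (\<lambda>z. f (xi m n (\<lambda>i j. z (i, j)))) \<Longrightarrow>
      integrable M (\<lambda>\<omega>. f (xi m n (\<lambda>i j. H i j \<omega>)))"
proof -
  let ?K = "{..<m} \<times> {..<n}"
  let ?T = "\<lambda>\<omega>. \<lambda>k\<in>?K. H (fst k) (snd k) \<omega>" and ?g = "\<lambda>z. f (xi m n (\<lambda>i j. z (i, j)))"
  have T: "?T \<in> measurable M (gauss ?K)"
    using std_gaussian_matrix_measurable[OF H] by (intro measurable_restrict) auto
  have g: "?g \<in> borel_measurable (gauss ?K)"
    by (intro measurable_compose[OF _ f] xi_measurable) (auto intro!: measurable_component_singleton)
  have gT: "?g (?T \<omega>) = f (xi m n (\<lambda>i j. H i j \<omega>))" for \<omega>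
    by (intro arg_cong[where f = f] xi_cong) simp
  show ?eq
    using integral_distr[OF T g] unfolding std_gaussian_matrix_distr[OF assms(1) H mn] gT by simp
  show "integrable M (\<lambda>\<omega>. f (xi m n (\<lambda>i j. H i j \<omega>)))" if "integrable (gauss ?K) ?g"
    using integrable_distr_eq[OF T g] that unfolding std_gaussian_matrix_distr[OF assms(1) H mn] gT by simp
qed

lemma xi_gauss_measurable: "(\<lambda>z. xi m n (\<lambda>i j. z (i, j))) \<in> borel_measurable (gauss ({..<m} \<times> {..<n}))"
  by (intro xi_measurable) (auto intro!: measurable_component_singleton)

lemma abs_xi_le_l1: "\<bar>xi m n (\<lambda>i j. z (i, j))\<bar> \<le> l1 ({..<m} \<times> {..<n}) z"
  using abs_xi_le[of m n "\<lambda>i j. z (i, j)"] by (simp add: l1_def sum.cartesian_product)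

lemma std_gaussian_matrix_xi_integrable:
  assumes "prob_space M" "std_gaussian_matrix M m n H" "0 < m" "0 < n"
  shows "integrable M (\<lambda>\<omega>. xi m n (\<lambda>i j. H i j \<omega>))"
    and "integrable M (\<lambda>\<omega>. exp (a * xi m n (\<lambda>i j. H i j \<omega>)))"
proof -
  let ?K = "{..<m} \<times> {..<n}" and ?x = "\<lambda>z. xi m n (\<lambda>i j. z (i, j))"
  have "\<bar>?x z\<bar> \<le> 1 * exp (1 * l1 ?K z)" for z
    unfolding mult_1 using abs_xi_le_l1[of m n z] exp_ge_add_one_self[of "l1 ?K z"] by linarith
  then have "integrable (gauss ?K) ?x" by (rule integrable_gauss_bound[rotated 2]) (use xi_gauss_measurable in auto)
  then show "integrable M (\<lambda>\<omega>. xi m n (\<lambda>i j. H i j \<omega>))"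
    using std_gaussian_matrix_integral(2)[OF assms, of "\<lambda>x. x"] by simp
  have "\<bar>exp (a * ?x z)\<bar> \<le> 1 * exp (\<bar>a\<bar> * l1 ?K z)" for z
  proof -
    have "a * ?x z \<le> \<bar>a\<bar> * \<bar>?x z\<bar>" using abs_ge_self[of "a * ?x z"] by (simp add: abs_mult)
    also have "\<dots> \<le> \<bar>a\<bar> * l1 ?K z" using abs_xi_le_l1 by (intro mult_left_mono) auto
    finally show ?thesis by simp
  qed
  then have "integrable (gauss ?K) (\<lambda>z. exp (a * ?x z))"
    by (rule integrable_gauss_bound[rotated 2]) (use xi_gauss_measurable in auto)
  then show "integrable M (\<lambda>\<omega>. exp (a * xi m n (\<lambda>i j. H i j \<omega>)))"
    using std_gaussian_matrix_integral(2)[OF assms, of "\<lambda>x. exp (a * x)"] by simp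
qed

lemma std_gaussian_matrix_exp_moment:
  assumes "prob_space M" "std_gaussian_matrix M m n H" "0 < m" "0 < n"
  shows "(\<integral>\<omega>. exp (- (c * sqrt n) * xi m n (\<lambda>i j. H i j \<omega>)) \<partial>M) = exp_moment c m n"
  using std_gaussian_matrix_integral(1)[OF assms, of "\<lambda>x. exp (- (c * sqrt n) * x)"] unfolding exp_moment_def by simp

lemma expectation_xi_ge:
  assumes M: "prob_space M" and H: "std_gaussian_matrix M m n H" and a: "0 < \<alpha>" and n: "0 < n" and m: "real m = \<alpha> * real n"
  shows "xi_lift \<alpha> \<le> prob_space.expectation M (\<lambda>\<omega>. xi m n (\<lambda>i j. H i j \<omega>)) / sqrt n"
proof -
  interpret prob_space M by fact
  have m0: "0 < m"
    using a n m by (metis of_nat_0_less_iff mult_pos_pos)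
  note int = std_gaussian_matrix_xi_integrable[OF M H m0 n]
  let ?x = "\<lambda>\<omega>. xi m n (\<lambda>i j. H i j \<omega>)"
  obtain c where c: "0 < c" "xi_lift \<alpha> = lift_expr \<alpha> c" using xi_lift_attained[OF a] by blast
  \<comment> \<open>The mean of the exponent: the tangent of \<open>exp\<close> at this point has
    expectation \<open>exp y\<close>.\<close>
  define y where "y = - (c * sqrt n) * expectation ?x"
  have "expectation (\<lambda>\<omega>. exp y * (1 + - (c * sqrt n) * ?x \<omega> - y)) \<le> expectation (\<lambda>\<omega>. exp (- (c * sqrt n) * ?x \<omega>))"
    by (intro integral_mono exp_tangent int(2)) (use int(1) in auto)
  also have "expectation (\<lambda>\<omega>. exp y * (1 + - (c * sqrt n) * ?x \<omega> - y)) = exp y * (1 + - (c * sqrt n) * expectation ?x - y)"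
    using int by (simp add: prob_space)
  also have "\<dots> = exp y" by (simp add: y_def)
  also have "expectation (\<lambda>\<omega>. exp (- (c * sqrt n) * ?x \<omega>)) = exp_moment c m n"
    by (rule std_gaussian_matrix_exp_moment[OF M H m0 n])
  finally have "exp (c\<^sup>2 * n / 2) * exp y \<le> exp (c\<^sup>2 * n / 2) * exp_moment c m n" by simp
  also have "\<dots> \<le> exp (n * comparison_rate \<alpha> c)" by (rule exp_moment_le[OF a c(1) n m])
  also have "comparison_rate \<alpha> c = c\<^sup>2 / 2 - c * xi_lift \<alpha>" using comparison_rate_eq[OF a] c by simp
  finally have "c\<^sup>2 * n / 2 + y \<le> n * (c\<^sup>2 / 2 - c * xi_lift \<alpha>)" by (simp add: exp_add[symmetric])
  then have "c * (n * xi_lift \<alpha>) \<le> c * (sqrt n * expectation ?x)" by (simp add: y_def algebra_simps)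
  then have "n * xi_lift \<alpha> \<le> sqrt n * expectation ?x" using c by simp
  also have "n * xi_lift \<alpha> = sqrt n * (sqrt n * xi_lift \<alpha>)" by (simp add: mult.assoc[symmetric])
  finally have "sqrt n * xi_lift \<alpha> \<le> expectation ?x"
    by (rule mult_left_le_imp_le) (use n in simp)
  then show ?thesis using n by (simp add: pos_le_divide_eq mult.commute)
qed

text \<open>The rate \<open>\<gamma>\<close> and the threshold \<open>N\<close> are obtained before
  the probability space is fixed, as only the law of the matrix matters. One rate thus serves a
  whole sequence of spaces.\<close>

lemma prob_xi_ge:
  assumes a: "0 < \<alpha>"
  obtains \<gamma> N where "0 < \<gamma>"
    "\<And>M :: 'w measure. \<And>H m n. prob_space M \<Longrightarrow> std_gaussian_matrix M m n H \<Longrightarrow> N \<le> n \<Longrightarrow> 0 < n \<Longrightarrow>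
      real m = \<alpha> * real n \<Longrightarrow>
      1 - exp (- (\<gamma> * n)) \<le> measure M {\<omega> \<in> space M. sqrt n * xi_lift \<alpha> \<le> xi m n (\<lambda>i j. H i j \<omega>)}"
proof -
  obtain c where c: "0 < c" "xi_lift \<alpha> = lift_expr \<alpha> c" using xi_lift_attained[OF a] by blast
  obtain \<gamma> N where g: "0 < \<gamma>" "\<And>n m. N \<le> n \<Longrightarrow> 0 < n \<Longrightarrow> real m = \<alpha> * real n \<Longrightarrow>
      exp (c\<^sup>2 * n / 2) * exp_moment c m n \<le> exp (n * (comparison_rate \<alpha> c - \<gamma>))"
    using exp_moment_strict[OF a c(1)] by blast
  show thesis
  proof (rule that[OF g(1)])
    fix M :: "'w measure" and H m n
    assume M: "prob_space M" and H: "std_gaussian_matrix M m n H" and n: "N \<le> n" "0 < n" and m: "real m = \<alpha> * real n"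
    interpret prob_space M by fact
    have m0: "0 < m" using a n(2) m by (metis of_nat_0_less_iff mult_pos_pos)
    let ?x = "\<lambda>\<omega>. xi m n (\<lambda>i j. H i j \<omega>)"
    have meas[measurable]: "?x \<in> borel_measurable M" by (rule std_gaussian_matrix_xi_measurable[OF H])
    let ?t = "c * n * xi_lift \<alpha>"
    let ?S = "{\<omega> \<in> space M. sqrt n * xi_lift \<alpha> \<le> ?x \<omega>}"
    have S[measurable]: "?S \<in> sets M" by measurable
    have "exp (- ?t) * prob (space M - ?S) = expectation (\<lambda>\<omega>. exp (- ?t) * indicator (space M - ?S) \<omega>)" by simp
    also have "\<dots> \<le> expectation (\<lambda>\<omega>. exp (- (c * sqrt n) * ?x \<omega>))"
    proof (rule integral_mono)
      fix \<omega> assume w: "\<omega> \<in> space M"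
      show "exp (- ?t) * indicator (space M - ?S) \<omega> \<le> exp (- (c * sqrt n) * ?x \<omega>)"
      proof (cases "\<omega> \<in> ?S")
        case False
        then have "?x \<omega> \<le> sqrt n * xi_lift \<alpha>" using w by simp
        then have "(c * sqrt n) * ?x \<omega> \<le> (c * sqrt n) * (sqrt n * xi_lift \<alpha>)" using c by (intro mult_left_mono) auto
        also have "\<dots> = ?t" by simp
        finally show ?thesis using False w by simp
      qed simp
    next
      show "integrable M (\<lambda>\<omega>. exp (- (c * sqrt n) * ?x \<omega>))"
        by (rule std_gaussian_matrix_xi_integrable(2)[OF M H m0 n(2)])
    qed (use S in \<open>auto simp: emeasure_eq_measure\<close>)
    also have "\<dots> = exp_moment c m n" by (rule std_gaussian_matrix_exp_moment[OF M H m0 n(2)])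
    finally have "exp (c\<^sup>2 * n / 2) * (exp (- ?t) * prob (space M - ?S)) \<le> exp (c\<^sup>2 * n / 2) * exp_moment c m n" by simp
    also have "\<dots> \<le> exp (n * (comparison_rate \<alpha> c - \<gamma>))" by (rule g(2)[OF n m])
    also have "comparison_rate \<alpha> c = c\<^sup>2 / 2 - c * xi_lift \<alpha>" using comparison_rate_eq[OF a] c by simp
    also have "exp (n * (c\<^sup>2 / 2 - c * xi_lift \<alpha> - \<gamma>)) = exp (c\<^sup>2 * n / 2) * (exp (- ?t) * exp (- (\<gamma> * n)))"
      unfolding exp_add[symmetric] by (simp add: algebra_simps)
    finally have "prob (space M - ?S) \<le> exp (- (\<gamma> * n))" by simp
    then show "1 - exp (- (\<gamma> * n)) \<le> prob ?S" using prob_compl[OF S] by simp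
  qed
qed

section \<open>Passage to the limit along the admissible dimensions\<close>

lemma tendsto_1_admissible:
  fixes P :: "nat \<Rightarrow> real"
  assumes "0 < \<gamma>" "\<And>n. N \<le> n \<Longrightarrow> n \<in> admissible \<alpha> \<Longrightarrow> 1 - exp (- (\<gamma> * n)) \<le> P n" "\<And>n. n \<in> admissible \<alpha> \<Longrightarrow> P n \<le> 1"
  shows "(P \<longlongrightarrow> 1) (admissible_at_top \<alpha>)"
proof (rule tendsto_sandwich)
  have ev: "eventually Q (admissible_at_top \<alpha>)" if "\<And>n. N \<le> n \<Longrightarrow> n \<in> admissible \<alpha> \<Longrightarrow> Q n" for Q
    unfolding admissible_at_top_def eventually_inf_principal eventually_sequentially using that by blast
  show "eventually (\<lambda>n. 1 - exp (- (\<gamma> * real n)) \<le> P n) (admissible_at_top \<alpha>)" by (rule ev) (use assms in auto)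
  show "eventually (\<lambda>n. P n \<le> 1) (admissible_at_top \<alpha>)" by (rule ev) (use assms in auto)
  have "filterlim (\<lambda>n. \<gamma> * real n) at_top sequentially"
    using assms(1) by (intro filterlim_tendsto_pos_mult_at_top[OF tendsto_const] filterlim_real_sequentially)
  then have "filterlim (\<lambda>n. - (\<gamma> * real n)) at_bot sequentially"
    by (simp add: filterlim_uminus_at_bot)
  then have "((\<lambda>n. exp (- (\<gamma> * real n))) \<longlonglongrightarrow> 0)" by (rule filterlim_compose[OF exp_at_bot])
  from tendsto_diff[OF tendsto_const this, of 1]
  have "((\<lambda>n. 1 - exp (- (\<gamma> * real n))) \<longlonglongrightarrow> 1)" by simp
  then show "((\<lambda>n. 1 - exp (- (\<gamma> * real n))) \<longlongrightarrow> 1) (admissible_at_top \<alpha>)"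
    unfolding admissible_at_top_def by (rule tendsto_mono[rotated]) simp
qed simp

theorem lemma13:
  fixes \<alpha> :: real
    and m :: "nat \<Rightarrow> nat"
    and M :: "nat \<Rightarrow> 'w measure"
    and H :: "nat \<Rightarrow> nat \<Rightarrow> nat \<Rightarrow> 'w \<Rightarrow> real"
    and \<xi> :: "nat \<Rightarrow> 'w \<Rightarrow> real"
  assumes "\<alpha> > 0"
    and "\<And>n. n \<in> admissible \<alpha> \<Longrightarrow> real (m n) = \<alpha> * real n"
    and "\<And>n. n \<in> admissible \<alpha> \<Longrightarrow> prob_space (M n)"
    and "\<And>n. n \<in> admissible \<alpha> \<Longrightarrow> std_gaussian_matrix (M n) (m n) n (H n)"
  defines "\<xi> \<equiv> (\<lambda>n \<omega>. xi (m n) n (\<lambda>i j. H n i j \<omega>))"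
  shows "(\<forall>n\<in>admissible \<alpha>. prob_space.expectation (M n) (\<xi> n) / sqrt (real n) \<ge> xi_lift \<alpha>) \<and>
    ((\<lambda>n. measure (M n) {\<omega> \<in> space (M n). \<xi> n \<omega> \<ge> sqrt (real n) * xi_lift \<alpha>}) \<longlongrightarrow> 1)
       (admissible_at_top \<alpha>) \<and>
    ((\<lambda>n. measure (M n) {\<omega> \<in> space (M n). (\<xi> n \<omega>)\<^sup>2 \<ge> real n * (xi_lift \<alpha>)\<^sup>2}) \<longlongrightarrow> 1)
       (admissible_at_top \<alpha>) \<and>
    (\<alpha> = 1 \<longrightarrow>
       (\<forall>n\<in>admissible \<alpha>. prob_space.expectation (M n) (\<xi> n) / sqrt (real n) \<ge> xi_lift \<alpha>) \<and>
       \<bar>xi_lift \<alpha> - 0.24439\<bar> \<le> 0.000005)"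
proof -
  have n0: "0 < n" if "n \<in> admissible \<alpha>" for n using that by (simp add: admissible_def)
  have E: "\<forall>n\<in>admissible \<alpha>. prob_space.expectation (M n) (\<xi> n) / sqrt (real n) \<ge> xi_lift \<alpha>"
    unfolding \<xi>_def using expectation_xi_ge[OF assms(3,4) assms(1) n0 assms(2)] by blast
  obtain \<gamma> N where g: "0 < \<gamma>"
    "\<And>M :: 'w measure. \<And>H m n. prob_space M \<Longrightarrow> std_gaussian_matrix M m n H \<Longrightarrow> N \<le> n \<Longrightarrow> 0 < n \<Longrightarrow>
      real m = \<alpha> * real n \<Longrightarrow>
      1 - exp (- (\<gamma> * n)) \<le> measure M {\<omega> \<in> space M. sqrt n * xi_lift \<alpha> \<le> xi m n (\<lambda>i j. H i j \<omega>)}"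
    using prob_xi_ge[OF assms(1)] by blast
  have g1: "1 - exp (- (\<gamma> * n)) \<le> measure (M n) {\<omega> \<in> space (M n). sqrt n * xi_lift \<alpha> \<le> \<xi> n \<omega>}"
    if "N \<le> n" "n \<in> admissible \<alpha>" for n
    unfolding \<xi>_def by (rule g(2)[OF assms(3)[OF that(2)] assms(4)[OF that(2)] that(1) n0[OF that(2)] assms(2)[OF that(2)]])
  have le1: "measure (M n) S \<le> 1" if "n \<in> admissible \<alpha>" for n S
    using prob_space.prob_le_1[OF assms(3)[OF that]] .
  have pos: "0 < xi_lift \<alpha>" using xi_lift_attained[OF assms(1)] by blast
  \<comment> \<open>As \<open>xi_lift \<alpha>\<close> is positive, the inequality defining the
    first event may be squared, so that event is contained in the second.\<close>
  have sq: "measure (M n) {\<omega> \<in> space (M n). sqrt n * xi_lift \<alpha> \<le> \<xi> n \<omega>} \<le>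
      measure (M n) {\<omega> \<in> space (M n). real n * (xi_lift \<alpha>)\<^sup>2 \<le> (\<xi> n \<omega>)\<^sup>2}" if n: "n \<in> admissible \<alpha>" for n
  proof -
    interpret prob_space "M n" by (rule assms(3)[OF n])
    have [measurable]: "\<xi> n \<in> borel_measurable (M n)"
      unfolding \<xi>_def by (rule std_gaussian_matrix_xi_measurable[OF assms(4)[OF n]])
    have "real n * (xi_lift \<alpha>)\<^sup>2 \<le> x\<^sup>2" if "sqrt n * xi_lift \<alpha> \<le> x" for x
      using power_mono[OF that, of 2] pos by (simp add: power_mult_distrib)
    then show ?thesis by (intro finite_measure_mono) auto
  qed
  have "((\<lambda>n. measure (M n) {\<omega> \<in> space (M n). \<xi> n \<omega> \<ge> sqrt (real n) * xi_lift \<alpha>}) \<longlongrightarrow> 1) (admissible_at_top \<alpha>)"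
    by (rule tendsto_1_admissible[OF g(1) g1 le1])
  moreover have "((\<lambda>n. measure (M n) {\<omega> \<in> space (M n). (\<xi> n \<omega>)\<^sup>2 \<ge> real n * (xi_lift \<alpha>)\<^sup>2}) \<longlongrightarrow> 1) (admissible_at_top \<alpha>)"
    by (rule tendsto_1_admissible[OF g(1) order_trans[OF g1 sq] le1])
  ultimately show ?thesis using E xi_lift_1 by blast
qed

end
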